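(* Let $f,g:\mathbb{R}\to\mathbb{R}$ be smooth. Consider a non-degenerate traveling wave of $$\partial_tu+\partial_x(f(u))=g(u)\qquad(t\ge0,\ x\in\mathbb{R})$$ of profile $\underline u$ and speed $\sigma$, discontinuous at $0$, such that $\underline u_{|(-\infty,0)}\equiv u_-$ and $\underline u_{|(0,+\infty)}\equiv u_+$ with constant values $u_-,u_+$ such that $g'(u_-)<0<g'(u_+)$. Set $\kappa^+:=g'(u_+)/|f'(u_+)-\sigma|$ and let $\rho$ be an integrable sub-exponential weight. Define weights $\Omega,\Omega_\rho:\mathbb{R}^*\to\mathbb{R}$ by $$\Omega(x):=\exp(-\kappa^+x_+),\qquad \Omega_\rho(x):=\rho(x_+)\exp(-\kappa^+x_+).$$ There exist positive $C$, $\theta$ and $\delta_0$ such that if $u_0\in BUC^1(\mathbb{R}^* )$ with $(u_0-\underline u)/\Omega_\rho\in BUC^0(\mathbb{R}^* )$, $\partial_x(u_0-\underline u)/\Omega_\rho\in BUC^0(\mathbb{R}^* )$ and $$E_0^{[\rho]}:=\|u_0-\underline u\|_{W^{1,\infty}_{\Omega_\rho}(\mathbb{R}^* )}\le\delta_0,$$ then there exists $\psi\in BUC^2(\mathbb{R}_+)$ such that the solution $u$ starting from $u(0,\cdot)=u_0$ satisfies for any $t\ge0$ $$\|u(t,\cdot+\sigma t+\psi(t))-\underline u\|_{W^{1,\infty}_\Omega(\mathbb{R}^* )}+|(\psi',\psi'')(t)|\le C\,E_0^{[\rho]}\,\rho(\theta t),$$ and there exists $\psi_\infty\in\mathbb{R}$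 such that for any $t\ge0$ $$|\psi_\infty|\le C\,E_0^{[\rho]},\qquad |\psi(t)-\psi_\infty|\le C\,E_0^{[\rho]}\int_{\theta t}^\infty\rho.$$
   Context: Solutions are Kružkov entropy solutions; a traveling wave is a solution $(t,x)\mapsto\underline u(x-\sigma t)$. $\mathbb{R}^*=\mathbb{R}\setminus\{0\}$, $x_+=\max(\{x,0\})$. $BUC^k(\mathbb{R}^* )$ (resp. $BUC^k(\mathbb{R}_+)$): functions of class $\mathcal{C}^k$, bounded and uniformly continuous together with derivatives up to order $k$, uniform continuity being required separately on $(-\infty,0)$ and $(0,\infty)$ (resp. on $\mathbb{R}_+$). For a positive weight $\omega$ on $\mathbb{R}^*$, $\|v\|_{W^{1,\infty}_{\omega}(\mathbb{R}^* )}:=\|\omega^{-1}(v,\partial_xv)\|_{L^\infty}$. Non-degenerate wave: $\underline u$ is piecewise smooth (with a discrete set of discontinuity points), bounded, and (i) any characteristic value $u_\star$ (value of $\underline u$ with $f'(u_\star)=\sigma$) satisfies $f''(u_\star)\ne0$; (ii) at any discontinuity point $d$, with one-sided limits $\underline u(d^\pm)$, neither $\underline u(d^-)$ nor $\underline u(d^+)$ is a characteristic value, $f'(\underline u(d^-))>\sigma>f'(\underline u(d^+))$ and for any $v$ strictly between $\underline u(d^-)$ and $\underline u(d^+)$, $\frac{f(v)-f(\underline u(d^-))}{v-\underline u(d^-)}>\frac{f(v)-f(\underline u(d^+))}{v-\underline u(d^+)}$; (iii) any endstate $u_\infty$ (limit of $\underline u$ at $\pm\infty$) satisfies $g'(u_\infty)\neq0$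 and is not a characteristic value. A sub-exponential weight is a positive non-increasing function $\rho:\mathbb{R}_+\to(0,\infty)$, converging to $0$ at $+\infty$, such that (i) there exist positive $\omega,C$ such that $C\exp(-\omega t)\le\rho(t)$ for any $t\ge0$; (ii) there exist positive $\omega,C$ such that $\int_0^t\exp(-\omega(t-s))\rho(s)\,\mathrm{d}s\le C\rho(t)$ for any $t\ge0$. *)

theory Defs
  imports "HOL-Analysis.Analysis" "HOL-Probability.Essential_Supremum"
begin

definition smooth :: "(real \<Rightarrow> real) \<Rightarrow> bool" where
  "smooth f \<longleftrightarrow> (\<forall>n x. ((deriv ^^ n) f) differentiable (at x))"

subsection \<open>Bounded uniformly continuous functions\<close>

text \<open>Derivatives are taken within \<open>S\<close>, hence are one-sided at the endpoint of \<open>{0..}\<close> and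
  coincide with \<^const>\<open>deriv\<close> on open intervals.\<close>

definition D_on :: "real set \<Rightarrow> (real \<Rightarrow> real) \<Rightarrow> real \<Rightarrow> real" where
  "D_on S v = (\<lambda>x. vector_derivative v (at x within S))"

definition BUC_on :: "nat \<Rightarrow> real set \<Rightarrow> (real \<Rightarrow> real) \<Rightarrow> bool" where
  "BUC_on k S v \<longleftrightarrow>
     (\<forall>j<k. \<forall>x\<in>S. ((D_on S ^^ j) v) differentiable (at x within S)) \<and>
     (\<forall>j\<le>k. bounded ((D_on S ^^ j) v ` S) \<and> uniformly_continuous_on S ((D_on S ^^ j) v))"

text \<open>Functions on \<open>\<real> \<setminus> {0}\<close> are total functions whose value at \<open>0\<close> is never used.\<close>

definition BUC_Rstar :: "nat \<Rightarrow> (real \<Rightarrow> real) \<Rightarrow> bool" where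
  "BUC_Rstar k v \<longleftrightarrow> BUC_on k {..<0} v \<and> BUC_on k {0<..} v"

definition BUC_Rplus :: "nat \<Rightarrow> (real \<Rightarrow> real) \<Rightarrow> bool" where
  "BUC_Rplus k v \<longleftrightarrow> BUC_on k {0..} v"

subsection \<open>Weighted Sobolev norm\<close>

text \<open>Throughout, test functions are \<open>C\<^sup>1\<close> with compact support. By mollification this gives the
  same notions as \<open>C\<^sup>\<infinity>\<close> test functions.\<close>

definition test_Rstar :: "(real \<Rightarrow> real) \<Rightarrow> (real \<Rightarrow> real) \<Rightarrow> bool" where
  "test_Rstar \<phi> \<phi>' \<longleftrightarrow>
     (\<forall>x. (\<phi> has_real_derivative \<phi>' x) (at x)) \<and> continuous_on UNIV \<phi>' \<and>
     (\<exists>K. compact K \<and> K \<subseteq> -{0} \<and> (\<forall>x. x \<notin> K \<longrightarrow> \<phi> x = 0))"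

definition loc_integrable_Rstar :: "(real \<Rightarrow> real) \<Rightarrow> bool" where
  "loc_integrable_Rstar v \<longleftrightarrow> (\<forall>K. compact K \<and> K \<subseteq> -{0} \<longrightarrow> set_integrable lborel K v)"

definition weak_deriv_Rstar :: "(real \<Rightarrow> real) \<Rightarrow> (real \<Rightarrow> real) \<Rightarrow> bool" where
  "weak_deriv_Rstar v w \<longleftrightarrow>
     loc_integrable_Rstar v \<and> loc_integrable_Rstar w \<and>
     (\<forall>\<phi> \<phi>'. test_Rstar \<phi> \<phi>' \<longrightarrow>
        (LINT x|lborel. v x * \<phi>' x) = - (LINT x|lborel. w x * \<phi> x))"

text \<open>Weak derivatives are unique almost everywhere, so the infimum below ranges over at most one
  value; it is \<open>\<infinity>\<close> if there is no weak derivative on \<open>\<real> \<setminus> {0}\<close>.\<close>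

definition W1inf_norm :: "(real \<Rightarrow> real) \<Rightarrow> (real \<Rightarrow> real) \<Rightarrow> ereal" where
  "W1inf_norm \<omega> v =
     (INF w\<in>{w. weak_deriv_Rstar v w}. esssup lborel (\<lambda>x. ereal (norm (v x, w x) / \<omega> x)))"

subsection \<open>Entropy solutions\<close>

definition test_halfplane ::
    "(real \<times> real \<Rightarrow> real) \<Rightarrow> (real \<times> real \<Rightarrow> real) \<Rightarrow> (real \<times> real \<Rightarrow> real) \<Rightarrow> bool" where
  "test_halfplane \<phi> \<phi>t \<phi>x \<longleftrightarrow>
     (\<forall>p. (\<phi> has_derivative (\<lambda>h. \<phi>t p * fst h + \<phi>x p * snd h)) (at p)) \<and>
     continuous_on UNIV \<phi>t \<and> continuous_on UNIV \<phi>x \<and>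
     (\<exists>K. compact K \<and> K \<subseteq> {0<..} \<times> UNIV \<and> (\<forall>p. p \<notin> K \<longrightarrow> \<phi> p = 0))"

text \<open>Kruzkov entropy solutions on \<open>[0,\<infinity>) \<times> \<real>\<close> of \<open>\<partial>\<^sub>t u + \<partial>\<^sub>x(f(u)) = g(u)\<close>, in the class of functions
  bounded on bounded time intervals and continuous in time with values in \<open>L\<^sup>1\<^sub>l\<^sub>o\<^sub>c\<close>; continuity
  gives a meaning, up to null sets, to \<open>u t\<close> for every \<open>t \<ge> 0\<close>. Elements of Lebesgue spaces
  are given by Borel representatives.\<close>

definition entropy_solution ::
    "(real \<Rightarrow> real) \<Rightarrow> (real \<Rightarrow> real) \<Rightarrow> (real \<Rightarrow> real) \<Rightarrow> (real \<Rightarrow> real \<Rightarrow> real) \<Rightarrow> bool" where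
  "entropy_solution f g u0 u \<longleftrightarrow>
     set_borel_measurable lborel ({0..} \<times> UNIV) (\<lambda>(t, x). u t x) \<and>
     (\<forall>T\<ge>0. \<exists>M. \<forall>t\<in>{0..T}. AE x in lborel. \<bar>u t x\<bar> \<le> M) \<and>
     (\<forall>t\<^sub>0\<ge>0. \<forall>R. ((\<lambda>t. LINT x:{-R..R}|lborel. \<bar>u t x - u t\<^sub>0 x\<bar>) \<longlongrightarrow> 0) (at t\<^sub>0 within {0..})) \<and>
     (AE x in lborel. u 0 x = u0 x) \<and>
     (\<forall>k \<phi> \<phi>t \<phi>x. test_halfplane \<phi> \<phi>t \<phi>x \<and> (\<forall>p. 0 \<le> \<phi> p) \<longrightarrow>
        0 \<le> (LINT (t, x):{0<..} \<times> UNIV|lborel.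
               \<bar>u t x - k\<bar> * \<phi>t (t, x)
               + sgn (u t x - k) * (f (u t x) - f k) * \<phi>x (t, x)
               + sgn (u t x - k) * g (u t x) * \<phi> (t, x)))"

definition the_entropy_solution ::
    "(real \<Rightarrow> real) \<Rightarrow> (real \<Rightarrow> real) \<Rightarrow> (real \<Rightarrow> real) \<Rightarrow> (real \<Rightarrow> real \<Rightarrow> real) \<Rightarrow> bool" where
  "the_entropy_solution f g u0 u \<longleftrightarrow>
     entropy_solution f g u0 u \<and>
     (\<forall>v. entropy_solution f g u0 v \<longrightarrow> (\<forall>t\<ge>0. AE x in lborel. v t x = u t x))"

subsection \<open>Non-degenerate traveling waves\<close>

definition discontinuities :: "(real \<Rightarrow> real) \<Rightarrow> real set" where
  "discontinuities U = {x. \<not> isCont U x}"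

definition piecewise_smooth :: "(real \<Rightarrow> real) \<Rightarrow> bool" where
  "piecewise_smooth U \<longleftrightarrow>
     (\<forall>x. \<not> x islimpt discontinuities U) \<and>
     (\<forall>n. \<forall>x. x \<notin> discontinuities U \<longrightarrow> ((deriv ^^ n) U) differentiable (at x)) \<and>
     (\<forall>n. \<forall>d\<in>discontinuities U.
        (\<exists>l. ((deriv ^^ n) U \<longlongrightarrow> l) (at_left d)) \<and> (\<exists>l. ((deriv ^^ n) U \<longlongrightarrow> l) (at_right d)))"

definition characteristic :: "(real \<Rightarrow> real) \<Rightarrow> real \<Rightarrow> real \<Rightarrow> bool" where
  "characteristic f \<sigma> v \<longleftrightarrow> deriv f v = \<sigma>"

text \<open>Values of the profile at its discontinuity points carry no information and are ignored.\<close>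

definition nondegenerate_wave ::
    "(real \<Rightarrow> real) \<Rightarrow> (real \<Rightarrow> real) \<Rightarrow> (real \<Rightarrow> real) \<Rightarrow> real \<Rightarrow> bool" where
  "nondegenerate_wave f g U \<sigma> \<longleftrightarrow>
     entropy_solution f g U (\<lambda>t x. U (x - \<sigma> * t)) \<and>
     piecewise_smooth U \<and> bounded (U ` (- discontinuities U)) \<and>
     (\<forall>x. x \<notin> discontinuities U \<and> characteristic f \<sigma> (U x) \<longrightarrow> deriv (deriv f) (U x) \<noteq> 0) \<and>
     (\<forall>d\<in>discontinuities U. \<forall>ul ur. (U \<longlongrightarrow> ul) (at_left d) \<and> (U \<longlongrightarrow> ur) (at_right d) \<longrightarrow>
        \<not> characteristic f \<sigma> ul \<and> \<not> characteristic f \<sigma> ur \<and>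
        deriv f ul > \<sigma> \<and> \<sigma> > deriv f ur \<and>
        (\<forall>v. min ul ur < v \<and> v < max ul ur \<longrightarrow>
           (f v - f ul) / (v - ul) > (f v - f ur) / (v - ur))) \<and>
     (\<forall>l. (U \<longlongrightarrow> l) at_bot \<or> (U \<longlongrightarrow> l) at_top \<longrightarrow>
        deriv g l \<noteq> 0 \<and> \<not> characteristic f \<sigma> l)"

subsection \<open>Weights\<close>

definition subexp_weight :: "(real \<Rightarrow> real) \<Rightarrow> bool" where
  "subexp_weight \<rho> \<longleftrightarrow>
     (\<forall>t\<ge>0. 0 < \<rho> t) \<and> antimono_on {0..} \<rho> \<and> (\<rho> \<longlongrightarrow> 0) at_top \<and>
     (\<exists>\<omega>>0. \<exists>C>0. \<forall>t\<ge>0. C * exp (- \<omega> * t) \<le> \<rho> t) \<and>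
     (\<exists>\<omega>>0. \<exists>C>0. \<forall>t\<ge>0. (LINT s:{0..t}|lborel. exp (- \<omega> * (t - s)) * \<rho> s) \<le> C * \<rho> t)"

definition exp_weight :: "real \<Rightarrow> real \<Rightarrow> real" where
  "exp_weight \<kappa> x = exp (- \<kappa> * max x 0)"

definition exp_weight_rho :: "(real \<Rightarrow> real) \<Rightarrow> real \<Rightarrow> real \<Rightarrow> real" where
  "exp_weight_rho \<rho> \<kappa> x = \<rho> (max x 0) * exp (- \<kappa> * max x 0)"

end

theory Submission
  imports Defs
begin

text \<open>On each side of the shock the perturbed solution is transported by explicit characteristics: the
  equilibria \<open>u\<^sub>-\<close> and \<open>u\<^sub>+\<close> are simple zeros of \<open>g\<close>, so a \<open>C\<^sup>1\<close> change of unknown makes the source linear. At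
  time \<open>t\<close> the left branch has decayed like \<open>exp (g' u\<^sub>- t)\<close>. The right branch has grown like
  \<open>exp (g' u\<^sub>+ t)\<close>, but its characteristics start at distance about \<open>(\<sigma> - f' u\<^sub>+) t\<close> to the right of the shock,
  where \<open>\<Omega>\<^sub>\<rho>\<close> compensates this growth and leaves the factor \<open>\<rho>\<close>. Both branches are continued across
  the shock, whose position then solves the Rankine-Hugoniot ordinary differential equation; its
  velocity differs from \<open>\<sigma>\<close> by a quantity controlled by the size of the branches at the shock. Gluing the
  two branches along this curve gives an entropy solution, since Oleinik's condition is open, and it
  is the only one by an \<open>L\<^sup>1\<close> contraction against a solution that is \<open>C\<^sup>1\<close> off a shock; no doubling of
  variables is needed.\<close>

subsection \<open>Test functions and integration by parts\<close>

text \<open>The exponent of the weight leaves nothing to spare: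
  \<open>\<kappa> * (\<sigma> - f' up) = g' up\<close>, so on the right the growth along a
  characteristic cancels the exponential in the weight exactly, and \<open>\<rho>\<close> alone is
  left to give decay. Bounding the growth rate by \<open>g' up\<close> plus a small constant would
  lose an exponential that \<open>\<rho>\<close> need not compensate. This is why the source is
  linearized by a change of unknown, which makes the growth exact. The same change integrates the
  characteristic speed: true characteristics stay within a bounded distance of straight lines for
  all times, and shifting the exponential weight by a bounded distance costs only a constant factor.
  Smallness fixes this distance, and the shift of the shock, at 1/2 each; the numbers 3/4, 5/4 and 2
  of the later estimates add up such margins. Nothing pulls the shock back to its original position.
  Its velocity is merely bounded by a multiple of \<open>\<rho> (\<theta> * t)\<close>, and
  integrability of \<open>\<rho>\<close> is what gives it a limiting position.\<close>

definition C1_on where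
  "C1_on S F Ft Fx \<longleftrightarrow>
     (\<forall>p\<in>S. (F has_derivative (\<lambda>h. Ft p * fst h + Fx p * snd h)) (at p)) \<and>
     continuous_on S Ft \<and> continuous_on (S :: (real \<times> real) set) (Fx :: _ \<Rightarrow> real)"

definition C1_test where
  "C1_test S \<phi> \<phi>t \<phi>x \<longleftrightarrow> C1_on UNIV \<phi> \<phi>t \<phi>x \<and> (\<exists>K. compact K \<and> K \<subseteq> S \<and> (\<forall>p. p \<notin> K \<longrightarrow> \<phi> p = 0))"

lemma test_halfplane_iff: "test_halfplane \<phi> \<phi>t \<phi>x \<longleftrightarrow> C1_test ({0<..} \<times> UNIV) \<phi> \<phi>t \<phi>x"
  by (simp add: test_halfplane_def C1_test_def C1_on_def conj_assoc)

lemma C1_on_D: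
  "C1_on S F Ft Fx \<Longrightarrow> p \<in> S \<Longrightarrow> (F has_derivative (\<lambda>h. Ft p * fst h + Fx p * snd h)) (at p)"
  by (simp add: C1_on_def)

lemma C1_on_continuous:
  assumes "C1_on S F Ft Fx"
  shows "continuous_on S F" "continuous_on S Ft" "continuous_on S Fx"
  using assms unfolding C1_on_def
  by (auto intro!: continuous_at_imp_continuous_on has_derivative_continuous)

lemma C1_on_subset: "C1_on S F Ft Fx \<Longrightarrow> T \<subseteq> S \<Longrightarrow> C1_on T F Ft Fx"
  unfolding C1_on_def using continuous_on_subset by blast

lemma C1_on_mult:
  assumes "C1_on S F Ft Fx" "C1_on S G Gt Gx"
  shows "C1_on S (\<lambda>p. F p * G p) (\<lambda>p. Ft p * G p + F p * Gt p) (\<lambda>p. Fx p * G p + F p * Gx p)"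
proof -
  have "((\<lambda>p. F p * G p) has_derivative
      (\<lambda>h. (Ft p * G p + F p * Gt p) * fst h + (Fx p * G p + F p * Gx p) * snd h)) (at p)"
    if "p \<in> S" for p
    by (rule has_derivative_eq_rhs[OF has_derivative_mult[OF C1_on_D[OF assms(1) that] C1_on_D[OF assms(2) that]]])
       (auto simp: algebra_simps)
  then show ?thesis
    unfolding C1_on_def using C1_on_continuous[OF assms(1)] C1_on_continuous[OF assms(2)]
    by (auto intro!: continuous_intros)
qed

lemma C1_on_compose:
  assumes F: "C1_on S F Ft Fx"
    and c: "\<And>p. p \<in> S \<Longrightarrow> (c has_real_derivative c' (F p)) (at (F p))"
    and c': "continuous_on (F ` S) c'"
  shows "C1_on S (\<lambda>p. c (F p)) (\<lambda>p. c' (F p) * Ft p) (\<lambda>p. c' (F p) * Fx p)"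
proof -
  have "((\<lambda>p. c (F p)) has_derivative
      (\<lambda>h. (c' (F p) * Ft p) * fst h + (c' (F p) * Fx p) * snd h)) (at p)"
    if "p \<in> S" for p
    by (rule has_derivative_eq_rhs[OF has_derivative_compose[OF C1_on_D[OF F that] c[OF that, unfolded has_field_derivative_def]]])
       (auto simp: algebra_simps)
  moreover have "continuous_on S (\<lambda>p. c' (F p))"
    using continuous_on_compose[OF C1_on_continuous(1)[OF F] c'] by (simp add: o_def)
  ultimately show ?thesis
    unfolding C1_on_def using C1_on_continuous[OF F]
    by (auto intro!: continuous_intros)
qed

text \<open>The complement of a compact set is open, so off \<open>K\<close> the function is locally
  zero and its derivatives vanish with it. A single \<open>K\<close> can therefore be used for the
  function and both partial derivatives.\<close>

lemma C1_test_support: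
  assumes "C1_test S \<phi> \<phi>t \<phi>x"
  obtains K where "compact K" "K \<subseteq> S" "\<And>p. p \<notin> K \<Longrightarrow> \<phi> p = 0"
    "\<And>p. p \<notin> K \<Longrightarrow> \<phi>t p = 0" "\<And>p. p \<notin> K \<Longrightarrow> \<phi>x p = 0"
proof -
  obtain K where K: "compact K" "K \<subseteq> S" "\<And>p. p \<notin> K \<Longrightarrow> \<phi> p = 0"
    using assms unfolding C1_test_def by blast
  have "(\<lambda>h. \<phi>t p * fst h + \<phi>x p * snd h) = (\<lambda>h. 0)" if "p \<notin> K" for p
  proof -
    have "(\<phi> has_derivative (\<lambda>h. 0)) (at p)"
      by (rule has_derivative_transform_within_open[where s="-K" and f="\<lambda>_. 0"])
         (use K(1,3) that in \<open>auto simp: open_Compl compact_imp_closed\<close>)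
    moreover have "(\<phi> has_derivative (\<lambda>h. \<phi>t p * fst h + \<phi>x p * snd h)) (at p)"
      using assms C1_on_D[of UNIV \<phi>] by (simp add: C1_test_def)
    ultimately show ?thesis using has_derivative_unique by blast
  qed
  from fun_cong[OF this, of _ "(1,0)"] fun_cong[OF this, of _ "(0,1)"]
  have "\<And>p. p \<notin> K \<Longrightarrow> \<phi>t p = 0" "\<And>p. p \<notin> K \<Longrightarrow> \<phi>x p = 0" by auto
  with K that show thesis by blast
qed

lemma C1_test_mono: "C1_test S \<phi> \<phi>t \<phi>x \<Longrightarrow> S \<subseteq> T \<Longrightarrow> C1_test T \<phi> \<phi>t \<phi>x"
  unfolding C1_test_def by blast

text \<open>Off \<open>T\<close> the values of \<open>F\<close> are arbitrary. The product is
  nevertheless \<open>C1\<close> on the whole plane: \<open>S\<close> and \<open>-K\<close> are open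
  and cover it, and on \<open>-K\<close> the first factor is locally zero. The closed set
  \<open>C\<close> confines the support; later it is one closed side of the shock, which cuts the
  test function down to the domain of one branch.\<close>

lemma C1_test_mult_support:
  assumes "C1_test S \<phi> \<phi>t \<phi>x" "C1_on T F Ft Fx" "open S" "S \<subseteq> T" "closed C"
    and "\<And>p. p \<in> S \<Longrightarrow> p \<notin> C \<Longrightarrow> F p = 0"
  shows "C1_test (S \<inter> C) (\<lambda>p. \<phi> p * F p) (\<lambda>p. \<phi>t p * F p + \<phi> p * Ft p) (\<lambda>p. \<phi>x p * F p + \<phi> p * Fx p)"
proof -
  obtain K where K: "compact K" "K \<subseteq> S" "\<And>p. p \<notin> K \<Longrightarrow> \<phi> p = 0"
    "\<And>p. p \<notin> K \<Longrightarrow> \<phi>t p = 0" "\<And>p. p \<notin> K \<Longrightarrow> \<phi>x p = 0"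
    using C1_test_support[OF assms(1)] by blast
  have phi: "C1_on UNIV \<phi> \<phi>t \<phi>x" using assms(1) by (simp add: C1_test_def)
  have oK: "open (-K)" using K(1) by (simp add: open_Compl compact_imp_closed)
  have "C1_on S (\<lambda>p. \<phi> p * F p) (\<lambda>p. \<phi>t p * F p + \<phi> p * Ft p) (\<lambda>p. \<phi>x p * F p + \<phi> p * Fx p)"
    by (rule C1_on_mult) (use C1_on_subset[OF phi] C1_on_subset[OF assms(2,4)] in auto)
  moreover have "C1_on (-K) (\<lambda>p. \<phi> p * F p) (\<lambda>p. \<phi>t p * F p + \<phi> p * Ft p) (\<lambda>p. \<phi>x p * F p + \<phi> p * Fx p)"
    unfolding C1_on_def
  proof (intro conjI ballI)
    fix p assume p: "p \<in> -K"
    have "((\<lambda>p. \<phi> p * F p) has_derivative (\<lambda>h. 0)) (at p)"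
      by (rule has_derivative_transform_within_open[where s="-K" and f="\<lambda>_. 0"])
         (use K p oK in auto)
    then show "((\<lambda>p. \<phi> p * F p) has_derivative (\<lambda>h. (\<phi>t p * F p + \<phi> p * Ft p) * fst h + (\<phi>x p * F p + \<phi> p * Fx p) * snd h)) (at p)"
      using p K by simp
  qed (use K in \<open>auto cong: continuous_on_cong_simp\<close>)
  ultimately have "C1_on (S \<union> -K) (\<lambda>p. \<phi> p * F p) (\<lambda>p. \<phi>t p * F p + \<phi> p * Ft p) (\<lambda>p. \<phi>x p * F p + \<phi> p * Fx p)"
    unfolding C1_on_def using continuous_on_open_Un[OF assms(3) oK] by blast
  moreover have "S \<union> -K = UNIV" using K(2) by blast
  moreover have "compact (K \<inter> C)" "K \<inter> C \<subseteq> S \<inter> C"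
    using K assms by (auto simp: compact_Int_closed)
  moreover have "\<forall>p. p \<notin> K \<inter> C \<longrightarrow> \<phi> p * F p = 0"
    using K(2,3) assms(6) by (metis IntI mult_eq_0_iff subsetD)
  ultimately show ?thesis unfolding C1_test_def by metis
qed

lemma C1_test_mult:
  assumes "C1_test S \<phi> \<phi>t \<phi>x" "C1_on S F Ft Fx" "open S"
  shows "C1_test S (\<lambda>p. \<phi> p * F p) (\<lambda>p. \<phi>t p * F p + \<phi> p * Ft p) (\<lambda>p. \<phi>x p * F p + \<phi> p * Fx p)"
  using C1_test_mult_support[OF assms order_refl closed_UNIV] by simp

lemma C1_on_UNIV_measurable:
  assumes "C1_on UNIV F Ft Fx"
  shows "F \<in> borel_measurable borel" "Ft \<in> borel_measurable borel" "Fx \<in> borel_measurable borel"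
  using C1_on_continuous[OF assms] by (auto intro!: borel_measurable_continuous_onI)

lemma C1_test_measurable:
  assumes "C1_test S F Ft Fx"
  shows "F \<in> borel_measurable borel" "Ft \<in> borel_measurable borel" "Fx \<in> borel_measurable borel"
  using C1_on_UNIV_measurable assms unfolding C1_test_def by blast+

lemma C1_test_bounded:
  assumes "C1_test S F Ft Fx"
  obtains B where "0 < B" "\<And>p. \<bar>F p\<bar> \<le> B" "\<And>p. \<bar>Ft p\<bar> \<le> B" "\<And>p. \<bar>Fx p\<bar> \<le> B"
proof -
  obtain K where K: "compact K" "\<And>p. p \<notin> K \<Longrightarrow> F p = 0"
    "\<And>p. p \<notin> K \<Longrightarrow> Ft p = 0" "\<And>p. p \<notin> K \<Longrightarrow> Fx p = 0"
    using C1_test_support[OF assms] by metis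
  have c: "continuous_on K F" "continuous_on K Ft" "continuous_on K Fx"
    using C1_on_continuous assms unfolding C1_test_def by (meson continuous_on_subset subset_UNIV)+
  have "bounded (F ` K \<union> Ft ` K \<union> Fx ` K)"
    using compact_imp_bounded compact_continuous_image[OF _ K(1)] c by auto
  then obtain B where "B > 0" and B: "\<And>y. y \<in> F ` K \<union> Ft ` K \<union> Fx ` K \<Longrightarrow> \<bar>y\<bar> \<le> B"
    unfolding bounded_pos by auto
  moreover have "\<bar>F p\<bar> \<le> B" "\<bar>Ft p\<bar> \<le> B" "\<bar>Fx p\<bar> \<le> B" for p
    using \<open>B > 0\<close> B[of "F p"] B[of "Ft p"] B[of "Fx p"] K(2-4)[of p] by (cases "p \<in> K"; simp)+
  ultimately show thesis using that by blast
qed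

lemma integrable_bounded_compact:
  fixes F :: "'a::euclidean_space \<Rightarrow> real"
  assumes "compact K" "F \<in> borel_measurable borel" "\<And>p. \<bar>F p\<bar> \<le> C" "\<And>p. p \<notin> K \<Longrightarrow> F p = 0"
  shows "integrable lborel F"
proof (rule Bochner_Integration.integrable_bound)
  show "integrable lborel (\<lambda>p. C * indicator K p :: real)"
    using assms(1) emeasure_compact_finite by (intro integrable_mult_right integrable_real_indicator) (auto simp: borel_compact)
  show "AE x in lborel. norm (F x) \<le> norm (C * indicator K x :: real)"
    using assms(3,4) by (intro AE_I2) (auto simp: indicator_def split: if_splits, metis abs_of_nonneg abs_ge_zero order_trans)
qed (use assms in simp)

lemma integral_derivative_compact_zero:
  fixes F F' :: "real \<Rightarrow> real"
  assumes "\<And>x. x \<notin> X \<Longrightarrow> (F has_real_derivative F' x) (at x)" "finite X"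
    and "continuous_on UNIV F" "F' \<in> borel_measurable borel"
    and "\<And>x. \<bar>F' x\<bar> \<le> B" "\<And>x. x \<notin> {a..b} \<Longrightarrow> F x = 0" "\<And>x. x \<notin> {a..b} \<Longrightarrow> F' x = 0"
  shows "(LINT x|lborel. F' x) = 0"
proof -
  \<comment> \<open>The margin 1 puts both endpoints outside \<open>{a..b}\<close>, where
    \<open>F\<close> is zero; \<open>min\<close> and \<open>max\<close> make the choice valid for an
    empty interval too.\<close>
  define c d where "c = min a b - 1" and "d = max a b + 1"
  have "integrable lborel F'"
    by (rule integrable_bounded_compact[of "{a..b}"]) (use assms in auto)
  then have 1: "(F' has_integral (LINT x|lborel. F' x)) UNIV"
    by (rule has_integral_integral_lborel)
  have "(F' has_integral (F d - F c)) {c..d}"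
    by (rule fundamental_theorem_of_calculus_strong[OF assms(2)])
       (use assms in \<open>auto simp: c_def d_def has_real_derivative_iff_has_vector_derivative intro: continuous_on_subset\<close>)
  moreover have "F d = 0" "F c = 0" by (rule assms(6); auto simp: c_def d_def max_def min_def)+
  ultimately have "(F' has_integral 0) {c..d}" by simp
  then have "(F' has_integral 0) UNIV"
    by (rule has_integral_on_superset) (rule assms(7), auto simp: c_def d_def)
  with 1 show ?thesis using has_integral_unique by blast
qed

text \<open>Integrate first in the variable of differentiation, where the fundamental theorem gives
  zero, then use Fubini. This discards constant multiples of \<open>\<phi>t\<close> and
  \<open>\<phi>x\<close> from entropy inequalities.\<close>

lemma C1_test_integral_zero:
  assumes "C1_test S \<phi> \<phi>t \<phi>x"
  shows "(LINT p|lborel. \<phi>t p) = 0" "(LINT p|lborel. \<phi>x p) = 0"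
proof -
  obtain K where K: "compact K" "\<And>p. p \<notin> K \<Longrightarrow> \<phi> p = 0"
    "\<And>p. p \<notin> K \<Longrightarrow> \<phi>t p = 0" "\<And>p. p \<notin> K \<Longrightarrow> \<phi>x p = 0"
    using C1_test_support[OF assms] by metis
  obtain B where B: "\<And>p. \<bar>\<phi>t p\<bar> \<le> B" "\<And>p. \<bar>\<phi>x p\<bar> \<le> B" using C1_test_bounded[OF assms] by metis
  note meas [measurable] = C1_test_measurable[OF assms]
  have meas' [measurable]: "\<phi>t \<in> borel_measurable (lborel \<Otimes>\<^sub>M lborel)" "\<phi>x \<in> borel_measurable (lborel \<Otimes>\<^sub>M lborel)"
    by (simp_all add: lborel_prod)
  obtain R where R: "\<And>p. p \<in> K \<Longrightarrow> norm p \<le> R"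
    using compact_imp_bounded[OF K(1)] by (auto simp: bounded_iff)
  have out: "p \<notin> K" if "fst p \<notin> {-R..R} \<or> snd p \<notin> {-R..R}" for p
  proof
    assume "p \<in> K"
    with R[OF this] norm_fst_le[of "fst p" "snd p"] norm_snd_le[of "snd p" "fst p"] that show False by auto
  qed
  have int: "integrable (lborel \<Otimes>\<^sub>M lborel) \<phi>t" "integrable (lborel \<Otimes>\<^sub>M lborel) \<phi>x"
    unfolding lborel_prod by (rule integrable_bounded_compact[OF K(1)]; use B K in auto)+
  have D: "(\<phi> has_derivative (\<lambda>h. \<phi>t p * fst h + \<phi>x p * snd h)) (at p)" for p
    using assms C1_on_D[of UNIV \<phi>] by (simp add: C1_test_def)
  have cont: "continuous_on UNIV \<phi>" using assms C1_on_continuous by (auto simp: C1_test_def)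
  have x: "(LINT x|lborel. \<phi>x (t, x)) = 0" for t
  proof (rule integral_derivative_compact_zero[of "{}" "\<lambda>x. \<phi> (t, x)" _ B "-R" R])
    fix x :: real
    have "((\<lambda>x. (t, x)) has_derivative (\<lambda>h. (0, h))) (at x)" by (auto intro!: derivative_eq_intros)
    from has_derivative_compose[OF this D[of "(t, x)"]] show "((\<lambda>x. \<phi> (t, x)) has_real_derivative \<phi>x (t, x)) (at x)"
      by (simp add: has_field_derivative_def)
  qed (use B K out in \<open>auto intro!: continuous_on_compose2[OF cont] continuous_intros\<close>)
  have t: "(LINT t|lborel. \<phi>t (t, x)) = 0" for x
  proof (rule integral_derivative_compact_zero[of "{}" "\<lambda>t. \<phi> (t, x)" _ B "-R" R])
    fix t :: real
    have "((\<lambda>t. (t, x)) has_derivative (\<lambda>h. (h, 0))) (at t)" by (auto intro!: derivative_eq_intros)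
    from has_derivative_compose[OF this D[of "(t, x)"]] show "((\<lambda>t. \<phi> (t, x)) has_real_derivative \<phi>t (t, x)) (at t)"
      by (simp add: has_field_derivative_def)
  qed (use B K out in \<open>auto intro!: continuous_on_compose2[OF cont] continuous_intros\<close>)
  show "(LINT p|lborel. \<phi>x p) = 0"
    using lborel_pair.integral_fst'[OF int(2)] x by (simp add: lborel_prod)
  show "(LINT p|lborel. \<phi>t p) = 0"
    using lborel_pair.integral_snd[of "\<lambda>t x. \<phi>t (t, x)"] int(1) t by (simp add: lborel_prod)
qed

subsection \<open>Varying the Kruzkov constant\<close>

text \<open>Squaring the positive part makes it \<open>C1\<close>. The bump, the step and the cone
  weight below are all built from it, which is enough since test functions have to be
  \<open>C1\<close> only.\<close>

lemma has_real_derivative_max0_square: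
  "((\<lambda>x::real. (max 0 x)\<^sup>2) has_real_derivative 2 * max 0 x) (at x)"
proof -
  consider "x < 0" | "x = 0" | "0 < x" by linarith
  then show ?thesis
  proof cases
    case 1
    have "((\<lambda>x::real. (max 0 x)\<^sup>2) has_real_derivative 0) (at x)"
      by (rule has_field_derivative_transform_within_open[where S="{..<0}" and f="\<lambda>_. 0"]) (use 1 in auto)
    then show ?thesis using 1 by simp
  next
    case 2
    have "((\<lambda>y::real. (max 0 y)\<^sup>2 / y) \<longlongrightarrow> 0) (at 0)"
    proof (rule Lim_null_comparison)
      show "\<forall>\<^sub>F y in at 0. norm ((max 0 y)\<^sup>2 / y) \<le> \<bar>y\<bar>" for y :: real
        by (intro always_eventually) (auto simp: max_def power2_eq_square)
    qed (auto intro!: tendsto_eq_intros)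
    then show ?thesis using 2 by (simp add: has_field_derivative_iff)
  next
    case 3
    have "((\<lambda>x::real. (max 0 x)\<^sup>2) has_real_derivative 2 * x) (at x)"
      by (rule has_field_derivative_transform_within_open[where S="{0<..}" and f="\<lambda>x. x\<^sup>2"])
         (use 3 in \<open>auto intro!: derivative_eq_intros\<close>)
    then show ?thesis using 3 by simp
  qed
qed

text \<open>An even piecewise polynomial profile on \<open>{-1..1}\<close> with value 1 at 0.
  Evenness removes the coincidence set in \<open>kruzkov_C1\<close>, and the value at 0 produces the
  jump relation in \<open>wave_relations\<close>.\<close>

definition bump :: "real \<Rightarrow> real" where "bump m = (max 0 (1 - m\<^sup>2))\<^sup>2"
definition bump' :: "real \<Rightarrow> real" where "bump' m = - 4 * m * max 0 (1 - m\<^sup>2)"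

lemma bump_deriv: "(bump has_real_derivative bump' m) (at m)"
proof -
  have "((\<lambda>m. 1 - m\<^sup>2) has_real_derivative - 2 * m) (at m)" by (auto intro!: derivative_eq_intros)
  from DERIV_chain2[OF has_real_derivative_max0_square this] show ?thesis
    by (simp add: bump_def[abs_def] bump'_def algebra_simps)
qed

lemma bump_continuous: "continuous_on A bump" "continuous_on A bump'"
  unfolding bump_def[abs_def] bump'_def[abs_def] by (intro continuous_intros)+

lemma bump_measurable [measurable]: "bump \<in> borel_measurable borel" "bump' \<in> borel_measurable borel"
  using bump_continuous[of UNIV] by (auto intro: borel_measurable_continuous_onI)

lemma bump_outside: "1 \<le> \<bar>m\<bar> \<Longrightarrow> bump m = 0" "1 \<le> \<bar>m\<bar> \<Longrightarrow> bump' m = 0"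
proof -
  assume "1 \<le> \<bar>m\<bar>"
  then have "1 \<le> m\<^sup>2" using abs_le_square_iff[of 1 m] by simp
  then show "bump m = 0" "bump' m = 0" by (auto simp: bump_def bump'_def)
qed

lemma bump_bounds: "0 \<le> bump m" "bump m \<le> 1" "\<bar>bump' m\<bar> \<le> 4"
proof -
  show "0 \<le> bump m" by (simp add: bump_def)
  show "bump m \<le> 1" unfolding bump_def by (rule power_le_one) auto
  show "\<bar>bump' m\<bar> \<le> 4"
  proof (cases "1 \<le> \<bar>m\<bar>")
    case False
    then have "\<bar>m\<bar> * \<bar>max 0 (1 - m\<^sup>2)\<bar> \<le> 1 * 1" by (intro mult_mono) auto
    then show ?thesis by (simp add: bump'_def abs_mult)
  qed (simp add: bump_outside)
qed

lemma bump_pos: "\<bar>m\<bar> < 1 \<Longrightarrow> 0 < bump m"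
  using abs_square_less_1[of m] by (simp add: bump_def)

lemma bump_integrable: "integrable lborel bump"
  by (rule integrable_bounded_compact[of "{-1..1}" _ 1])
     (auto simp: bump_bounds intro: bump_outside)

text \<open>By oddness of the integrand. In \<open>kruzkov_C1\<close> this annihilates the limit at
  the points where the two compared functions coincide.\<close>

lemma bump_sgn_integral: "integrable lborel (\<lambda>m. bump m * sgn m)" "(LINT m|lborel. bump m * sgn m) = 0"
proof -
  show "integrable lborel (\<lambda>m. bump m * sgn m)"
    by (rule Bochner_Integration.integrable_bound[OF bump_integrable])
       (auto simp: abs_mult sgn_if)
  have "(LINT m|lborel. bump m * sgn m) = - (LINT m|lborel. bump m * sgn m)"
    using lborel_integral_real_affine[of "-1" "\<lambda>m. bump m * sgn m" 0]
    by (simp add: bump_def sgn_minus)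
  then show "(LINT m|lborel. bump m * sgn m) = 0" by simp
qed

text \<open>The bump is left unnormalized; its mass appears as a common factor and is divided
  out.\<close>

lemma bump_integral_pos: "0 < (LINT m|lborel. bump m)"
proof -
  have "(LINT m|lborel. bump m) \<noteq> 0"
  proof
    assume "(LINT m|lborel. bump m) = 0"
    then have "AE m in lborel. bump m = 0"
      using integral_nonneg_eq_0_iff_AE[OF bump_integrable] bump_bounds by auto
    then have "AE m in lborel. m \<notin> {-1<..<1::real}"
      by eventually_elim (use bump_pos in \<open>force simp: abs_less_iff\<close>)
    then have "emeasure lborel {-1<..<1::real} = 0"
      by (subst AE_iff_measurable[symmetric, of _ _ "\<lambda>m. m \<notin> {-1<..<1::real}"]) auto
    then show False by simp
  qed
  moreover have "0 \<le> (LINT m|lborel. bump m)" by (simp add: bump_bounds)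
  ultimately show ?thesis by simp
qed

text \<open>The source is a function \<open>b\<close> of the point and not \<open>g\<close> composed
  with \<open>v\<close>. In this way constants qualify with \<open>b = 0\<close>, even if they are
  no equilibria of \<open>g\<close>.\<close>

definition kruzkov where
  "kruzkov S f v b \<longleftrightarrow> (\<forall>k \<phi> \<phi>t \<phi>x. C1_test S \<phi> \<phi>t \<phi>x \<and> (\<forall>p. 0 \<le> \<phi> p) \<longrightarrow>
     0 \<le> (LINT p|lborel. \<bar>v p - k\<bar> * \<phi>t p + sgn (v p - k) * (f (v p) - f k) * \<phi>x p
            + sgn (v p - k) * b p * \<phi> p))"

section \<open>Boundedness of composite integrands\<close>

lemma bounded_range_mult:
  fixes F G :: "'a \<Rightarrow> real"
  assumes "bounded (range F)" "bounded (range G)"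
  shows "bounded (range (\<lambda>x. F x * G x))"
proof -
  obtain a b where "\<forall>x. \<bar>F x\<bar> \<le> a" "\<forall>x. \<bar>G x\<bar> \<le> b" using assms by (auto simp: bounded_iff)
  then have "\<bar>F x * G x\<bar> \<le> a * b" for x
    unfolding abs_mult by (intro mult_mono) (auto intro: order_trans[OF abs_ge_zero])
  then show ?thesis by (auto simp: bounded_iff)
qed

lemma bounded_range_abs: "bounded (range F) \<Longrightarrow> bounded (range (\<lambda>x. \<bar>F x :: real\<bar>))"
  by (auto simp: bounded_iff)

lemma bounded_range_uminus: "bounded (range F) \<Longrightarrow> bounded (range (\<lambda>x. - F x :: real))"
  by (auto simp: bounded_iff)

lemma bounded_range_const: "bounded (range (\<lambda>x. c :: real))"
  by (auto simp: bounded_iff)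

lemma bounded_range_sgn: "bounded (range (\<lambda>x. sgn (F x :: real)))"
  unfolding bounded_iff by (rule exI[of _ 1]) (auto simp: sgn_if)

lemma bounded_range_comp: "bounded (range F) \<Longrightarrow> bounded (range (\<lambda>x. F (h x)))"
  by (rule bounded_subset) auto

lemmas bounded_range_intros =
  bounded_plus_comp bounded_minus_comp bounded_range_mult bounded_range_abs bounded_range_sgn

text \<open>The integrand is the derivative in \<open>k\<close> of the entropy pair, weighted by
  \<open>P\<close> and \<open>Q\<close>, times the bump. With \<open>P\<close> and \<open>Q\<close>
  equal to \<open>\<phi>\<close> times the partial derivatives of \<open>w\<close>, this exchanges a
  derivative of the bump for the transport term \<open>P + f' k * Q\<close>.\<close>

lemma integral_bump_by_parts:
  fixes f f' :: "real \<Rightarrow> real"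
  assumes f: "\<And>x. (f has_real_derivative f' x) (at x)" and f': "continuous_on UNIV f'" and "0 < e"
  shows "(LINT k|lborel. (\<bar>v - k\<bar> * P + sgn (v - k) * (f v - f k) * Q) * (bump' ((k - w) / e) / e)
           - sgn (v - k) * (P + f' k * Q) * bump ((k - w) / e)) = 0"
proof -
  let ?F = "\<lambda>k. (\<bar>v - k\<bar> * P + sgn (v - k) * (f v - f k) * Q) * bump ((k - w) / e)"
  let ?F' = "\<lambda>k. (\<bar>v - k\<bar> * P + sgn (v - k) * (f v - f k) * Q) * (bump' ((k - w) / e) / e)
           - sgn (v - k) * (P + f' k * Q) * bump ((k - w) / e)"
  have cf: "continuous_on UNIV f" using f by (meson DERIV_isCont continuous_at_imp_continuous_on)
  note [measurable] = borel_measurable_continuous_onI[OF cf] borel_measurable_continuous_onI[OF f']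
  have out: "?F k = 0 \<and> ?F' k = 0" if "k \<notin> {w-e..w+e}" for k
  proof -
    have "1 \<le> \<bar>(k - w) / e\<bar>" using that \<open>0 < e\<close> by (auto simp: abs_if field_simps)
    then show ?thesis using bump_outside by simp
  qed
  \<comment> \<open>The jump of \<open>sgn\<close> at \<open>k = v\<close> is harmless because the
    other factor vanishes there.\<close>
  have cont: "continuous_on UNIV (\<lambda>k. sgn (v - k) * (f v - f k))"
    unfolding continuous_on_eq_continuous_at[OF open_UNIV]
  proof
    fix k show "isCont (\<lambda>k. sgn (v - k) * (f v - f k)) k"
    proof (cases "v = k")
      case True
      have "((\<lambda>k. sgn (v - k) * (f v - f k)) \<longlongrightarrow> 0) (at k)"
      proof (rule Lim_null_comparison)
        show "\<forall>\<^sub>F y in at k. norm (sgn (v - y) * (f v - f y)) \<le> \<bar>f v - f y\<bar>"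
          by (intro always_eventually) (auto simp: abs_mult sgn_if)
        have "isCont (\<lambda>y. \<bar>f v - f y\<bar>) k" using cf by (auto intro!: continuous_intros simp: continuous_on_eq_continuous_at)
        then show "((\<lambda>y. \<bar>f v - f y\<bar>) \<longlongrightarrow> 0) (at k)" using True by (simp add: isCont_def)
      qed
      then show ?thesis using True by (simp add: isCont_def)
    next
      case False
      have "isCont f k" using cf by (auto simp: continuous_on_eq_continuous_at)
      then show ?thesis using False by (auto intro!: continuous_intros)
    qed
  qed
  have "\<exists>B. \<forall>k. \<bar>?F' k\<bar> \<le> B"
  proof -
    let ?I = "{w-e..w+e}"
    let ?G = "\<lambda>k. (\<bar>v - k\<bar> * P + sgn (v - k) * (f v - f k) * Q) * (bump' ((k - w) / e) / e)"
    let ?H = "\<lambda>k. (P + f' k * Q) * bump ((k - w) / e)"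
    have "continuous_on UNIV (\<lambda>k. bump ((k - w) / e))" "continuous_on UNIV (\<lambda>k. bump' ((k - w) / e))"
      by (rule continuous_on_compose2[OF bump_continuous(1)] continuous_on_compose2[OF bump_continuous(2)];
          use \<open>0 < e\<close> in \<open>auto intro!: continuous_intros\<close>)+
    then have "continuous_on UNIV ?G" "continuous_on UNIV ?H"
      using cont f' \<open>0 < e\<close> by (auto intro!: continuous_intros)
    then have "continuous_on ?I ?G" "continuous_on ?I ?H"
      by (meson continuous_on_subset subset_UNIV)+
    then have "bounded (?G ` ?I)" "bounded (?H ` ?I)"
      by (meson compact_Icc compact_continuous_image compact_imp_bounded)+
    then obtain b1 b2 where b: "\<And>k. k \<in> ?I \<Longrightarrow> \<bar>?G k\<bar> \<le> b1" "\<And>k. k \<in> ?I \<Longrightarrow> \<bar>?H k\<bar> \<le> b2"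
      unfolding bounded_iff real_norm_def by blast
    have "\<bar>?F' k\<bar> \<le> max 0 (b1 + b2)" for k
    proof (cases "k \<in> ?I")
      case True
      have aux: "\<bar>x - s * y\<bar> \<le> max 0 (b1 + b2)" if "\<bar>x\<bar> \<le> b1" "\<bar>y\<bar> \<le> b2" "\<bar>s\<bar> \<le> 1" for x y s
      proof -
        have "\<bar>s * y\<bar> \<le> \<bar>y\<bar>" using that(3) by (simp add: abs_mult mult_left_le_one_le)
        then show ?thesis using that abs_triangle_ineq4[of x "s * y"] by linarith
      qed
      show ?thesis using aux[OF b[OF True], of "sgn (v - k)"] by (simp add: sgn_if mult.assoc)
    qed (use out in simp)
    then show ?thesis by blast
  qed
  then obtain B where B: "\<And>k. \<bar>?F' k\<bar> \<le> B" by blast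
  show ?thesis
  proof (rule integral_derivative_compact_zero[of "{v}" ?F ?F' B "w-e" "w+e"])
    fix k assume k: "k \<notin> {v}"
    have 1: "((\<lambda>k. \<bar>v - k\<bar> * P + sgn (v - k) * (f v - f k) * Q) has_real_derivative - sgn (v - k) * (P + f' k * Q)) (at k)"
    proof (cases "k < v")
      case True
      have "((\<lambda>k. (v - k) * P + (f v - f k) * Q) has_real_derivative - (P + f' k * Q)) (at k)"
        by (auto intro!: derivative_eq_intros f)
      then have "((\<lambda>k. \<bar>v - k\<bar> * P + sgn (v - k) * (f v - f k) * Q) has_real_derivative - (P + f' k * Q)) (at k)"
        by (rule has_field_derivative_transform_within_open[where S="{..<v}"]) (use True in auto)
      then show ?thesis using True by simp
    next
      case False
      have "((\<lambda>k. - ((v - k) * P + (f v - f k) * Q)) has_real_derivative (P + f' k * Q)) (at k)"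
        by (auto intro!: derivative_eq_intros f)
      then have "((\<lambda>k. \<bar>v - k\<bar> * P + sgn (v - k) * (f v - f k) * Q) has_real_derivative (P + f' k * Q)) (at k)"
        by (rule has_field_derivative_transform_within_open[where S="{v<..}"]) (use False k in \<open>auto simp: algebra_simps\<close>)
      then show ?thesis using False k by simp
    qed
    have 2: "((\<lambda>k. bump ((k - w) / e)) has_real_derivative bump' ((k - w) / e) / e) (at k)"
    proof -
      have "((\<lambda>k. (k - w) / e) has_real_derivative 1 / e) (at k)"
        using \<open>0 < e\<close> by (auto intro!: derivative_eq_intros)
      from DERIV_chain2[OF bump_deriv this] show ?thesis by simp
    qed
    show "(?F has_real_derivative ?F' k) (at k)"
      by (rule DERIV_cong[OF DERIV_mult[OF 1 2]]) (simp add: algebra_simps)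
  next
    show "continuous_on UNIV ?F"
      by (intro continuous_intros cont continuous_on_compose2[OF bump_continuous(1)]) (use \<open>0 < e\<close> in auto)
  qed (use B out in auto)
qed


text \<open>Testing the entropy inequality of level \<open>k\<close> with \<open>\<phi>\<close> times a bump concentrated at \<open>k = w\<close>
  and integrating over \<open>k\<close> replaces the constant \<open>k\<close> by the function \<open>w\<close>.\<close>

lemma kruzkov_C1:
  fixes f f' :: "real \<Rightarrow> real"
  assumes kr: "kruzkov S f v b" and S: "open S"
    and v [measurable]: "v \<in> borel_measurable borel" and b [measurable]: "b \<in> borel_measurable borel"
    and vM: "\<And>p. \<bar>v p\<bar> \<le> M" and bM: "\<And>p. \<bar>b p\<bar> \<le> M"
    and f: "\<And>x. (f has_real_derivative f' x) (at x)" and f': "continuous_on UNIV f'"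
    and w: "C1_on S w wt wx"
    and phi: "C1_test S \<phi> \<phi>t \<phi>x" and phi0: "\<And>p. 0 \<le> \<phi> p"
  shows "0 \<le> (LINT p|lborel. \<bar>v p - w p\<bar> * \<phi>t p + sgn (v p - w p) * (f (v p) - f (w p)) * \<phi>x p
            + sgn (v p - w p) * (b p - wt p - f' (w p) * wx p) * \<phi> p)"
proof -
  obtain K where K: "compact K" "K \<subseteq> S" "\<And>p. p \<notin> K \<Longrightarrow> \<phi> p = 0"
    "\<And>p. p \<notin> K \<Longrightarrow> \<phi>t p = 0" "\<And>p. p \<notin> K \<Longrightarrow> \<phi>x p = 0"
    using C1_test_support[OF phi] by metis
  note [measurable] = C1_test_measurable[OF phi] borel_compact[OF K(1)]
  have cf: "continuous_on UNIV f" using f by (meson DERIV_isCont continuous_at_imp_continuous_on)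
  \<comment> \<open>Outside \<open>S\<close> nothing is known about \<open>w\<close>. Cutting it off
    to the support of \<open>\<phi>\<close> gives bounded Borel functions on the plane and changes
    no integral.\<close>
  define w0 wt0 wx0 where "w0 = (\<lambda>p. if p \<in> K then w p else 0)"
    and "wt0 = (\<lambda>p. if p \<in> K then wt p else 0)" and "wx0 = (\<lambda>p. if p \<in> K then wx p else 0)"
  note w0_defs = w0_def wt0_def wx0_def
  have cK: "continuous_on K w" "continuous_on K wt" "continuous_on K wx"
    using C1_on_continuous[OF C1_on_subset[OF w K(2)]] .
  have [measurable]: "w0 \<in> borel_measurable borel" "wt0 \<in> borel_measurable borel" "wx0 \<in> borel_measurable borel"
    unfolding w0_defs by (intro borel_measurable_continuous_on_if; use cK K(1) in \<open>auto intro: borel_compact\<close>)+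
  have bd: "bounded (range (\<lambda>p. if p \<in> K then h p else 0))" if "continuous_on K h" for h :: "_ \<Rightarrow> real"
    by (rule bounded_subset[of "insert 0 (h ` K)"])
       (use compact_imp_bounded[OF compact_continuous_image[OF that K(1)]] in auto)
  have bw: "bounded (range w0)" "bounded (range wt0)" "bounded (range wx0)"
    unfolding w0_defs using bd cK by auto
  obtain B where "0 < B" and B: "\<And>p. \<bar>w0 p\<bar> \<le> B"
    using bw(1) unfolding bounded_pos real_norm_def by blast
  have bphi: "bounded (range \<phi>)" "bounded (range \<phi>t)" "bounded (range \<phi>x)"
    using C1_test_bounded[OF phi] unfolding bounded_iff real_norm_def by (metis rangeE)+
  have bv: "bounded (range v)" "bounded (range b)"
    using vM bM unfolding bounded_iff real_norm_def by (metis rangeE)+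
  \<comment> \<open>Clipping the level keeps \<open>f (c k)\<close> and \<open>f' (c k)\<close>
    bounded in \<open>k\<close>. It is inactive wherever the bump around \<open>w0 p\<close> is
    nonzero, since \<open>\<bar>w0 p\<bar> \<le> B\<close> and the bump has radius
    \<open>e n \<le> 1\<close>.\<close>
  define c :: "real \<Rightarrow> real" where "c k = max (- (B + 1)) (min (B + 1) k)" for k
  have c_id: "\<bar>k\<bar> \<le> B + 1 \<Longrightarrow> c k = k" for k by (auto simp: c_def)
  have c_cont: "continuous_on UNIV c" unfolding c_def by (intro continuous_intros)
  have [measurable]: "c \<in> borel_measurable borel" "f \<in> borel_measurable borel" "f' \<in> borel_measurable borel"
    using c_cont cf f' by (auto intro: borel_measurable_continuous_onI)
  have bcomp: "bounded (range (\<lambda>k. h (c k)))" if "continuous_on UNIV h" for h :: "real \<Rightarrow> real"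
  proof (rule bounded_subset)
    show "bounded (h ` {-(B+1)..B+1})"
      using that by (intro compact_imp_bounded compact_continuous_image) (auto intro: continuous_on_subset)
    show "range (\<lambda>k. h (c k)) \<subseteq> h ` {-(B+1)..B+1}" using \<open>0 < B\<close> by (auto simp: c_def)
  qed
  have bc: "bounded (range c)" "bounded (range (\<lambda>k. f (c k)))" "bounded (range (\<lambda>k. f' (c k)))"
    using bcomp[OF cf] bcomp[OF f'] bcomp[OF continuous_on_id] by auto
  have bfv: "bounded (range (\<lambda>p. f (v p)))"
  proof (rule bounded_subset)
    show "bounded (f ` {-M..M})"
      using cf by (intro compact_imp_bounded compact_continuous_image) (auto intro: continuous_on_subset)
    show "range (\<lambda>p. f (v p)) \<subseteq> f ` {-M..M}" using vM by (auto simp: abs_le_iff minus_le_iff intro!: imageI)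
  qed
  \<comment> \<open>The integrand of the goal, with the level \<open>k\<close> in place of
    \<open>w\<close> everywhere except in the derivatives of \<open>w\<close>.\<close>
  define L where "L k p = \<bar>v p - c k\<bar> * \<phi>t p + sgn (v p - c k) * (f (v p) - f (c k)) * \<phi>x p
      + sgn (v p - c k) * (b p - wt0 p - f' (c k) * wx0 p) * \<phi> p" for k p
  have "(\<lambda>x. L (fst x) (snd x)) \<in> borel_measurable (borel \<Otimes>\<^sub>M borel)"
    unfolding L_def by measurable
  then have L_meas: "(\<lambda>x. L (fst x) (snd x)) \<in> borel_measurable borel" by (simp add: borel_prod)
  note bintros = bounded_range_intros bounded_range_comp[OF bphi(1)] bounded_range_comp[OF bphi(2)]
    bounded_range_comp[OF bphi(3)] bounded_range_comp[OF bv(1)] bounded_range_comp[OF bv(2)]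
    bounded_range_comp[OF bw(2)] bounded_range_comp[OF bw(3)] bounded_range_comp[OF bc(1)]
    bounded_range_comp[OF bc(2)] bounded_range_comp[OF bc(3)] bounded_range_comp[OF bfv]
  have L_bdd: "bounded (range (\<lambda>x. L (fst x) (snd x)))"
    unfolding L_def by (intro bintros)
  then obtain CL where CL: "\<And>k p. \<bar>L k p\<bar> \<le> CL" unfolding bounded_iff by (metis fst_conv rangeI real_norm_def snd_conv)
  have L_out: "p \<notin> K \<Longrightarrow> L k p = 0" for k p using K by (simp add: L_def)
  define e where "e n = 1 / real (Suc n)" for n
  have e: "0 < e n" "e n \<le> 1" for n by (auto simp: e_def)
  \<comment> \<open>The argument stands for \<open>(m, p)\<close> and the level is
    \<open>w0 p + e n * m\<close>. In this variable the bump no longer depends on \<open>n\<close>,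
    so dominated convergence applies.\<close>
  define G where "G n x = bump (fst x) * L (w0 (snd x) + e n * fst x) (snd x)" for n and x :: "real \<times> real \<times> real"
  have G_meas [measurable]: "G n \<in> borel_measurable borel" for n
  proof -
    have "(\<lambda>x::real \<times> real \<times> real. (w0 (snd x) + e n * fst x, snd x)) \<in> borel_measurable (borel \<Otimes>\<^sub>M borel)" by measurable
    from measurable_compose[OF this L_meas]
    have "G n \<in> borel_measurable (borel \<Otimes>\<^sub>M borel)" unfolding G_def fst_conv snd_conv by measurable
    then show ?thesis by (simp add: borel_prod)
  qed
  have G_bd: "\<bar>G n x\<bar> \<le> CL * indicator ({-1..1} \<times> K) x" for n x
  proof (cases "x \<in> {-1..1} \<times> K")
    case True
    have "\<bar>G n x\<bar> \<le> 1 * CL" unfolding G_def abs_mult using bump_bounds CL by (intro mult_mono) auto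
    then show ?thesis using True by simp
  next
    case False
    then have "G n x = 0" unfolding G_def using L_out bump_outside by (cases x) auto
    then show ?thesis using False by simp
  qed
  have K3: "compact ({-1..1::real} \<times> K)" using K(1) by (intro compact_Times) auto
  have dom: "integrable lborel (\<lambda>x. CL * indicator ({-1..1::real} \<times> K) x)"
    using emeasure_compact_finite[OF K3] by (intro integrable_mult_right integrable_real_indicator) (auto simp: borel_compact[OF K3])
  have Gint: "integrable lborel (G n)" for n
    by (rule Bochner_Integration.integrable_bound[OF dom]) (use G_bd[of n] in \<open>auto intro!: AE_I2 order_trans[OF G_bd] \<close>)
  have Gpos: "0 \<le> integral\<^sup>L lborel (G n)" for n
  proof -
    define \<beta> \<beta>' where "\<beta> k p = bump ((c k - w0 p) / e n)" and "\<beta>' k p = bump' ((c k - w0 p) / e n) / e n" for k p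
    \<comment> \<open>The entropy integrand of level \<open>k\<close> for the test function
      \<open>\<phi> * \<beta> k\<close>. The terms with \<open>\<beta>'\<close> arise from the chain
      rule, as the bump follows \<open>w\<close>.\<close>
    define E where "E k p = indicator {-(B+1)..B+1} k * (\<bar>v p - c k\<bar> * (\<phi>t p * \<beta> k p + \<phi> p * (- \<beta>' k p * wt0 p))
        + sgn (v p - c k) * (f (v p) - f (c k)) * (\<phi>x p * \<beta> k p + \<phi> p * (- \<beta>' k p * wx0 p))
        + sgn (v p - c k) * b p * (\<phi> p * \<beta> k p))" for k p
    have "\<bar>bump m\<bar> \<le> 1" "\<bar>bump' m / e n\<bar> \<le> 4 / e n" for m
      using bump_bounds[of m] e[of n] by (auto intro!: divide_right_mono)
    then have bump_bd: "bounded (range bump)" "bounded (range (\<lambda>m. bump' m / e n))"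
      unfolding bounded_iff real_norm_def by blast+
    have bb: "bounded (range (\<lambda>x. \<beta> (fst x) (snd x)))" "bounded (range (\<lambda>x. \<beta>' (fst x) (snd x)))"
      unfolding \<beta>_def \<beta>'_def by (rule bounded_range_comp[OF bump_bd(1)] bounded_range_comp[OF bump_bd(2)])+
    have "(\<lambda>x. E (fst x) (snd x)) \<in> borel_measurable (borel \<Otimes>\<^sub>M borel)"
      unfolding E_def \<beta>_def \<beta>'_def by measurable
    then have E_meas: "(\<lambda>x. E (fst x) (snd x)) \<in> borel_measurable borel" by (simp add: borel_prod)
    have E_bdd: "bounded (range (\<lambda>x. E (fst x) (snd x)))"
      unfolding E_def
      by (intro bintros bb bounded_range_uminus)
         (auto simp: bounded_iff indicator_def intro!: exI[of _ 1])
    then obtain CE where CE: "\<And>k p. \<bar>E k p\<bar> \<le> CE" unfolding bounded_iff by (metis fst_conv rangeI real_norm_def snd_conv)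
    have E_out: "E k p = 0" if "(k, p) \<notin> {-(B+1)..B+1} \<times> K" for k p
      using that K(3-5)[of p] by (cases "p \<in> K") (simp_all add: E_def)
    have Eint: "integrable lborel (\<lambda>x. E (fst x) (snd x))"
    proof (rule integrable_bounded_compact[of "{-(B+1)..B+1} \<times> K" _ CE])
      fix x assume "x \<notin> {-(B+1)..B+1} \<times> K"
      then show "E (fst x) (snd x) = 0" using E_out[of "fst x" "snd x"] by simp
    qed (use K(1) CE E_meas in \<open>simp_all add: compact_Times\<close>)
    have Epos: "0 \<le> (LINT p|lborel. E k p)" for k
    proof (cases "k \<in> {-(B+1)..B+1}")
      case True
      then have ck: "c k = k" by (intro c_id) auto
      have 1: "C1_on S (\<lambda>p. bump ((k - w p) / e n)) (\<lambda>p. - bump' ((k - w p) / e n) / e n * wt p) (\<lambda>p. - bump' ((k - w p) / e n) / e n * wx p)"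
      proof (rule C1_on_compose[OF w, where c="\<lambda>y. bump ((k - y) / e n)" and c'="\<lambda>y. - bump' ((k - y) / e n) / e n"])
        fix p
        have "((\<lambda>y. (k - y) / e n) has_real_derivative - 1 / e n) (at (w p))"
          using e[of n] by (auto intro!: derivative_eq_intros)
        from DERIV_chain2[OF bump_deriv this]
        show "((\<lambda>y. bump ((k - y) / e n)) has_real_derivative - bump' ((k - w p) / e n) / e n) (at (w p))" by simp
        show "continuous_on (w ` S) (\<lambda>y. - bump' ((k - y) / e n) / e n)"
          using e[of n] by (intro continuous_intros continuous_on_compose2[OF bump_continuous(2)[of UNIV]]) auto
      qed
      have "0 \<le> (LINT p|lborel. \<bar>v p - k\<bar> * (\<phi>t p * bump ((k - w p) / e n) + \<phi> p * (- bump' ((k - w p) / e n) / e n * wt p))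
         + sgn (v p - k) * (f (v p) - f k) * (\<phi>x p * bump ((k - w p) / e n) + \<phi> p * (- bump' ((k - w p) / e n) / e n * wx p))
            + sgn (v p - k) * b p * (\<phi> p * bump ((k - w p) / e n)))"
        using kr C1_test_mult[OF phi 1 S] phi0 bump_bounds(1) unfolding kruzkov_def by (meson mult_nonneg_nonneg)
      also have "\<dots> = (LINT p|lborel. E k p)"
      proof (rule Bochner_Integration.integral_cong[OF refl])
        fix p show "\<bar>v p - k\<bar> * (\<phi>t p * bump ((k - w p) / e n) + \<phi> p * (- bump' ((k - w p) / e n) / e n * wt p))
         + sgn (v p - k) * (f (v p) - f k) * (\<phi>x p * bump ((k - w p) / e n) + \<phi> p * (- bump' ((k - w p) / e n) / e n * wx p))
            + sgn (v p - k) * b p * (\<phi> p * bump ((k - w p) / e n)) = E k p"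
          using True K(3-5)[of p] by (cases "p \<in> K") (simp_all add: E_def \<beta>_def \<beta>'_def ck w0_defs)
      qed
      finally show ?thesis .
    qed (simp add: E_def)
    have inner: "(LINT k|lborel. E k p) = e n * (LINT m|lborel. G n (m, p))" for p
    proof -
      let ?P = "\<phi> p * wt0 p" and ?Q = "\<phi> p * wx0 p"
      let ?Z = "\<lambda>k. (\<bar>v p - k\<bar> * ?P + sgn (v p - k) * (f (v p) - f k) * ?Q) * (bump' ((k - w0 p) / e n) / e n)
           - sgn (v p - k) * (?P + f' k * ?Q) * bump ((k - w0 p) / e n)"
      let ?g = "\<lambda>k. bump ((k - w0 p) / e n) * L k p"
      \<comment> \<open>The two integrands differ by \<open>?Z\<close>, whose integral over
        \<open>k\<close> vanishes: the derivatives of the bump in \<open>E\<close> have become the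
        transport term in \<open>L\<close>.\<close>
      have eq: "?g k - ?Z k = E k p" for k
      proof (cases "\<bar>k\<bar> \<le> B + 1")
        case True
        then have "k \<in> {-(B+1)..B+1}" by auto
        then show ?thesis using c_id[OF True] by (simp add: E_def \<beta>_def \<beta>'_def L_def algebra_simps)
      next
        case False
        have "e n \<le> \<bar>k - w0 p\<bar>" using False B[of p] e[of n] by (auto simp: abs_if split: if_splits)
        then have "1 \<le> \<bar>(k - w0 p) / e n\<bar>" using e[of n] by simp
        then have "?g k = 0" "?Z k = 0" by (simp_all only: bump_outside mult_zero_right mult_zero_left diff_self div_0)
        moreover have "E k p = 0" by (rule E_out) (use False in auto)
        ultimately show ?thesis by simp
      qed
      have g_int: "integrable lborel ?g"
      proof (rule integrable_bounded_compact[of "{-(B+1)..B+1}" _ CL])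
        have "(\<lambda>k. (k, p)) \<in> borel_measurable borel" by (intro borel_measurable_continuous_onI continuous_intros)
        from measurable_compose[OF this L_meas]
        show "?g \<in> borel_measurable borel" using e[of n] by simp
        fix k
        show "\<bar>?g k\<bar> \<le> CL" unfolding abs_mult
          using mult_mono[of "\<bar>bump ((k - w0 p) / e n)\<bar>" 1 "\<bar>L k p\<bar>" CL] bump_bounds CL[of k p] by simp
        assume "k \<notin> {-(B+1)..B+1}"
        then have "e n \<le> \<bar>k - w0 p\<bar>" using B[of p] e[of n] by (auto simp: abs_if split: if_splits)
        then have "1 \<le> \<bar>(k - w0 p) / e n\<bar>" using e[of n] by simp
        then show "?g k = 0" by (simp add: bump_outside)
      qed auto
      have E_int: "integrable lborel (\<lambda>k. E k p)"
      proof (rule integrable_bounded_compact[of "{-(B+1)..B+1}" _ CE])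
        have "(\<lambda>k. (k, p)) \<in> borel_measurable borel" by (intro borel_measurable_continuous_onI continuous_intros)
        from measurable_compose[OF this E_meas] show "(\<lambda>k. E k p) \<in> borel_measurable borel" by simp
      qed (use CE in \<open>auto simp: E_def\<close>)
      have "(LINT k|lborel. ?g k) - (LINT k|lborel. E k p) = (LINT k|lborel. ?g k - E k p)"
        using g_int E_int by simp
      also have "\<dots> = (LINT k|lborel. ?Z k)"
        by (rule Bochner_Integration.integral_cong[OF refl]) (simp add: eq[symmetric])
      also have "\<dots> = 0" by (rule integral_bump_by_parts[OF f f' e(1)])
      finally have "(LINT k|lborel. E k p) = (LINT k|lborel. ?g k)" by simp
      also have "\<dots> = e n * (LINT m|lborel. ?g (w0 p + e n * m))"
        using lborel_integral_real_affine[of "e n" ?g "w0 p"] e[of n] by simp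
      also have "(LINT m|lborel. ?g (w0 p + e n * m)) = (LINT m|lborel. G n (m, p))"
        using e[of n] by (simp add: G_def)
      finally show ?thesis .
    qed
    have "0 \<le> (LINT k|lborel. LINT p|lborel. E k p)" using Epos by simp
    also have "\<dots> = (LINT p|lborel. LINT k|lborel. E k p)"
      using lborel_pair.Fubini_integral[of "\<lambda>k p. E k p"] Eint by (simp add: lborel_prod case_prod_beta')
    also have "\<dots> = e n * (LINT p|lborel. LINT m|lborel. G n (m, p))"
      unfolding inner by simp
    also have "(LINT p|lborel. LINT m|lborel. G n (m, p)) = integral\<^sup>L lborel (G n)"
      using lborel_pair.integral_snd[of "\<lambda>m p. G n (m, p)"] Gint[of n] by (simp add: lborel_prod)
    finally show ?thesis using e(1)[of n] by (simp add: zero_le_mult_iff)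
  qed
  \<comment> \<open>The limit of \<open>sgn (v p - (w0 p + e n * m))\<close>. Where \<open>v\<close>
    and \<open>w0\<close> agree this is \<open>- sgn m\<close> and not 0, because the level
    approaches \<open>w0 p\<close> from one side.\<close>
  define s where "s m p = (if v p = w0 p then - sgn m else sgn (v p - w0 p))" for m p
  define G0 where "G0 x = bump (fst x) * (\<bar>v (snd x) - w0 (snd x)\<bar> * \<phi>t (snd x) + sgn (v (snd x) - w0 (snd x)) * (f (v (snd x)) - f (w0 (snd x))) * \<phi>x (snd x)
      + s (fst x) (snd x) * (b (snd x) - wt0 (snd x) - f' (w0 (snd x)) * wx0 (snd x)) * \<phi> (snd x))" for x
  have "G0 \<in> borel_measurable (borel \<Otimes>\<^sub>M borel)" unfolding G0_def s_def by measurable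
  then have G0_meas [measurable]: "G0 \<in> borel_measurable borel" by (simp add: borel_prod)
  have lim: "(\<lambda>n. G n x) \<longlonglongrightarrow> G0 x" for x
  proof (cases "\<bar>fst x\<bar> < 1")
    case True
    define k where "k n = w0 (snd x) + e n * fst x" for n
    have "(\<lambda>n. e n) \<longlonglongrightarrow> 0" unfolding e_def by (rule LIMSEQ_Suc[OF lim_1_over_n])
    then have "k \<longlonglongrightarrow> w0 (snd x) + 0 * fst x" unfolding k_def by (intro tendsto_intros)
    then have k: "k \<longlonglongrightarrow> w0 (snd x)" by simp
    have ck: "c (k n) = k n" for n
    proof (rule c_id)
      have "\<bar>k n\<bar> \<le> \<bar>w0 (snd x)\<bar> + \<bar>e n * fst x\<bar>" unfolding k_def by (rule abs_triangle_ineq)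
      also have "\<bar>e n * fst x\<bar> \<le> 1 * 1" unfolding abs_mult using True e[of n] by (intro mult_mono) auto
      finally show "\<bar>k n\<bar> \<le> B + 1" using B[of "snd x"] by simp
    qed
    have fk: "(\<lambda>n. f (k n)) \<longlonglongrightarrow> f (w0 (snd x))" "(\<lambda>n. f' (k n)) \<longlonglongrightarrow> f' (w0 (snd x))"
      using continuous_on_tendsto_compose[OF cf k] continuous_on_tendsto_compose[OF f' k] by simp_all
    have sk: "(\<lambda>n. sgn (v (snd x) - k n)) \<longlonglongrightarrow> s (fst x) (snd x)"
    proof (cases "v (snd x) = w0 (snd x)")
      case True
      then have "sgn (v (snd x) - k n) = s (fst x) (snd x)" for n
        using e(1)[of n] by (simp add: k_def s_def sgn_mult sgn_minus)
      then show ?thesis by simp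
    next
      case False
      then show ?thesis using tendsto_sgn[OF tendsto_diff[OF tendsto_const k], of "v (snd x)"] by (simp add: s_def)
    qed
    have sf: "(\<lambda>n. sgn (v (snd x) - k n) * (f (v (snd x)) - f (k n))) \<longlonglongrightarrow> sgn (v (snd x) - w0 (snd x)) * (f (v (snd x)) - f (w0 (snd x)))"
    proof (cases "v (snd x) = w0 (snd x)")
      case True
      have "(\<lambda>n. sgn (v (snd x) - k n) * (f (v (snd x)) - f (k n))) \<longlonglongrightarrow> s (fst x) (snd x) * (f (v (snd x)) - f (w0 (snd x)))"
        by (intro tendsto_intros sk fk)
      then show ?thesis using True by simp
    next
      case False
      have "(\<lambda>n. sgn (v (snd x) - k n) * (f (v (snd x)) - f (k n))) \<longlonglongrightarrow> s (fst x) (snd x) * (f (v (snd x)) - f (w0 (snd x)))"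
        by (intro tendsto_intros sk fk)
      then show ?thesis using False by (simp add: s_def)
    qed
    have "(\<lambda>n. bump (fst x) * (\<bar>v (snd x) - k n\<bar> * \<phi>t (snd x) + sgn (v (snd x) - k n) * (f (v (snd x)) - f (k n)) * \<phi>x (snd x)
      + sgn (v (snd x) - k n) * (b (snd x) - wt0 (snd x) - f' (k n) * wx0 (snd x)) * \<phi> (snd x))) \<longlonglongrightarrow> G0 x"
      unfolding G0_def
      by (intro sk sf fk k tendsto_add tendsto_mult tendsto_diff tendsto_rabs tendsto_const)
    then show ?thesis unfolding G_def L_def k_def[symmetric] ck .
  next
    case False
    then show ?thesis by (simp add: G_def G0_def bump_outside)
  qed
  have ae: "AE x in lborel. (\<lambda>n. G n x) \<longlonglongrightarrow> G0 x" "\<And>n. AE x in lborel. norm (G n x) \<le> CL * indicator ({-1..1} \<times> K) x"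
    using lim G_bd by simp_all
  have G0_int: "integrable lborel G0"
    by (rule integrable_dominated_convergence[OF _ _ dom ae]) measurable
  have Glim: "(\<lambda>n. integral\<^sup>L lborel (G n)) \<longlonglongrightarrow> integral\<^sup>L lborel G0"
    by (rule integral_dominated_convergence[OF _ _ dom ae]) measurable
  have "0 \<le> integral\<^sup>L lborel G0" by (rule LIMSEQ_le_const[OF Glim]) (use Gpos in blast)
  also have "\<dots> = (LINT p|lborel. LINT m|lborel. G0 (m, p))"
    using lborel_pair.integral_snd[of "\<lambda>m p. G0 (m, p)"] G0_int by (simp add: lborel_prod)
  also have "\<dots> = (LINT p|lborel. (LINT m|lborel. bump m) * (\<bar>v p - w p\<bar> * \<phi>t p + sgn (v p - w p) * (f (v p) - f (w p)) * \<phi>x p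
            + sgn (v p - w p) * (b p - wt p - f' (w p) * wx p) * \<phi> p))"
  proof (rule Bochner_Integration.integral_cong[OF refl])
    fix p
    consider "p \<notin> K" | "p \<in> K" "v p = w p" | "p \<in> K" "v p \<noteq> w p" by blast
    then show "(LINT m|lborel. G0 (m, p)) = (LINT m|lborel. bump m) * (\<bar>v p - w p\<bar> * \<phi>t p + sgn (v p - w p) * (f (v p) - f (w p)) * \<phi>x p
            + sgn (v p - w p) * (b p - wt p - f' (w p) * wx p) * \<phi> p)"
    proof cases
      case 1 then show ?thesis using K by (simp add: G0_def)
    next
      case 2
      \<comment> \<open>On the coincidence set the limit is odd in \<open>m\<close>, so averaging
        over \<open>m\<close> yields 0, in agreement with the convention
        \<open>sgn 0 = 0\<close>.\<close>
      have "(\<lambda>m. G0 (m, p)) = (\<lambda>m. (bump m * sgn m) * (- (b p - wt p - f' (w p) * wx p) * \<phi> p))"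
        using 2 by (auto simp: G0_def s_def w0_defs algebra_simps)
      then have "(LINT m|lborel. G0 (m, p)) = (LINT m|lborel. (bump m * sgn m)) * (- (b p - wt p - f' (w p) * wx p) * \<phi> p)"
        by (simp only: integral_mult_left_zero)
      then show ?thesis using 2 bump_sgn_integral by simp
    next
      case 3
      then show ?thesis by (simp add: G0_def s_def w0_defs)
    qed
  qed
  also have "\<dots> = (LINT m|lborel. bump m) * (LINT p|lborel. \<bar>v p - w p\<bar> * \<phi>t p + sgn (v p - w p) * (f (v p) - f (w p)) * \<phi>x p
            + sgn (v p - w p) * (b p - wt p - f' (w p) * wx p) * \<phi> p)"
    by simp
  finally show ?thesis using bump_integral_pos by (simp add: zero_le_mult_iff)
qed

subsection \<open>Entropy inequality across a shock\<close>

text \<open>A second difference of squared positive parts: its derivative is a tent of height 2 on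
  \<open>{-1..0}\<close>. The rise is placed to the left of 0, so that only the right branch has to
  be continued across the shock.\<close>

definition step :: "real \<Rightarrow> real" where
  "step y = 2 * (max 0 (y + 1))\<^sup>2 - 4 * (max 0 (y + 1/2))\<^sup>2 + 2 * (max 0 y)\<^sup>2"
definition step' :: "real \<Rightarrow> real" where
  "step' y = 4 * max 0 (y + 1) - 8 * max 0 (y + 1/2) + 4 * max 0 y"

lemma step_deriv: "(step has_real_derivative step' y) (at y)"
proof -
  have 1: "((\<lambda>y. (max 0 (y + c))\<^sup>2) has_real_derivative 2 * max 0 (y + c)) (at y)" for c :: real
  proof -
    have "((\<lambda>y. y + c) has_real_derivative 1) (at y)" by (auto intro!: derivative_eq_intros)
    from DERIV_chain2[OF has_real_derivative_max0_square this] show ?thesis by simp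
  qed
  show ?thesis unfolding step_def[abs_def] step'_def
    by (rule DERIV_cong[OF DERIV_add[OF DERIV_diff[OF DERIV_cmult[OF 1] DERIV_cmult[OF 1]] DERIV_cmult[OF has_real_derivative_max0_square]]]) simp
qed

lemma step_continuous: "continuous_on A step" "continuous_on A step'"
  unfolding step_def[abs_def] step'_def[abs_def] by (intro continuous_intros)+

lemma step_measurable [measurable]: "step \<in> borel_measurable borel" "step' \<in> borel_measurable borel"
  using step_continuous[of UNIV] by (auto intro: borel_measurable_continuous_onI)

lemma step_left: "y \<le> -1 \<Longrightarrow> step y = 0" "y \<le> -1 \<Longrightarrow> step' y = 0"
  by (auto simp: step_def step'_def)

lemma step_right: "0 \<le> y \<Longrightarrow> step y = 1" "0 \<le> y \<Longrightarrow> step' y = 0"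
  by (auto simp: step_def step'_def power2_eq_square algebra_simps)

lemma step_bounds: "0 \<le> step y" "step y \<le> 1" "0 \<le> step' y" "step' y \<le> 2"
proof -
  have *: "0 \<le> step' z" "step' z \<le> 2" for z by (auto simp: step'_def max_def)
  then show "0 \<le> step' y" "step' y \<le> 2" by auto
  have mono: "step a \<le> step b" if "a \<le> b" for a b
    by (rule DERIV_nonneg_imp_nondecreasing[OF that]) (use step_deriv * in blast)
  show "0 \<le> step y" using mono[of "min y (-1)" y] step_left(1)[of "min y (-1)"] by simp
  show "step y \<le> 1" using mono[of y "max y 0"] step_right(1)[of "max y 0"] by simp
qed

lemma kruzkov_mono: "kruzkov S f v b \<Longrightarrow> T \<subseteq> S \<Longrightarrow> kruzkov T f v b"
  unfolding kruzkov_def using C1_test_mono by blast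

text \<open>The test function is split as \<open>\<phi> = \<phi> (1 - H) + \<phi> H\<close>, where \<open>H\<close> goes from \<open>0\<close> to \<open>1\<close> in a thin
  layer on the left of the shock. The layer contributes a term that is nonpositive up to a quantity
  of the order of its thickness, by the Oleinik condition.\<close>

lemma kruzkov_shock:
  fixes f f' g :: "real \<Rightarrow> real"
  assumes kr: "kruzkov S f v b" and S: "open S"
    and v [measurable]: "v \<in> borel_measurable borel" and b [measurable]: "b \<in> borel_measurable borel"
    and vM: "\<And>p. \<bar>v p\<bar> \<le> M" and bM: "\<And>p. \<bar>b p\<bar> \<le> M"
    and f: "\<And>x. (f has_real_derivative f' x) (at x)" and f': "continuous_on UNIV f'"
    and g: "continuous_on UNIV g"
    and wl: "C1_on Sl wl wlt wlx" "open Sl" and wr: "C1_on Sr wr wrt wrx" "open Sr"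
    and s: "\<And>t. t \<in> fst ` S \<Longrightarrow> (s has_real_derivative s' t) (at t)" "continuous_on UNIV s"
      "continuous_on (fst ` S) s'"
    and "0 < \<delta>" "0 \<le> C"
    and Sl: "\<And>p. p \<in> S \<Longrightarrow> snd p \<le> s (fst p) \<Longrightarrow> p \<in> Sl"
    and Sr: "\<And>p. p \<in> S \<Longrightarrow> s (fst p) - \<delta> \<le> snd p \<Longrightarrow> p \<in> Sr"
    and pde_l: "\<And>p. p \<in> S \<Longrightarrow> p \<in> Sl \<Longrightarrow> wlt p + f' (wl p) * wlx p = g (wl p)"
    and pde_r: "\<And>p. p \<in> S \<Longrightarrow> p \<in> Sr \<Longrightarrow> wrt p + f' (wr p) * wrx p = g (wr p)"
    and shock: "\<And>p k. p \<in> S \<Longrightarrow> s (fst p) - \<delta> \<le> snd p \<Longrightarrow> snd p \<le> s (fst p) \<Longrightarrow>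
      sgn (k - wr p) * (f k - f (wr p)) - sgn (k - wl p) * (f k - f (wl p))
        - s' (fst p) * (\<bar>k - wr p\<bar> - \<bar>k - wl p\<bar>) \<le> C * (s (fst p) - snd p)"
    and phi: "C1_test S \<phi> \<phi>t \<phi>x" and phi0: "\<And>p. 0 \<le> \<phi> p"
  defines "u \<equiv> \<lambda>p. if snd p < s (fst p) then wl p else wr p"
  shows "0 \<le> (LINT p|lborel. \<bar>v p - u p\<bar> * \<phi>t p + sgn (v p - u p) * (f (v p) - f (u p)) * \<phi>x p
            + sgn (v p - u p) * (b p - g (u p)) * \<phi> p)"
proof -
  obtain K where K: "compact K" "K \<subseteq> S" "\<And>p. p \<notin> K \<Longrightarrow> \<phi> p = 0"
    "\<And>p. p \<notin> K \<Longrightarrow> \<phi>t p = 0" "\<And>p. p \<notin> K \<Longrightarrow> \<phi>x p = 0"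
    using C1_test_support[OF phi] by metis
  note [measurable] = C1_test_measurable[OF phi]
  have cf: "continuous_on UNIV f" using f by (meson DERIV_isCont continuous_at_imp_continuous_on)
  define h :: "real \<times> real \<Rightarrow> real" where "h p = snd p - s (fst p)" for p
  have h_cont: "continuous_on UNIV h" unfolding h_def
    by (intro continuous_intros continuous_on_compose2[OF s(2)]) auto
  note [measurable] = borel_measurable_continuous_onI[OF h_cont] borel_measurable_continuous_onI[OF cf]
    borel_measurable_continuous_onI[OF g]
  define Cl Cr where "Cl = {p. h p \<le> 0}" and "Cr = {p. - (\<delta> / 2) \<le> h p}"
  have closed: "closed Cl" "closed Cr"
    unfolding Cl_def Cr_def using h_cont by (auto intro: closed_Collect_le continuous_on_const)
  have subl: "S \<inter> Cl \<subseteq> S \<inter> Sl" and subr: "S \<inter> Cr \<subseteq> S \<inter> Sr"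
    using Sl Sr \<open>0 < \<delta>\<close> by (auto simp: Cl_def Cr_def h_def)
  \<comment> \<open>Each branch is kept only on its closed side, enlarged by half the margin
    \<open>\<delta>\<close> for the right one, and only on the support of \<open>\<phi>\<close>.
    There it is continuous, hence bounded and Borel after the cut.\<close>
  define wl0 wr0 s0 where "wl0 = (\<lambda>p. if p \<in> K \<inter> Cl then wl p else 0)"
    and "wr0 = (\<lambda>p. if p \<in> K \<inter> Cr then wr p else 0)"
    and "s0 = (\<lambda>p. if p \<in> K then s' (fst p) else 0)"
  have Kc: "compact (K \<inter> Cl)" "compact (K \<inter> Cr)" using K(1) closed by (auto simp: compact_Int_closed)
  have cK: "continuous_on (K \<inter> Cl) wl" "continuous_on (K \<inter> Cr) wr" "continuous_on K (\<lambda>p. s' (fst p))"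
  proof -
    show "continuous_on (K \<inter> Cl) wl"
      using C1_on_continuous(1)[OF wl(1)] by (rule continuous_on_subset) (use subl K(2) in blast)
    show "continuous_on (K \<inter> Cr) wr"
      using C1_on_continuous(1)[OF wr(1)] by (rule continuous_on_subset) (use subr K(2) in blast)
    show "continuous_on K (\<lambda>p. s' (fst p))"
      by (rule continuous_on_compose2[OF s(3)]) (use K(2) in \<open>auto intro!: continuous_intros\<close>)
  qed
  have [measurable]: "wl0 \<in> borel_measurable borel" "wr0 \<in> borel_measurable borel" "s0 \<in> borel_measurable borel"
    unfolding wl0_def wr0_def s0_def
    by (intro borel_measurable_continuous_on_if cK continuous_on_const borel_compact Kc K(1))+
  have bd: "bounded (range (\<lambda>p. if p \<in> L then F p else 0))" if L: "compact L" and cL: "continuous_on L F"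
    for L :: "(real \<times> real) set" and F :: "_ \<Rightarrow> real"
    by (rule bounded_subset[of "insert 0 (F ` L)"])
       (use compact_imp_bounded[OF compact_continuous_image[OF cL L]] in auto)
  have bw: "bounded (range wl0)" "bounded (range wr0)" "bounded (range s0)"
    unfolding wl0_def wr0_def s0_def by (intro bd Kc K(1) cK)+
  have bcomp: "bounded (range (\<lambda>p. F (G p)))" if F: "continuous_on UNIV F" and G: "bounded (range G)"
    for F :: "real \<Rightarrow> real" and G :: "real \<times> real \<Rightarrow> real"
  proof -
    obtain a where a: "\<And>p. \<bar>G p\<bar> \<le> a" using G unfolding bounded_iff real_norm_def by blast
    show ?thesis
    proof (rule bounded_subset)
      show "bounded (F ` {-a..a})"
        using F by (intro compact_imp_bounded compact_continuous_image) (auto intro: continuous_on_subset)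
      show "range (\<lambda>p. F (G p)) \<subseteq> F ` {-a..a}" using a by (auto simp: abs_le_iff minus_le_iff intro!: imageI)
    qed
  qed
  have bphi: "bounded (range \<phi>)" "bounded (range \<phi>t)" "bounded (range \<phi>x)"
    using C1_test_bounded[OF phi] unfolding bounded_iff real_norm_def by (metis rangeE)+
  have bv: "bounded (range v)" "bounded (range b)"
    using vM bM unfolding bounded_iff real_norm_def by (metis rangeE)+
  note bi = bphi bv bw bcomp[OF cf bv(1)] bcomp[OF cf bw(1)] bcomp[OF cf bw(2)] bcomp[OF g bw(1)] bcomp[OF g bw(2)]
  define T where "T w p = \<bar>v p - w p\<bar> * \<phi>t p + sgn (v p - w p) * (f (v p) - f (w p)) * \<phi>x p
            + sgn (v p - w p) * (b p - g (w p)) * \<phi> p" for w p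
  have T_meas [measurable]: "T wl0 \<in> borel_measurable borel" "T wr0 \<in> borel_measurable borel"
    unfolding T_def by measurable
  have T_bdd: "bounded (range (T wl0))" "bounded (range (T wr0))"
    unfolding T_def by (intro bounded_range_intros bi)+
  have T_out: "T w p = 0" if "p \<notin> K" for w p using K(3-5)[OF that] by (simp add: T_def)
  \<comment> \<open>Starting at \<open>n + 2\<close> gives \<open>d n \<le> \<delta> / 2\<close>, so
    the layer lies in \<open>Cr\<close>, where the right branch solves the equation.\<close>
  define d where "d n = \<delta> / real (n + 2)" for n
  have d: "0 < d n" "d n \<le> \<delta> / 2" for n
    unfolding d_def by (use \<open>0 < \<delta>\<close> in simp, rule divide_left_mono) (use \<open>0 < \<delta>\<close> in auto)
  define H H' where "H n p = step (h p / d n)" and "H' n p = step' (h p / d n) / d n" for n p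
  have H_meas [measurable]: "H n \<in> borel_measurable borel" "H' n \<in> borel_measurable borel" for n
    unfolding H_def H'_def by measurable
  \<comment> \<open>\<open>A\<close> tests against the left branch with
    \<open>\<phi> * (1 - H n)\<close> and \<open>B\<close> against the right one with
    \<open>\<phi> * H n\<close>. The terms with \<open>s0\<close> come from the time derivative of
    \<open>H\<close>, which moves with the shock.\<close>
  define A where "A n p = \<bar>v p - wl0 p\<bar> * (\<phi>t p * (1 - H n p) + \<phi> p * (s0 p * H' n p))
      + sgn (v p - wl0 p) * (f (v p) - f (wl0 p)) * (\<phi>x p * (1 - H n p) + \<phi> p * (- H' n p))
      + sgn (v p - wl0 p) * (b p - g (wl0 p)) * (\<phi> p * (1 - H n p))" for n p
  define B where "B n p = \<bar>v p - wr0 p\<bar> * (\<phi>t p * H n p + \<phi> p * (- s0 p * H' n p))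
      + sgn (v p - wr0 p) * (f (v p) - f (wr0 p)) * (\<phi>x p * H n p + \<phi> p * H' n p)
      + sgn (v p - wr0 p) * (b p - g (wr0 p)) * (\<phi> p * H n p)" for n p
  have HC: "C1_on S (H n) (\<lambda>p. - s' (fst p) * H' n p) (H' n)" for n
  proof -
    have "((\<lambda>p. h p / d n) has_derivative (\<lambda>q. (- s' (fst p) / d n) * fst q + (1 / d n) * snd q)) (at p)"
      if "p \<in> S" for p
    proof -
      have "((\<lambda>p. s (fst p)) has_derivative (\<lambda>q. s' (fst p) * fst q)) (at p)"
      proof (rule has_derivative_compose[where f="\<lambda>p. fst p" and f'="\<lambda>q. fst q" and g=s and g'="\<lambda>q. s' (fst p) * q"])
        show "((\<lambda>p. fst p) has_derivative (\<lambda>q. fst q)) (at p)" by (intro derivative_intros)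
        show "(s has_derivative (\<lambda>q. s' (fst p) * q)) (at (fst p))"
          using s(1)[of "fst p"] that by (simp add: has_field_derivative_def)
      qed
      then show ?thesis unfolding h_def using d[of n]
        by (auto intro!: derivative_eq_intros simp: field_simps)
    qed
    moreover have "continuous_on S (\<lambda>p. - s' (fst p) / d n)"
      using d[of n] by (intro continuous_intros continuous_on_compose2[OF s(3)]) auto
    ultimately have "C1_on S (\<lambda>p. h p / d n) (\<lambda>p. - s' (fst p) / d n) (\<lambda>p. 1 / d n)"
      unfolding C1_on_def by simp
    from C1_on_compose[OF this step_deriv step_continuous(2)] show ?thesis
      by (simp add: H_def[abs_def] H'_def[abs_def] mult.commute)
  qed
  have H1C: "C1_on S (\<lambda>p. 1 - H n p) (\<lambda>p. s' (fst p) * H' n p) (\<lambda>p. - H' n p)" for n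
    using C1_on_compose[OF HC, of "\<lambda>y. 1 - y" "\<lambda>_. -1" n]
    by (simp add: DERIV_diff[OF DERIV_const DERIV_ident, simplified])
  have Hout: "H n p = 1" "H' n p = 0" if "0 \<le> h p" for n p
    using that d[of n] step_right[of "h p / d n"] by (auto simp: H_def H'_def)
  have Hout': "H n p = 0" "H' n p = 0" if "h p \<le> - d n" for n p
  proof -
    have "h p / d n \<le> -1" using that d[of n] by (simp add: divide_le_eq)
    then show "H n p = 0" "H' n p = 0" using step_left by (auto simp: H_def H'_def)
  qed
  have Hb: "0 \<le> H n p" "H n p \<le> 1" "0 \<le> H' n p" "H' n p \<le> 2 / d n" for n p
    using step_bounds d[of n] by (auto simp: H_def H'_def intro!: divide_right_mono)
  have Apos: "0 \<le> integral\<^sup>L lborel (A n)" for n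
  proof -
    have "C1_test (S \<inter> Cl) (\<lambda>p. \<phi> p * (1 - H n p)) (\<lambda>p. \<phi>t p * (1 - H n p) + \<phi> p * (s' (fst p) * H' n p))
       (\<lambda>p. \<phi>x p * (1 - H n p) + \<phi> p * (- H' n p))"
      by (rule C1_test_mult_support[OF phi H1C S order_refl closed(1)]) (auto simp: Cl_def Hout)
    then have "C1_test (S \<inter> Sl) (\<lambda>p. \<phi> p * (1 - H n p)) (\<lambda>p. \<phi>t p * (1 - H n p) + \<phi> p * (s' (fst p) * H' n p))
       (\<lambda>p. \<phi>x p * (1 - H n p) + \<phi> p * (- H' n p))"
      using subl by (rule C1_test_mono)
    from kruzkov_C1[OF kruzkov_mono[OF kr] _ v b vM bM f f' C1_on_subset[OF wl(1)] this]
    have "0 \<le> (LINT p|lborel. \<bar>v p - wl p\<bar> * (\<phi>t p * (1 - H n p) + \<phi> p * (s' (fst p) * H' n p))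
        + sgn (v p - wl p) * (f (v p) - f (wl p)) * (\<phi>x p * (1 - H n p) + \<phi> p * (- H' n p))
        + sgn (v p - wl p) * (b p - wlt p - f' (wl p) * wlx p) * (\<phi> p * (1 - H n p)))"
      using S wl(2) Hb phi0 by auto
    also have "\<dots> = integral\<^sup>L lborel (A n)"
    proof (rule Bochner_Integration.integral_cong[OF refl])
      fix p
      consider "p \<notin> K" | "p \<in> K" "0 < h p" | "p \<in> K" "h p \<le> 0" by linarith
      then show "\<bar>v p - wl p\<bar> * (\<phi>t p * (1 - H n p) + \<phi> p * (s' (fst p) * H' n p))
        + sgn (v p - wl p) * (f (v p) - f (wl p)) * (\<phi>x p * (1 - H n p) + \<phi> p * (- H' n p))
        + sgn (v p - wl p) * (b p - wlt p - f' (wl p) * wlx p) * (\<phi> p * (1 - H n p)) = A n p"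
      proof cases
        case 3
        then have "p \<in> S" "p \<in> Cl" using K(2) by (auto simp: Cl_def)
        then have "b p - wlt p - f' (wl p) * wlx p = b p - g (wl p)"
          using pde_l[of p] subl by auto
        then show ?thesis using 3 \<open>p \<in> Cl\<close> by (simp add: A_def wl0_def s0_def)
      qed (use K Hout in \<open>simp_all add: A_def\<close>)
    qed
    finally show ?thesis .
  qed
  have Bpos: "0 \<le> integral\<^sup>L lborel (B n)" for n
  proof -
    have *: "p \<in> Cr" if "H n p \<noteq> 0 \<or> H' n p \<noteq> 0" for p
      using that Hout'[of p n] d[of n] by (force simp: Cr_def)
    have "C1_test (S \<inter> Cr) (\<lambda>p. \<phi> p * H n p) (\<lambda>p. \<phi>t p * H n p + \<phi> p * (- s' (fst p) * H' n p))
       (\<lambda>p. \<phi>x p * H n p + \<phi> p * H' n p)"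
      by (rule C1_test_mult_support[OF phi HC S order_refl closed(2)]) (use * in blast)
    then have "C1_test (S \<inter> Sr) (\<lambda>p. \<phi> p * H n p) (\<lambda>p. \<phi>t p * H n p + \<phi> p * (- s' (fst p) * H' n p))
       (\<lambda>p. \<phi>x p * H n p + \<phi> p * H' n p)"
      using subr by (rule C1_test_mono)
    from kruzkov_C1[OF kruzkov_mono[OF kr] _ v b vM bM f f' C1_on_subset[OF wr(1)] this]
    have "0 \<le> (LINT p|lborel. \<bar>v p - wr p\<bar> * (\<phi>t p * H n p + \<phi> p * (- s' (fst p) * H' n p))
        + sgn (v p - wr p) * (f (v p) - f (wr p)) * (\<phi>x p * H n p + \<phi> p * H' n p)
        + sgn (v p - wr p) * (b p - wrt p - f' (wr p) * wrx p) * (\<phi> p * H n p))"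
      using S wr(2) Hb phi0 by auto
    also have "\<dots> = integral\<^sup>L lborel (B n)"
    proof (rule Bochner_Integration.integral_cong[OF refl])
      fix p
      consider "p \<notin> K" | "p \<in> K" "p \<notin> Cr" | "p \<in> K" "p \<in> Cr" by blast
      then show "\<bar>v p - wr p\<bar> * (\<phi>t p * H n p + \<phi> p * (- s' (fst p) * H' n p))
        + sgn (v p - wr p) * (f (v p) - f (wr p)) * (\<phi>x p * H n p + \<phi> p * H' n p)
        + sgn (v p - wr p) * (b p - wrt p - f' (wr p) * wrx p) * (\<phi> p * H n p) = B n p"
      proof cases
        case 2
        then have "H n p = 0" "H' n p = 0" using * by blast+
        then show ?thesis by (simp add: B_def)
      next
        case 3
        then have "p \<in> S" using K(2) by auto
        then have "b p - wrt p - f' (wr p) * wrx p = b p - g (wr p)"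
          using pde_r[of p] subr 3 by auto
        then show ?thesis using 3 by (simp add: B_def wr0_def s0_def)
      qed (use K(3-5)[of p] in \<open>simp add: B_def\<close>)
    qed
    finally show ?thesis .
  qed
  have AB_int: "integrable lborel (A n)" "integrable lborel (B n)" for n
  proof -
    have bH: "bounded (range (H n))" "bounded (range (H' n))"
    proof -
      have "\<bar>H n p\<bar> \<le> 1" "\<bar>H' n p\<bar> \<le> 2 / d n" for p using Hb[of n p] by auto
      then show "bounded (range (H n))" "bounded (range (H' n))" unfolding bounded_iff real_norm_def by blast+
    qed
    have "bounded (range (A n))" "bounded (range (B n))"
      unfolding A_def B_def by (intro bounded_range_intros bounded_range_uminus bi bH bounded_range_const)+
    then obtain a b where "\<And>p. \<bar>A n p\<bar> \<le> a" "\<And>p. \<bar>B n p\<bar> \<le> b" unfolding bounded_iff real_norm_def by blast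
    moreover have "A n \<in> borel_measurable borel" "B n \<in> borel_measurable borel"
      unfolding A_def B_def by measurable
    moreover have "\<And>p. p \<notin> K \<Longrightarrow> A n p = 0" "\<And>p. p \<notin> K \<Longrightarrow> B n p = 0"
      using K(3-5) by (simp_all add: A_def B_def)
    ultimately show "integrable lborel (A n)" "integrable lborel (B n)"
      using integrable_bounded_compact[OF K(1)] by metis+
  qed
  \<comment> \<open>In the layer \<open>H'\<close> is at most \<open>2 / d n\<close> and the defect
    in \<open>shock\<close> at most \<open>C * d n\<close>. The product leaves
    \<open>2 * C * \<phi> p\<close> on a strip that shrinks to nothing, so the last term disappears
    in the limit.\<close>
  define D where "D n p = (1 - H n p) * T wl0 p + H n p * T wr0 p + (if - d n < h p \<and> h p < 0 then 2 * C * \<phi> p else 0)" for n p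
  have D_meas [measurable]: "D n \<in> borel_measurable borel" for n unfolding D_def by measurable
  have AB_D: "A n p + B n p \<le> D n p" for n p
  proof -
    \<comment> \<open>The left side of \<open>shock\<close> at the level \<open>v p\<close>: the
      jump of the entropy flux minus the shock speed times the jump of the entropy.\<close>
    define X where "X = (sgn (v p - wr0 p) * (f (v p) - f (wr0 p)) - sgn (v p - wl0 p) * (f (v p) - f (wl0 p)))
        - s0 p * (\<bar>v p - wr0 p\<bar> - \<bar>v p - wl0 p\<bar>)"
    have "A n p + B n p = (1 - H n p) * T wl0 p + H n p * T wr0 p + \<phi> p * H' n p * X"
      unfolding A_def B_def T_def X_def by (simp add: algebra_simps)
    moreover have "\<phi> p * H' n p * X \<le> (if - d n < h p \<and> h p < 0 then 2 * C * \<phi> p else 0)"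
    proof (cases "- d n < h p \<and> h p < 0")
      case True
      show ?thesis
      proof (cases "p \<in> K")
        case True
        note h = \<open>- d n < h p \<and> h p < 0\<close>
        have "X \<le> C * (s (fst p) - snd p)"
          using shock[of p "v p"] True K(2) h d[of n] unfolding X_def
          by (auto simp: wl0_def wr0_def s0_def Cl_def Cr_def h_def)
        also have "\<dots> \<le> C * d n" using h \<open>0 \<le> C\<close> by (intro mult_left_mono) (auto simp: h_def)
        finally have "\<phi> p * H' n p * X \<le> \<phi> p * H' n p * (C * d n)"
          using Hb phi0 by (intro mult_left_mono) auto
        also have "\<dots> \<le> \<phi> p * (2 / d n) * (C * d n)"
          using Hb phi0 \<open>0 \<le> C\<close> d[of n] by (intro mult_right_mono mult_left_mono) auto
        also have "\<dots> = 2 * C * \<phi> p" using d[of n] by simp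
        finally show ?thesis using h by simp
      qed (use K(3)[of p] in simp)
    next
      case False
      then have "H' n p = 0" using Hout(2)[of p n] Hout'(2)[of p n] by linarith
      then show ?thesis using False by auto
    qed
    ultimately show ?thesis by (simp add: D_def)
  qed
  have "\<exists>a. \<forall>n p. \<bar>D n p\<bar> \<le> a * indicator K p"
  proof -
    obtain a1 a2 a3 where a: "\<And>p. \<bar>T wl0 p\<bar> \<le> a1" "\<And>p. \<bar>T wr0 p\<bar> \<le> a2" "\<And>p. \<bar>\<phi> p\<bar> \<le> a3"
      using T_bdd bphi(1) unfolding bounded_iff real_norm_def by blast
    have "\<bar>D n p\<bar> \<le> (a1 + a2 + 2 * C * a3) * indicator K p" for n p
    proof (cases "p \<in> K")
      case True
      have "\<bar>(1 - H n p) * T wl0 p\<bar> \<le> 1 * a1" "\<bar>H n p * T wr0 p\<bar> \<le> 1 * a2"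
        unfolding abs_mult using a Hb[of n p] by (intro mult_mono; simp)+
      moreover have "\<bar>if - d n < h p \<and> h p < 0 then 2 * C * \<phi> p else 0\<bar> \<le> 2 * C * a3"
        using a(3)[of p] phi0[of p] \<open>0 \<le> C\<close> mult_left_mono[of "\<phi> p" a3 "2 * C"] mult_nonneg_nonneg[of C "\<phi> p"] mult_nonneg_nonneg[of C a3] by auto
      ultimately show ?thesis using True unfolding D_def by simp
    next
      case False
      then show ?thesis using K(3) T_out by (simp add: D_def)
    qed
    then show ?thesis by blast
  qed
  then obtain a where a: "\<And>n p. \<bar>D n p\<bar> \<le> a * indicator K p" by blast
  define T0 where "T0 p = (if h p < 0 then T wl0 p else T wr0 p)" for p
  have T0_meas [measurable]: "T0 \<in> borel_measurable borel" unfolding T0_def by measurable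
  have lim: "(\<lambda>n. D n p) \<longlonglongrightarrow> T0 p" for p
  proof (cases "h p < 0")
    case True
    have "d \<longlonglongrightarrow> 0" unfolding d_def[abs_def]
      by (rule LIMSEQ_ignore_initial_segment[OF lim_const_over_n, of "\<delta>" 2])
    then have "\<forall>\<^sub>F n in sequentially. d n < - h p" using True by (intro order_tendstoD) auto
    then have "\<forall>\<^sub>F n in sequentially. D n p = T0 p"
      by eventually_elim (use True Hout' in \<open>auto simp: D_def T0_def\<close>)
    then show ?thesis by (rule tendsto_eventually)
  next
    case False
    then have "D n p = T0 p" for n using Hout[of p n] by (simp add: D_def T0_def)
    then show ?thesis by simp
  qed
  have dom: "integrable lborel (\<lambda>p. a * indicator K p)"
    using emeasure_compact_finite[OF K(1)] borel_compact[OF K(1)]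
    by (intro integrable_mult_right integrable_real_indicator) auto
  have ae: "AE p in lborel. (\<lambda>n. D n p) \<longlonglongrightarrow> T0 p" "\<And>n. AE p in lborel. norm (D n p) \<le> a * indicator K p"
    using lim a by simp_all
  have Dint: "integrable lborel (D n)" for n
    by (rule Bochner_Integration.integrable_bound[OF dom]) (use a order_trans[OF a abs_ge_self] in auto)
  have "(\<lambda>n. integral\<^sup>L lborel (D n)) \<longlonglongrightarrow> integral\<^sup>L lborel T0"
    by (rule integral_dominated_convergence[OF _ _ dom ae]) measurable
  moreover have "0 \<le> integral\<^sup>L lborel (D n)" for n
  proof -
    have "0 \<le> integral\<^sup>L lborel (\<lambda>p. A n p + B n p)" using Apos Bpos AB_int by simp
    also have "\<dots> \<le> integral\<^sup>L lborel (D n)"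
      by (rule integral_mono) (use AB_int Dint AB_D in auto)
    finally show ?thesis .
  qed
  ultimately have "0 \<le> integral\<^sup>L lborel T0" by (intro LIMSEQ_le_const) auto
  also have "T0 = T u"
  proof
    fix p
    show "T0 p = T u p"
    proof (cases "p \<in> K")
      case True
      show ?thesis
      proof (cases "h p < 0")
        case h: True
        then have "p \<in> Cl" by (simp add: Cl_def)
        then show ?thesis using h True by (simp add: T0_def T_def wl0_def u_def h_def)
      next
        case h: False
        then have "p \<in> Cr" using \<open>0 < \<delta>\<close> by (simp add: Cr_def)
        then show ?thesis using h True by (simp add: T0_def T_def wr0_def u_def h_def)
      qed
    qed (simp add: T0_def T_out)
  qed
  finally show ?thesis unfolding T_def .
qed

subsection \<open>Uniqueness of entropy solutions\<close>

text \<open>A backward cone of slope \<open>L\<close>, with \<open>\<bar>x\<bar>\<close> smoothed to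
  \<open>sqrt (1 + x\<^sup>2)\<close>. The weight below is its square, hence \<open>C1\<close>,
  times an exponential in time that plays the part of Gronwall's inequality for the source.\<close>

definition cone :: "real \<Rightarrow> real \<Rightarrow> real \<times> real \<Rightarrow> real" where
  "cone L R p = max 0 (R - L * fst p - sqrt (1 + (snd p)\<^sup>2))"
definition cone_weight :: "real \<Rightarrow> real \<Rightarrow> real \<Rightarrow> real \<times> real \<Rightarrow> real" where
  "cone_weight L N R p = exp (- N * fst p) * (cone L R p)\<^sup>2"
definition cone_weight_t :: "real \<Rightarrow> real \<Rightarrow> real \<Rightarrow> real \<times> real \<Rightarrow> real" where
  "cone_weight_t L N R p = - N * cone_weight L N R p - 2 * L * exp (- N * fst p) * cone L R p"
definition cone_weight_x :: "real \<Rightarrow> real \<Rightarrow> real \<Rightarrow> real \<times> real \<Rightarrow> real" where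
  "cone_weight_x L N R p = - 2 * exp (- N * fst p) * cone L R p * (snd p / sqrt (1 + (snd p)\<^sup>2))"

lemma one_plus_square_pos: "0 < 1 + (x::real)\<^sup>2" "1 + x\<^sup>2 \<noteq> 0" "0 < sqrt (1 + x\<^sup>2)"
proof -
  show "0 < 1 + (x::real)\<^sup>2" by (rule add_pos_nonneg) auto
  then show "1 + x\<^sup>2 \<noteq> 0" "0 < sqrt (1 + x\<^sup>2)" by auto
qed

lemma cone_weight_C1: "C1_on UNIV (cone_weight L N R) (cone_weight_t L N R) (cone_weight_x L N R)"
proof -
  let ?q = "\<lambda>p::real\<times>real. R - L * fst p - sqrt (1 + (snd p)\<^sup>2)"
  have "(?q has_derivative (\<lambda>h. (- L) * fst h + (- (snd p / sqrt (1 + (snd p)\<^sup>2))) * snd h)) (at p)" for p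
    by (auto intro!: derivative_eq_intros simp: one_plus_square_pos field_simps)
  moreover have "continuous_on UNIV (\<lambda>p::real\<times>real. - (snd p / sqrt (1 + (snd p)\<^sup>2)))"
    by (intro continuous_intros) (auto simp: one_plus_square_pos)
  ultimately have q: "C1_on UNIV ?q (\<lambda>_. - L) (\<lambda>p. - (snd p / sqrt (1 + (snd p)\<^sup>2)))"
    unfolding C1_on_def by auto
  have "continuous_on (range ?q) (\<lambda>a. 2 * max 0 a)" by (intro continuous_intros)
  from C1_on_compose[OF q has_real_derivative_max0_square this]
  have 1: "C1_on UNIV (\<lambda>p. (cone L R p)\<^sup>2) (\<lambda>p. 2 * cone L R p * (- L)) (\<lambda>p. 2 * cone L R p * (- (snd p / sqrt (1 + (snd p)\<^sup>2))))"
    unfolding cone_def .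
  have 2: "C1_on UNIV (\<lambda>p. exp (- N * fst p)) (\<lambda>p. - N * exp (- N * fst p)) (\<lambda>p. 0)"
    unfolding C1_on_def by (auto intro!: derivative_eq_intros continuous_intros)
  have "cone_weight L N R = (\<lambda>p. exp (- N * fst p) * (cone L R p)\<^sup>2)" by (simp add: cone_weight_def[abs_def])
  moreover have "cone_weight_t L N R = (\<lambda>p. - N * exp (- N * fst p) * (cone L R p)\<^sup>2 + exp (- N * fst p) * (2 * cone L R p * (- L)))"
    by (auto simp: cone_weight_def cone_weight_t_def)
  moreover have "cone_weight_x L N R = (\<lambda>p. 0 * (cone L R p)\<^sup>2 + exp (- N * fst p) * (2 * cone L R p * (- (snd p / sqrt (1 + (snd p)\<^sup>2)))))"
    by (auto simp: cone_weight_x_def)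
  ultimately show ?thesis using C1_on_mult[OF 2 1] by simp
qed

lemma cone_weight_nonneg: "0 \<le> cone_weight L N R p"
  by (simp add: cone_weight_def)

text \<open>The smoothed modulus has slope at most 1, so narrowing the cone at speed
  \<open>L\<close> outweighs \<open>L\<close> times its slope in \<open>x\<close>; the exponential
  supplies the rest. With Lipschitz constants \<open>L\<close> of \<open>f\<close> and
  \<open>N\<close> of \<open>g\<close> this is what absorbs the flux and the source.\<close>

lemma cone_weight_decay:
  assumes "0 \<le> L"
  shows "cone_weight_t L N R p + L * \<bar>cone_weight_x L N R p\<bar> + N * cone_weight L N R p \<le> 0"
proof -
  have "\<bar>snd p\<bar> \<le> sqrt (1 + (snd p)\<^sup>2)" by (rule real_le_rsqrt) simp
  then have "\<bar>snd p / sqrt (1 + (snd p)\<^sup>2)\<bar> \<le> 1" using one_plus_square_pos[of "snd p"] by simp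
  then have "2 * exp (- N * fst p) * cone L R p * \<bar>snd p / sqrt (1 + (snd p)\<^sup>2)\<bar> \<le> 2 * exp (- N * fst p) * cone L R p * 1"
    by (intro mult_left_mono) (auto simp: cone_def)
  then have "\<bar>cone_weight_x L N R p\<bar> \<le> 2 * exp (- N * fst p) * cone L R p"
    by (simp add: cone_weight_x_def abs_mult cone_def)
  from mult_left_mono[OF this assms] show ?thesis by (simp add: cone_weight_t_def algebra_simps)
qed

lemma cone_outside: "0 \<le> L \<Longrightarrow> 0 \<le> fst p \<Longrightarrow> R \<le> \<bar>snd p\<bar> \<Longrightarrow> cone L R p = 0"
proof -
  assume "0 \<le> L" "0 \<le> fst p" "R \<le> \<bar>snd p\<bar>"
  moreover have "\<bar>snd p\<bar> \<le> sqrt (1 + (snd p)\<^sup>2)" by (rule real_le_rsqrt) simp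
  moreover have "0 \<le> L * fst p" using calculation by simp
  ultimately show ?thesis unfolding cone_def by linarith
qed

text \<open>A kernel of mass one supported in \<open>{c - h..c}\<close>, used to average over a
  short time interval.\<close>

lemma step'_integral: assumes "0 < h" shows "integrable lborel (\<lambda>t. step' ((t - c) / h) / h)" "(LINT t|lborel. step' ((t - c) / h) / h) = 1"
proof -
  have int: "integrable lborel step'"
    by (rule integrable_bounded_compact[of "{-1..0}" _ 2])
       (use step_left step_right step_bounds in \<open>auto simp: abs_le_iff intro: order_trans[OF _ step_bounds(3)]\<close>)
  have "(step' has_integral (step 0 - step (-1))) {-1..0}"
    by (rule fundamental_theorem_of_calculus) (auto intro: has_field_derivative_at_within step_deriv simp: has_real_derivative_iff_has_vector_derivative[symmetric])
  then have "(step' has_integral 1) {-1..0}" by (simp add: step_right step_left)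
  then have "(step' has_integral 1) UNIV"
    by (rule has_integral_on_superset) (auto simp: step_left step_right not_le)
  then have 1: "(LINT t|lborel. step' t) = 1"
    using has_integral_integral_lborel[OF int] has_integral_unique by blast
  have "(LINT t|lborel. step' t) = (1/h) * (LINT t|lborel. step' ((t - c) / h))"
    using lborel_integral_real_affine[of "1/h" step' "- c / h"] assms by (simp add: field_simps)
  then show "(LINT t|lborel. step' ((t - c) / h) / h) = 1" using 1 assms by (simp add: field_simps)
  show "integrable lborel (\<lambda>t. step' ((t - c) / h) / h)"
    using lborel_integrable_real_affine[OF int, of "1/h" "- c / h"] assms by (simp add: field_simps)
qed

lemma step_mono: "a \<le> b \<Longrightarrow> step a \<le> step b"
  by (rule DERIV_nonneg_imp_nondecreasing) (use step_deriv step_bounds in blast)+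

text \<open>The inequality \<open>kato\<close> is tested with the cone weight times a plateau in
  time. What remains says that the weighted distance, averaged over a window near the end of the
  plateau, is at most its average over a window near the start. Continuity in time turns the
  averages into values at \<open>t1\<close> and 0.\<close>

lemma L1_contraction:
  fixes v u :: "real \<times> real \<Rightarrow> real" and f g :: "real \<Rightarrow> real"
  assumes "0 < T"
    and [measurable]: "v \<in> borel_measurable borel" "u \<in> borel_measurable borel"
      "f \<in> borel_measurable borel" "g \<in> borel_measurable borel"
    and vM: "\<And>p. \<bar>v p\<bar> \<le> M" and uM: "\<And>p. \<bar>u p\<bar> \<le> M"
    and L: "0 \<le> L" "\<And>a b. \<bar>a\<bar> \<le> M \<Longrightarrow> \<bar>b\<bar> \<le> M \<Longrightarrow> \<bar>f a - f b\<bar> \<le> L * \<bar>a - b\<bar>"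
    and N: "\<And>a b. \<bar>a\<bar> \<le> M \<Longrightarrow> \<bar>b\<bar> \<le> M \<Longrightarrow> \<bar>g a - g b\<bar> \<le> N * \<bar>a - b\<bar>"
    and kato: "\<And>\<phi> \<phi>t \<phi>x. C1_test ({0<..<T} \<times> UNIV) \<phi> \<phi>t \<phi>x \<Longrightarrow> (\<And>p. 0 \<le> \<phi> p) \<Longrightarrow>
       0 \<le> (LINT p|lborel. \<bar>v p - u p\<bar> * \<phi>t p + sgn (v p - u p) * (f (v p) - f (u p)) * \<phi>x p
            + sgn (v p - u p) * (g (v p) - g (u p)) * \<phi> p)"
    and cv: "\<And>t0 R. 0 \<le> t0 \<Longrightarrow> t0 < T \<Longrightarrow> ((\<lambda>t. LINT x:{-R..R}|lborel. \<bar>v (t, x) - v (t0, x)\<bar>) \<longlongrightarrow> 0) (at t0 within {0..<T})"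
    and cu: "\<And>t0 R. 0 \<le> t0 \<Longrightarrow> t0 < T \<Longrightarrow> ((\<lambda>t. LINT x:{-R..R}|lborel. \<bar>u (t, x) - u (t0, x)\<bar>) \<longlongrightarrow> 0) (at t0 within {0..<T})"
    and init: "AE x in lborel. v (0, x) = u (0, x)"
    and t1: "0 \<le> t1" "t1 < T"
  shows "AE x in lborel. v (t1, x) = u (t1, x)"
proof -
  have sl [measurable]: "(\<lambda>x. F (t, x)) \<in> borel_measurable borel" if "F \<in> borel_measurable borel" for F :: "real \<times> real \<Rightarrow> real" and t
    using measurable_compose[OF _ that, of "\<lambda>x. (t, x)" borel] by (auto intro!: borel_measurable_continuous_onI continuous_intros)
  have main: "AE x in lborel. \<bar>v (t1, x) - u (t1, x)\<bar> * cone_weight L N R (t1, x) = 0" for R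
  proof -
    define \<omega> where "\<omega> = cone_weight L N R"
    have \<omega>C: "C1_on UNIV \<omega> (cone_weight_t L N R) (cone_weight_x L N R)" unfolding \<omega>_def by (rule cone_weight_C1)
    have \<omega>0: "0 \<le> \<omega> p" for p by (simp add: \<omega>_def cone_weight_nonneg)
    have \<omega>_out: "\<omega> p = 0" if "0 \<le> fst p" "snd p \<notin> {-R..R}" for p
      using cone_outside[OF L(1) that(1), of R] that(2) by (auto simp: \<omega>_def cone_weight_def abs_if not_le split: if_splits)
    have \<omega>_cont: "continuous_on UNIV \<omega>" using C1_on_continuous(1)[OF \<omega>C] .
    note [measurable] = borel_measurable_continuous_onI[OF \<omega>_cont]
    have "bounded (\<omega> ` ({0..T} \<times> {-R..R}))"
      by (intro compact_imp_bounded compact_continuous_image continuous_on_subset[OF \<omega>_cont] compact_Times) auto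
    then obtain W where W0: "0 < W" and W': "\<And>p. p \<in> {0..T} \<times> {-R..R} \<Longrightarrow> \<bar>\<omega> p\<bar> \<le> W"
      unfolding bounded_pos by auto
    have W: "\<omega> (t, x) \<le> W * indicator {-R..R} x" if "t \<in> {0..T}" for t x
      using W'[of "(t, x)"] \<omega>_out[of "(t, x)"] that by (auto simp: indicator_def)
    define m where "m t = (LINT x|lborel. \<bar>v (t, x) - u (t, x)\<bar> * \<omega> (t, x))" for t
    have M0: "0 \<le> M" using vM[of undefined] by linarith
    have D2M: "\<bar>v p - u p\<bar> \<le> 2 * M" for p using vM[of p] uM[of p] by linarith
    have int_ind: "integrable lborel (\<lambda>x. c * indicator {-R..R} x :: real)" for c
      using emeasure_compact_finite[of "{-R..R}"] by (intro integrable_mult_right integrable_real_indicator) auto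
    have int_m: "integrable lborel (\<lambda>x. \<bar>v (t, x) - u (t, x)\<bar> * \<omega> (s, x))" if "t \<in> {0..T}" "s \<in> {0..T}" for t s
    proof (rule Bochner_Integration.integrable_bound[OF int_ind[of "2 * M * W"]])
      show "AE x in lborel. norm (\<bar>v (t, x) - u (t, x)\<bar> * \<omega> (s, x)) \<le> norm (2 * M * W * indicator {-R..R} x)"
      proof (rule AE_I2)
        fix x
        have "\<bar>v (t, x) - u (t, x)\<bar> * \<omega> (s, x) \<le> (2 * M) * (W * indicator {-R..R} x)"
          using D2M W[OF that(2)] \<omega>0 M0 by (intro mult_mono) auto
        then show "norm (\<bar>v (t, x) - u (t, x)\<bar> * \<omega> (s, x)) \<le> norm (2 * M * W * indicator {-R..R} x)"
          using \<omega>0[of "(s, x)"] M0 W0 by (simp add: abs_mult mult.assoc)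
      qed
    qed measurable
    have m0: "0 \<le> m t" for t unfolding m_def by (intro integral_nonneg_AE AE_I2) (simp add: \<omega>0)
    have m_cont: "(m \<longlongrightarrow> m t0) (at t0 within {0..<T})" if t0: "0 \<le> t0" "t0 < T" for t0
    proof -
      define A where "A F t = (LINT x:{-R..R}|lborel. \<bar>F (t, x) - F (t0, x)\<bar>)" for F :: "real \<times> real \<Rightarrow> real" and t
      \<comment> \<open>\<open>Q\<close> freezes the two functions at \<open>t0\<close> and lets
        only the weight move. Then \<open>m - Q\<close> is controlled by continuity in local
        \<open>L1\<close>, and \<open>Q\<close> by continuity of the weight.\<close>
      define Q where "Q t = (LINT x|lborel. \<bar>v (t0, x) - u (t0, x)\<bar> * \<omega> (t, x))" for t
      have intA: "integrable lborel (\<lambda>x. indicator {-R..R} x * \<bar>F (t, x) - F (t0, x)\<bar>)"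
        if [measurable]: "F \<in> borel_measurable borel" and "\<And>p. \<bar>F p\<bar> \<le> M" for F t
      proof (rule Bochner_Integration.integrable_bound[OF int_ind[of "2 * M"]])
        show "AE x in lborel. norm (indicator {-R..R} x * \<bar>F (t, x) - F (t0, x)\<bar>) \<le> norm (2 * M * indicator {-R..R} x)"
        proof (rule AE_I2)
          fix x
          have "\<bar>F (t, x) - F (t0, x)\<bar> \<le> 2 * M" using that(2)[of "(t, x)"] that(2)[of "(t0, x)"] by linarith
          then show "norm (indicator {-R..R} x * \<bar>F (t, x) - F (t0, x)\<bar>) \<le> norm (2 * M * indicator {-R..R} x)"
            by (auto simp: indicator_def)
        qed
      qed measurable
      have bound: "\<bar>m t - Q t\<bar> \<le> W * (A v t + A u t)" if t: "t \<in> {0..<T}" for t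
      proof -
        have t': "t \<in> {0..T}" "t0 \<in> {0..T}" using t t0 by auto
        have eq: "m t - Q t = (LINT x|lborel. \<bar>v (t, x) - u (t, x)\<bar> * \<omega> (t, x) - \<bar>v (t0, x) - u (t0, x)\<bar> * \<omega> (t, x))"
          unfolding m_def Q_def using int_m t' by simp
        have "\<bar>m t - Q t\<bar> \<le> (LINT x|lborel. W * (indicator {-R..R} x * \<bar>v (t, x) - v (t0, x)\<bar> + indicator {-R..R} x * \<bar>u (t, x) - u (t0, x)\<bar>))"
        unfolding eq proof (rule Bochner_Integration.integral_abs_bound_integral)
          show "integrable lborel (\<lambda>x. \<bar>v (t, x) - u (t, x)\<bar> * \<omega> (t, x) - \<bar>v (t0, x) - u (t0, x)\<bar> * \<omega> (t, x))"
            using int_m t' by simp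
          show "integrable lborel (\<lambda>x. W * (indicator {-R..R} x * \<bar>v (t, x) - v (t0, x)\<bar> + indicator {-R..R} x * \<bar>u (t, x) - u (t0, x)\<bar>))"
            by (intro integrable_mult_right Bochner_Integration.integrable_add intA) (use vM uM in auto)
          fix x
          have "\<bar>\<bar>v (t, x) - u (t, x)\<bar> * \<omega> (t, x) -  \<bar>v (t0, x) - u (t0, x)\<bar> * \<omega> (t, x)\<bar>
             = \<bar>\<bar>v (t, x) - u (t, x)\<bar> - \<bar>v (t0, x) - u (t0, x)\<bar>\<bar> * \<omega> (t, x)"
            using \<omega>0[of "(t, x)"] by (simp add: left_diff_distrib[symmetric] abs_mult)
          also have "\<dots> \<le> (\<bar>v (t, x) - v (t0, x)\<bar> + \<bar>u (t, x) - u (t0, x)\<bar>) * (W * indicator {-R..R} x)"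
            by (intro mult_mono W[OF t'(1)] \<omega>0) auto
          finally show "\<bar>\<bar>v (t, x) - u (t, x)\<bar> * \<omega> (t, x) - \<bar>v (t0, x) - u (t0, x)\<bar> * \<omega> (t, x)\<bar>
             \<le> W * (indicator {-R..R} x * \<bar>v (t, x) - v (t0, x)\<bar> + indicator {-R..R} x * \<bar>u (t, x) - u (t0, x)\<bar>)"
            by (simp add: algebra_simps)
        qed
        also have "\<dots> = W * (A v t + A u t)"
          unfolding A_def set_lebesgue_integral_def using intA[of v t] intA[of u t] vM uM by simp
        finally show ?thesis .
      qed
      have "((\<lambda>t. W * (A v t + A u t)) \<longlongrightarrow> W * (0 + 0)) (at t0 within {0..<T})"
        unfolding A_def by (intro tendsto_intros cv cu t0)
      then have 1: "((\<lambda>t. W * (A v t + A u t)) \<longlongrightarrow> 0) (at t0 within {0..<T})" by simp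
      have "((\<lambda>t. m t - Q t) \<longlongrightarrow> 0) (at t0 within {0..<T})"
        by (rule Lim_null_comparison[OF _ 1]) (use bound in \<open>auto simp: eventually_at_filter intro!: always_eventually\<close>)
      moreover have "(Q \<longlongrightarrow> m t0) (at t0 within {0..<T})"
        unfolding tendsto_at_iff_sequentially
      proof (intro allI impI)
        fix X assume X: "\<forall>i. X i \<in> {0..<T} - {t0}" and lim: "X \<longlonglongrightarrow> t0"
        show "(Q \<circ> X) \<longlonglongrightarrow> m t0"
          unfolding o_def Q_def m_def
        proof (rule integral_dominated_convergence[OF _ _ int_ind[of "2 * M * W"]])
          show "AE x in lborel. (\<lambda>i. \<bar>v (t0, x) - u (t0, x)\<bar> * \<omega> (X i, x)) \<longlonglongrightarrow> \<bar>v (t0, x) - u (t0, x)\<bar> * \<omega> (t0, x)"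
            by (intro AE_I2 tendsto_intros continuous_on_tendsto_compose[OF \<omega>_cont] lim) auto
          fix i
          show "AE x in lborel. norm (\<bar>v (t0, x) - u (t0, x)\<bar> * \<omega> (X i, x)) \<le> 2 * M * W * indicator {-R..R} x"
          proof (rule AE_I2)
            fix x
            have "\<bar>v (t0, x) - u (t0, x)\<bar> * \<omega> (X i, x) \<le> (2 * M) * (W * indicator {-R..R} x)"
              using D2M W[of "X i"] \<omega>0 M0 X by (intro mult_mono) (auto simp: less_imp_le)
            then show "norm (\<bar>v (t0, x) - u (t0, x)\<bar> * \<omega> (X i, x)) \<le> 2 * M * W * indicator {-R..R} x"
              using \<omega>0[of "(X i, x)"] by (simp add: abs_mult mult.assoc)
          qed
        qed measurable
      qed
      ultimately have "((\<lambda>t. (m t - Q t) + Q t) \<longlongrightarrow> 0 + m t0) (at t0 within {0..<T})" by (rule tendsto_add)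
      then show ?thesis by simp
    qed
    have "m t1 = 0"
    proof (rule ccontr)
      assume "m t1 \<noteq> 0"
      then have pos: "0 < m t1" using m0[of t1] by linarith
      have "m 0 = (LINT (x::real)|lborel. 0)" unfolding m_def
        by (rule integral_cong_AE) (use init in \<open>auto elim!: eventually_mono\<close>)
      then have "m 0 = 0" by simp
      then have "0 < t1" using pos t1 by (cases "t1 = 0") auto
      have "\<forall>\<^sub>F t in at 0 within {0..<T}. m t < m t1 / 4"
        using order_tendstoD(2)[OF m_cont[of 0], of "m t1 / 4"] \<open>m 0 = 0\<close> pos \<open>0 < T\<close> by simp
      then obtain r where r: "0 < r" "\<forall>t\<in>{0..<T}. t \<noteq> 0 \<and> dist t 0 < r \<longrightarrow> m t < m t1 / 4"
        unfolding eventually_at by blast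
      have r2: "m t < m t1 / 4" if "0 < t" "t < r" "t < T" for t
        using r(2)[rule_format, of t] that by (simp add: dist_real_def)
      have "\<forall>\<^sub>F t in at t1 within {0..<T}. m t1 / 2 < m t"
        using order_tendstoD(1)[OF m_cont[OF t1], of "m t1 / 2"] pos by simp
      then obtain r' where r': "0 < r'" "\<forall>t\<in>{0..<T}. t \<noteq> t1 \<and> dist t t1 < r' \<longrightarrow> m t1 / 2 < m t"
        unfolding eventually_at by blast
      have r'2: "m t1 / 2 < m t" if "t1 < t" "t < t1 + r'" "t < T" for t
        using r'(2)[rule_format, of t] that t1 by (simp add: dist_real_def)
      \<comment> \<open>The plateau rises during \<open>(h, 2 * h)\<close>, where \<open>m\<close>
        is below \<open>m t1 / 4\<close>, and falls during \<open>(t1, t1 + h)\<close>, where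
        \<open>m\<close> exceeds \<open>m t1 / 2\<close>. The fractions of \<open>r\<close>,
        \<open>t1\<close>, \<open>r'\<close> and \<open>T - t1\<close> keep both windows within
        reach of these estimates and apart from each other.\<close>
      define h where "h = min (min (r / 3) (t1 / 3)) (min (r' / 2) (T / 2 - t1 / 2))"
      have h: "0 < h" "3 * h \<le> r" "3 * h \<le> t1" "h < r'" "t1 + h < T"
      proof -
        have "h \<le> r / 3" "h \<le> t1 / 3" "h \<le> r' / 2" "h \<le> T / 2 - t1 / 2" unfolding h_def by (linarith, linarith, linarith, linarith)
        moreover show "0 < h" using r(1) r'(1) \<open>0 < t1\<close> t1(2) by (simp add: h_def)
        ultimately show "3 * h \<le> r" "3 * h \<le> t1" "h < r'" "t1 + h < T"
          using r'(1) t1(2) by - (linarith+)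
      qed
      define \<alpha> where "\<alpha> t = step ((t - 2 * h) / h) - step ((t - (t1 + h)) / h)" for t
      define \<alpha>1 where "\<alpha>1 t = step' ((t - 2 * h) / h) / h" for t
      define \<alpha>2 where "\<alpha>2 t = step' ((t - (t1 + h)) / h) / h" for t
      have \<alpha>0: "0 \<le> \<alpha> t" for t
        unfolding \<alpha>_def using h by (auto intro!: step_mono divide_right_mono)
      have \<alpha>12: "0 \<le> \<alpha>1 t" "0 \<le> \<alpha>2 t" for t unfolding \<alpha>1_def \<alpha>2_def using h step_bounds(3) by auto
      have \<alpha>_out: "\<alpha> t = 0 \<and> \<alpha>1 t = 0 \<and> \<alpha>2 t = 0" if "t \<notin> {h..t1+h}" for t
      proof (cases "t < h")
        case True
        then have "(t - 2 * h) / h \<le> -1" "(t - (t1 + h)) / h \<le> -1" using h by (auto simp: divide_le_eq)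
        then show ?thesis by (simp add: \<alpha>_def \<alpha>1_def \<alpha>2_def step_left)
      next
        case False
        then have "0 \<le> (t - 2 * h) / h" "0 \<le> (t - (t1 + h)) / h" using h that by auto
        then show ?thesis by (simp add: \<alpha>_def \<alpha>1_def \<alpha>2_def step_right)
      qed
      have \<alpha>D: "(\<alpha> has_real_derivative \<alpha>1 t - \<alpha>2 t) (at t)" for t
      proof -
        have "((\<lambda>t. step ((t - c) / h)) has_real_derivative step' ((t - c) / h) / h) (at t)" for c
        proof -
          have "((\<lambda>t. (t - c) / h) has_real_derivative 1 / h) (at t)" using h by (auto intro!: derivative_eq_intros)
          from DERIV_chain2[OF step_deriv this] show ?thesis by simp
        qed
        from DERIV_diff[OF this this] show ?thesis unfolding \<alpha>_def[abs_def] \<alpha>1_def \<alpha>2_def .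
      qed
      have \<alpha>c: "continuous_on UNIV \<alpha>1" "continuous_on UNIV \<alpha>2"
        unfolding \<alpha>1_def \<alpha>2_def
        by (intro continuous_intros continuous_on_compose2[OF step_continuous(2)[of UNIV]]; use h in auto)+
      have \<alpha>C: "C1_on UNIV (\<lambda>p. \<alpha> (fst p)) (\<lambda>p. \<alpha>1 (fst p) - \<alpha>2 (fst p)) (\<lambda>p. 0)"
      proof -
        have "C1_on UNIV (\<lambda>p::real\<times>real. fst p) (\<lambda>_. 1) (\<lambda>_. 0)" unfolding C1_on_def by (auto intro!: derivative_eq_intros)
        from C1_on_compose[OF this \<alpha>D] show ?thesis using \<alpha>c by (auto intro!: continuous_intros)
      qed
      define \<phi> \<phi>t \<phi>x where "\<phi> p = \<alpha> (fst p) * \<omega> p"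
        and "\<phi>t p = (\<alpha>1 (fst p) - \<alpha>2 (fst p)) * \<omega> p + \<alpha> (fst p) * cone_weight_t L N R p"
        and "\<phi>x p = 0 * \<omega> p + \<alpha> (fst p) * cone_weight_x L N R p" for p
      have "C1_test ({0<..<T} \<times> UNIV) \<phi> \<phi>t \<phi>x"
        unfolding C1_test_def
      proof (intro conjI exI allI impI)
        show "C1_on UNIV \<phi> \<phi>t \<phi>x" unfolding \<phi>_def \<phi>t_def \<phi>x_def by (rule C1_on_mult[OF \<alpha>C \<omega>C])
        show "compact ({h..t1+h} \<times> {-R..R})" by (intro compact_Times) auto
        show "{h..t1+h} \<times> {-R..R} \<subseteq> {0<..<T} \<times> UNIV" using h by auto
        fix p assume "p \<notin> {h..t1+h} \<times> {-R..R}"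
        then have "fst p \<notin> {h..t1+h} \<or> 0 \<le> fst p \<and> snd p \<notin> {-R..R}" using h by (cases p) force
        then show "\<phi> p = 0" using \<alpha>_out[of "fst p"] \<omega>_out[of p] by (auto simp: \<phi>_def simp del: atLeastAtMost_iff)
      qed
      note test = this
      have "0 \<le> \<phi> p" for p using \<alpha>0 \<omega>0 by (simp add: \<phi>_def)
      note kt = kato[OF test this]
      note [measurable] = C1_test_measurable[OF test] borel_measurable_continuous_onI[OF \<alpha>c(1)] borel_measurable_continuous_onI[OF \<alpha>c(2)]
      \<comment> \<open>The part of the tested inequality that survives once the flux, the source
        and the derivative of the cone weight have been absorbed: only the rise and the fall of the
        plateau are left.\<close>
      define E where "E p = \<bar>v p - u p\<bar> * ((\<alpha>1 (fst p) - \<alpha>2 (fst p)) * \<omega> p)" for p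
      have "E \<in> borel_measurable (borel \<Otimes>\<^sub>M borel)"
      proof -
        have "v \<in> borel_measurable (borel \<Otimes>\<^sub>M borel)" "u \<in> borel_measurable (borel \<Otimes>\<^sub>M borel)" "\<omega> \<in> borel_measurable (borel \<Otimes>\<^sub>M borel)"
          by (simp_all add: borel_prod)
        then show ?thesis unfolding E_def by measurable
      qed
      then have E_meas [measurable]: "E \<in> borel_measurable borel" by (simp add: borel_prod)
      have E_out: "E p = 0" if "p \<notin> {h..t1+h} \<times> {-R..R}" for p
      proof -
        have "fst p \<notin> {h..t1+h} \<or> 0 \<le> fst p \<and> snd p \<notin> {-R..R}" using h that by (cases p) force
        then show ?thesis using \<alpha>_out[of "fst p"] \<omega>_out[of p] by (auto simp: E_def simp del: atLeastAtMost_iff)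
      qed
      have Eint: "integrable lborel E"
      proof -
        have "\<bar>\<alpha>1 t - \<alpha>2 t\<bar> \<le> 2 / h" for t
          using step_bounds(3,4) h unfolding \<alpha>1_def \<alpha>2_def diff_divide_distrib[symmetric]
          by (auto simp: abs_le_iff divide_right_mono intro!: divide_right_mono) (smt (verit) step_bounds)+
        note b1 = this
        have "\<bar>E p\<bar> \<le> (2 * M) * ((2 / h) * W)" for p
        proof (cases "p \<in> {h..t1+h} \<times> {-R..R}")
          case True
          then have "p \<in> {0..T} \<times> {-R..R}" using h by auto
          then show ?thesis unfolding E_def abs_mult abs_abs
            using D2M b1 W'[of p] M0 W0 h by (intro mult_mono) auto
        next
          case False
          then show ?thesis using E_out[OF False] M0 W0 h by simp
        qed
        then show ?thesis
          by (rule integrable_bounded_compact[of "{h..t1+h} \<times> {-R..R}", rotated 2]) (use E_out in \<open>auto intro: compact_Times\<close>)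
      qed
      have "0 \<le> integral\<^sup>L lborel E"
      proof (rule order_trans[OF kt integral_mono[OF _ Eint]])
        have bfg: "bounded (range (\<lambda>p. f (v p) - f (u p)))" "bounded (range (\<lambda>p. g (v p) - g (u p)))"
        proof -
          have "\<bar>f (v p) - f (u p)\<bar> \<le> L * (2 * M)" for p
            using L(2)[OF vM uM, of p p] mult_left_mono[OF D2M L(1), of p] by linarith
          moreover have "\<bar>g (v p) - g (u p)\<bar> \<le> \<bar>N\<bar> * (2 * M)" for p
            using N[OF vM uM, of p p] mult_right_mono[OF abs_ge_self, of "\<bar>v p - u p\<bar>" N] mult_left_mono[OF D2M abs_ge_zero, of N p] by linarith
          ultimately show "bounded (range (\<lambda>p. f (v p) - f (u p)))" "bounded (range (\<lambda>p. g (v p) - g (u p)))"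
            unfolding bounded_iff real_norm_def by blast+
        qed
        have bphi: "bounded (range \<phi>)" "bounded (range \<phi>t)" "bounded (range \<phi>x)" "bounded (range v)" "bounded (range u)"
          using C1_test_bounded[OF test] vM uM unfolding bounded_iff real_norm_def by (metis rangeE)+
        obtain K where K: "compact K" "\<And>p. p \<notin> K \<Longrightarrow> \<phi> p = 0" "\<And>p. p \<notin> K \<Longrightarrow> \<phi>t p = 0" "\<And>p. p \<notin> K \<Longrightarrow> \<phi>x p = 0"
          using C1_test_support[OF test] by metis
        let ?I = "\<lambda>p. \<bar>v p - u p\<bar> * \<phi>t p + sgn (v p - u p) * (f (v p) - f (u p)) * \<phi>x p
            + sgn (v p - u p) * (g (v p) - g (u p)) * \<phi> p"
        have "bounded (range ?I)" by (intro bounded_range_intros(1,3-)  bphi bfg bounded_minus_comp)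
        then obtain B where "\<And>p. \<bar>?I p\<bar> \<le> B" unfolding bounded_iff real_norm_def by blast
        then show "integrable lborel ?I"
          by (intro integrable_bounded_compact[OF K(1), of _ B]) (use K(2-4) in \<open>simp_all\<close>)
      next
        fix p
        have s: "sgn a * x \<le> \<bar>x\<bar>" for a x :: real by (auto simp: sgn_if)
        have "sgn (v p - u p) * (f (v p) - f (u p)) * \<phi>x p \<le> \<bar>f (v p) - f (u p)\<bar> * \<bar>\<phi>x p\<bar>"
          using s[of "v p - u p" "(f (v p) - f (u p)) * \<phi>x p"] by (simp add: abs_mult mult.assoc)
        also have "\<dots> \<le> (L * \<bar>v p - u p\<bar>) * \<bar>\<phi>x p\<bar>" using L(2)[OF vM uM] by (intro mult_right_mono) auto
        also have "\<dots> = \<bar>v p - u p\<bar> * (\<alpha> (fst p) * (L * \<bar>cone_weight_x L N R p\<bar>))"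
          using \<alpha>0 by (simp add: \<phi>x_def abs_mult)
        finally have 1: "sgn (v p - u p) * (f (v p) - f (u p)) * \<phi>x p \<le> \<bar>v p - u p\<bar> * (\<alpha> (fst p) * (L * \<bar>cone_weight_x L N R p\<bar>))" .
        have "sgn (v p - u p) * (g (v p) - g (u p)) \<le> \<bar>g (v p) - g (u p)\<bar>"
          by (rule s)
        also have "\<dots> \<le> N * \<bar>v p - u p\<bar>" by (rule N[OF vM uM])
        finally have "sgn (v p - u p) * (g (v p) - g (u p)) * \<phi> p \<le> N * \<bar>v p - u p\<bar> * \<phi> p"
          using \<open>0 \<le> \<phi> p\<close> by (rule mult_right_mono)
        then have 2: "sgn (v p - u p) * (g (v p) - g (u p)) * \<phi> p \<le> \<bar>v p - u p\<bar> * (\<alpha> (fst p) * (N * \<omega> p))"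
          by (simp add: \<phi>_def mult_ac)
        have "\<bar>v p - u p\<bar> * (\<alpha> (fst p) * (cone_weight_t L N R p + L * \<bar>cone_weight_x L N R p\<bar> + N * \<omega> p)) \<le> 0"
          using cone_weight_decay[OF L(1), of N R p] \<alpha>0 unfolding \<omega>_def by (intro mult_nonneg_nonpos) auto
        then show "\<bar>v p - u p\<bar> * \<phi>t p + sgn (v p - u p) * (f (v p) - f (u p)) * \<phi>x p
            + sgn (v p - u p) * (g (v p) - g (u p)) * \<phi> p \<le> E p"
          using 1 2 unfolding E_def \<phi>t_def by (simp add: algebra_simps)
      qed
      also have "integral\<^sup>L lborel E = (LINT t|lborel. LINT x|lborel. E (t, x))"
        using lborel_pair.integral_fst'[of E] Eint by (simp add: lborel_prod)
      also have "\<dots> = (LINT t|lborel. (\<alpha>1 t - \<alpha>2 t) * m t)"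
      proof (rule Bochner_Integration.integral_cong[OF refl])
        fix t
        have "(\<lambda>x. E (t, x)) = (\<lambda>x. (\<alpha>1 t - \<alpha>2 t) * (\<bar>v (t, x) - u (t, x)\<bar> * \<omega> (t, x)))"
          by (auto simp: E_def mult_ac)
        then show "(LINT x|lborel. E (t, x)) = (\<alpha>1 t - \<alpha>2 t) * m t" by (simp add: m_def)
      qed
      also have "\<dots> \<le> (LINT t|lborel. m t1 / 4 * \<alpha>1 t - m t1 / 2 * \<alpha>2 t)"
      proof (rule integral_mono)
        have "integrable lborel (\<lambda>t. LINT x|lborel. E (t, x))"
          using lborel_pair.integrable_fst'[of E] Eint by (simp add: lborel_prod)
        moreover have "(LINT x|lborel. E (t, x)) = (\<alpha>1 t - \<alpha>2 t) * m t" for t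
        proof -
          have "(\<lambda>x. E (t, x)) = (\<lambda>x. (\<alpha>1 t - \<alpha>2 t) * (\<bar>v (t, x) - u (t, x)\<bar> * \<omega> (t, x)))"
            by (auto simp: E_def mult_ac)
          then show ?thesis by (simp add: m_def)
        qed
        ultimately show "integrable lborel (\<lambda>t. (\<alpha>1 t - \<alpha>2 t) * m t)" by simp
        show "integrable lborel (\<lambda>t. m t1 / 4 * \<alpha>1 t - m t1 / 2 * \<alpha>2 t)"
          unfolding \<alpha>1_def \<alpha>2_def by (intro Bochner_Integration.integrable_diff integrable_mult_right step'_integral h)
        fix t
        have "\<alpha>1 t * m t \<le> \<alpha>1 t * (m t1 / 4)"
        proof (cases "h < t \<and> t < 2 * h")
          case True
          then show ?thesis using r2[of t] h \<alpha>12(1)[of t] by (intro mult_left_mono) auto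
        next
          case False
          then have "(t - 2 * h) / h \<le> -1 \<or> 0 \<le> (t - 2 * h) / h" using h by (auto simp: divide_le_eq)
          then have "\<alpha>1 t = 0" unfolding \<alpha>1_def using step_left step_right by auto
          then show ?thesis by simp
        qed
        moreover have "\<alpha>2 t * (m t1 / 2) \<le> \<alpha>2 t * m t"
        proof (cases "t1 < t \<and> t < t1 + h")
          case True
          then show ?thesis using r'2[of t] h \<alpha>12(2)[of t] by (intro mult_left_mono) auto
        next
          case False
          then have "(t - (t1 + h)) / h \<le> -1 \<or> 0 \<le> (t - (t1 + h)) / h" using h by (auto simp: divide_le_eq)
          then have "\<alpha>2 t = 0" unfolding \<alpha>2_def using step_left step_right by auto
          then show ?thesis by simp
        qed
        ultimately show "(\<alpha>1 t - \<alpha>2 t) * m t \<le> m t1 / 4 * \<alpha>1 t - m t1 / 2 * \<alpha>2 t"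
          by (simp add: algebra_simps)
      qed
      also have "\<dots> = m t1 / 4 - m t1 / 2"
      proof -
        have "integrable lborel \<alpha>1" "integrable lborel \<alpha>2" "integral\<^sup>L lborel \<alpha>1 = 1" "integral\<^sup>L lborel \<alpha>2 = 1"
          unfolding \<alpha>1_def \<alpha>2_def by (rule step'_integral[OF h(1)])+
        then show ?thesis by simp
      qed
      finally show False using pos by simp
    qed
    then show ?thesis
      using integral_nonneg_eq_0_iff_AE[OF int_m[of t1 t1]] t1 \<omega>0 unfolding m_def \<omega>_def by auto
  qed
  \<comment> \<open>Each cone controls only a bounded interval at time \<open>t1\<close>. Countably
    many of them exhaust the line, so the exceptional sets still form a null set.\<close>
  have "AE x in lborel. \<forall>n. \<bar>v (t1, x) - u (t1, x)\<bar> * cone_weight L N (real n) (t1, x) = 0"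
    unfolding AE_all_countable using main by blast
  then show ?thesis
  proof eventually_elim
    case (elim x)
    obtain n where "L * t1 + sqrt (1 + x\<^sup>2) < real n" using reals_Archimedean2 by blast
    then have "cone_weight L N (real n) (t1, x) \<noteq> 0" by (simp add: cone_weight_def cone_def max_def)
    then show ?case using elim by auto
  qed
qed

text \<open>A solution is bounded only up to null sets, slice by slice and with a bound depending on
  the time horizon. Truncation at that bound produces a function that is Borel and bounded
  everywhere, as the comparison lemmas require. It agrees with the solution almost everywhere on
  every slice, not only on almost every one, so values at a prescribed time are retained.\<close>

lemma entropy_solution_representative:
  assumes sol: "entropy_solution f g u0 v" and "0 < T"
    and cf: "continuous_on UNIV f" and cg: "continuous_on UNIV g"
  obtains M V where "V \<in> borel_measurable borel" "\<And>p. \<bar>V p\<bar> \<le> M"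
    "\<And>t. t \<in> {0..T} \<Longrightarrow> AE x in lborel. V (t, x) = v t x"
    "kruzkov ({0<..<T} \<times> UNIV) f V (\<lambda>p. g (V p))"
    "\<And>t. 0 \<le> t \<Longrightarrow> v t \<in> borel_measurable borel"
proof -
  obtain M' where M': "\<And>t. t \<in> {0..T} \<Longrightarrow> AE x in lborel. \<bar>v t x\<bar> \<le> M'"
    using sol \<open>0 < T\<close> unfolding entropy_solution_def by (meson less_imp_le)
  define M where "M = \<bar>M'\<bar>"
  have M: "AE x in lborel. \<bar>v t x\<bar> \<le> M" if "t \<in> {0..T}" for t
    using M'[OF that] by eventually_elim (simp add: M_def)
  define v0 where "v0 p = indicator ({0..} \<times> UNIV) p *\<^sub>R v (fst p) (snd p)" for p :: "real \<times> real"
  have v0 [measurable]: "v0 \<in> borel_measurable borel"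
    using sol unfolding entropy_solution_def set_borel_measurable_def v0_def[abs_def] by (simp add: case_prod_beta')
  define V where "V p = max (- M) (min M (v0 p))" for p
  have V [measurable]: "V \<in> borel_measurable borel" unfolding V_def[abs_def] by measurable
  have VM: "\<bar>V p\<bar> \<le> M" for p by (auto simp: V_def M_def max_def min_def abs_le_iff)
  have Vv: "AE x in lborel. V (t, x) = v t x" if "t \<in> {0..T}" for t
    using M[OF that] by eventually_elim (use that in \<open>auto simp: V_def v0_def abs_le_iff max_def min_def\<close>)
  have VV: "AE p in lborel. fst p \<in> {0..T} \<longrightarrow> V p = v0 p"
    unfolding lborel_prod[symmetric]
  proof (rule lborel_pair.AE_pair_measure)
    have "v0 \<in> borel_measurable (lborel \<Otimes>\<^sub>M lborel)" "V \<in> borel_measurable (lborel \<Otimes>\<^sub>M lborel)" by (simp_all add: lborel_prod)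
    then show "{p \<in> space (lborel \<Otimes>\<^sub>M lborel). fst p \<in> {0..T} \<longrightarrow> V p = v0 p} \<in> sets (lborel \<Otimes>\<^sub>M lborel)"
      by measurable
    show "AE t in lborel. AE x in lborel. fst (t, x) \<in> {0..T} \<longrightarrow> V (t, x) = v0 (t, x)"
    proof (rule AE_I2)
      fix t :: real
      show "AE x in lborel. fst (t, x) \<in> {0..T} \<longrightarrow> V (t, x) = v0 (t, x)"
      proof (cases "t \<in> {0..T}")
        case True
        then show ?thesis using Vv[OF True] by (auto simp: v0_def elim!: eventually_mono)
      next
        case False
        then show ?thesis by (intro AE_I2) auto
      qed
    qed
  qed
  note [measurable] = borel_measurable_continuous_onI[OF cf] borel_measurable_continuous_onI[OF cg]
  have "kruzkov ({0<..<T} \<times> UNIV) f V (\<lambda>p. g (V p))"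
    unfolding kruzkov_def
  proof (intro allI impI, elim conjE)
    fix k \<phi> \<phi>t \<phi>x assume phi: "C1_test ({0<..<T} \<times> UNIV) \<phi> \<phi>t \<phi>x" and phi0: "\<forall>p. 0 \<le> \<phi> p"
    obtain K where K: "K \<subseteq> {0<..<T} \<times> UNIV" "\<And>p. p \<notin> K \<Longrightarrow> \<phi> p = 0" "\<And>p. p \<notin> K \<Longrightarrow> \<phi>t p = 0" "\<And>p. p \<notin> K \<Longrightarrow> \<phi>x p = 0"
      using C1_test_support[OF phi] by metis
    note [measurable] = C1_test_measurable[OF phi]
    have "test_halfplane \<phi> \<phi>t \<phi>x"
      unfolding test_halfplane_iff by (rule C1_test_mono[OF phi]) auto
    then have "0 \<le> (LINT (t, x):{0<..} \<times> UNIV|lborel.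
               \<bar>v t x - k\<bar> * \<phi>t (t, x)
               + sgn (v t x - k) * (f (v t x) - f k) * \<phi>x (t, x)
               + sgn (v t x - k) * g (v t x) * \<phi> (t, x))"
      using sol phi0 unfolding entropy_solution_def by blast
    also have "\<dots> = (LINT p|lborel. \<bar>v0 p - k\<bar> * \<phi>t p + sgn (v0 p - k) * (f (v0 p) - f k) * \<phi>x p
            + sgn (v0 p - k) * g (v0 p) * \<phi> p)"
      unfolding set_lebesgue_integral_def
    proof (rule Bochner_Integration.integral_cong[OF refl])
      fix p :: "real \<times> real"
      show "indicator ({0<..} \<times> UNIV) p *\<^sub>R (case p of (t, x) \<Rightarrow> \<bar>v t x - k\<bar> * \<phi>t (t, x)
               + sgn (v t x - k) * (f (v t x) - f k) * \<phi>x (t, x)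
               + sgn (v t x - k) * g (v t x) * \<phi> (t, x))
          = \<bar>v0 p - k\<bar> * \<phi>t p + sgn (v0 p - k) * (f (v0 p) - f k) * \<phi>x p
            + sgn (v0 p - k) * g (v0 p) * \<phi> p"
      proof (cases "p \<in> K")
        case True
        then have "0 < fst p" using K(1) by auto
        then show ?thesis by (cases p) (simp add: v0_def)
      next
        case False
        then show ?thesis using K(2-4)[of p] by (cases p) simp
      qed
    qed
    also have "\<dots> = (LINT p|lborel. \<bar>V p - k\<bar> * \<phi>t p + sgn (V p - k) * (f (V p) - f k) * \<phi>x p
            + sgn (V p - k) * g (V p) * \<phi> p)"
    proof (rule integral_cong_AE)
      show "AE p in lborel. \<bar>v0 p - k\<bar> * \<phi>t p + sgn (v0 p - k) * (f (v0 p) - f k) * \<phi>x p + sgn (v0 p - k) * g (v0 p) * \<phi> p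
          = \<bar>V p - k\<bar> * \<phi>t p + sgn (V p - k) * (f (V p) - f k) * \<phi>x p + sgn (V p - k) * g (V p) * \<phi> p"
        using VV
      proof eventually_elim
        case (elim p)
        show ?case
        proof (cases "p \<in> K")
          case True
          then have "fst p \<in> {0..T}" using K(1) by auto
          then show ?thesis using elim by simp
        next
          case False
          then show ?thesis using K(2-4) by simp
        qed
      qed
    qed measurable
    finally show "0 \<le> (LINT p|lborel. \<bar>V p - k\<bar> * \<phi>t p + sgn (V p - k) * (f (V p) - f k) * \<phi>x p
            + sgn (V p - k) * g (V p) * \<phi> p)" .
  qed
  moreover have "v t \<in> borel_measurable borel" if "0 \<le> t" for t
  proof -
    have "(\<lambda>x. v0 (t, x)) \<in> borel_measurable borel"
      by (rule measurable_compose[OF _ v0]) (intro borel_measurable_continuous_onI continuous_intros)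
    then show ?thesis using that by (simp add: v0_def)
  qed
  ultimately show thesis using that V VM Vv by blast
qed

section \<open>Two classical branches glued along a shock\<close>

lemma C1_Lipschitz_on_interval:
  fixes f f' :: "real \<Rightarrow> real"
  assumes f: "\<And>x. (f has_real_derivative f' x) (at x)" and f': "continuous_on UNIV f'"
  obtains L where "0 \<le> L" "\<And>a b. \<bar>a\<bar> \<le> M \<Longrightarrow> \<bar>b\<bar> \<le> M \<Longrightarrow> \<bar>f a - f b\<bar> \<le> L * \<bar>a - b\<bar>"
proof -
  have "bounded (f' ` {-M..M})"
    by (intro compact_imp_bounded compact_continuous_image continuous_on_subset[OF f']) auto
  then obtain L where "0 < L" and L: "\<And>x. x \<in> {-M..M} \<Longrightarrow> \<bar>f' x\<bar> \<le> L"
    unfolding bounded_pos by auto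
  have "\<bar>f a - f b\<bar> \<le> L * \<bar>a - b\<bar>" if "\<bar>a\<bar> \<le> M" "\<bar>b\<bar> \<le> M" for a b
    using field_differentiable_bound[of "{-M..M}" f f' L b a] f L that
    by (auto simp: abs_le_iff has_field_derivative_at_within abs_minus_commute)
  with that[of L] \<open>0 < L\<close> show thesis by auto
qed

lemma kruzkov_const: "kruzkov S f (\<lambda>_. c) (\<lambda>_. 0)"
  unfolding kruzkov_def
proof (intro allI impI, elim conjE)
  fix k \<phi> \<phi>t \<phi>x assume phi: "C1_test S \<phi> \<phi>t \<phi>x" and "\<forall>p. 0 \<le> \<phi> p"
  obtain K where K: "compact K" "\<And>p. p \<notin> K \<Longrightarrow> \<phi>t p = 0" "\<And>p. p \<notin> K \<Longrightarrow> \<phi>x p = 0"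
    using C1_test_support[OF phi] by metis
  obtain B where B: "\<And>p. \<bar>\<phi>t p\<bar> \<le> B" "\<And>p. \<bar>\<phi>x p\<bar> \<le> B" using C1_test_bounded[OF phi] by metis
  have "integrable lborel \<phi>t" "integrable lborel \<phi>x"
    using integrable_bounded_compact[OF K(1)] C1_test_measurable[OF phi] K B by metis+
  then show "0 \<le> (LINT p|lborel. \<bar>c - k\<bar> * \<phi>t p + sgn (c - k) * (f c - f k) * \<phi>x p + sgn (c - k) * 0 * \<phi> p)"
    using C1_test_integral_zero[OF phi] by simp
qed

text \<open>Existence and uniqueness come from the same comparison \<open>kato\<close>. With a
  constant in place of the arbitrary entropy solution it is the entropy inequality of the glued
  function itself; with a competing solution it is the hypothesis of
  \<open>L1_contraction\<close>.\<close>

lemma shock_entropy_solution: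
  fixes f f' g g' :: "real \<Rightarrow> real"
  assumes f: "\<And>x. (f has_real_derivative f' x) (at x)" and f': "continuous_on UNIV f'"
    and g: "\<And>x. (g has_real_derivative g' x) (at x)" and g': "continuous_on UNIV g'"
    and wl: "C1_on Sl wl wlt wlx" "open Sl" and wr: "C1_on Sr wr wrt wrx" "open Sr"
    and s: "\<And>t. 0 < t \<Longrightarrow> (s has_real_derivative s' t) (at t)" "continuous_on UNIV s"
      "continuous_on {0<..} s'"
    and \<delta>: "0 < \<delta>" and C: "0 \<le> C"
    and Sl: "\<And>t x. 0 \<le> t \<Longrightarrow> x \<le> s t \<Longrightarrow> (t, x) \<in> Sl"
    and Sr: "\<And>t x. 0 \<le> t \<Longrightarrow> s t - \<delta> \<le> x \<Longrightarrow> (t, x) \<in> Sr"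
    and pde_l: "\<And>p. p \<in> Sl \<Longrightarrow> wlt p + f' (wl p) * wlx p = g (wl p)"
    and pde_r: "\<And>p. p \<in> Sr \<Longrightarrow> wrt p + f' (wr p) * wrx p = g (wr p)"
    and shock: "\<And>t x k. 0 < t \<Longrightarrow> s t - \<delta> \<le> x \<Longrightarrow> x \<le> s t \<Longrightarrow>
      sgn (k - wr (t, x)) * (f k - f (wr (t, x))) - sgn (k - wl (t, x)) * (f k - f (wl (t, x)))
        - s' t * (\<bar>k - wr (t, x)\<bar> - \<bar>k - wl (t, x)\<bar>) \<le> C * (s t - x)"
    and M: "\<And>t x. 0 \<le> t \<Longrightarrow> x \<le> s t \<Longrightarrow> \<bar>wl (t, x)\<bar> \<le> M" "\<And>t x. 0 \<le> t \<Longrightarrow> s t \<le> x \<Longrightarrow> \<bar>wr (t, x)\<bar> \<le> M"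
    and u: "\<And>t x. 0 \<le> t \<Longrightarrow> u t x = (if x < s t then wl (t, x) else wr (t, x))"
    and init: "AE x in lborel. u 0 x = u0 x"
  shows "the_entropy_solution f g u0 u"
proof -
  have cf: "continuous_on UNIV f" and cg: "continuous_on UNIV g"
    using f g by (meson DERIV_isCont continuous_at_imp_continuous_on)+
  note [measurable] = borel_measurable_continuous_onI[OF cf] borel_measurable_continuous_onI[OF cg]
  define A B where "A = {p :: real \<times> real. 0 \<le> fst p \<and> snd p < s (fst p)}" and "B = {p :: real \<times> real. 0 \<le> fst p \<and> s (fst p) \<le> snd p}"
  have cs: "continuous_on UNIV (\<lambda>p :: real \<times> real. s (fst p))"
    by (rule continuous_on_compose2[OF s(2)]) (auto intro!: continuous_intros)
  have sets: "A \<in> sets borel" "B \<in> sets borel"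
  proof -
    have "open {p :: real \<times> real. snd p < s (fst p)}" "closed {p :: real \<times> real. s (fst p) \<le> snd p}" "closed {p :: real \<times> real. 0 \<le> fst p}"
      by (intro open_Collect_less closed_Collect_le cs continuous_intros)+
    then have "{p :: real \<times> real. 0 \<le> fst p} \<inter> {p. snd p < s (fst p)} \<in> sets borel"
      "{p :: real \<times> real. 0 \<le> fst p} \<inter> {p. s (fst p) \<le> snd p} \<in> sets borel"
      by (auto intro!: sets.Int)
    moreover have "A = {p :: real \<times> real. 0 \<le> fst p} \<inter> {p. snd p < s (fst p)}" "B = {p :: real \<times> real. 0 \<le> fst p} \<inter> {p. s (fst p) \<le> snd p}"
      by (auto simp: A_def B_def)
    ultimately show "A \<in> sets borel" "B \<in> sets borel" by simp_all
  qed
  have sub: "A \<subseteq> Sl" "B \<subseteq> Sr" using Sl Sr \<delta> by (auto simp: A_def B_def less_imp_le)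
  \<comment> \<open>Equal to \<open>u\<close> for nonnegative times and to 0 before. Since
    \<open>A\<close> and \<open>B\<close> are Borel and the branches continuous on them, it is Borel
    on the whole plane.\<close>
  define ub where "ub p = indicator A p *\<^sub>R wl p + indicator B p *\<^sub>R wr p" for p
  have ub_u: "ub (t, x) = u t x" if "0 \<le> t" for t x
    using that by (auto simp: ub_def A_def B_def u indicator_def)
  have ub [measurable]: "ub \<in> borel_measurable borel"
    unfolding ub_def[abs_def]
    by (intro borel_measurable_add borel_measurable_continuous_on_indicator sets
        continuous_on_subset[OF C1_on_continuous(1)[OF wl(1)] sub(1)] continuous_on_subset[OF C1_on_continuous(1)[OF wr(1)] sub(2)])
  have M0: "0 \<le> M" using M(1)[of 0 "s 0"] by simp
  have ubM: "\<bar>ub p\<bar> \<le> M" for p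
    using M[of "fst p" "snd p"] M0 by (auto simp: ub_def A_def B_def indicator_def)
  have uM: "\<bar>u t x\<bar> \<le> M" if "0 \<le> t" for t x using ubM[of "(t, x)"] ub_u[OF that] by simp
  have cont: "((\<lambda>t. LINT x:{-R..R}|lborel. \<bar>u t x - u t0 x\<bar>) \<longlongrightarrow> 0) (at t0 within {0..})" if t0: "0 \<le> t0" for t0 R
    unfolding tendsto_at_iff_sequentially
  proof (intro allI impI)
    fix X assume X: "\<forall>i. X i \<in> {0..} - {t0}" and lim: "X \<longlonglongrightarrow> t0"
    have X0: "0 \<le> X i" for i using X by auto
    have slm: "(\<lambda>x. u t x) \<in> borel_measurable borel" if "0 \<le> t" for t
      using measurable_compose[OF _ ub, of "\<lambda>x. (t, x)" borel] ub_u[OF that]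
      by (auto intro!: borel_measurable_continuous_onI continuous_intros)
    \<comment> \<open>Away from the single point \<open>s t0\<close> the values at nearby times come
      from the same branch and converge; the common bound \<open>M\<close> allows dominated
      convergence.\<close>
    have "AE x in lborel. x \<noteq> s t0" by (rule AE_lborel_singleton)
    then have ae: "AE x in lborel. (\<lambda>i. indicator {-R..R} x *\<^sub>R \<bar>u (X i) x - u t0 x\<bar>) \<longlonglongrightarrow> indicator {-R..R} x *\<^sub>R 0"
    proof eventually_elim
      case (elim x)
      have sX: "(\<lambda>i. s (X i)) \<longlonglongrightarrow> s t0" using continuous_on_tendsto_compose[OF s(2) lim] by simp
      have pX: "(\<lambda>i. (X i, x)) \<longlonglongrightarrow> (t0, x)" by (intro tendsto_intros lim)
      have "(\<lambda>i. u (X i) x) \<longlonglongrightarrow> u t0 x"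
      proof (cases "x < s t0")
        case True
        have "isCont wl (t0, x)" using C1_on_continuous(1)[OF wl(1)] wl(2) Sl[of t0 x] t0 True by (auto simp: continuous_on_eq_continuous_at)
        then have "(\<lambda>i. wl (X i, x)) \<longlonglongrightarrow> wl (t0, x)" using pX isCont_tendsto_compose by blast
        moreover have "\<forall>\<^sub>F i in sequentially. wl (X i, x) = u (X i) x"
          using order_tendstoD(1)[OF sX True] by eventually_elim (simp add: u X0)
        ultimately show ?thesis using True t0 by (simp add: u tendsto_cong)
      next
        case False
        then have *: "s t0 < x" using elim by simp
        have "isCont wr (t0, x)" using C1_on_continuous(1)[OF wr(1)] wr(2) Sr[of t0 x] t0 * \<delta> by (auto simp: continuous_on_eq_continuous_at)
        then have "(\<lambda>i. wr (X i, x)) \<longlonglongrightarrow> wr (t0, x)" using pX isCont_tendsto_compose by blast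
        moreover have "\<forall>\<^sub>F i in sequentially. wr (X i, x) = u (X i) x"
          using order_tendstoD(2)[OF sX *] by eventually_elim (simp add: u X0)
        ultimately show ?thesis using False t0 by (simp add: u tendsto_cong)
      qed
      then have "(\<lambda>i. \<bar>u (X i) x - u t0 x\<bar>) \<longlonglongrightarrow> \<bar>u t0 x - u t0 x\<bar>" by (intro tendsto_intros)
      then show ?case by (intro tendsto_scaleR tendsto_const) simp
    qed
    have "(\<lambda>i. LINT x|lborel. indicator {-R..R} x *\<^sub>R \<bar>u (X i) x - u t0 x\<bar>) \<longlonglongrightarrow> (LINT x|lborel. indicator {-R..R} x *\<^sub>R 0 :: real)"
    proof (rule integral_dominated_convergence[where w="\<lambda>x. 2 * M * indicator {-R..R} x"])
      show "integrable lborel (\<lambda>x. 2 * M * indicator {-R..R} x)"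
        using emeasure_compact_finite[of "{-R..R}"] by (intro integrable_mult_right integrable_real_indicator) auto
      show "AE x in lborel. (\<lambda>i. indicator {-R..R} x *\<^sub>R \<bar>u (X i) x - u t0 x\<bar>) \<longlonglongrightarrow> indicator {-R..R} x *\<^sub>R 0" by (rule ae)
      fix i
      note [measurable] = slm[OF X0] slm[OF t0]
      show "(\<lambda>x. indicator {-R..R} x *\<^sub>R \<bar>u (X i) x - u t0 x\<bar>) \<in> borel_measurable lborel" by measurable
      show "AE x in lborel. norm (indicator {-R..R} x *\<^sub>R \<bar>u (X i) x - u t0 x\<bar>) \<le> 2 * M * indicator {-R..R} x"
      proof (rule AE_I2)
        fix x
        have "\<bar>u (X i) x - u t0 x\<bar> \<le> 2 * M" using uM[OF X0, of i x] uM[OF t0, of x] by linarith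
        then show "norm (indicator {-R..R} x *\<^sub>R \<bar>u (X i) x - u t0 x\<bar>) \<le> 2 * M * indicator {-R..R} x"
          by (auto simp: indicator_def)
      qed
    qed simp
    then show "((\<lambda>t. LINT x:{-R..R}|lborel. \<bar>u t x - u t0 x\<bar>) \<circ> X) \<longlonglongrightarrow> 0"
      by (simp add: o_def set_lebesgue_integral_def)
  qed
  have kato: "0 \<le> (LINT p|lborel. \<bar>v p - ub p\<bar> * \<phi>t p + sgn (v p - ub p) * (f (v p) - f (ub p)) * \<phi>x p
            + sgn (v p - ub p) * (b p - g (ub p)) * \<phi> p)"
    if kr: "kruzkov S f v b" and S: "open S" "S \<subseteq> {0<..} \<times> UNIV"
      and v: "v \<in> borel_measurable borel" and b: "b \<in> borel_measurable borel"
      and vM: "\<And>p. \<bar>v p\<bar> \<le> M'" and bM: "\<And>p. \<bar>b p\<bar> \<le> M'"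
      and phi: "C1_test S \<phi> \<phi>t \<phi>x" and phi0: "\<And>p. 0 \<le> \<phi> p" for S v b \<phi> \<phi>t \<phi>x M'
  proof -
    let ?u = "\<lambda>p. if snd p < s (fst p) then wl p else wr p"
    have pos: "0 < fst p" if "p \<in> S" for p using S(2) that by auto
    have "0 \<le> (LINT p|lborel. \<bar>v p - ?u p\<bar> * \<phi>t p + sgn (v p - ?u p) * (f (v p) - f (?u p)) * \<phi>x p
            + sgn (v p - ?u p) * (b p - g (?u p)) * \<phi> p)"
    proof (rule kruzkov_shock[OF kr S(1) v b vM bM f f' cg wl wr _ s(2) _ \<delta> C, where s'=s'])
      show "continuous_on (fst ` S) s'" by (rule continuous_on_subset[OF s(3)]) (use S(2) in auto)
      show "p \<in> Sl" if "p \<in> S" "snd p \<le> s (fst p)" for p using Sl[of "fst p" "snd p"] that pos[of p] by auto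
      show "p \<in> Sr" if "p \<in> S" "s (fst p) - \<delta> \<le> snd p" for p using Sr[of "fst p" "snd p"] that pos[of p] by auto
      show "sgn (k - wr p) * (f k - f (wr p)) - sgn (k - wl p) * (f k - f (wl p))
        - s' (fst p) * (\<bar>k - wr p\<bar> - \<bar>k - wl p\<bar>) \<le> C * (s (fst p) - snd p)"
        if "p \<in> S" "s (fst p) - \<delta> \<le> snd p" "snd p \<le> s (fst p)" for p k
        using shock[of "fst p" "snd p" k] that pos[of p] by simp
    qed (use s(1) pde_l pde_r phi phi0 S(2) in auto)
    also have "\<dots> = (LINT p|lborel. \<bar>v p - ub p\<bar> * \<phi>t p + sgn (v p - ub p) * (f (v p) - f (ub p)) * \<phi>x p
            + sgn (v p - ub p) * (b p - g (ub p)) * \<phi> p)"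
    proof (rule Bochner_Integration.integral_cong[OF refl])
      fix p
      obtain K where K: "K \<subseteq> S" "p \<notin> K \<Longrightarrow> \<phi> p = 0" "p \<notin> K \<Longrightarrow> \<phi>t p = 0" "p \<notin> K \<Longrightarrow> \<phi>x p = 0"
        using C1_test_support[OF phi] by metis
      show "\<bar>v p - ?u p\<bar> * \<phi>t p + sgn (v p - ?u p) * (f (v p) - f (?u p)) * \<phi>x p
            + sgn (v p - ?u p) * (b p - g (?u p)) * \<phi> p = \<bar>v p - ub p\<bar> * \<phi>t p + sgn (v p - ub p) * (f (v p) - f (ub p)) * \<phi>x p
            + sgn (v p - ub p) * (b p - g (ub p)) * \<phi> p"
      proof (cases "p \<in> K")
        case True
        then have "?u p = ub p" using K(1) pos[of p] ub_u[of "fst p" "snd p"] u[of "fst p" "snd p"] by auto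
        then show ?thesis by simp
      qed (use K in simp)
    qed
    finally show ?thesis .
  qed
  have "entropy_solution f g u0 u"
    unfolding entropy_solution_def
  proof (intro conjI allI impI; (elim conjE)?)
    have "(\<lambda>p. indicator ({0..} \<times> UNIV) p *\<^sub>R (case p of (t, x) \<Rightarrow> u t x)) = ub"
    proof
      fix p :: "real \<times> real"
      show "indicator ({0..} \<times> UNIV) p *\<^sub>R (case p of (t, x) \<Rightarrow> u t x) = ub p"
        using ub_u[of "fst p" "snd p"] by (cases p) (auto simp: indicator_def ub_def A_def B_def)
    qed
    then show "set_borel_measurable lborel ({0..} \<times> UNIV) (\<lambda>(t, x). u t x)"
      unfolding set_borel_measurable_def by simp
  next
    fix T :: real assume "0 \<le> T"
    show "\<exists>M. \<forall>t\<in>{0..T}. AE x in lborel. \<bar>u t x\<bar> \<le> M"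
      by (intro exI[of _ M] ballI AE_I2 uM) auto
  next
    fix k \<phi> \<phi>t \<phi>x assume test: "test_halfplane \<phi> \<phi>t \<phi>x" and phi0: "\<forall>p. 0 \<le> \<phi> p"
    then have phi: "C1_test ({0<..} \<times> UNIV) \<phi> \<phi>t \<phi>x" by (simp add: test_halfplane_iff)
    \<comment> \<open>Here the constant \<open>k\<close> is the entropy solution, with zero source,
      and \<open>ub\<close> is the function compared with. Exchanging the two arguments turns this
      into the entropy inequality of \<open>u\<close> at level \<open>k\<close>.\<close>
    have "0 \<le> (LINT p|lborel. \<bar>k - ub p\<bar> * \<phi>t p + sgn (k - ub p) * (f k - f (ub p)) * \<phi>x p
            + sgn (k - ub p) * (0 - g (ub p)) * \<phi> p)"
      by (rule kato[OF kruzkov_const _ _ _ _ _ _ phi, of _ "\<bar>k\<bar>"]) (use phi0 in \<open>auto intro!: open_Times\<close>)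
    also have "\<dots> = (LINT (t, x):{0<..} \<times> UNIV|lborel.
               \<bar>u t x - k\<bar> * \<phi>t (t, x)
               + sgn (u t x - k) * (f (u t x) - f k) * \<phi>x (t, x)
               + sgn (u t x - k) * g (u t x) * \<phi> (t, x))"
      unfolding set_lebesgue_integral_def
    proof (rule Bochner_Integration.integral_cong[OF refl])
      fix p :: "real \<times> real"
      obtain K where K: "K \<subseteq> {0<..} \<times> UNIV" "p \<notin> K \<Longrightarrow> \<phi> p = 0" "p \<notin> K \<Longrightarrow> \<phi>t p = 0" "p \<notin> K \<Longrightarrow> \<phi>x p = 0"
        using C1_test_support[OF phi] by metis
      have sg: "sgn (k - a) = - sgn (a - k)" for a :: real by (simp add: sgn_if)
      show "\<bar>k - ub p\<bar> * \<phi>t p + sgn (k - ub p) * (f k - f (ub p)) * \<phi>x p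
            + sgn (k - ub p) * (0 - g (ub p)) * \<phi> p = indicator ({0<..} \<times> UNIV) p *\<^sub>R (case p of (t, x) \<Rightarrow>
               \<bar>u t x - k\<bar> * \<phi>t (t, x)
               + sgn (u t x - k) * (f (u t x) - f k) * \<phi>x (t, x)
               + sgn (u t x - k) * g (u t x) * \<phi> (t, x))"
      proof (cases "0 < fst p")
        case True
        then show ?thesis
          by (cases p) (simp add: ub_u sg abs_minus_commute algebra_simps)
      next
        case False
        then have "p \<notin> K" using K(1) by auto
        then show ?thesis using K False by (cases p) simp
      qed
    qed
    finally show "0 \<le> (LINT (t, x):{0<..} \<times> UNIV|lborel.
               \<bar>u t x - k\<bar> * \<phi>t (t, x)
               + sgn (u t x - k) * (f (u t x) - f k) * \<phi>x (t, x)
               + sgn (u t x - k) * g (u t x) * \<phi> (t, x))" .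
  qed (use cont init in auto)
  moreover have "AE x in lborel. v t1 x = u t1 x" if v: "entropy_solution f g u0 v" and t1: "0 \<le> t1" for v t1
  proof -
    define T where "T = t1 + 1"
    have T: "0 < T" "t1 < T" using t1 by (auto simp: T_def)
    obtain M1 V where V [measurable]: "V \<in> borel_measurable borel" and VM: "\<And>p. \<bar>V p\<bar> \<le> M1"
      and Vv: "\<And>t. t \<in> {0..T} \<Longrightarrow> AE x in lborel. V (t, x) = v t x"
      and kr: "kruzkov ({0<..<T} \<times> UNIV) f V (\<lambda>p. g (V p))"
      and vm: "\<And>t. 0 \<le> t \<Longrightarrow> v t \<in> borel_measurable borel"
      by (rule entropy_solution_representative[OF v T(1) cf cg]) (rule that)
    define M2 where "M2 = max M M1"
    have VM2: "\<bar>V p\<bar> \<le> M2" and ubM2: "\<bar>ub p\<bar> \<le> M2" for p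
      using VM[of p] ubM[of p] by (auto simp: M2_def)
    obtain L where L: "0 \<le> L" "\<And>a b. \<bar>a\<bar> \<le> M2 \<Longrightarrow> \<bar>b\<bar> \<le> M2 \<Longrightarrow> \<bar>f a - f b\<bar> \<le> L * \<bar>a - b\<bar>"
      using C1_Lipschitz_on_interval[OF f f'] by metis
    obtain N where N: "0 \<le> N" "\<And>a b. \<bar>a\<bar> \<le> M2 \<Longrightarrow> \<bar>b\<bar> \<le> M2 \<Longrightarrow> \<bar>g a - g b\<bar> \<le> N * \<bar>a - b\<bar>"
      using C1_Lipschitz_on_interval[OF g g'] by metis
    have "\<bar>g (V p)\<bar> \<le> N * M2 + \<bar>g 0\<bar>" for p
    proof -
      have "0 \<le> M2" using VM2[of p] by linarith
      then have "\<bar>g (V p) - g 0\<bar> \<le> N * \<bar>V p - 0\<bar>" using VM2[of p] by (intro N(2)) auto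
      also have "\<dots> \<le> N * M2" using VM2[of p] N(1) by (intro mult_left_mono) auto
      finally show ?thesis by linarith
    qed
    then obtain M3 where M3: "\<And>p. \<bar>V p\<bar> \<le> M3" "\<And>p. \<bar>g (V p)\<bar> \<le> M3"
      using VM2 by (metis max.coboundedI1 max.coboundedI2)
    have "AE x in lborel. V (t1, x) = ub (t1, x)"
    proof (rule L1_contraction[OF T(1) V ub _ _ VM2 ubM2 L N(2)])
      fix \<phi> \<phi>t \<phi>x assume "C1_test ({0<..<T} \<times> UNIV) \<phi> \<phi>t \<phi>x" "\<And>p::real\<times>real. 0 \<le> \<phi> p"
      then show "0 \<le> (LINT p|lborel. \<bar>V p - ub p\<bar> * \<phi>t p + sgn (V p - ub p) * (f (V p) - f (ub p)) * \<phi>x p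
            + sgn (V p - ub p) * (g (V p) - g (ub p)) * \<phi> p)"
        by (intro kato[OF kr _ _ V _ M3]) (auto intro!: open_Times)
    next
      fix t0 R assume t0: "0 \<le> t0" "t0 < T"
      have eqV: "(LINT x:{-R..R}|lborel. \<bar>V (t, x) - V (t0, x)\<bar>) = (LINT x:{-R..R}|lborel. \<bar>v t x - v t0 x\<bar>)" if "t \<in> {0..<T}" for t
        unfolding set_lebesgue_integral_def
      proof (rule integral_cong_AE)
        have Vm: "(\<lambda>x. V (t, x)) \<in> borel_measurable borel" for t
          by (rule measurable_compose[OF _ V]) (intro borel_measurable_continuous_onI continuous_intros)
        have vt: "v t \<in> borel_measurable borel" using vm[of t] that by simp
        note [measurable] = Vm[of t] Vm[of t0] vt vm[OF t0(1)]
        show "(\<lambda>x. indicator {-R..R} x *\<^sub>R \<bar>V (t, x) - V (t0, x)\<bar>) \<in> borel_measurable lborel" by measurable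
        show "(\<lambda>x. indicator {-R..R} x *\<^sub>R \<bar>v t x - v t0 x\<bar>) \<in> borel_measurable lborel" by measurable
        have "AE x in lborel. V (t, x) = v t x" "AE x in lborel. V (t0, x) = v t0 x" using Vv that t0 by auto
        then show "AE x in lborel. indicator {-R..R} x *\<^sub>R \<bar>V (t, x) - V (t0, x)\<bar> = indicator {-R..R} x *\<^sub>R \<bar>v t x - v t0 x\<bar>"
          by eventually_elim simp
      qed
      have "((\<lambda>t. LINT x:{-R..R}|lborel. \<bar>v t x - v t0 x\<bar>) \<longlongrightarrow> 0) (at t0 within {0..<T})"
      proof (rule tendsto_within_subset)
        show "((\<lambda>t. LINT x:{-R..R}|lborel. \<bar>v t x - v t0 x\<bar>) \<longlongrightarrow> 0) (at t0 within {0..})"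
          using v t0(1) unfolding entropy_solution_def by blast
      qed auto
      then show "((\<lambda>t. LINT x:{-R..R}|lborel. \<bar>V (t, x) - V (t0, x)\<bar>) \<longlongrightarrow> 0) (at t0 within {0..<T})"
        by (rule Lim_transform_within[OF _ zero_less_one]) (simp add: eqV)
      have "((\<lambda>t. LINT x:{-R..R}|lborel. \<bar>u t x - u t0 x\<bar>) \<longlongrightarrow> 0) (at t0 within {0..<T})"
        by (rule tendsto_within_subset[OF cont[OF t0(1)]]) auto
      then show "((\<lambda>t. LINT x:{-R..R}|lborel. \<bar>ub (t, x) - ub (t0, x)\<bar>) \<longlongrightarrow> 0) (at t0 within {0..<T})"
        by (rule Lim_transform_within[OF _ zero_less_one]) (simp add: ub_u t0)
    next
      have "AE x in lborel. v 0 x = u0 x" using v unfolding entropy_solution_def by blast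
      with init Vv[of 0] show "AE x in lborel. V (0, x) = ub (0, x)"
        using T by (auto simp: ub_u elim!: eventually_elim2)
    qed (use t1 T in auto)
    with Vv[of t1] t1 T show ?thesis by (auto simp: ub_u elim!: eventually_elim2)
  qed
  ultimately show ?thesis unfolding the_entropy_solution_def by blast
qed

subsection \<open>Branches along characteristics\<close>

text \<open>Near a simple zero \<open>u\<close> of \<open>g\<close> the change of unknown \<open>w = W y\<close> conjugates \<open>w' = g w\<close> to the linear
  equation \<open>y' = \<lambda> y\<close>, \<open>\<lambda> = g' u\<close>. The function \<open>A\<close> integrates \<open>c (w(t)) - c u\<close> along the flow, so that
  characteristics become explicit.\<close>

lemma linearization:
  fixes g g' g'' c c' :: "real \<Rightarrow> real" and u l :: real
  assumes g: "\<And>x. (g has_real_derivative g' x) (at x)" "\<And>x. (g' has_real_derivative g'' x) (at x)"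
    and c: "\<And>x. (c has_real_derivative c' x) (at x)"
    and u: "g u = 0" "g' u = l" "l \<noteq> 0"
  obtains r \<eta> W W' A A' B h h' where "0 < r" "0 < \<eta>"
    "\<And>y. \<bar>y\<bar> < r \<Longrightarrow> (W has_real_derivative W' y) (at y)" "continuous_on {-r<..<r} W'"
    "\<And>y. \<bar>y\<bar> < r \<Longrightarrow> (A has_real_derivative A' y) (at y)" "continuous_on {-r<..<r} A'"
    "\<And>y. \<bar>y\<bar> < r \<Longrightarrow> \<bar>W' y\<bar> \<le> 2" "\<And>y. \<bar>y\<bar> < r \<Longrightarrow> \<bar>A' y\<bar> \<le> B"
    "\<And>y. \<bar>y\<bar> < r \<Longrightarrow> l * y * W' y = g (W y)" "\<And>y. \<bar>y\<bar> < r \<Longrightarrow> l * y * A' y = c (W y) - c u"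
    "W 0 = u"
    "\<And>x. \<bar>x - u\<bar> < \<eta> \<Longrightarrow> (h has_real_derivative h' x) (at x)" "continuous_on {u-\<eta><..<u+\<eta>} h'"
    "\<And>x. \<bar>x - u\<bar> < \<eta> \<Longrightarrow> \<bar>h x\<bar> \<le> 2 * \<bar>x - u\<bar>" "\<And>x. \<bar>x - u\<bar> < \<eta> \<Longrightarrow> \<bar>h' x\<bar> \<le> 2"
    "\<And>x. \<bar>x - u\<bar> < \<eta> \<Longrightarrow> \<bar>h x\<bar> < r" "\<And>x. \<bar>x - u\<bar> < \<eta> \<Longrightarrow> W (h x) = x"
proof -
  have cg: "isCont g x" "isCont c x" for x using g(1) c DERIV_isCont by blast+
  have lim_g: "((\<lambda>v. g v / (v - u)) \<longlongrightarrow> l) (at u)"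
    using g(1)[of u] u by (simp add: has_field_derivative_iff)
  have "\<forall>\<^sub>F v in at u. g v / (v - u) \<noteq> 0"
    using tendsto_imp_eventually_ne[OF lim_g u(3)] .
  then obtain \<rho>' where "0 < \<rho>'" and \<rho>': "\<And>v. v \<noteq> u \<Longrightarrow> dist v u < \<rho>' \<Longrightarrow> g v / (v - u) \<noteq> 0"
    unfolding eventually_at by auto
  define \<rho> where "\<rho> = \<rho>' / 2"
  have \<rho>: "0 < \<rho>" and g0: "g v \<noteq> 0" if "v \<noteq> u" "\<bar>v - u\<bar> \<le> \<rho>" for v
    using \<open>0 < \<rho>'\<close> \<rho>'[of v] that by (auto simp: \<rho>_def dist_real_def)
  have \<rho>0: "0 < \<rho>" using \<open>0 < \<rho>'\<close> by (simp add: \<rho>_def)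
  have lim_g': "((\<lambda>v. (v - u) / g v) \<longlongrightarrow> 1 / l) (at u)"
    using tendsto_inverse[OF lim_g u(3)] by (simp add: inverse_eq_divide)
  \<comment> \<open>The continuous extension of \<open>l / g v - 1 / (v - u)\<close>. Multiplying
    \<open>v - u\<close> by the exponential of a primitive of \<open>k\<close> gives
    \<open>h\<close> with \<open>h' * g = l * h\<close>, that is, a coordinate in which the flow of
    \<open>g\<close> is linear. Its value at \<open>u\<close> is found by l'Hopital's rule.\<close>
  define k where "k v = (if v = u then - g'' u / 2 / l else (l * (v - u) - g v) / (g v * (v - u)))" for v
  \<comment> \<open>A primitive of \<open>b\<close> has derivative \<open>c v - c u\<close> along
    \<open>v' = g v\<close>; composed with \<open>W\<close> it becomes \<open>A\<close>.\<close>
  define b where "b v = (if v = u then c' u / l else (c v - c u) / g v)" for v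
  have "((\<lambda>v. (l * (v - u) - g v) / (v - u)\<^sup>2) \<longlongrightarrow> - g'' u / 2) (at u)"
  proof (rule lhopital)
    have "((\<lambda>v. l * (v - u) - g v) \<longlongrightarrow> l * (u - u) - g u) (at u)"
      using cg(1)[of u] unfolding isCont_def by (intro tendsto_intros)
    then show "((\<lambda>v. l * (v - u) - g v) \<longlongrightarrow> 0) (at u)" using u by simp
    have "((\<lambda>v. (v - u)\<^sup>2) \<longlongrightarrow> (u - u)\<^sup>2) (at u)" by (intro tendsto_intros)
    then show "((\<lambda>v. (v - u)\<^sup>2) \<longlongrightarrow> 0) (at u)" by simp
    show "\<forall>\<^sub>F v in at u. (v - u)\<^sup>2 \<noteq> 0" "\<forall>\<^sub>F v in at u. 2 * (v - u) \<noteq> 0"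
      by (auto simp: eventually_at_filter)
    show "\<forall>\<^sub>F v in at u. ((\<lambda>v. l * (v - u) - g v) has_real_derivative l - g' v) (at v)"
      by (intro always_eventually allI) (auto intro!: derivative_eq_intros g)
    show "\<forall>\<^sub>F v in at u. ((\<lambda>v. (v - u)\<^sup>2) has_real_derivative 2 * (v - u)) (at v)"
      by (intro always_eventually allI) (auto intro!: derivative_eq_intros)
    have "((\<lambda>v. (g' v - g' u) / (v - u)) \<longlongrightarrow> g'' u) (at u)" using g(2)[of u] by (simp add: has_field_derivative_iff)
    then have "((\<lambda>v. - ((g' v - g' u) / (v - u)) / 2) \<longlongrightarrow> - g'' u / 2) (at u)" by (intro tendsto_intros) auto
    moreover have "(\<lambda>v. - ((g' v - g' u) / (v - u)) / 2) = (\<lambda>v. (l - g' v) / (2 * (v - u)))"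
      using u by (auto simp: field_simps minus_divide_left)
    ultimately show "((\<lambda>v. (l - g' v) / (2 * (v - u))) \<longlongrightarrow> - g'' u / 2) (at u)" by simp
  qed
  from tendsto_mult[OF this lim_g']
  have "((\<lambda>v. (l * (v - u) - g v) / (v - u)\<^sup>2 * ((v - u) / g v)) \<longlongrightarrow> - g'' u / 2 * (1 / l)) (at u)" .
  moreover have "\<forall>\<^sub>F v in at u. (l * (v - u) - g v) / (v - u)\<^sup>2 * ((v - u) / g v) = k v"
    unfolding eventually_at_filter by (rule always_eventually) (auto simp: k_def power2_eq_square)
  ultimately have k_lim: "(k \<longlongrightarrow> - g'' u / 2 * (1 / l)) (at u)" by (rule Lim_transform_eventually)
  then have k_u: "isCont k u" by (simp add: isCont_def k_def)
  have "((\<lambda>v. (c v - c u) / (v - u)) \<longlongrightarrow> c' u) (at u)" using c[of u] by (simp add: has_field_derivative_iff)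
  from tendsto_mult[OF this lim_g']
  have "((\<lambda>v. (c v - c u) / (v - u) * ((v - u) / g v)) \<longlongrightarrow> c' u * (1 / l)) (at u)" .
  moreover have "\<forall>\<^sub>F v in at u. (c v - c u) / (v - u) * ((v - u) / g v) = b v"
    unfolding eventually_at_filter by (rule always_eventually) (auto simp: b_def)
  ultimately have "(b \<longlongrightarrow> c' u * (1 / l)) (at u)" by (rule Lim_transform_eventually)
  then have b_u: "isCont b u" by (simp add: isCont_def b_def)
  have kb_cont: "isCont k v \<and> isCont b v" if "\<bar>v - u\<bar> \<le> \<rho>" for v
  proof (cases "v = u")
    case False
    have "isCont (\<lambda>v. (l * (v - u) - g v) / (g v * (v - u))) v" "isCont (\<lambda>v. (c v - c u) / g v) v"
      using False g0[OF False that] by (auto intro!: continuous_intros cg)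
    note c12 = this
    have ev: "\<forall>\<^sub>F w in nhds v. w \<noteq> u" using False by (intro t1_space_nhds)
    have e1: "\<forall>\<^sub>F w in nhds v. (l * (w - u) - g w) / (g w * (w - u)) = k w"
      using ev by (rule eventually_mono) (simp add: k_def)
    have e2: "\<forall>\<^sub>F w in nhds v. (c w - c u) / g w = b w"
      using ev by (rule eventually_mono) (simp add: b_def)
    show ?thesis using c12 isCont_cong[OF e1] isCont_cong[OF e2] by simp
  qed (use k_u b_u in simp)
  let ?I = "{u-\<rho>..u+\<rho>}"
  have cont: "continuous_on ?I k" "continuous_on ?I b"
    using kb_cont by (auto intro!: continuous_at_imp_continuous_on simp: abs_le_iff)
  obtain K0 where K0: "\<And>x. x \<in> ?I \<Longrightarrow> (K0 has_vector_derivative k x) (at x within ?I)"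
    using antiderivative_continuous[OF cont(1)] by blast
  obtain A0 where A0: "\<And>x. x \<in> ?I \<Longrightarrow> (A0 has_vector_derivative b x) (at x within ?I)"
    using antiderivative_continuous[OF cont(2)] by blast
  have K0': "(K0 has_real_derivative k x) (at x)" and A0': "(A0 has_real_derivative b x) (at x)" if "\<bar>x - u\<bar> < \<rho>" for x
  proof -
    have "x \<in> {u-\<rho><..<u+\<rho>}" using that by auto
    then have x: "x \<in> interior ?I" by (simp add: interior_atLeastAtMost_real)
    then show "(K0 has_real_derivative k x) (at x)" "(A0 has_real_derivative b x) (at x)"
      using K0[of x] A0[of x] interior_subset at_within_interior[OF x]
      by (auto simp: has_real_derivative_iff_has_vector_derivative)
  qed
  obtain B0 where "0 < B0" and B0: "\<And>v. v \<in> ?I \<Longrightarrow> \<bar>b v\<bar> \<le> B0"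
    using compact_imp_bounded[OF compact_continuous_image[OF cont(2) compact_Icc]] unfolding bounded_pos by auto
  define h where "h v = (v - u) * exp (K0 v - K0 u)" for v
  define h' where "h' v = exp (K0 v - K0 u) * (1 + (v - u) * k v)" for v
  have hD: "(h has_real_derivative h' x) (at x)" if "\<bar>x - u\<bar> < \<rho>" for x
    unfolding h_def[abs_def] h'_def
    by (auto intro!: derivative_eq_intros K0' that simp: algebra_simps)
  have h'_cont: "isCont h' x" if "\<bar>x - u\<bar> < \<rho>" for x
    unfolding h'_def[abs_def] using kb_cont[of x] DERIV_isCont[OF K0'[OF that]] that
    by (auto intro!: continuous_intros)
  have hg: "h' v * g v = l * h v" if "\<bar>v - u\<bar> < \<rho>" for v
  proof (cases "v = u")
    case False
    then have "g v \<noteq> 0" using g0 that by simp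
    then have "(1 + (v - u) * k v) * g v = l * (v - u)" using False by (simp add: k_def field_simps)
    then show ?thesis by (simp add: h_def h'_def mult.commute mult.left_commute)
  qed (use u in \<open>simp add: h_def\<close>)
  \<comment> \<open>This normalization is the source of the bounds by 2 for \<open>h'\<close> and
    for the derivative of its inverse.\<close>
  have "h' u = 1" by (simp add: h'_def)
  then have "\<forall>\<^sub>F v in nhds u. 1/2 < h' v \<and> h' v < 2"
    using h'_cont[of u] \<rho>0 unfolding isCont_def tendsto_at_iff_tendsto_nhds
    by (intro eventually_conj order_tendstoD[of h' "h' u"]) auto
  then obtain \<rho>2 where "0 < \<rho>2" and \<rho>2: "\<And>v. dist v u < \<rho>2 \<Longrightarrow> 1/2 < h' v \<and> h' v < 2"
    unfolding eventually_nhds_metric by blast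
  define \<rho>1 where "\<rho>1 = min (\<rho> / 2) \<rho>2"
  have \<rho>1: "0 < \<rho>1" "\<rho>1 < \<rho>" using \<rho>0 \<open>0 < \<rho>2\<close> by (auto simp: \<rho>1_def)
  have h'b: "1/2 < h' v" "h' v < 2" if "\<bar>v - u\<bar> < \<rho>1" for v
    using \<rho>2[of v] that by (auto simp: \<rho>1_def dist_real_def)
  have mvt: "\<exists>d. 1/2 < d \<and> d < 2 \<and> h y - h x = d * (y - x)" if "\<bar>x - u\<bar> < \<rho>1" "\<bar>y - u\<bar> < \<rho>1" "x < y" for x y
  proof -
    have "\<exists>z. x < z \<and> z < y \<and> h y - h x = (y - x) * h' z"
      by (rule MVT2[OF that(3)]) (use hD that \<rho>1 in auto)
    then obtain z where "x < z" "z < y" "h y - h x = (y - x) * h' z" by blast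
    then show ?thesis using h'b[of z] that by (auto intro!: exI[of _ "h' z"] simp: mult.commute)
  qed
  have lips: "\<bar>y - x\<bar> / 2 \<le> \<bar>h y - h x\<bar> \<and> \<bar>h y - h x\<bar> \<le> 2 * \<bar>y - x\<bar>" if xy: "\<bar>x - u\<bar> < \<rho>1" "\<bar>y - u\<bar> < \<rho>1" for x y
  proof -
    have *: "\<bar>b - a\<bar> / 2 \<le> \<bar>h b - h a\<bar> \<and> \<bar>h b - h a\<bar> \<le> 2 * \<bar>b - a\<bar>" if ab: "\<bar>a - u\<bar> < \<rho>1" "\<bar>b - u\<bar> < \<rho>1" "a < b" for a b
    proof -
      obtain d where d: "1/2 < d" "d < 2" "h b - h a = d * (b - a)" using mvt[OF ab] by blast
      then show ?thesis using mult_right_mono[of "1/2" d "b - a"] mult_right_mono[of d 2 "b - a"] \<open>a < b\<close> by (simp add: abs_mult)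
    qed
    consider "x < y" | "x = y" | "y < x" by linarith
    then show ?thesis
      by cases (use *[OF xy] *[OF xy(2,1)] in \<open>auto simp: abs_minus_commute\<close>)
  qed
  have hu: "h u = 0" by (simp add: h_def)
  \<comment> \<open>With slope at least 1/2, \<open>h\<close> maps the interval of radius
    \<open>\<rho>1 / 2\<close> around \<open>u\<close> onto a set containing \<open>{-r..r}\<close>.
    Half of \<open>\<rho>1\<close> is kept in reserve so that the inverse stays strictly inside the
    region of the slope bounds.\<close>
  define r where "r = \<rho>1 / 4"
  have r: "0 < r" using \<rho>1 by (simp add: r_def)
  have ex: "\<exists>v. \<bar>v - u\<bar> \<le> \<rho>1 / 2 \<and> h v = y" if "\<bar>y\<bar> \<le> r" for y
  proof -
    have m: "\<bar>(u - \<rho>1 / 2) - u\<bar> < \<rho>1" "\<bar>(u + \<rho>1 / 2) - u\<bar> < \<rho>1" "\<bar>u - u\<bar> < \<rho>1" using \<rho>1 by auto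
    obtain d where d: "1/2 < d" "d < 2" "h (u + \<rho>1 / 2) - h u = d * (\<rho>1 / 2)" using mvt[OF m(3,2)] \<rho>1 by auto
    obtain e where e: "1/2 < e" "e < 2" "h u - h (u - \<rho>1 / 2) = e * (\<rho>1 / 2)" using mvt[OF m(1,3)] \<rho>1 by auto
    have "r \<le> h (u + \<rho>1 / 2)" "h (u - \<rho>1 / 2) \<le> - r"
    proof -
      have "1 / 2 * (\<rho>1 / 2) \<le> d * (\<rho>1 / 2)" "1 / 2 * (\<rho>1 / 2) \<le> e * (\<rho>1 / 2)"
        using d e \<rho>1 by (intro mult_right_mono; simp)+
      then show "r \<le> h (u + \<rho>1 / 2)" "h (u - \<rho>1 / 2) \<le> - r" using d(3) e(3) hu unfolding r_def by linarith+
    qed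
    then have "\<exists>v\<ge>u - \<rho>1 / 2. v \<le> u + \<rho>1 / 2 \<and> h v = y"
      using that \<rho>1 by (intro IVT) (auto intro!: DERIV_isCont[OF hD] simp: abs_le_iff abs_less_iff)
    then obtain v where "u - \<rho>1 / 2 \<le> v" "v \<le> u + \<rho>1 / 2" "h v = y" by blast
    then have "\<bar>v - u\<bar> \<le> \<rho>1 / 2" by linarith
    with \<open>h v = y\<close> show ?thesis by blast
  qed
  define W where "W y = (SOME v. \<bar>v - u\<bar> \<le> \<rho>1 / 2 \<and> h v = y)" for y
  have W: "\<bar>W y - u\<bar> \<le> \<rho>1 / 2" "h (W y) = y" if "\<bar>y\<bar> \<le> r" for y
    using someI_ex[OF ex[OF that]] by (auto simp: W_def)
  have W1: "\<bar>W y - u\<bar> < \<rho>1" "\<bar>W y - u\<bar> < \<rho>" if "\<bar>y\<bar> \<le> r" for y using W(1)[OF that] \<rho>1 by linarith+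
  have W_inv: "W (h x) = x" if "\<bar>x - u\<bar> < \<rho>1" "\<bar>h x\<bar> \<le> r" for x
    using lips[OF W1(1)[OF that(2)] that(1)] W(2)[OF that(2)] by simp
  have W_lip: "\<bar>W y - W z\<bar> \<le> 2 * \<bar>y - z\<bar>" if "\<bar>y\<bar> \<le> r" "\<bar>z\<bar> \<le> r" for y z
    using lips[OF W1(1)[OF that(2)] W1(1)[OF that(1)]] W(2) that by simp
  have W_cont: "isCont W y" if "\<bar>y\<bar> < r" for y
  proof -
    have "((\<lambda>z. W z - W y) \<longlongrightarrow> 0) (at y)"
    proof (rule Lim_null_comparison)
      have "\<forall>\<^sub>F z in at y. dist z y < r - \<bar>y\<bar>" unfolding eventually_at by (rule exI[of _ "r - \<bar>y\<bar>"]) (use that in auto)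
      then show "\<forall>\<^sub>F z in at y. norm (W z - W y) \<le> 2 * \<bar>z - y\<bar>"
        by eventually_elim (use that in \<open>auto simp: dist_real_def intro!: W_lip\<close>)
      have "((\<lambda>z. 2 * \<bar>z - y\<bar>) \<longlongrightarrow> 2 * \<bar>y - y\<bar>) (at y)" by (intro tendsto_intros)
      then show "((\<lambda>z. 2 * \<bar>z - y\<bar>) \<longlongrightarrow> 0) (at y)" by simp
    qed
    then show ?thesis by (simp add: isCont_def LIM_zero_iff)
  qed
  define W' where "W' y = inverse (h' (W y))" for y
  have WD: "(W has_real_derivative W' y) (at y)" if "\<bar>y\<bar> < r" for y
  proof -
    have y: "\<bar>y\<bar> \<le> r" "- r < y" "y < r" using that by (auto simp: abs_less_iff)
    show ?thesis
      unfolding W'_def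
    proof (rule DERIV_inverse_function[where f=h and a="-r" and b=r])
      show "(h has_real_derivative h' (W y)) (at (W y))" by (rule hD[OF W1(2)[OF y(1)]])
      show "h' (W y) \<noteq> 0" using h'b(1)[OF W1(1)[OF y(1)]] by simp
      show "h (W z) = z" if "- r < z" "z < r" for z using W(2)[of z] that by simp
    qed (use y W_cont[OF that] in auto)
  qed
  have W'b: "\<bar>W' y\<bar> \<le> 2" if "\<bar>y\<bar> < r" for y
  proof -
    have "1 / 2 < h' (W y)" by (rule h'b(1)[OF W1(1)]) (use that in simp)
    then show ?thesis using le_imp_inverse_le[of "1/2" "h' (W y)"] by (simp add: W'_def)
  qed
  have W'_cont: "isCont W' y" if "\<bar>y\<bar> < r" for y
  proof -
    have y: "\<bar>y\<bar> \<le> r" using that by simp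
    have "isCont (\<lambda>y. h' (W y)) y" by (rule isCont_o2[OF W_cont[OF that] h'_cont[OF W1(2)[OF y]]])
    moreover have "h' (W y) \<noteq> 0" using h'b(1)[OF W1(1)[OF y]] by simp
    ultimately show ?thesis unfolding W'_def[abs_def] by (intro continuous_intros)
  qed
  define A where "A y = A0 (W y)" for y
  define A' where "A' y = b (W y) * W' y" for y
  have bW: "isCont b (W y)" if "\<bar>y\<bar> < r" for y using kb_cont[of "W y"] W1(2)[of y] that by simp
  have AD: "(A has_real_derivative A' y) (at y)" if "\<bar>y\<bar> < r" for y
    unfolding A_def[abs_def] A'_def
    by (rule DERIV_chain2[OF A0' WD]) (use W1(2)[of y] that in auto)
  have A'_cont: "isCont A' y" if "\<bar>y\<bar> < r" for y
    unfolding A'_def[abs_def] using isCont_o2[OF W_cont[OF that] bW[OF that]] W'_cont[OF that]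
    by (intro continuous_intros) auto
  have A'b: "\<bar>A' y\<bar> \<le> B0 * 2" if "\<bar>y\<bar> < r" for y
    unfolding A'_def abs_mult using B0[of "W y"] W1(2)[of y] W'b[OF that] that \<open>0 < B0\<close>
    by (intro mult_mono) (auto simp: abs_less_iff)
  have Wg: "l * y * W' y = g (W y)" if "\<bar>y\<bar> < r" for y
    using hg[of "W y"] W1(2)[of y] W(2)[of y] h'b(1)[OF W1(1)[of y]] that by (simp add: W'_def field_simps)
  have Ac: "l * y * A' y = c (W y) - c u" if "\<bar>y\<bar> < r" for y
  proof -
    have "l * y * A' y = b (W y) * (l * y * W' y)" by (simp add: A'_def)
    also have "\<dots> = b (W y) * g (W y)" by (simp add: Wg that)
    also have "\<dots> = c (W y) - c u" using g0[of "W y"] W1(2)[of y] that u by (auto simp: b_def)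
    finally show ?thesis .
  qed
  have W0: "W 0 = u" using W_inv[of u] hu r \<rho>1 by simp
  \<comment> \<open>As \<open>h\<close> has slope at most 2, this radius is mapped into the domain
    of \<open>W\<close>.\<close>
  define \<eta> where "\<eta> = r / 2"
  have \<eta>: "\<bar>x - u\<bar> < \<rho>1" "\<bar>x - u\<bar> < \<rho>" "\<bar>h x\<bar> \<le> 2 * \<bar>x - u\<bar>" "\<bar>h x\<bar> < r" if "\<bar>x - u\<bar> < \<eta>" for x
  proof -
    show 1: "\<bar>x - u\<bar> < \<rho>1" using that \<rho>1 by (simp add: \<eta>_def r_def)
    then show "\<bar>x - u\<bar> < \<rho>" using \<rho>1 by simp
    show 2: "\<bar>h x\<bar> \<le> 2 * \<bar>x - u\<bar>" using lips[of u x] 1 \<rho>1 hu by simp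
    then show "\<bar>h x\<bar> < r" using that by (simp add: \<eta>_def)
  qed
  show thesis
  proof (rule that[of r \<eta> W W' A A' "B0 * 2" h h'])
    show "continuous_on {-r<..<r} W'" "continuous_on {-r<..<r} A'"
      using W'_cont A'_cont by (auto intro!: continuous_at_imp_continuous_on simp: abs_less_iff)
    show "continuous_on {u-\<eta><..<u+\<eta>} h'"
      using h'_cont \<eta>(2) by (intro continuous_at_imp_continuous_on) (auto simp: abs_less_iff)
    show "\<bar>h' x\<bar> \<le> 2" if "\<bar>x - u\<bar> < \<eta>" for x using h'b[OF \<eta>(1)[OF that]] by auto
    show "W (h x) = x" if "\<bar>x - u\<bar> < \<eta>" for x using W_inv \<eta>[OF that] by simp
  qed (use r \<eta> WD AD W'b A'b Wg Ac W0 hD in \<open>auto simp: \<eta>_def\<close>)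
qed

lemma C1_on_compose_open:
  assumes F: "C1_on S F Ft Fx" and I: "F ` S \<subseteq> I"
    and c: "\<And>y. y \<in> I \<Longrightarrow> (c has_real_derivative c' y) (at y)" "continuous_on I c'"
  shows "C1_on S (\<lambda>p. c (F p)) (\<lambda>p. c' (F p) * Ft p) (\<lambda>p. c' (F p) * Fx p)"
  using C1_on_compose[OF F, of c c'] I c continuous_on_subset by blast

lemma C1_on_add:
  assumes "C1_on S F Ft Fx" "C1_on S G Gt Gx"
  shows "C1_on S (\<lambda>p. F p + G p) (\<lambda>p. Ft p + Gt p) (\<lambda>p. Fx p + Gx p)"
proof -
  have "((\<lambda>p. F p + G p) has_derivative (\<lambda>h. (Ft p + Gt p) * fst h + (Fx p + Gx p) * snd h)) (at p)" if "p \<in> S" for p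
    by (rule has_derivative_eq_rhs[OF has_derivative_add[OF C1_on_D[OF assms(1) that] C1_on_D[OF assms(2) that]]])
       (auto simp: algebra_simps)
  then show ?thesis
    unfolding C1_on_def using C1_on_continuous[OF assms(1)] C1_on_continuous[OF assms(2)]
    by (auto intro!: continuous_intros)
qed

lemma C1_on_cmult:
  assumes "C1_on S F Ft Fx"
  shows "C1_on S (\<lambda>p. k * F p) (\<lambda>p. k * Ft p) (\<lambda>p. k * Fx p)"
proof -
  have "C1_on S (\<lambda>_. k) (\<lambda>_. 0) (\<lambda>_. 0)" by (auto simp: C1_on_def)
  from C1_on_mult[OF this assms] show ?thesis by simp
qed

text \<open>Characteristics of the conjugated equation start at \<open>z - a t\<close> and sit at
  \<open>\<sigma> t + z + A (Y (t, z)) - A (y\<^sub>0 (z - a t))\<close> at time \<open>t\<close>, carrying the value \<open>W (Y (t, z))\<close>, where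
  \<open>Y (t, z) = exp (l t) y\<^sub>0 (z - a t)\<close>. Times slightly negative are included so that \<open>t = 0\<close> is interior.\<close>

lemma characteristics_solution:
  fixes W W' A A' y0 y0' c g :: "real \<Rightarrow> real" and l a \<sigma> r B :: real and S S' :: "real set"
  assumes W: "\<And>y. \<bar>y\<bar> < r \<Longrightarrow> (W has_real_derivative W' y) (at y)" "continuous_on {-r<..<r} W'"
    and A: "\<And>y. \<bar>y\<bar> < r \<Longrightarrow> (A has_real_derivative A' y) (at y)" "continuous_on {-r<..<r} A'"
    and W'2: "\<And>y. \<bar>y\<bar> < r \<Longrightarrow> \<bar>W' y\<bar> \<le> 2" and A'B: "\<And>y. \<bar>y\<bar> < r \<Longrightarrow> \<bar>A' y\<bar> \<le> B"
    and Wg: "\<And>y. \<bar>y\<bar> < r \<Longrightarrow> l * y * W' y = g (W y)"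
    and Ac: "\<And>y. \<bar>y\<bar> < r \<Longrightarrow> l * y * A' y = c (W y) - (a + \<sigma>)"
    and cc: "continuous_on UNIV c" and cg: "continuous_on UNIV g"
    and y0: "\<And>x. (y0 has_real_derivative y0' x) (at x)" "continuous_on UNIV y0'"
    and S: "open S" "convex S" and S': "open S'" "\<And>\<xi>. \<xi> \<in> S' \<Longrightarrow> \<xi> - 1/2 \<in> S \<and> \<xi> + 1/2 \<in> S"
    and b: "\<And>t z. - 1 < t \<Longrightarrow> z \<in> S \<Longrightarrow> \<bar>exp (l * t) * y0 (z - a * t)\<bar> < r"
      "\<And>t z. - 1 < t \<Longrightarrow> z \<in> S \<Longrightarrow> \<bar>y0 (z - a * t)\<bar> < r"
      "\<And>t z. - 1 < t \<Longrightarrow> z \<in> S \<Longrightarrow> B * \<bar>exp (l * t) * y0 (z - a * t)\<bar> \<le> 1/4"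
      "\<And>t z. - 1 < t \<Longrightarrow> z \<in> S \<Longrightarrow> B * \<bar>y0 (z - a * t)\<bar> \<le> 1/4"
      "\<And>t z. - 1 < t \<Longrightarrow> z \<in> S \<Longrightarrow> B * \<bar>exp (l * t) * y0' (z - a * t)\<bar> \<le> 1/4"
      "\<And>t z. - 1 < t \<Longrightarrow> z \<in> S \<Longrightarrow> B * \<bar>y0' (z - a * t)\<bar> \<le> 1/4"
  obtains w wt wx where "C1_on {p. - 1 < fst p \<and> snd p - \<sigma> * fst p \<in> S'} w wt wx"
    "\<And>p. wt p + c (w p) * wx p = g (w p)"
    "\<And>t \<xi>. - 1 < t \<Longrightarrow> \<xi> \<in> S' \<Longrightarrow> \<exists>z\<in>S. \<bar>z - \<xi>\<bar> \<le> 1/2 \<and> w (t, \<sigma> * t + \<xi>) = W (exp (l * t) * y0 (z - a * t))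
        \<and> \<bar>wx (t, \<sigma> * t + \<xi>)\<bar> \<le> 4 * \<bar>exp (l * t) * y0' (z - a * t)\<bar>"
    "\<And>\<xi>. \<xi> \<in> S' \<Longrightarrow> w (0, \<xi>) = W (y0 \<xi>)"
proof -
  define D where "D = {p :: real \<times> real. - 1 < fst p \<and> snd p \<in> S}"
  define D' where "D' = {p :: real \<times> real. - 1 < fst p \<and> snd p - \<sigma> * fst p \<in> S'}"
  define Q Y where "Q p = y0 (snd p - a * fst p)" and "Y p = exp (l * fst p) * y0 (snd p - a * fst p)" for p :: "real \<times> real"
  define Qx Yx where "Qx p = y0' (snd p - a * fst p)" and "Yx p = exp (l * fst p) * y0' (snd p - a * fst p)" for p :: "real \<times> real"
  define Yt where "Yt p = l * Y p - a * Yx p" for p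
  have D: "open D"
  proof -
    have "D = {-1<..} \<times> S" by (auto simp: D_def)
    then show ?thesis using S(1) by (simp add: open_Times)
  qed
  have bD: "\<bar>Y p\<bar> < r" "\<bar>Q p\<bar> < r" "B * \<bar>Y p\<bar> \<le> 1/4" "B * \<bar>Q p\<bar> \<le> 1/4" "B * \<bar>Yx p\<bar> \<le> 1/4" "B * \<bar>Qx p\<bar> \<le> 1/4"
    if "p \<in> D" for p
    unfolding Q_def Y_def Qx_def Yx_def using b[of "fst p" "snd p"] that by (simp_all add: D_def)
  have lin: "C1_on UNIV (\<lambda>p. snd p - a * fst p) (\<lambda>_. - a) (\<lambda>_. 1)"
    unfolding C1_on_def by (auto intro!: derivative_eq_intros)
  have QC: "C1_on UNIV Q (\<lambda>p. - a * Qx p) Qx"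
    using C1_on_compose_open[OF lin subset_UNIV y0] by (simp add: Q_def[abs_def] Qx_def[abs_def] mult.commute)
  have "C1_on UNIV (\<lambda>p. exp (l * fst p)) (\<lambda>p. l * exp (l * fst p)) (\<lambda>p. 0)"
    unfolding C1_on_def by (auto intro!: derivative_eq_intros continuous_intros)
  from C1_on_mult[OF this QC] have YC: "C1_on UNIV Y Yt Yx"
    by (simp add: Y_def[abs_def] Yx_def[abs_def] Yt_def[abs_def] Q_def[abs_def] Qx_def[abs_def] algebra_simps)
  have inr: "y \<in> {-r<..<r}" if "\<bar>y\<bar> < r" for y using that unfolding greaterThanLessThan_iff by linarith
  have sub: "Y ` D \<subseteq> {-r<..<r}" "Q ` D \<subseteq> {-r<..<r}"
    by (intro image_subsetI inr bD; assumption)+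
  have AYC: "C1_on D (\<lambda>p. A (Y p)) (\<lambda>p. A' (Y p) * Yt p) (\<lambda>p. A' (Y p) * Yx p)"
    by (rule C1_on_compose_open[OF C1_on_subset[OF YC subset_UNIV] sub(1) A(1) A(2)]) (auto simp: abs_less_iff)
  have AQC: "C1_on D (\<lambda>p. A (Q p)) (\<lambda>p. A' (Q p) * (- a * Qx p)) (\<lambda>p. A' (Q p) * Qx p)"
    by (rule C1_on_compose_open[OF C1_on_subset[OF QC subset_UNIV] sub(2) A(1) A(2)]) (auto simp: abs_less_iff)
  define P where "P p = \<sigma> * fst p + snd p + A (Y p) - A (Q p)" for p
  define Px where "Px p = 1 + A' (Y p) * Yx p - A' (Q p) * Qx p" for p
  define Pt where "Pt p = \<sigma> + A' (Y p) * Yt p + a * (A' (Q p) * Qx p)" for p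
  have PC: "C1_on D P Pt Px"
  proof -
    have "C1_on UNIV (\<lambda>p. \<sigma> * fst p + snd p) (\<lambda>_. \<sigma>) (\<lambda>_. 1)"
      unfolding C1_on_def by (auto intro!: derivative_eq_intros)
    from C1_on_add[OF C1_on_add[OF C1_on_subset[OF this subset_UNIV] AYC] C1_on_cmult[OF AQC, of "-1"]]
    show ?thesis
      by (simp add: P_def[abs_def] Pt_def[abs_def] Px_def[abs_def] algebra_simps)
  qed
  \<comment> \<open>The two corrections to the slope 1 are at most 1/4 each. Hence characteristics
    never cross, at any time, and the position can be inverted for the label
    \<open>z\<close>.\<close>
  have Px: "1/2 \<le> Px p" if "p \<in> D" for p
  proof -
    have "\<bar>A' (Y p) * Yx p\<bar> \<le> B * \<bar>Yx p\<bar>" "\<bar>A' (Q p) * Qx p\<bar> \<le> B * \<bar>Qx p\<bar>"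
      unfolding abs_mult using A'B bD(1,2)[OF that] by (intro mult_right_mono; simp)+
    then show ?thesis using bD(5,6)[OF that] unfolding Px_def by linarith
  qed
  have Psec: "((\<lambda>z. P (t, z)) has_real_derivative Px (t, z)) (at z)" if "(t, z) \<in> D" for t z
  proof -
    have "((\<lambda>z. (t, z)) has_derivative (\<lambda>h. (0, h))) (at z)" by (auto intro!: derivative_eq_intros)
    from has_derivative_compose[OF this C1_on_D[OF PC that]] show ?thesis
      by (simp add: has_field_derivative_def)
  qed
  have seg: "z \<in> S" if "x \<in> S" "y \<in> S" "x \<le> z" "z \<le> y" for x y z
    by (rule mem_is_interval_1_I[OF _ that]) (use S(2) in \<open>simp add: is_interval_convex_1\<close>)
  have mono: "P (t, z1) < P (t, z2)" if t: "- 1 < t" and z: "z1 \<in> S" "z2 \<in> S" "z1 < z2" for t z1 z2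
  proof -
    have "\<exists>\<xi>. z1 < \<xi> \<and> \<xi> < z2 \<and> P (t, z2) - P (t, z1) = (z2 - z1) * Px (t, \<xi>)"
      by (rule MVT2[OF z(3)]) (use seg[OF z(1,2)] t in \<open>auto intro!: Psec simp: D_def\<close>)
    then obtain \<xi> where \<xi>: "z1 < \<xi>" "\<xi> < z2" "P (t, z2) - P (t, z1) = (z2 - z1) * Px (t, \<xi>)" by blast
    then have "(t, \<xi>) \<in> D" using seg[OF z(1,2), of \<xi>] t by (auto simp: D_def)
    then have "0 < Px (t, \<xi>)" using Px by fastforce
    then have "0 < (z2 - z1) * Px (t, \<xi>)" using z(3) by simp
    then show ?thesis using \<xi>(3) by linarith
  qed
  have inj: "z1 = z2" if "- 1 < t" "z1 \<in> S" "z2 \<in> S" "P (t, z1) = P (t, z2)" for t z1 z2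
    using mono[OF that(1-3)] mono[OF that(1,3,2)] that(4) by fastforce
  \<comment> \<open>The displacement from straight motion is a difference of two values of
    \<open>A\<close>, not an integral over time, and is therefore bounded uniformly in
    \<open>t\<close>.\<close>
  have Pclose: "\<bar>P p - (\<sigma> * fst p + snd p)\<bar> \<le> 1/2" if "p \<in> D" for p
  proof -
    have *: "\<bar>A y - A 0\<bar> \<le> B * \<bar>y\<bar>" if "\<bar>y\<bar> < r" for y
    proof -
      have in_r: "\<bar>z\<bar> < r" if "z \<in> {-\<bar>y\<bar>..\<bar>y\<bar>}" for z using that \<open>\<bar>y\<bar> < r\<close> by auto
      have "norm (A y - A 0) \<le> B * norm (y - 0)"
        by (rule field_differentiable_bound[of "{-\<bar>y\<bar>..\<bar>y\<bar>}"])
           (use A(1)[OF in_r] A'B[OF in_r] in \<open>auto intro: has_field_derivative_at_within\<close>)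
      then show ?thesis by simp
    qed
    show ?thesis using *[OF bD(1)[OF that]] *[OF bD(2)[OF that]] bD(3,4)[OF that] unfolding P_def by linarith
  qed
  \<comment> \<open>The margin 1/2 between \<open>S'\<close> and \<open>S\<close> is exactly the
    possible displacement, so the intermediate value theorem finds a label inside
    \<open>S\<close>.\<close>
  have ex: "\<exists>z. z \<in> S \<and> \<bar>z - (snd p - \<sigma> * fst p)\<bar> \<le> 1/2 \<and> P (fst p, z) = snd p" if "p \<in> D'" for p
  proof -
    define \<xi> where "\<xi> = snd p - \<sigma> * fst p"
    have \<xi>: "\<xi> - 1/2 \<in> S" "\<xi> + 1/2 \<in> S" and t: "- 1 < fst p" using that S'(2)[of \<xi>] by (auto simp: D'_def \<xi>_def)
    have inD: "(fst p, z) \<in> D" if "\<xi> - 1/2 \<le> z" "z \<le> \<xi> + 1/2" for z using seg[OF \<xi>, of z] t that by (simp add: D_def)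
    have "P (fst p, \<xi> - 1/2) \<le> snd p" "snd p \<le> P (fst p, \<xi> + 1/2)"
      using Pclose[OF inD, of "\<xi> - 1/2"] Pclose[OF inD, of "\<xi> + 1/2"] 
      unfolding abs_le_iff by (simp_all add: \<xi>_def algebra_simps)
    then have "\<exists>z\<ge>\<xi> - 1/2. z \<le> \<xi> + 1/2 \<and> P (fst p, z) = snd p"
      by (intro IVT) (auto intro!: DERIV_isCont[OF Psec] inD)
    then obtain z where "\<xi> - 1/2 \<le> z" "z \<le> \<xi> + 1/2" "P (fst p, z) = snd p" by blast
    moreover from this have "z \<in> S" using inD[of z] by (simp add: D_def)
    moreover from calculation have "\<bar>z - \<xi>\<bar> \<le> 1/2" by linarith
    ultimately show ?thesis unfolding \<xi>_def by blast
  qed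
  define Z where "Z p = (SOME z. z \<in> S \<and> \<bar>z - (snd p - \<sigma> * fst p)\<bar> \<le> 1/2 \<and> P (fst p, z) = snd p)" for p
  have Z: "Z p \<in> S" "\<bar>Z p - (snd p - \<sigma> * fst p)\<bar> \<le> 1/2" "P (fst p, Z p) = snd p" if "p \<in> D'" for p
    using someI_ex[OF ex[OF that]] by (auto simp: Z_def)
  text \<open>Off \<open>D'\<close> the inverse is completed so as to be a left inverse on all of \<open>D\<close>.\<close>
  define G where "G p = (if p \<in> D' then (fst p, Z p) else (SOME q. q \<in> D \<and> (fst q, P q) = p))" for p
  define F where "F p = (fst p, P p)" for p
  have GD: "G p \<in> D" and FG: "F (G p) = p" if "p \<in> D'" for p
    using Z[OF that] that by (auto simp: G_def F_def D_def D'_def)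
  have GF: "G (F p) = p" if "p \<in> D" for p
  proof (cases "F p \<in> D'")
    case True
    have "P (fst p, Z (F p)) = P (fst p, snd p)" using Z(3)[OF True] by (simp add: F_def)
    then have "Z (F p) = snd p" using inj[OF _ Z(1)[OF True], of "fst p" "snd p"] that by (simp add: D_def)
    then show ?thesis using True by (simp add: G_def F_def)
  next
    case False
    then have "G (F p) = (SOME q. q \<in> D \<and> (fst q, P q) = F p)" by (simp add: G_def)
    moreover have "q = p" if q: "q \<in> D \<and> (fst q, P q) = F p" for q
    proof -
      have "fst q = fst p" "P (fst p, snd q) = P (fst p, snd p)" using q by (auto simp: F_def) (metis prod.collapse)
      then show ?thesis using inj[of "fst p" "snd q" "snd p"] q \<open>p \<in> D\<close> by (auto simp: D_def prod_eq_iff)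
    qed
    ultimately show ?thesis using \<open>p \<in> D\<close> by (metis (mono_tags, lifting) F_def someI_ex)
  qed
  have FD: "(F has_derivative (\<lambda>h. (fst h, Pt p * fst h + Px p * snd h))) (at p)" if "p \<in> D" for p
    unfolding F_def[abs_def] by (intro has_derivative_Pair C1_on_D[OF PC that] derivative_intros)
  have Fcont: "continuous_on D F"
    unfolding F_def[abs_def] using C1_on_continuous(1)[OF PC] by (intro continuous_intros)
  have GDer: "(G has_derivative (\<lambda>h. (fst h, (snd h - Pt (G p) * fst h) / Px (G p)))) (at p)" if "p \<in> D'" for p
  proof (rule has_derivative_inverse_strong_x[OF D GD[OF that] Fcont GF FD[OF GD[OF that]] _ FG[OF that]])
    have "Px (G p) \<noteq> 0" using Px[OF GD[OF that]] by auto
    then show "(\<lambda>h. (fst h, Pt (G p) * fst h + Px (G p) * snd h)) \<circ> (\<lambda>h. (fst h, (snd h - Pt (G p) * fst h) / Px (G p))) = id"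
      by (auto simp: fun_eq_iff)
  qed
  have Gcont: "continuous_on D' G"
    using GDer by (intro continuous_at_imp_continuous_on ballI has_derivative_continuous)
  define w where "w p = W (Y (G p))" for p
  define wx where "wx p = W' (Y (G p)) * Yx (G p) / Px (G p)" for p
  \<comment> \<open>Defined through the equation, so that the equation holds at every point, also
    off \<open>D'\<close>. That this is the time derivative on \<open>D'\<close> is then the content
    of \<open>wD\<close>.\<close>
  define wt where "wt p = g (w p) - c (w p) * wx p" for p
  have wD: "(w has_derivative (\<lambda>h. wt p * fst h + wx p * snd h)) (at p)" if "p \<in> D'" for p
  proof -
    let ?q = "G p"
    have Yr: "\<bar>Y ?q\<bar> < r" using bD(1)[OF GD[OF that]] .
    have Y0: "Px ?q \<noteq> 0" using Px[OF GD[OF that]] by auto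
    have "((\<lambda>p. Y (G p)) has_derivative (\<lambda>h. Yt ?q * fst h + Yx ?q * ((snd h - Pt ?q * fst h) / Px ?q))) (at p)"
      using has_derivative_compose[OF GDer[OF that] C1_on_D[OF YC UNIV_I]] by simp
    from has_derivative_compose[OF this W(1)[OF Yr, unfolded has_field_derivative_def]]
    have "(w has_derivative (\<lambda>h. W' (Y ?q) * (Yt ?q * fst h + Yx ?q * ((snd h - Pt ?q * fst h) / Px ?q)))) (at p)"
      by (simp add: w_def[abs_def])
    moreover have "W' (Y ?q) * (Yt ?q * x + Yx ?q * ((y - Pt ?q * x) / Px ?q)) = wt p * x + wx p * y" for x y
    proof -
      \<comment> \<open>A fixed starting point means \<open>z\<close> moving with speed
        \<open>a\<close>. Along this motion \<open>P\<close> has speed \<open>Pt + a * Px\<close>,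
        and the identity for \<open>A'\<close> shows that this is \<open>c (w p)\<close>, the
        characteristic speed.\<close>
      have "Pt ?q = \<sigma> + l * Y ?q * A' (Y ?q) - a * (Px ?q - 1)"
        by (simp add: Pt_def Px_def Yt_def algebra_simps)
      then have Pt: "Pt ?q = c (w p) - a * Px ?q" using Ac[OF Yr] by (simp add: w_def algebra_simps)
      have Wg': "W' (Y ?q) * (l * Y ?q) = g (w p)" using Wg[OF Yr] by (simp add: w_def mult_ac)
      have "Yt ?q * x + Yx ?q * ((y - Pt ?q * x) / Px ?q) = l * Y ?q * x + (Yx ?q / Px ?q) * (y - c (w p) * x)"
        unfolding Pt Yt_def using Y0 by (simp add: field_simps)
      then have "W' (Y ?q) * (Yt ?q * x + Yx ?q * ((y - Pt ?q * x) / Px ?q))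
          = (W' (Y ?q) * (l * Y ?q)) * x + wx p * (y - c (w p) * x)"
        by (simp add: wx_def distrib_left mult.assoc)
      then show ?thesis unfolding Wg' wt_def by (simp add: algebra_simps)
    qed
    ultimately show ?thesis by simp
  qed
  have YG: "continuous_on D' (\<lambda>p. Y (G p))" "continuous_on D' (\<lambda>p. Yx (G p))" "continuous_on D' (\<lambda>p. Px (G p))"
  proof -
    show "continuous_on D' (\<lambda>p. Y (G p))" "continuous_on D' (\<lambda>p. Yx (G p))"
      by (rule continuous_on_compose2[OF C1_on_continuous(1)[OF YC] Gcont] continuous_on_compose2[OF C1_on_continuous(3)[OF YC] Gcont]; simp)+
    show "continuous_on D' (\<lambda>p. Px (G p))"
      by (rule continuous_on_compose2[OF C1_on_continuous(3)[OF PC] Gcont]) (use GD in auto)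
  qed
  have wx_cont: "continuous_on D' wx"
  proof -
    have "continuous_on D' (\<lambda>p. W' (Y (G p)))"
      by (rule continuous_on_compose2[OF W(2) YG(1)]) (intro image_subsetI inr bD(1) GD, assumption)
    moreover have "Px (G p) \<noteq> 0" if "p \<in> D'" for p using Px[OF GD[OF that]] by auto
    ultimately show ?thesis unfolding wx_def[abs_def] using YG by (intro continuous_intros) auto
  qed
  have w_cont: "continuous_on D' w"
    using wD by (intro continuous_at_imp_continuous_on ballI has_derivative_continuous)
  have wt_cont: "continuous_on D' wt"
    unfolding wt_def[abs_def]
    by (intro continuous_intros wx_cont continuous_on_compose2[OF cg w_cont] continuous_on_compose2[OF cc w_cont]) auto
  show thesis
  proof (rule that[of w wt wx])
    show "C1_on {p. - 1 < fst p \<and> snd p - \<sigma> * fst p \<in> S'} w wt wx"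
      unfolding C1_on_def D'_def[symmetric] using wD wt_cont wx_cont by blast
    show "wt p + c (w p) * wx p = g (w p)" for p by (simp add: wt_def)
    show "\<exists>z\<in>S. \<bar>z - \<xi>\<bar> \<le> 1/2 \<and> w (t, \<sigma> * t + \<xi>) = W (exp (l * t) * y0 (z - a * t))
        \<and> \<bar>wx (t, \<sigma> * t + \<xi>)\<bar> \<le> 4 * \<bar>exp (l * t) * y0' (z - a * t)\<bar>" if t: "- 1 < t" and \<xi>: "\<xi> \<in> S'" for t \<xi>
    proof -
      let ?p = "(t, \<sigma> * t + \<xi>)"
      have p: "?p \<in> D'" using t \<xi> by (simp add: D'_def)
      then have Gp: "G ?p = (t, Z ?p)" by (simp add: G_def)
      \<comment> \<open>The factor 4 of the conclusion: 2 from \<open>W'\<close> and another 2 from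
        the lower bound 1/2 of \<open>Px\<close>.\<close>
      have "\<bar>W' (Y (G ?p))\<bar> * \<bar>Yx (G ?p)\<bar> / Px (G ?p) \<le> 2 * \<bar>Yx (G ?p)\<bar> / (1/2)"
        using Px[OF GD[OF p]] W'2[OF bD(1)[OF GD[OF p]]] by (intro frac_le mult_right_mono) auto
      then have "\<bar>wx ?p\<bar> \<le> 4 * \<bar>Yx (G ?p)\<bar>"
        using Px[OF GD[OF p]] by (simp add: wx_def abs_mult)
      then show ?thesis using Z[OF p]
        by (intro bexI[of _ "Z ?p"]) (auto simp: Gp w_def Y_def Yx_def)
    qed
    show "w (0, \<xi>) = W (y0 \<xi>)" if "\<xi> \<in> S'" for \<xi>
    proof -
      have p: "(0, \<xi>) \<in> D'" using that by (simp add: D'_def)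
      have "P (0, Z (0, \<xi>)) = \<xi>" using Z(3)[OF p] by simp
      moreover have "P (0, z) = z" for z by (simp add: P_def Y_def Q_def)
      ultimately have "Z (0, \<xi>) = \<xi>" by simp
      then show ?thesis using p by (simp add: w_def G_def Y_def)
    qed
  qed
qed

subsection \<open>Shock front\<close>

text \<open>With \<open>c = f'\<close> this is the divided difference of \<open>f\<close>, in a form
  that stays continuous when the two states coincide.\<close>

definition mean_slope :: "(real \<Rightarrow> real) \<Rightarrow> real \<Rightarrow> real \<Rightarrow> real" where
  "mean_slope c x y = integral {0..1} (\<lambda>\<theta>. c (x + \<theta> * (y - x)))"

lemma mean_slope_eq:
  assumes f: "\<And>x. (f has_real_derivative f' x) (at x)"
  shows "f y - f x = (y - x) * mean_slope f' x y"
proof -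
  have "((\<lambda>\<theta>. (y - x) * f' (x + \<theta> * (y - x))) has_integral f (x + 1 * (y - x)) - f (x + 0 * (y - x))) {0..1}"
  proof (rule fundamental_theorem_of_calculus)
    fix \<theta> :: real
    have "((\<lambda>\<theta>. x + \<theta> * (y - x)) has_real_derivative y - x) (at \<theta>)" by (auto intro!: derivative_eq_intros)
    from DERIV_chain2[OF f this]
    show "((\<lambda>\<theta>. f (x + \<theta> * (y - x))) has_vector_derivative (y - x) * f' (x + \<theta> * (y - x))) (at \<theta> within {0..1})"
      by (simp add: has_real_derivative_iff_has_vector_derivative[symmetric] has_field_derivative_at_within mult.commute)
  qed simp
  from integral_unique[OF this] show ?thesis by (simp add: mean_slope_def)
qed

lemma mean_slope_same: "mean_slope c x x = c x"
  by (simp add: mean_slope_def)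

lemma mean_slope_quotient:
  assumes "\<And>x. (f has_real_derivative f' x) (at x)" "x \<noteq> y"
  shows "mean_slope f' x y = (f y - f x) / (y - x)"
  using mean_slope_eq[of f f' y x] assms by simp

lemma mean_slope_continuous:
  assumes "continuous_on UNIV c"
  shows "continuous_on UNIV (\<lambda>p. mean_slope c (fst p) (snd p))"
proof -
  have "continuous_on (UNIV \<times> cbox 0 1) (\<lambda>(p::real\<times>real, \<theta>). c (fst p + \<theta> * (snd p - fst p)))"
    unfolding case_prod_beta' by (rule continuous_on_compose2[OF assms]) (auto intro!: continuous_intros)
  from integral_continuous_on_param[OF this] show ?thesis by (simp add: mean_slope_def)
qed

text \<open>The tube lemma: positivity on a compact fibre persists over a neighbourhood of its base
  point, uniformly in the parameter.\<close>

lemma positive_near_compact_fibre: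
  fixes H :: "(real \<times> real) \<times> real \<Rightarrow> real"
  assumes H: "continuous_on UNIV H" and K: "compact K" and pos: "\<And>\<theta>. \<theta> \<in> K \<Longrightarrow> 0 < H ((a, b), \<theta>)"
  obtains e where "0 < e" "\<And>l r \<theta>. \<bar>l - a\<bar> < e \<Longrightarrow> \<bar>r - b\<bar> < e \<Longrightarrow> \<theta> \<in> K \<Longrightarrow> 0 < H ((l, r), \<theta>)"
proof -
  have "compact ({(a, b)} \<times> K)" using K by (intro compact_Times) auto
  moreover have "open {q. 0 < H q}" by (intro open_Collect_less continuous_on_const H)
  moreover have "{(a, b)} \<times> K \<subseteq> {q. 0 < H q}" using pos by auto
  ultimately obtain e where e: "0 < e" "(\<Union>q\<in>{(a, b)} \<times> K. ball q e) \<subseteq> {q. 0 < H q}"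
    by (rule compact_subset_open_imp_ball_epsilon_subset)
  show thesis
  proof (rule that[of "e / 2"])
    show "0 < e / 2" using e by simp
    fix l r \<theta> assume *: "\<bar>l - a\<bar> < e / 2" "\<bar>r - b\<bar> < e / 2" "\<theta> \<in> K"
    have "dist (a, b) (l, r) \<le> \<bar>a - l\<bar> + \<bar>b - r\<bar>"
      unfolding dist_Pair_Pair dist_real_def using sqrt_sum_squares_le_sum_abs[of "\<bar>a - l\<bar>" "\<bar>b - r\<bar>"] by simp
    moreover have "dist ((a, b), \<theta>) ((l, r), \<theta>) = dist (a, b) (l, r)" by (simp add: dist_Pair_Pair)
    ultimately have "dist ((a, b), \<theta>) ((l, r), \<theta>) < e" using *(1,2) by (simp add: abs_minus_commute)
    then show "0 < H ((l, r), \<theta>)" using e(2) *(3) by (auto simp: subset_eq)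
  qed
qed

text \<open>Admissibility of a shock between nearby states. Cutting the segment between the two states in
  halves, each half uses the strict inequality at the end where it does not degenerate.\<close>

lemma oleinik_stable:
  fixes f f' :: "real \<Rightarrow> real"
  assumes f: "\<And>x. (f has_real_derivative f' x) (at x)" and f': "continuous_on UNIV f'"
    and ne: "um \<noteq> up" and rh: "f um - f up = \<sigma> * (um - up)" and lax: "\<sigma> < f' um" "f' up < \<sigma>"
    and ol: "\<And>v. min um up < v \<Longrightarrow> v < max um up \<Longrightarrow> (f v - f up) / (v - up) < (f v - f um) / (v - um)"
  obtains \<eta> where "0 < \<eta>" "\<And>l r. \<bar>l - um\<bar> < \<eta> \<Longrightarrow> \<bar>r - up\<bar> < \<eta> \<Longrightarrow> l \<noteq> r"
    "\<And>l r k. \<bar>l - um\<bar> < \<eta> \<Longrightarrow> \<bar>r - up\<bar> < \<eta> \<Longrightarrow>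
      sgn (k - r) * (f k - f r) - sgn (k - l) * (f k - f l) - (f l - f r) / (l - r) * (\<bar>k - r\<bar> - \<bar>k - l\<bar>) \<le> 0"
proof -
  define D where "D = mean_slope f'"
  have D: "f y - f x = (y - x) * D x y" for x y unfolding D_def by (rule mean_slope_eq[OF f])
  have Dc: "continuous_on UNIV (\<lambda>p. D (fst p) (snd p))" unfolding D_def by (rule mean_slope_continuous[OF f'])
  have "(up - um) * D um up = (up - um) * \<sigma>" using D[of up um] rh by (simp add: algebra_simps)
  then have D\<sigma>: "D um up = \<sigma>" using ne by simp
  \<comment> \<open>By the Rankine-Hugoniot relation \<open>\<sigma>\<close> is the convex
    combination of the slopes \<open>X\<close> and \<open>Y\<close> with weights
    \<open>\<theta>\<close> and \<open>1 - \<theta>\<close>. The strict inequality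
    \<open>Y < X\<close> therefore places \<open>\<sigma>\<close> strictly between them.\<close>
  have XY: "\<sigma> < D um v \<and> D v up < \<sigma>" if v: "v = um + \<theta> * (up - um)" "0 < \<theta>" "\<theta> < 1" for v \<theta>
  proof -
    define X Y where "X = D um v" and "Y = D v up"
    have vd: "v - um = \<theta> * (up - um)" "up - v = (1 - \<theta>) * (up - um)" using v(1) by (auto simp: algebra_simps)
    moreover have "\<theta> * (up - um) \<noteq> 0" "(1 - \<theta>) * (up - um) \<noteq> 0" using v ne by auto
    ultimately have "v \<noteq> um" "v \<noteq> up" by auto
    then have XY: "X = (f v - f um) / (v - um)" "Y = (f v - f up) / (v - up)"
      using D[of v um] D[of up v] by (auto simp: X_def Y_def field_simps)
    have "min um up < v \<and> v < max um up"
    proof (cases "um < up")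
      case True
      then have "0 < \<theta> * (up - um)" "0 < (1 - \<theta>) * (up - um)" using v by auto
      then show ?thesis using True v(1) by (auto simp: algebra_simps)
    next
      case False
      then have "0 < \<theta> * (um - up)" "0 < (1 - \<theta>) * (um - up)" using v ne by auto
      then show ?thesis using False v(1) by (auto simp: algebra_simps)
    qed
    then have "Y < X" using ol XY by simp
    have "X * (v - um) + Y * (up - v) = \<sigma> * (up - um)"
      using D[of v um] D[of up v] rh by (simp add: X_def Y_def algebra_simps)
    then have "(X * \<theta> + Y * (1 - \<theta>)) * (up - um) = \<sigma> * (up - um)" unfolding vd by (simp add: algebra_simps)
    then have "X * \<theta> + Y * (1 - \<theta>) = \<sigma>" using ne by simp
    then have "X - \<sigma> = (1 - \<theta>) * (X - Y)" "\<sigma> - Y = \<theta> * (X - Y)" by (auto simp: algebra_simps)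
    moreover have "0 < (1 - \<theta>) * (X - Y)" "0 < \<theta> * (X - Y)" using v \<open>Y < X\<close> by auto
    ultimately show ?thesis by (simp add: X_def Y_def)
  qed
  \<comment> \<open>At \<open>\<theta> = 0\<close> the function \<open>H1\<close> is the
    characteristic speed of the left state minus the chord slope, positive by the Lax condition, but
    at \<open>\<theta> = 1\<close> it vanishes. For \<open>H2\<close> the two ends are
    exchanged.\<close>
  define H1 where "H1 q = D (fst (fst q)) (fst (fst q) + snd q * (snd (fst q) - fst (fst q))) - D (fst (fst q)) (snd (fst q))" for q :: "(real \<times> real) \<times> real"
  define H2 where "H2 q = D (fst (fst q)) (snd (fst q)) - D (fst (fst q) + snd q * (snd (fst q) - fst (fst q))) (snd (fst q))" for q :: "(real \<times> real) \<times> real"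
  have Dcomp: "continuous_on UNIV (\<lambda>q. D (F q) (G q))" if "continuous_on UNIV F" "continuous_on UNIV G" for F G :: "(real \<times> real) \<times> real \<Rightarrow> real"
    using continuous_on_compose2[OF Dc continuous_on_Pair[OF that]] by simp
  have Hc: "continuous_on UNIV H1" "continuous_on UNIV H2"
    unfolding H1_def[abs_def] H2_def[abs_def] by (intro continuous_on_diff Dcomp continuous_intros)+
  obtain e1 where e1: "0 < e1" "\<And>l r \<theta>. \<bar>l - um\<bar> < e1 \<Longrightarrow> \<bar>r - up\<bar> < e1 \<Longrightarrow> \<theta> \<in> {0..1/2} \<Longrightarrow> 0 < H1 ((l, r), \<theta>)"
  proof (rule positive_near_compact_fibre[OF Hc(1) compact_Icc])
    fix \<theta> :: real assume "\<theta> \<in> {0..1/2}"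
    then show "0 < H1 ((um, up), \<theta>)"
      using XY[OF refl, of \<theta>] D\<sigma> lax by (cases "\<theta> = 0") (auto simp: H1_def D_def mean_slope_same)
  qed (rule that)
  obtain e2 where e2: "0 < e2" "\<And>l r \<theta>. \<bar>l - um\<bar> < e2 \<Longrightarrow> \<bar>r - up\<bar> < e2 \<Longrightarrow> \<theta> \<in> {1/2..1} \<Longrightarrow> 0 < H2 ((l, r), \<theta>)"
  proof (rule positive_near_compact_fibre[OF Hc(2) compact_Icc])
    fix \<theta> :: real assume "\<theta> \<in> {1/2..1}"
    then show "0 < H2 ((um, up), \<theta>)"
      using XY[OF refl, of \<theta>] D\<sigma> lax by (cases "\<theta> = 1") (auto simp: H2_def D_def mean_slope_same)
  qed (rule that)
  \<comment> \<open>Half the jump is included to keep the two perturbed states apart.\<close>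
  define \<eta> where "\<eta> = min (min e1 e2) (\<bar>um - up\<bar> / 2)"
  show thesis
  proof (rule that[of \<eta>])
    show "0 < \<eta>" using e1 e2 ne by (simp add: \<eta>_def)
    show lr: "l \<noteq> r" if "\<bar>l - um\<bar> < \<eta>" "\<bar>r - up\<bar> < \<eta>" for l r
    proof
      assume "l = r"
      then have "\<bar>um - up\<bar> \<le> \<bar>l - um\<bar> + \<bar>r - up\<bar>" by linarith
      then show False using that by (simp add: \<eta>_def)
    qed
    fix l r k assume *: "\<bar>l - um\<bar> < \<eta>" "\<bar>r - up\<bar> < \<eta>"
    define s where "s = (f l - f r) / (l - r)"
    \<comment> \<open>The height of the graph of \<open>f\<close> over the chord. The expression to
      be bounded equals \<open>(sgn (k - r) - sgn (k - l)) * F\<close>, which vanishes for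
      \<open>k\<close> outside the segment; inside, Oleinik's condition gives the sign of
      \<open>F\<close>.\<close>
    define F where "F = f k - f l - s * (k - l)"
    have ne': "l \<noteq> r" using lr[OF *] .
    have s: "s = D l r" using D[of r l] ne' by (simp add: s_def field_simps)
    have s': "f l - f r = s * (l - r)" using ne' by (simp add: s_def)
    have F': "F = f k - f r - s * (k - r)" using s' by (simp add: F_def algebra_simps)
    have eq: "sgn (k - r) * (f k - f r) - sgn (k - l) * (f k - f l) - s * (\<bar>k - r\<bar> - \<bar>k - l\<bar>) = (sgn (k - r) - sgn (k - l)) * F"
    proof -
      have "sgn (k - r) * F = sgn (k - r) * (f k - f r) - s * \<bar>k - r\<bar>"
        unfolding F' by (simp add: algebra_simps sgn_if abs_if)
      moreover have "sgn (k - l) * F = sgn (k - l) * (f k - f l) - s * \<bar>k - l\<bar>"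
        unfolding F_def by (simp add: algebra_simps sgn_if abs_if)
      ultimately show ?thesis by (simp add: algebra_simps)
    qed
    have sign: "(l - r) * F \<le> 0" if \<theta>: "k = l + \<theta> * (r - l)" "0 \<le> \<theta>" "\<theta> \<le> 1" for \<theta>
    proof (cases "\<theta> \<le> 1/2")
      case True
      have "0 < H1 ((l, r), \<theta>)" by (rule e1(2)) (use * \<theta> True in \<open>auto simp: \<eta>_def\<close>)
      then have "0 < D l k - s" using \<theta> by (simp add: H1_def s)
      moreover have "(l - r) * F = - (\<theta> * (l - r)\<^sup>2 * (D l k - s))"
      proof -
        have F: "F = (k - l) * (D l k - s)" using D[of k l] by (simp add: F_def algebra_simps)
        have k: "k - l = \<theta> * (r - l)" using \<theta>(1) by (simp add: algebra_simps)
        show ?thesis unfolding F k by (simp add: power2_eq_square algebra_simps)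
      qed
      ultimately show ?thesis using \<theta> by simp
    next
      case False
      have "0 < H2 ((l, r), \<theta>)" by (rule e2(2)) (use * \<theta> False in \<open>auto simp: \<eta>_def\<close>)
      then have "0 < s - D k r" using \<theta> by (simp add: H2_def s)
      moreover have "(l - r) * F = - ((1 - \<theta>) * (l - r)\<^sup>2 * (s - D k r))"
      proof -
        have F: "F = (r - k) * (s - D k r)" using D[of r k] by (simp add: F' algebra_simps)
        have k: "r - k = (1 - \<theta>) * (r - l)" using \<theta>(1) by (simp add: algebra_simps)
        show ?thesis unfolding F k by (simp add: power2_eq_square algebra_simps)
      qed
      ultimately show ?thesis using \<theta> by simp
    qed
    have between: "(l - r) * F \<le> 0" if "min l r \<le> k" "k \<le> max l r"
    proof (rule sign)
      let ?\<theta> = "(k - l) / (r - l)"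
      show "k = l + ?\<theta> * (r - l)" using ne' by simp
      show "0 \<le> ?\<theta>" "?\<theta> \<le> 1" using that ne' by (auto simp: divide_simps min_def max_def split: if_splits)
    qed
    have "(sgn (k - r) - sgn (k - l)) * F \<le> 0"
    proof (cases "min l r \<le> k \<and> k \<le> max l r")
      case True
      show ?thesis
      proof (cases "r < l")
        case rl: True
        then have "F \<le> 0" using between True by (simp add: mult_le_0_iff)
        moreover have "0 \<le> sgn (k - r) - sgn (k - l)" using True rl by (auto simp: sgn_if)
        ultimately show ?thesis by (rule mult_nonneg_nonpos[rotated])
      next
        case False
        then have "0 \<le> F" using between True ne' by (simp add: mult_le_0_iff)
        moreover have "sgn (k - r) - sgn (k - l) \<le> 0" using True False by (auto simp: sgn_if)
        ultimately show ?thesis by (simp add: mult_nonpos_nonneg)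
      qed
    next
      case False
      then have "sgn (k - r) = sgn (k - l)" by (auto simp: sgn_if min_def max_def split: if_splits)
      then show ?thesis by simp
    qed
    then show "sgn (k - r) * (f k - f r) - sgn (k - l) * (f k - f l) - (f l - f r) / (l - r) * (\<bar>k - r\<bar> - \<bar>k - l\<bar>) \<le> 0"
      unfolding eq[unfolded s_def] by (simp add: s_def[symmetric])
  qed
qed

text \<open>The Lipschitz constant \<open>\<beta>\<close> is integrable over all times with mass at
  most 1/2. Hence the Picard map contracts bounded continuous functions on the whole time axis at
  once, without continuation from interval to interval, and the same mass bounds the solution by
  1/2.\<close>

lemma integrable_lipschitz_ode:
  fixes V :: "real \<Rightarrow> real \<Rightarrow> real" and \<beta> :: "real \<Rightarrow> real"
  assumes V: "continuous_on ({0..} \<times> UNIV) (\<lambda>p. V (fst p) (snd p))"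
    and Vb: "\<And>t p. 0 \<le> t \<Longrightarrow> \<bar>V t p\<bar> \<le> \<beta> t"
    and Vl: "\<And>t p q. 0 \<le> t \<Longrightarrow> \<bar>V t p - V t q\<bar> \<le> \<beta> t * \<bar>p - q\<bar>"
    and \<beta>: "set_integrable lborel {0..} \<beta>" "(LINT t:{0..}|lborel. \<beta> t) \<le> 1/2"
  obtains \<psi> where "continuous_on UNIV \<psi>" "\<psi> 0 = 0"
    "\<And>t. 0 \<le> t \<Longrightarrow> (\<psi> has_real_derivative V t (\<psi> t)) (at t within {0..})"
    "\<And>a b. 0 \<le> a \<Longrightarrow> a \<le> b \<Longrightarrow> \<bar>\<psi> b - \<psi> a\<bar> \<le> (LINT t:{a..}|lborel. \<beta> t)"
    "\<And>t. 0 \<le> t \<Longrightarrow> \<bar>\<psi> t\<bar> \<le> 1/2"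
proof -
  have \<beta>0: "0 \<le> \<beta> t" if "0 \<le> t" for t using Vb[OF that, of 0] by linarith
  have \<beta>i: "\<beta> integrable_on {a..b}" "\<beta> integrable_on {a..}" if "0 \<le> a" for a b
    using that by (auto intro!: set_borel_integral_eq_integral(1) set_integrable_subset[OF \<beta>(1)])
  have \<beta>tail: "integral {a..b} \<beta> \<le> integral {a..} \<beta>" if "0 \<le> a" for a b
    by (rule integral_subset_le) (use \<beta>i[OF that] \<beta>0 that in auto)
  have \<beta>L: "(LINT t:{a..}|lborel. \<beta> t) = integral {a..} \<beta>" if "0 \<le> a" for a
    by (rule set_borel_integral_eq_integral(2)[OF set_integrable_subset[OF \<beta>(1)]]) (use that in auto)
  have \<beta>half: "integral {0..b} \<beta> \<le> 1/2" for b
    using \<beta>tail[of 0 b] \<beta>(2) \<beta>L[of 0] by simp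
  have cV: "continuous_on {0..b} (\<lambda>s. V s (\<xi> s))" if "continuous_on UNIV \<xi>" for \<xi> b
  proof -
    have "continuous_on {0..b} (\<lambda>s. (s, \<xi> s))"
      using continuous_on_subset[OF that subset_UNIV] by (intro continuous_intros)
    moreover have "(\<lambda>s. (s, \<xi> s)) ` {0..b} \<subseteq> {0..} \<times> UNIV" by auto
    ultimately show ?thesis using continuous_on_compose2[OF V] by fastforce
  qed
  \<comment> \<open>The image is continued by 0 to negative times, so that the fixed point can be
    sought in the complete type of bounded continuous functions on the line.\<close>
  define T where "T \<xi> t = integral {0..max 0 t} (\<lambda>s. V s (\<xi> s))" for \<xi> t
  have inc: "\<bar>T \<xi> b - T \<xi> a\<bar> \<le> integral {a..b} \<beta>" if \<xi>: "continuous_on UNIV \<xi>" and ab: "0 \<le> a" "a \<le> b" for \<xi> a b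
  proof -
    have "T \<xi> b - T \<xi> a = integral {a..b} (\<lambda>s. V s (\<xi> s))"
      using Henstock_Kurzweil_Integration.integral_combine[OF ab integrable_continuous_real[OF cV[OF \<xi>]]] ab
      by (simp add: T_def)
    moreover have "norm (integral {a..b} (\<lambda>s. V s (\<xi> s))) \<le> integral {a..b} \<beta>"
    proof (rule integral_norm_bound_integral)
      show "(\<lambda>s. V s (\<xi> s)) integrable_on {a..b}"
        by (rule integrable_continuous_real, rule continuous_on_subset[OF cV[OF \<xi>, of b]]) (use ab in auto)
    qed (use \<beta>i ab Vb in auto)
    ultimately show ?thesis by simp
  qed
  have T0: "T \<xi> t = 0" if "t \<le> 0" for \<xi> t using that by (simp add: T_def max_def)
  have Tder0: "((\<lambda>t. integral {0..t} (\<lambda>s. V s (\<xi> s))) has_real_derivative V t (\<xi> t)) (at t within {0..})"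
    if \<xi>: "continuous_on UNIV \<xi>" and t: "0 \<le> t" for \<xi> t
  proof -
    have "((\<lambda>t. integral {0..t} (\<lambda>s. V s (\<xi> s))) has_real_derivative V t (\<xi> t)) (at t within {0..t+1})"
      by (rule integral_has_real_derivative[OF cV[OF \<xi>]]) (use t in auto)
    moreover have "at t within {0..t+1} = at t within {0..}"
      by (rule at_within_nhd[of _ "{..<t+1}"]) auto
    ultimately show ?thesis by simp
  qed
  have Tcont: "continuous_on UNIV (T \<xi>)" if \<xi>: "continuous_on UNIV \<xi>" for \<xi>
  proof -
    have "continuous_on {0..} (\<lambda>t. integral {0..t} (\<lambda>s. V s (\<xi> s)))"
      by (rule DERIV_continuous_on, rule Tder0[OF \<xi>]) simp
    then show ?thesis unfolding T_def by (rule continuous_on_compose2) (auto intro!: continuous_intros)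
  qed
  have Tbound: "\<bar>T \<xi> t\<bar> \<le> 1/2" if \<xi>: "continuous_on UNIV \<xi>" for \<xi> t
    using inc[OF \<xi>, of 0 "max 0 t"] T0[of 0 \<xi>] \<beta>half[of "max 0 t"] by (simp add: T_def)
  have Tmem: "T \<xi> \<in> bcontfun" if \<xi>: "continuous_on UNIV \<xi>" for \<xi>
    by (rule bcontfun_normI[where b="1/2"]) (use Tcont[OF \<xi>] Tbound[OF \<xi>] in auto)
  define \<Phi> where "\<Phi> \<xi> = Bcontfun (T (apply_bcontfun \<xi>))" for \<xi>
  have \<Phi>: "apply_bcontfun (\<Phi> \<xi>) = T (apply_bcontfun \<xi>)" for \<xi>
    unfolding \<Phi>_def by (rule Bcontfun_inverse[OF Tmem]) simp
  have "\<exists>!\<xi>. \<Phi> \<xi> = \<xi>"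
  proof (rule banach_fix_type[of "1/2"])
    show "\<forall>\<xi> \<zeta>. dist (\<Phi> \<xi>) (\<Phi> \<zeta>) \<le> 1/2 * dist \<xi> \<zeta>"
    proof (intro allI dist_bound)
      fix \<xi> \<zeta> :: "real \<Rightarrow>\<^sub>C real" and t :: real
      let ?b = "max 0 t"
      have ci: "(\<lambda>s. V s (apply_bcontfun \<eta> s)) integrable_on {0..?b}" for \<eta>
        by (rule integrable_continuous_real[OF cV]) simp
      have "T (apply_bcontfun \<xi>) t - T (apply_bcontfun \<zeta>) t
          = integral {0..?b} (\<lambda>s. V s (apply_bcontfun \<xi> s) - V s (apply_bcontfun \<zeta> s))"
        unfolding T_def by (rule Henstock_Kurzweil_Integration.integral_diff[symmetric, OF ci ci])
      moreover have "norm (integral {0..?b} (\<lambda>s. V s (apply_bcontfun \<xi> s) - V s (apply_bcontfun \<zeta> s)))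
          \<le> integral {0..?b} (\<lambda>s. \<beta> s * dist \<xi> \<zeta>)"
      proof (rule integral_norm_bound_integral)
        show "(\<lambda>s. V s (apply_bcontfun \<xi> s) - V s (apply_bcontfun \<zeta> s)) integrable_on {0..?b}"
          by (rule Henstock_Kurzweil_Integration.integrable_diff[OF ci ci])
        show "(\<lambda>s. \<beta> s * dist \<xi> \<zeta>) integrable_on {0..?b}"
          by (rule integrable_on_mult_left[OF \<beta>i(1)]) simp
        fix s assume "s \<in> {0..?b}"
        then have s: "0 \<le> s" by simp
        have "\<bar>apply_bcontfun \<xi> s - apply_bcontfun \<zeta> s\<bar> \<le> dist \<xi> \<zeta>"
          using dist_bounded[of \<xi> s \<zeta>] by (simp add: dist_real_def)
        from mult_left_mono[OF this \<beta>0[OF s]] Vl[OF s, of "apply_bcontfun \<xi> s" "apply_bcontfun \<zeta> s"]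
        show "norm (V s (apply_bcontfun \<xi> s) - V s (apply_bcontfun \<zeta> s)) \<le> \<beta> s * dist \<xi> \<zeta>" by simp
      qed
      moreover have "integral {0..?b} (\<lambda>s. \<beta> s * dist \<xi> \<zeta>) = integral {0..?b} \<beta> * dist \<xi> \<zeta>"
        by (rule integral_mult_left)
      moreover have "\<dots> \<le> 1/2 * dist \<xi> \<zeta>" by (intro mult_right_mono \<beta>half) simp
      ultimately show "dist (apply_bcontfun (\<Phi> \<xi>) t) (apply_bcontfun (\<Phi> \<zeta>) t) \<le> 1/2 * dist \<xi> \<zeta>"
        unfolding \<Phi> dist_real_def real_norm_def by linarith
    qed
  qed auto
  then obtain \<xi> where \<xi>: "\<Phi> \<xi> = \<xi>" by blast
  define \<psi> where "\<psi> = apply_bcontfun \<xi>"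
  have c: "continuous_on UNIV \<psi>" by (simp add: \<psi>_def)
  have fix_eq: "\<psi> = T \<psi>" using \<Phi>[of \<xi>] \<xi> by (simp add: \<psi>_def)
  show thesis
  proof (rule that[of \<psi>])
    show "continuous_on UNIV \<psi>" by (rule c)
    show "\<psi> 0 = 0" using T0[of 0 \<psi>] fun_cong[OF fix_eq, of 0] by simp
    show "(\<psi> has_real_derivative V t (\<psi> t)) (at t within {0..})" if "0 \<le> t" for t
    proof (rule has_field_derivative_transform_within[OF Tder0[OF c that] zero_less_one])
      fix s :: real assume "s \<in> {0..}"
      then have "T \<psi> s = integral {0..s} (\<lambda>s. V s (\<psi> s))" by (simp add: T_def max_def)
      then show "integral {0..s} (\<lambda>s. V s (\<psi> s)) = \<psi> s" using fun_cong[OF fix_eq, of s] by simp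
    qed (use that in auto)
    show "\<bar>\<psi> b - \<psi> a\<bar> \<le> (LINT t:{a..}|lborel. \<beta> t)" if "0 \<le> a" "a \<le> b" for a b
      using inc[OF c that] \<beta>tail[OF that(1), of b] \<beta>L[OF that(1)] fun_cong[OF fix_eq, of a] fun_cong[OF fix_eq, of b] by linarith
    show "\<bar>\<psi> t\<bar> \<le> 1/2" for t using Tbound[OF c, of t] fun_cong[OF fix_eq, of t] by linarith
  qed
qed

subsection \<open>Weighted norms\<close>

text \<open>A jump at 0 is invisible to test functions: \<open>K\<close> is compact and avoids 0, so
  the product vanishes near 0 and is continuous on the whole line.\<close>

lemma Rstar_mult_compact:
  fixes h \<psi> :: "real \<Rightarrow> real"
  assumes h: "continuous_on (-{0}) h" and \<psi>: "continuous_on UNIV \<psi>"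
    and K: "compact K" "K \<subseteq> -{0}" "\<And>x. x \<notin> K \<Longrightarrow> \<psi> x = 0"
  shows "continuous_on UNIV (\<lambda>x. h x * \<psi> x)" "\<exists>B. \<forall>x. \<bar>h x * \<psi> x\<bar> \<le> B" "integrable lborel (\<lambda>x. h x * \<psi> x)"
proof -
  have "continuous_on (-{0}) (\<lambda>x. h x * \<psi> x)"
    using h continuous_on_subset[OF \<psi>] by (intro continuous_intros) auto
  moreover have "continuous_on (-K) (\<lambda>x. h x * \<psi> x)"
    by (rule continuous_on_eq[of _ "\<lambda>_. 0"]) (use K in auto)
  moreover have "open (-K)" using K(1) by (simp add: open_Compl compact_imp_closed)
  ultimately have "continuous_on (-{0} \<union> -K) (\<lambda>x. h x * \<psi> x)"
    by (intro continuous_on_open_Un) auto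
  moreover have "-{0} \<union> -K = UNIV" using K(2) by auto
  ultimately show c: "continuous_on UNIV (\<lambda>x. h x * \<psi> x)" by simp
  have "bounded ((\<lambda>x. h x * \<psi> x) ` K)"
    by (intro compact_imp_bounded compact_continuous_image K continuous_on_subset[OF c]) auto
  then obtain B where B: "0 < B" "\<And>x. x \<in> K \<Longrightarrow> \<bar>h x * \<psi> x\<bar> \<le> B" unfolding bounded_pos by auto
  have B': "\<bar>h x * \<psi> x\<bar> \<le> B" for x using B K(3)[of x] by (cases "x \<in> K") auto
  then show "\<exists>B. \<forall>x. \<bar>h x * \<psi> x\<bar> \<le> B" by blast
  show "integrable lborel (\<lambda>x. h x * \<psi> x)"
    by (rule integrable_bounded_compact[OF K(1) _ B']) (use c K(3) in \<open>auto intro: borel_measurable_continuous_onI\<close>)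
qed

lemma test_Rstar_support:
  assumes "test_Rstar \<phi> \<phi>'"
  obtains K where "compact K" "K \<subseteq> -{0}" "\<And>x. x \<notin> K \<Longrightarrow> \<phi> x = 0" "\<And>x. x \<notin> K \<Longrightarrow> \<phi>' x = 0"
proof -
  obtain K where K: "compact K" "K \<subseteq> -{0}" "\<And>x. x \<notin> K \<Longrightarrow> \<phi> x = 0"
    using assms unfolding test_Rstar_def by blast
  have "\<phi>' x = 0" if "x \<notin> K" for x
  proof -
    have "(\<phi> has_real_derivative 0) (at x)"
      by (rule has_field_derivative_transform_within_open[where S="-K" and f="\<lambda>_. 0"])
         (use K(1,3) that in \<open>auto simp: open_Compl compact_imp_closed\<close>)
    then show ?thesis using assms DERIV_unique unfolding test_Rstar_def by blast
  qed
  with K that show thesis by blast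
qed

lemma test_Rstar_by_parts:
  assumes v: "\<And>x. x \<noteq> 0 \<Longrightarrow> (v has_real_derivative v' x) (at x)" "continuous_on (-{0}) v'"
    and test: "test_Rstar \<phi> \<phi>'"
  shows "(LINT x|lborel. v x * \<phi>' x) = - (LINT x|lborel. v' x * \<phi> x)"
proof -
  obtain K where K: "compact K" "K \<subseteq> -{0}" "\<And>x. x \<notin> K \<Longrightarrow> \<phi> x = 0" "\<And>x. x \<notin> K \<Longrightarrow> \<phi>' x = 0"
    using test_Rstar_support[OF test] by metis
  have \<phi>: "\<And>x. (\<phi> has_real_derivative \<phi>' x) (at x)" "continuous_on UNIV \<phi>'"
    using test by (auto simp: test_Rstar_def)
  have c\<phi>: "continuous_on UNIV \<phi>" using \<phi>(1) by (meson DERIV_isCont continuous_at_imp_continuous_on)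
  have cv: "continuous_on (-{0}) v" using v(1) by (auto intro!: continuous_at_imp_continuous_on DERIV_isCont)
  note 1 = Rstar_mult_compact[OF cv \<phi>(2) K(1,2,4)] and 2 = Rstar_mult_compact[OF v(2) c\<phi> K(1-3)]
  note 3 = Rstar_mult_compact(1)[OF cv c\<phi> K(1-3)]
  obtain b1 b2 where b: "\<And>x. \<bar>v x * \<phi>' x\<bar> \<le> b1" "\<And>x. \<bar>v' x * \<phi> x\<bar> \<le> b2" using 1(2) 2(2) by blast
  obtain R where R: "\<And>x. x \<in> K \<Longrightarrow> \<bar>x\<bar> \<le> R" using compact_imp_bounded[OF K(1)] by (auto simp: bounded_iff)
  have out: "x \<notin> K" if "x \<notin> {-R..R}" for x using R[of x] that by (auto simp: abs_le_iff)
  have "(LINT x|lborel. v x * \<phi>' x + v' x * \<phi> x) = 0"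
  proof (rule integral_derivative_compact_zero[of "{}" "\<lambda>x. v x * \<phi> x" _ "b1 + b2" "-R" R])
    fix x :: real
    show "((\<lambda>x. v x * \<phi> x) has_real_derivative v x * \<phi>' x + v' x * \<phi> x) (at x)"
    proof (cases "x \<in> K")
      case True
      then have "x \<noteq> 0" using K(2) by auto
      from DERIV_mult[OF v(1)[OF this] \<phi>(1)] show ?thesis by (simp add: algebra_simps)
    next
      case False
      have "((\<lambda>x. v x * \<phi> x) has_real_derivative 0) (at x)"
        by (rule has_field_derivative_transform_within_open[where S="-K" and f="\<lambda>_. 0"])
           (use K(1,3) False in \<open>auto simp: open_Compl compact_imp_closed\<close>)
      then show ?thesis using K(3,4)[OF False] by simp
    qed
    show "\<bar>v x * \<phi>' x + v' x * \<phi> x\<bar> \<le> b1 + b2" using b[of x] by linarith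
  qed (use 1(1) 2(1) 3 out K in \<open>auto intro!: borel_measurable_continuous_onI continuous_on_add\<close>)
  then show ?thesis using 1(3) 2(3) by simp
qed

text \<open>The classical derivative off 0 is a weak derivative and hence a competitor in the
  infimum. The factor 2 pays for the Euclidean norm of the pair.\<close>

lemma W1inf_norm_le:
  assumes v: "\<And>x. x \<noteq> 0 \<Longrightarrow> (v has_real_derivative v' x) (at x)" "continuous_on (-{0}) v'"
    and \<Omega>: "\<And>x. 0 < \<Omega> x" "\<Omega> \<in> borel_measurable borel"
    and b: "\<And>x. x \<noteq> 0 \<Longrightarrow> \<bar>v x\<bar> \<le> c * \<Omega> x" "\<And>x. x \<noteq> 0 \<Longrightarrow> \<bar>v' x\<bar> \<le> c * \<Omega> x"
  shows "W1inf_norm \<Omega> v \<le> ereal (2 * c)"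
proof -
  note [measurable] = \<Omega>(2)
  have cv: "continuous_on (-{0}) v" using v(1) by (auto intro!: continuous_at_imp_continuous_on DERIV_isCont)
  have [measurable]: "v \<in> borel_measurable borel" "v' \<in> borel_measurable borel"
    by (rule borel_measurable_continuous_countable_exceptions[of "{0}"]; use cv v(2) in simp)+
  have loc: "loc_integrable_Rstar h" if "continuous_on (-{0}) h" for h :: "real \<Rightarrow> real"
    unfolding loc_integrable_Rstar_def set_integrable_def
    using that borel_integrable_compact continuous_on_subset by blast
  have "weak_deriv_Rstar v v'"
    unfolding weak_deriv_Rstar_def using loc[OF cv] loc[OF v(2)] test_Rstar_by_parts[OF v] by blast
  then have "W1inf_norm \<Omega> v \<le> esssup lborel (\<lambda>x. ereal (norm (v x, v' x) / \<Omega> x))"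
    unfolding W1inf_norm_def by (intro INF_lower) simp
  also have "\<dots> \<le> ereal (2 * c)"
  proof (rule esssup_I)
    show "(\<lambda>x. ereal (norm (v x, v' x) / \<Omega> x)) \<in> borel_measurable lborel" by measurable
    have "AE x in lborel. x \<noteq> (0::real)" by (rule AE_lborel_singleton)
    then show "AE x in lborel. ereal (norm (v x, v' x) / \<Omega> x) \<le> ereal (2 * c)"
    proof eventually_elim
      case (elim x)
      have "norm (v x, v' x) \<le> \<bar>v x\<bar> + \<bar>v' x\<bar>"
        using sqrt_sum_squares_le_sum_abs[of "v x" "v' x"] by (simp add: norm_Pair)
      then have "norm (v x, v' x) \<le> 2 * c * \<Omega> x" using b[OF elim] by linarith
      then show ?case using \<Omega>(1)[of x] by (simp add: divide_le_eq)
    qed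
  qed
  finally show ?thesis .
qed

lemma AE_lborel_ex_interval:
  fixes a b :: real
  assumes "AE y in lborel. P y" "a < b"
  shows "\<exists>y\<in>{a<..<b}. P y"
proof (rule ccontr)
  assume "\<not> ?thesis"
  with assms(1) have "AE y in lborel. y \<notin> {a<..<b}" by (auto elim!: eventually_mono)
  then have "emeasure lborel {a<..<b} = 0"
    by (subst AE_iff_measurable[symmetric, of _ _ "\<lambda>y. y \<notin> {a<..<b}"]) auto
  then show False using assms(2) by simp
qed

lemma continuous_on_gt_interval:
  fixes h :: "real \<Rightarrow> real"
  assumes "continuous_on S h" "open S" "x \<in> S" "c < h x"
  obtains a b where "a < x" "x < b" "{a..b} \<subseteq> S" "\<And>y. y \<in> {a..b} \<Longrightarrow> c < h y"
proof -
  have "isCont h x" using assms by (simp add: continuous_on_eq_continuous_at)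
  then have "\<forall>\<^sub>F y in nhds x. c < h y"
    using assms(4) unfolding isCont_def tendsto_at_iff_tendsto_nhds by (rule order_tendstoD)
  moreover have "\<forall>\<^sub>F y in nhds x. y \<in> S" using assms(2,3) by (rule eventually_nhds_in_open)
  ultimately have "\<forall>\<^sub>F y in nhds x. c < h y \<and> y \<in> S" by (rule eventually_conj)
  then obtain d where d: "0 < d" "\<And>y. dist y x < d \<Longrightarrow> c < h y \<and> y \<in> S"
    unfolding eventually_nhds_metric by blast
  have dd: "c < h y \<and> y \<in> S" if "y \<in> {x - d/2..x + d/2}" for y
  proof (rule d(2))
    have "\<bar>y - x\<bar> \<le> d / 2" using that unfolding atLeastAtMost_iff by linarith
    then show "dist y x < d" using d(1) by (simp add: dist_real_def)
  qed
  show thesis by (rule that[of "x - d/2" "x + d/2"]) (use d(1) dd in auto)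
qed

text \<open>The bump test functions avoid the uniqueness of weak derivatives.\<close>

lemma W1inf_norm_pointwise:
  assumes v: "\<And>x. x \<noteq> 0 \<Longrightarrow> (v has_real_derivative v' x) (at x)" "continuous_on (-{0}) v'"
    and \<Omega>: "\<And>x. 0 < \<Omega> x" "\<Omega> \<in> borel_measurable borel" "\<And>x. \<Omega> x \<le> Z"
    and cont: "continuous_on (-{0}) (\<lambda>x. v x / \<Omega> x)" "continuous_on (-{0}) (\<lambda>x. v' x / \<Omega> x)"
    and "x \<noteq> 0"
  shows "ereal (\<bar>v x\<bar> / \<Omega> x) \<le> W1inf_norm \<Omega> v" "ereal (\<bar>v' x\<bar> / \<Omega> x) \<le> W1inf_norm \<Omega> v"
proof -
  have main: "ereal (\<bar>v x\<bar> / \<Omega> x) \<le> e \<and> ereal (\<bar>v' x\<bar> / \<Omega> x) \<le> e"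
    if w: "weak_deriv_Rstar v w" and e: "e = esssup lborel (\<lambda>x. ereal (norm (v x, w x) / \<Omega> x))" for w e
  proof -
    have ae: "AE y in lborel. ereal (norm (v y, w y) / \<Omega> y) \<le> e" unfolding e by (rule esssup_AE)
    have ae1: "AE y in lborel. ereal (\<bar>v y\<bar> / \<Omega> y) \<le> e" and ae2: "AE y in lborel. ereal (\<bar>w y\<bar> / \<Omega> y) \<le> e"
    proof -
      have "\<bar>v y\<bar> / \<Omega> y \<le> norm (v y, w y) / \<Omega> y" "\<bar>w y\<bar> / \<Omega> y \<le> norm (v y, w y) / \<Omega> y" for y
        using norm_fst_le[of "v y" "w y"] norm_snd_le[of "w y" "v y"] less_imp_le[OF \<Omega>(1), of y] by (auto intro!: divide_right_mono)
      then show "AE y in lborel. ereal (\<bar>v y\<bar> / \<Omega> y) \<le> e" "AE y in lborel. ereal (\<bar>w y\<bar> / \<Omega> y) \<le> e"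
        using ae by (auto elim!: eventually_mono intro: order_trans simp del: norm_Pair) (meson ereal_less_eq(3) order_trans)+
    qed
    show ?thesis
    proof (cases e)
      case PInf
      then show ?thesis by simp
    next
      \<comment> \<open>Excluded because the quotient is a real number at some point where the
        almost everywhere bound holds.\<close>
      case MInf
      obtain y where "ereal (\<bar>v y\<bar> / \<Omega> y) \<le> e" using AE_lborel_ex_interval[OF ae1, of 0 1] by auto
      then show ?thesis using MInf by simp
    next
      case (real e')
      have c0: "open (-{0::real})" and xin: "x \<in> -{0}" using \<open>x \<noteq> 0\<close> by auto
      have "\<bar>v x\<bar> / \<Omega> x \<le> e'"
      proof (rule ccontr)
        assume "\<not> ?thesis"
        then have gt: "e' < \<bar>v x / \<Omega> x\<bar>" using \<Omega>(1)[of x] by (simp add: abs_divide)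
        obtain a b where ab: "a < x" "x < b" "{a..b} \<subseteq> -{0}" "\<And>y. y \<in> {a..b} \<Longrightarrow> e' < \<bar>v y / \<Omega> y\<bar>"
          by (rule continuous_on_gt_interval[OF continuous_on_rabs[OF cont(1)] c0 xin gt]) (rule that)
        obtain y where "y \<in> {a<..<b}" "ereal (\<bar>v y\<bar> / \<Omega> y) \<le> e" using AE_lborel_ex_interval[OF ae1, of a b] ab by auto
        then show False using ab(4)[of y] \<Omega>(1)[of y] real by (simp add: abs_divide)
      qed
      moreover have "\<bar>v' x\<bar> / \<Omega> x \<le> e'"
      proof (rule ccontr)
        assume "\<not> ?thesis"
        \<comment> \<open>A strict gap is needed. Near \<open>x\<close> the signed derivative
          \<open>s * v'\<close> exceeds \<open>e1 * \<Omega>\<close>, while \<open>s * w\<close> is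
          at most \<open>e' * \<Omega>\<close> almost everywhere; yet both have the same integral
          against a bump supported there.\<close>
        then obtain e1 where e1: "e' < e1" "e1 < \<bar>v' x\<bar> / \<Omega> x" using dense not_le by blast
        define s where "s = sgn (v' x)"
        have gt: "e1 < s * (v' x / \<Omega> x)" using e1(2) abs_sgn[of "v' x"] by (simp add: s_def mult.commute)
        obtain a b where ab: "a < x" "x < b" "{a..b} \<subseteq> -{0}" "\<And>y. y \<in> {a..b} \<Longrightarrow> e1 < s * (v' y / \<Omega> y)"
          by (rule continuous_on_gt_interval[OF continuous_on_mult_left[OF cont(2)] c0 xin gt]) (rule that)
        define h m where "h = (b - a) / 2" and "m = (a + b) / 2"
        have h: "0 < h" and hm: "m - h = a" "m + h = b" using ab by (auto simp: h_def m_def field_simps)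
        define \<phi> \<phi>' where "\<phi> y = bump ((y - m) / h)" and "\<phi>' y = bump' ((y - m) / h) / h" for y
        have \<phi>D: "(\<phi> has_real_derivative \<phi>' y) (at y)" for y
        proof -
          have "((\<lambda>y. (y - m) / h) has_real_derivative 1 / h) (at y)" using h by (auto intro!: derivative_eq_intros)
          from DERIV_chain2[OF bump_deriv this] show ?thesis by (simp add: \<phi>_def[abs_def] \<phi>'_def)
        qed
        have \<phi>c: "continuous_on UNIV \<phi>" "continuous_on UNIV \<phi>'"
          unfolding \<phi>_def[abs_def] \<phi>'_def[abs_def] using h
          by (auto intro!: continuous_intros continuous_on_compose2[OF bump_continuous(1)[of UNIV]] continuous_on_compose2[OF bump_continuous(2)[of UNIV]])
        note [measurable] = borel_measurable_continuous_onI[OF \<phi>c(1)] \<Omega>(2)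
        have \<phi>b: "0 \<le> \<phi> y" "\<phi> y \<le> 1" for y using bump_bounds by (auto simp: \<phi>_def)
        have \<phi>out: "\<phi> y = 0" if "y \<notin> {a..b}" for y
        proof -
          have "1 \<le> \<bar>(y - m) / h\<bar>" using that h hm by (auto simp: abs_if field_simps)
          then show ?thesis by (simp add: \<phi>_def bump_outside)
        qed
        have \<phi>pos: "0 < \<phi> y" if "y \<in> {a<..<b}" for y
          unfolding \<phi>_def by (rule bump_pos) (use that h hm in \<open>auto simp: abs_less_iff field_simps\<close>)
        have test: "test_Rstar \<phi> \<phi>'"
          unfolding test_Rstar_def using \<phi>D \<phi>c(2) \<phi>out ab(3) by (intro conjI allI exI[of _ "{a..b}"]) auto
        have "(LINT x|lborel. v x * \<phi>' x) = - (LINT x|lborel. w x * \<phi> x)"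
          using w test unfolding weak_deriv_Rstar_def by blast
        then have eq: "(LINT x|lborel. v' x * \<phi> x) = (LINT x|lborel. w x * \<phi> x)"
          using test_Rstar_by_parts[OF v test] by simp
        have iv: "integrable lborel (\<lambda>y. v' y * \<phi> y)"
          by (rule Rstar_mult_compact(3)[OF v(2) \<phi>c(1) compact_Icc ab(3) \<phi>out])
        have iw: "integrable lborel (\<lambda>y. w y * \<phi> y)"
        proof -
          have "set_integrable lborel {a..b} w"
            using w ab(3) unfolding weak_deriv_Rstar_def loc_integrable_Rstar_def by blast
          then have i: "integrable lborel (\<lambda>y. indicator {a..b} y *\<^sub>R w y)" by (simp add: set_integrable_def)
          have "integrable lborel (\<lambda>y. (indicator {a..b} y *\<^sub>R w y) * \<phi> y)"
          proof (rule Bochner_Integration.integrable_bound[OF i])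
            show "(\<lambda>y. (indicator {a..b} y *\<^sub>R w y) * \<phi> y) \<in> borel_measurable lborel"
              by (intro borel_measurable_times borel_measurable_integrable[OF i]) measurable
          qed (auto intro!: AE_I2 simp: abs_mult \<phi>b mult_left_le)
          moreover have "(\<lambda>y. (indicator {a..b} y *\<^sub>R w y) * \<phi> y) = (\<lambda>y. w y * \<phi> y)"
          proof
            fix y show "(indicator {a..b} y *\<^sub>R w y) * \<phi> y = w y * \<phi> y"
              using \<phi>out[of y] by (cases "y \<in> {a..b}") auto
          qed
          ultimately show ?thesis by simp
        qed
        have i\<Omega>: "integrable lborel (\<lambda>y. \<Omega> y * \<phi> y)"
        proof (rule integrable_bounded_compact[of "{a..b}" _ Z])
          show "\<bar>\<Omega> y * \<phi> y\<bar> \<le> Z" for y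
            using \<Omega>(1,3)[of y] \<phi>b[of y] mult_mono[of "\<Omega> y" Z "\<phi> y" 1] by (simp add: abs_mult)
        qed (use \<phi>out in auto)
        have "e1 * (LINT y|lborel. \<Omega> y * \<phi> y) = (LINT y|lborel. e1 * (\<Omega> y * \<phi> y))" by simp
        also have "\<dots> \<le> (LINT y|lborel. s * (v' y * \<phi> y))"
        proof (rule integral_mono[OF integrable_mult_right[OF i\<Omega>] integrable_mult_right[OF iv]])
          fix y
          show "e1 * (\<Omega> y * \<phi> y) \<le> s * (v' y * \<phi> y)"
          proof (cases "y \<in> {a..b}")
            case True
            then have "e1 * \<Omega> y \<le> s * v' y" using ab(4)[OF True] \<Omega>(1)[of y] by (simp add: field_simps)
            from mult_right_mono[OF this \<phi>b(1)] show ?thesis by (simp add: mult.assoc)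
          qed (simp add: \<phi>out)
        qed
        also have "\<dots> = (LINT y|lborel. s * (w y * \<phi> y))" using eq by simp
        also have "\<dots> \<le> (LINT y|lborel. e' * (\<Omega> y * \<phi> y))"
        proof (rule integral_mono_AE[OF integrable_mult_right[OF iw] integrable_mult_right[OF i\<Omega>]])
          show "AE y in lborel. s * (w y * \<phi> y) \<le> e' * (\<Omega> y * \<phi> y)"
            using ae2
          proof eventually_elim
            case (elim y)
            then have "\<bar>w y\<bar> \<le> e' * \<Omega> y" using real \<Omega>(1)[of y] by (simp add: field_simps)
            moreover have "s * w y \<le> \<bar>w y\<bar>" by (auto simp: s_def sgn_if)
            ultimately have "s * w y \<le> e' * \<Omega> y" by linarith
            from mult_right_mono[OF this \<phi>b(1)] show ?case by (simp add: mult.assoc)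
          qed
        qed
        also have "\<dots> = e' * (LINT y|lborel. \<Omega> y * \<phi> y)" by simp
        finally have "(e1 - e') * (LINT y|lborel. \<Omega> y * \<phi> y) \<le> 0" by (simp add: left_diff_distrib)
        then have "(LINT y|lborel. \<Omega> y * \<phi> y) \<le> 0" using e1(1) by (simp add: mult_le_0_iff)
        moreover have nn: "0 \<le> \<Omega> y * \<phi> y" for y using \<Omega>(1)[of y] \<phi>b[of y] by simp
        moreover have "0 \<le> (LINT y|lborel. \<Omega> y * \<phi> y)" by (rule integral_nonneg_AE) (simp add: nn)
        ultimately have "(LINT y|lborel. \<Omega> y * \<phi> y) = 0" by simp
        then have "AE y in lborel. \<Omega> y * \<phi> y = 0"
          using integral_nonneg_eq_0_iff_AE[OF i\<Omega>] nn by auto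
        then have "\<exists>y\<in>{a<..<b}. \<Omega> y * \<phi> y = 0" using AE_lborel_ex_interval ab(1,2) by (meson order_less_trans)
        then obtain y where "y \<in> {a<..<b}" "\<Omega> y * \<phi> y = 0" by blast
        then show False using \<phi>pos[of y] \<Omega>(1)[of y] by simp
      qed
      ultimately show ?thesis using real by simp
    qed
  qed
  show "ereal (\<bar>v x\<bar> / \<Omega> x) \<le> W1inf_norm \<Omega> v" "ereal (\<bar>v' x\<bar> / \<Omega> x) \<le> W1inf_norm \<Omega> v"
    unfolding W1inf_norm_def by (rule INF_greatest; use main in blast)+
qed

subsection \<open>Stability of the step wave\<close>

lemma bump_half_integral: "integrable lborel (\<lambda>y. indicator {..<0} y * bump' y)" "(LINT y|lborel. indicator {..<0} y * bump' y) = 1"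
proof -
  have i1: "integrable lborel (\<lambda>y. indicator {..<0} y * bump' y)"
    by (rule integrable_bounded_compact[of "{-1..1}" _ 4])
       (use bump_bounds(3) in \<open>auto simp: indicator_def intro!: bump_outside\<close>)
  then show "integrable lborel (\<lambda>y. indicator {..<0} y * bump' y)" .
  have i2: "integrable lborel (indicator {0..<1::real} :: real \<Rightarrow> real)" by (intro integrable_real_indicator) auto
  \<comment> \<open>The half bump ends at the value 1 and is continued by a linear ramp down to 0.
    The whole has compact support, so its derivative integrates to 0, and the ramp accounts for
    -1.\<close>
  let ?F = "\<lambda>y::real. if y < 0 then bump y else max 0 (1 - y)"
  let ?F' = "\<lambda>y::real. indicator {..<0} y * bump' y - indicator {0..<1} y"
  have "(LINT y|lborel. ?F' y) = 0"
  proof (rule integral_derivative_compact_zero[of "{0, 1}" ?F ?F' 5 "-1" 1])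
    fix y :: real assume y: "y \<notin> {0, 1}"
    consider "y < 0" | "0 < y" "y < 1" | "1 < y" using y by force
    then show "(?F has_real_derivative ?F' y) (at y)"
    proof cases
      case 1
      have "(?F has_real_derivative bump' y) (at y)"
        by (rule has_field_derivative_transform_within_open[OF bump_deriv, where S="{..<0}"]) (use 1 in auto)
      then show ?thesis using 1 by simp
    next
      case 2
      have "((\<lambda>y. 1 - y) has_real_derivative - 1) (at y)" by (auto intro!: derivative_eq_intros)
      then have "(?F has_real_derivative - 1) (at y)"
        by (rule has_field_derivative_transform_within_open[where S="{0<..<1}"]) (use 2 in auto)
      then show ?thesis using 2 by simp
    next
      case 3
      have "(?F has_real_derivative 0) (at y)"
        by (rule has_field_derivative_transform_within_open[where f="\<lambda>_. 0" and S="{1<..}"]) (use 3 in auto)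
      then show ?thesis using 3 by simp
    qed
  next
    have eq: "?F = (\<lambda>y. bump (min y 0) + max 0 (1 - max y 0) - 1)" by (auto simp: bump_def max_def min_def)
    show "continuous_on UNIV ?F"
      unfolding eq by (intro continuous_intros continuous_on_compose2[OF bump_continuous(1)[of UNIV]]) auto
  next
    fix y :: real
    have "\<bar>indicator {..<0} y * bump' y\<bar> \<le> 4" using bump_bounds(3)[of y] by (auto simp: indicator_def)
    moreover have "\<bar>indicator {0..<1} y :: real\<bar> \<le> 1" by (auto simp: indicator_def)
    ultimately show "\<bar>?F' y\<bar> \<le> 5" by linarith
    assume "y \<notin> {-1..1}"
    then have "1 \<le> \<bar>y\<bar>" "y < -1 \<or> 1 < y" by auto
    then show "?F y = 0" "?F' y = 0" by (auto simp: bump_outside)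
  qed (auto intro!: borel_measurable_diff borel_measurable_times)
  then show "(LINT y|lborel. indicator {..<0} y * bump' y) = 1" using i1 i2 by simp
qed

lemma bump'_integral: "integrable lborel bump'" "(LINT y|lborel. bump' y) = 0"
proof -
  show "integrable lborel bump'"
    by (rule integrable_bounded_compact[of "{-1..1}" _ 4]) (use bump_bounds(3) in \<open>auto intro!: bump_outside\<close>)
  show "(LINT y|lborel. bump' y) = 0"
    by (rule integral_derivative_compact_zero[of "{}" bump _ 4 "-1" 1])
       (use bump_deriv bump_bounds(3) bump_continuous in \<open>auto intro!: bump_outside\<close>)
qed

text \<open>The entropy inequalities imply the weak equation. Tested with a function that travels
  with the wave, it reduces to one integral identity in the variable
  \<open>x - \<sigma> * t\<close>, from which the relations are read off by placing a bump on the
  left, on the right and at the jump.\<close>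

lemma wave_relations:
  fixes f g U :: "real \<Rightarrow> real"
  assumes sol: "entropy_solution f g U (\<lambda>t x. U (x - \<sigma> * t))"
    and cf: "continuous_on UNIV f" and cg: "continuous_on UNIV g"
    and U: "\<And>x. x < 0 \<Longrightarrow> U x = um" "\<And>x. 0 < x \<Longrightarrow> U x = up"
  shows "g um = 0" "g up = 0" "f um - f up = \<sigma> * (um - up)"
proof -
  define U0 where "U0 y = (if y < 0 then um else up)" for y :: real
  have [measurable]: "U0 \<in> borel_measurable borel" unfolding U0_def[abs_def] by measurable
  obtain M V where V: "V \<in> borel_measurable borel" "\<And>p. \<bar>V p\<bar> \<le> M"
    "\<And>t. t \<in> {0..3} \<Longrightarrow> AE x in lborel. V (t, x) = U (x - \<sigma> * t)"
    "kruzkov ({0<..<3} \<times> UNIV) f V (\<lambda>p. g (V p))"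
    "\<And>t. 0 \<le> t \<Longrightarrow> (\<lambda>x. U (x - \<sigma> * t)) \<in> borel_measurable borel"
    by (rule entropy_solution_representative[OF sol _ cf cg, of 3]) (simp, rule that)
  note [measurable] = V(1) borel_measurable_continuous_onI[OF cf] borel_measurable_continuous_onI[OF cg]
  have VU: "AE x in lborel. V (t, x) = U0 (x - \<sigma> * t)" if t: "t \<in> {0..3}" for t
  proof -
    have "AE x in lborel. x \<noteq> \<sigma> * t" by (rule AE_lborel_singleton)
    with V(3)[OF t] show ?thesis by eventually_elim (use U in \<open>auto simp: U0_def\<close>)
  qed
  have key: "(LINT y|lborel. (f (U0 y) - \<sigma> * U0 y) * bump' (y - m) + g (U0 y) * bump (y - m)) = 0" for m
  proof -
    \<comment> \<open>The bump in time is centred at 3/2 with radius 1, well inside the horizon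
      \<open>(0, 3)\<close>.\<close>
    define \<alpha> \<alpha>' where "\<alpha> t = bump (t - 3/2)" and "\<alpha>' t = bump' (t - 3/2)" for t :: real
    define \<phi> \<phi>t \<phi>x where "\<phi> p = \<alpha> (fst p) * bump (snd p - \<sigma> * fst p - m)"
      and "\<phi>t p = \<alpha>' (fst p) * bump (snd p - \<sigma> * fst p - m) + \<alpha> (fst p) * (bump' (snd p - \<sigma> * fst p - m) * (- \<sigma>))"
      and "\<phi>x p = 0 * bump (snd p - \<sigma> * fst p - m) + \<alpha> (fst p) * (bump' (snd p - \<sigma> * fst p - m) * 1)" for p :: "real \<times> real"
    have C: "C1_on UNIV \<phi> \<phi>t \<phi>x"
    proof -
      have 1: "C1_on UNIV (\<lambda>p::real\<times>real. fst p - 3/2) (\<lambda>_. 1) (\<lambda>_. 0)"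
        and 2: "C1_on UNIV (\<lambda>p::real\<times>real. snd p - \<sigma> * fst p - m) (\<lambda>_. - \<sigma>) (\<lambda>_. 1)"
        unfolding C1_on_def by (auto intro!: derivative_eq_intros)
      from C1_on_mult[OF C1_on_compose[OF 1 bump_deriv bump_continuous(2)] C1_on_compose[OF 2 bump_deriv bump_continuous(2)]]
      show ?thesis by (simp add: \<phi>_def[abs_def] \<phi>t_def[abs_def] \<phi>x_def[abs_def] \<alpha>_def[abs_def] \<alpha>'_def[abs_def])
    qed
    have \<alpha>out: "\<alpha> t = 0" "\<alpha>' t = 0" if "t \<notin> {1/2..5/2}" for t
      using that unfolding \<alpha>_def \<alpha>'_def by (intro bump_outside; auto simp: abs_if)+
    have test: "C1_test ({0<..<3} \<times> UNIV) \<phi> \<phi>t \<phi>x"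
      unfolding C1_test_def
    proof (intro conjI exI allI impI)
      let ?K = "(\<lambda>q. (fst q, snd q + \<sigma> * fst q)) ` ({1/2..5/2} \<times> {m-1..m+1})"
      show "C1_on UNIV \<phi> \<phi>t \<phi>x" by (rule C)
      show "compact ?K" by (intro compact_continuous_image compact_Times continuous_intros) auto
      show "?K \<subseteq> {0<..<3} \<times> UNIV" by auto
      fix p assume p: "p \<notin> ?K"
      show "\<phi> p = 0"
      proof (cases "fst p \<in> {1/2..5/2}")
        case True
        have "p = (\<lambda>q. (fst q, snd q + \<sigma> * fst q)) (fst p, snd p - \<sigma> * fst p)" by simp
        then have "snd p - \<sigma> * fst p \<notin> {m-1..m+1}" using p True by (metis (no_types, lifting) SigmaI image_eqI)
        then have "1 \<le> \<bar>snd p - \<sigma> * fst p - m\<bar>" by (auto simp: abs_if)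
        then show ?thesis by (simp add: \<phi>_def bump_outside)
      qed (simp add: \<phi>_def \<alpha>out)
    qed
    have \<phi>0: "0 \<le> \<phi> p" for p by (simp add: \<phi>_def \<alpha>_def bump_bounds)
    obtain K where K: "compact K" "\<And>p. p \<notin> K \<Longrightarrow> \<phi> p = 0" "\<And>p. p \<notin> K \<Longrightarrow> \<phi>t p = 0" "\<And>p. p \<notin> K \<Longrightarrow> \<phi>x p = 0"
      using C1_test_support[OF test] by metis
    note [measurable] = C1_test_measurable[OF test]
    have bd: "bounded (range \<phi>)" "bounded (range \<phi>t)" "bounded (range \<phi>x)"
      using C1_test_bounded[OF test] unfolding bounded_iff real_norm_def by (metis rangeE)+
    have bV: "bounded (range V)" using V(2) unfolding bounded_iff real_norm_def by blast
    have bc: "bounded (range (\<lambda>p. F (V p)))" if "continuous_on UNIV F" for F :: "real \<Rightarrow> real"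
    proof (rule bounded_subset)
      show "bounded (F ` {-M..M})"
        using that by (intro compact_imp_bounded compact_continuous_image) (auto intro: continuous_on_subset)
      show "range (\<lambda>p. F (V p)) \<subseteq> F ` {-M..M}" using V(2) by (auto simp: abs_le_iff minus_le_iff intro!: imageI)
    qed
    define J where "J p = V p * \<phi>t p + f (V p) * \<phi>x p + g (V p) * \<phi> p" for p
    have "bounded (range J)" unfolding J_def by (intro bounded_range_intros bd bV bc cf cg)
    then obtain B where B: "\<And>p. \<bar>J p\<bar> \<le> B" unfolding bounded_iff real_norm_def by blast
    have Jm [measurable]: "J \<in> borel_measurable borel" unfolding J_def by measurable
    have Ji: "integrable lborel J"
      by (rule integrable_bounded_compact[OF K(1) Jm B]) (use K(2-4) in \<open>simp add: J_def\<close>)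
    have \<phi>i: "integrable lborel \<phi>t" "integrable lborel \<phi>x"
    proof -
      obtain b where "\<And>p. \<bar>\<phi>t p\<bar> \<le> b" "\<And>p. \<bar>\<phi>x p\<bar> \<le> b" using C1_test_bounded[OF test] by metis
      then show "integrable lborel \<phi>t" "integrable lborel \<phi>x"
        using integrable_bounded_compact[OF K(1)] K C1_test_measurable[OF test] by metis+
    qed
    have sgnV: "sgn (V p - (M + 1)) = -1" "sgn (V p - (- M - 1)) = 1" "\<bar>V p - (M + 1)\<bar> = M + 1 - V p" "\<bar>V p - (- M - 1)\<bar> = V p + (M + 1)" for p
      using V(2)[of p] by (auto simp: sgn_if)
    have "0 \<le> (LINT p|lborel. \<bar>V p - k\<bar> * \<phi>t p + sgn (V p - k) * (f (V p) - f k) * \<phi>x p + sgn (V p - k) * g (V p) * \<phi> p)" for k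
      using V(4) test \<phi>0 unfolding kruzkov_def by blast
    \<comment> \<open>Levels outside the range of \<open>V\<close> make the sign constant. One
      inequality bounds the integral of \<open>J\<close> by 0 from above and the other from below,
      as \<open>\<phi>t\<close> and \<open>\<phi>x\<close> have integral zero.\<close>
    from this[of "M + 1"] this[of "- M - 1"]
    have 1: "0 \<le> (LINT p|lborel. (M + 1) * \<phi>t p + f (M + 1) * \<phi>x p - J p)"
      and 2: "0 \<le> (LINT p|lborel. J p + (M + 1) * \<phi>t p - f (- M - 1) * \<phi>x p)"
      unfolding sgnV J_def by (simp_all add: algebra_simps)
    have J0: "integral\<^sup>L lborel J = 0"
      using 1 2 Ji \<phi>i C1_test_integral_zero[OF test] by simp
    have J1: "integral\<^sup>L lborel J = (LINT t|lborel. LINT x|lborel. J (t, x))"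
      using lborel_pair.integral_fst'[of J] Ji by (simp add: lborel_prod)
    define c1 where "c1 = (LINT y|lborel. U0 y * bump (y - m))"
    define c2 where "c2 = (LINT y|lborel. (f (U0 y) - \<sigma> * U0 y) * bump' (y - m) + g (U0 y) * bump (y - m))"
    \<comment> \<open>In the frame of the wave the time dependence factors out. The integral of
      \<open>\<alpha>'\<close> is 0 and that of \<open>\<alpha>\<close> is positive, which isolates
      \<open>c2\<close>.\<close>
    have inner: "(LINT x|lborel. J (t, x)) = \<alpha>' t * c1 + \<alpha> t * c2" for t
    proof (cases "t \<in> {0..3}")
      case False
      then have "t \<notin> {1/2..5/2}" by auto
      from \<alpha>out[OF this] show ?thesis by (simp add: J_def \<phi>_def \<phi>t_def \<phi>x_def)
    next
      case True
      have bU: "bounded (range (\<lambda>y. F (U0 y)))" for F :: "real \<Rightarrow> real"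
        by (rule bounded_subset[of "{F um, F up}"]) (auto simp: U0_def)
      have bb: "bounded (range (\<lambda>y. bump (y - m)))" "bounded (range (\<lambda>y. bump' (y - m)))"
      proof -
        have "\<bar>bump (y - m)\<bar> \<le> 1" "\<bar>bump' (y - m)\<bar> \<le> 4" for y using bump_bounds[of "y - m"] by auto
        then show "bounded (range (\<lambda>y. bump (y - m)))" "bounded (range (\<lambda>y. bump' (y - m)))"
          unfolding bounded_iff real_norm_def by blast+
      qed
      have bout: "bump (y - m) = 0" "bump' (y - m) = 0" if "y \<notin> {m-1..m+1}" for y
        using that by (intro bump_outside; auto simp: abs_if)+
      define j1 j2 where "j1 y = U0 y * bump (y - m)" and "j2 y = (f (U0 y) - \<sigma> * U0 y) * bump' (y - m) + g (U0 y) * bump (y - m)" for y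
      have jm [measurable]: "j1 \<in> borel_measurable borel" "j2 \<in> borel_measurable borel"
        unfolding j1_def[abs_def] j2_def[abs_def] by measurable
      have ji: "integrable lborel j1" "integrable lborel j2"
      proof -
        have "bounded (range j1)" "bounded (range j2)"
          unfolding j1_def j2_def by (intro bounded_range_intros bounded_range_const bb bU[of "\<lambda>y. y"] bU[of f] bU[of g])+
        then obtain b1 b2 where "\<And>y. \<bar>j1 y\<bar> \<le> b1" "\<And>y. \<bar>j2 y\<bar> \<le> b2" unfolding bounded_iff real_norm_def by blast
        then show "integrable lborel j1" "integrable lborel j2"
          using bout jm by (auto intro!: integrable_bounded_compact[of "{m-1..m+1}" j1 b1] integrable_bounded_compact[of "{m-1..m+1}" j2 b2] simp: j1_def j2_def)
      qed
      have "(LINT x|lborel. J (t, x)) = (LINT x|lborel. \<alpha>' t * j1 (x - \<sigma> * t) + \<alpha> t * j2 (x - \<sigma> * t))"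
      proof (rule integral_cong_AE)
        show "AE x in lborel. J (t, x) = \<alpha>' t * j1 (x - \<sigma> * t) + \<alpha> t * j2 (x - \<sigma> * t)"
          using VU[OF True] by eventually_elim (simp add: J_def \<phi>_def \<phi>t_def \<phi>x_def j1_def j2_def algebra_simps)
        have "(\<lambda>x. J (t, x)) \<in> borel_measurable borel"
          by (rule measurable_compose[OF _ Jm]) (intro borel_measurable_continuous_onI continuous_intros)
        then show "(\<lambda>x. J (t, x)) \<in> borel_measurable lborel" by simp
      qed measurable
      also have "\<dots> = (LINT y|lborel. \<alpha>' t * j1 y + \<alpha> t * j2 y)"
        using lborel_integral_real_affine[of 1 "\<lambda>y. \<alpha>' t * j1 y + \<alpha> t * j2 y" "- \<sigma> * t"] by (simp add: add.commute)
      also have "\<dots> = \<alpha>' t * c1 + \<alpha> t * c2" using ji by (simp add: c1_def c2_def j1_def[symmetric] j2_def[symmetric])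
      finally show ?thesis .
    qed
    have \<alpha>i: "integrable lborel \<alpha>" "integrable lborel \<alpha>'" "(LINT t|lborel. \<alpha>' t) = 0" "(LINT t|lborel. \<alpha> t) = (LINT t|lborel. bump t)"
      using lborel_integrable_real_affine[OF bump_integrable, of 1 "-3/2"] lborel_integrable_real_affine[OF bump'_integral(1), of 1 "-3/2"]
        lborel_integral_real_affine[of 1 bump "-3/2"] lborel_integral_real_affine[of 1 bump' "-3/2"] bump'_integral(2)
      by (simp_all add: \<alpha>_def[abs_def] \<alpha>'_def[abs_def])
    have "(LINT t|lborel. \<alpha>' t * c1 + \<alpha> t * c2) = 0" using J0 J1 inner by simp
    then have "(LINT t|lborel. bump t) * c2 = 0" using \<alpha>i by simp
    then show ?thesis using bump_integral_pos by (simp add: c2_def)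
  qed
  have bi: "integrable lborel (\<lambda>y. bump (y - m))" "(LINT y|lborel. bump (y - m)) = (LINT y|lborel. bump y)"
    "integrable lborel (\<lambda>y. bump' (y - m))" "(LINT y|lborel. bump' (y - m)) = 0" for m
    using lborel_integrable_real_affine[OF bump_integrable, of 1 "-m"] lborel_integrable_real_affine[OF bump'_integral(1), of 1 "-m"]
      lborel_integral_real_affine[of 1 bump "-m"] lborel_integral_real_affine[of 1 bump' "-m"] bump'_integral(2)
    by (simp_all add: add.commute)
  \<comment> \<open>Centred at -2, the bump meets only the left state: the flux is constant there
    and drops out, leaving the source. The centre 2 does the same for the right state, and the
    centre 0 then sees the jump of the flux alone.\<close>
  show gm: "g um = 0"
  proof -
    have "(\<lambda>y. (f (U0 y) - \<sigma> * U0 y) * bump' (y - (-2)) + g (U0 y) * bump (y - (-2))) = (\<lambda>y. (f um - \<sigma> * um) * bump' (y - (-2)) + g um * bump (y - (-2)))"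
      by (auto simp: U0_def bump_outside)
    then have "(LINT y|lborel. (f um - \<sigma> * um) * bump' (y - (-2)) + g um * bump (y - (-2))) = 0" using key[of "-2"] by simp
    then show ?thesis using bi[of "-2"] bump_integral_pos by simp
  qed
  show gp: "g up = 0"
  proof -
    have "(\<lambda>y. (f (U0 y) - \<sigma> * U0 y) * bump' (y - 2) + g (U0 y) * bump (y - 2)) = (\<lambda>y. (f up - \<sigma> * up) * bump' (y - 2) + g up * bump (y - 2))"
      by (auto simp: U0_def bump_outside)
    then have "(LINT y|lborel. (f up - \<sigma> * up) * bump' (y - 2) + g up * bump (y - 2)) = 0" using key[of 2] by simp
    then show ?thesis using bi[of 2] bump_integral_pos by simp
  qed
  have "(\<lambda>y. (f (U0 y) - \<sigma> * U0 y) * bump' (y - 0) + g (U0 y) * bump (y - 0))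
      = (\<lambda>y. ((f um - \<sigma> * um) - (f up - \<sigma> * up)) * (indicator {..<0} y * bump' y) + (f up - \<sigma> * up) * bump' y)"
    using gm gp by (auto simp: U0_def algebra_simps)
  then have "(LINT y|lborel. ((f um - \<sigma> * um) - (f up - \<sigma> * up)) * (indicator {..<0} y * bump' y) + (f up - \<sigma> * up) * bump' y) = 0"
    using key[of 0] by simp
  then have "(f um - \<sigma> * um) - (f up - \<sigma> * up) = 0"
    using bump_half_integral bump'_integral by simp
  then show "f um - f up = \<sigma> * (um - up)" by (simp add: algebra_simps)
qed

text \<open>Characteristics reaching one side of the shock may start slightly beyond 0, so the data
  need a \<open>C1\<close> extension. The reflection \<open>2 * e 0 - v (- x)\<close> keeps the
  derivative continuous, by making it even; uniform continuity of \<open>v'\<close> supplies its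
  limit at 0. The bound \<open>3 * b\<close> is \<open>2 * b\<close> for the doubled endpoint value
  plus \<open>b\<close>.\<close>

lemma odd_reflection_extension:
  fixes v v' :: "real \<Rightarrow> real"
  assumes v: "\<And>x. 0 < x \<Longrightarrow> (v has_real_derivative v' x) (at x)"
    and uc: "uniformly_continuous_on {0<..} v'"
    and b: "\<And>x. 0 < x \<Longrightarrow> \<bar>v x - u\<bar> \<le> b" "\<And>x. 0 < x \<Longrightarrow> \<bar>v' x\<bar> \<le> b"
  obtains e e' where "\<And>x. (e has_real_derivative e' x) (at x)" "continuous_on UNIV e'"
    "\<And>x. 0 < x \<Longrightarrow> e x = v x" "\<And>x. 0 < x \<Longrightarrow> e' x = v' x"
    "\<And>x. \<bar>e x - u\<bar> \<le> 3 * b" "\<And>x. \<bar>e' x\<bar> \<le> b"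
proof -
  obtain g where g: "uniformly_continuous_on (closure {0<..}) g" and gv: "\<And>x. x \<in> {0<..} \<Longrightarrow> v' x = g x"
    using uniformly_continuous_on_extension_on_closure[OF uc] by metis
  have cg: "continuous_on {0..} g" using uniformly_continuous_imp_continuous[OF g] by simp
  have gb: "\<bar>g x\<bar> \<le> b" if "0 \<le> x" for x
  proof -
    have "closed {y \<in> {0..}. \<bar>g y\<bar> \<le> b}"
      by (intro continuous_on_closed_Collect_le continuous_intros cg)
    moreover have "{0<..} \<subseteq> {y \<in> {0..}. \<bar>g y\<bar> \<le> b}" using b(2) gv by force
    ultimately have "closure {0<..} \<subseteq> {y \<in> {0..}. \<bar>g y\<bar> \<le> b}" by (rule closure_minimal[rotated])
    then show ?thesis using that by auto
  qed
  define e' where "e' x = g \<bar>x\<bar>" for x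
  have e'c: "continuous_on UNIV e'" unfolding e'_def[abs_def]
    by (rule continuous_on_compose2[OF cg]) (auto intro!: continuous_intros)
  have e'b: "\<bar>e' x\<bar> \<le> b" for x using gb[of "\<bar>x\<bar>"] by (simp add: e'_def)
  define F where "F x = integral {0..x} e'" for x
  have FD: "(F has_real_derivative e' x) (at x within {0..})" if x: "0 \<le> x" for x
  proof -
    have "(F has_real_derivative e' x) (at x within {0..x+1})" unfolding F_def
      by (rule integral_has_real_derivative[OF continuous_on_subset[OF e'c]]) (use x in auto)
    moreover have "at x within {0..x+1} = at x within {0..}"
      by (rule at_within_nhd[of _ "{..<x+1}"]) auto
    ultimately show ?thesis by simp
  qed
  have F0: "F 0 = 0" by (simp add: F_def)
  define c where "c = v 1 - F 1"
  define e where "e x = (if 0 \<le> x then c + F x else c - F (- x))" for x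
  have right: "(e has_real_derivative e' x) (at x within {0..})" if "0 \<le> x" for x
  proof -
    have "((\<lambda>x. c + F x) has_real_derivative e' x) (at x within {0..})"
      using DERIV_add[OF DERIV_const FD[OF that], of c] by simp
    then show ?thesis
      by (rule has_field_derivative_transform_within[OF _ zero_less_one]) (use that in \<open>auto simp: e_def\<close>)
  qed
  have left: "(e has_real_derivative e' x) (at x within {..0})" if "x \<le> 0" for x
  proof -
    have "(F has_real_derivative e' x) (at (- x) within uminus ` {..0})"
      using FD[of "- x"] that by (simp add: e'_def)
    from DERIV_image_chain[OF this DERIV_minus[OF DERIV_ident]]
    have "((\<lambda>x. c - F (- x)) has_real_derivative e' x) (at x within {..0})"
      using DERIV_diff[OF DERIV_const[of c]] by (fastforce simp: o_def)
    then show ?thesis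
      by (rule has_field_derivative_transform_within[OF _ zero_less_one]) (use that F0 in \<open>auto simp: e_def\<close>)
  qed
  have eD: "(e has_real_derivative e' x) (at x)" for x
  proof -
    consider "0 < x" | "x = 0" | "x < 0" by linarith
    then show ?thesis
    proof cases
      case 1
      have "at x within {0..} = at x" by (rule at_within_interior) (use 1 in simp)
      then show ?thesis using right[of x] 1 by simp
    next
      case 2
      have "(e has_real_derivative e' x) (at x within ({0..} \<union> {..0}))"
        using right[of x] left[of x] 2 unfolding has_field_derivative_iff by (intro Lim_Un) auto
      moreover have "{0..} \<union> {..0} = (UNIV :: real set)" by auto
      ultimately show ?thesis by simp
    next
      case 3
      have "at x within {..0} = at x" by (rule at_within_interior) (use 3 in simp)
      then show ?thesis using left[of x] 3 by simp
    qed
  qed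
  have ev: "e x = v x" if "0 < x" for x
  proof -
    have "\<exists>k. \<forall>x\<in>{0<..}. e x - v x = k"
    proof (rule has_field_derivative_zero_constant)
      fix x :: real assume x: "x \<in> {0<..}"
      have "((\<lambda>x. e x - v x) has_real_derivative e' x - v' x) (at x)"
        by (rule DERIV_diff[OF eD v]) (use x in simp)
      moreover have "e' x - v' x = 0" using gv[OF x] x by (simp add: e'_def)
      ultimately show "((\<lambda>x. e x - v x) has_real_derivative 0) (at x within {0<..})"
        by (simp only: has_field_derivative_at_within)
    qed simp
    moreover have "e 1 = v 1" by (simp add: e_def c_def)
    ultimately show ?thesis using that by (metis cancel_comm_monoid_add_class.diff_cancel eq_iff_diff_eq_0 greaterThan_iff zero_less_one)
  qed
  have eb: "\<bar>e x - u\<bar> \<le> b" if "0 < x" for x using b(1)[OF that] ev[OF that] by simp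
  have e0: "\<bar>e 0 - u\<bar> \<le> b"
  proof -
    have "((\<lambda>x. \<bar>e x - u\<bar>) \<longlongrightarrow> \<bar>e 0 - u\<bar>) (at_right 0)"
      using DERIV_isCont[OF eD[of 0]] by (intro tendsto_intros) (simp add: isCont_def filterlim_at_split)
    moreover have "\<forall>\<^sub>F x in at_right 0. \<bar>e x - u\<bar> \<le> b"
      unfolding eventually_at by (rule exI[of _ 1]) (use eb in auto)
    ultimately show ?thesis by (intro tendsto_upperbound[of _ _ "at_right 0"]) auto
  qed
  have "\<bar>e x - u\<bar> \<le> 3 * b" for x
  proof -
    consider "0 < x" | "x = 0" | "x < 0" by linarith
    then show ?thesis
    proof cases
      case 3
      have "e x = 2 * e 0 - e (- x)" using 3 F0 by (simp add: e_def)
      then show ?thesis using eb[of "- x"] e0 3 by simp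
    qed (use eb[of x] e0 in auto)
  qed
  with that eD e'c ev e'b gv show thesis by (metis abs_of_pos e'_def greaterThan_iff)
qed

section \<open>Branches issued from perturbed data\<close>

definition C1_near :: "real \<Rightarrow> (real \<Rightarrow> real) \<Rightarrow> (real \<Rightarrow> real) \<Rightarrow> (real \<Rightarrow> real) \<Rightarrow> bool" where
  "C1_near u b e e' \<longleftrightarrow> (\<forall>x. (e has_real_derivative e' x) (at x)) \<and> continuous_on UNIV e' \<and>
     (\<forall>x. \<bar>e x - u\<bar> \<le> b x \<and> \<bar>e' x\<bar> \<le> b x)"

text \<open>The shift \<open>z - \<xi>\<close> accounts for the displacement of the characteristics.\<close>

definition solution_branch ::
    "(real \<Rightarrow> real) \<Rightarrow> (real \<Rightarrow> real) \<Rightarrow> real \<Rightarrow> real set \<Rightarrow> real \<Rightarrow> (real \<Rightarrow> real \<Rightarrow> real) \<Rightarrow> (real \<Rightarrow> real) \<Rightarrow>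
     (real \<times> real \<Rightarrow> real) \<Rightarrow> (real \<times> real \<Rightarrow> real) \<Rightarrow> (real \<times> real \<Rightarrow> real) \<Rightarrow> bool" where
  "solution_branch f' g \<sigma> S u b e w wt wx \<longleftrightarrow>
     C1_on {p. - 1 < fst p \<and> snd p - \<sigma> * fst p \<in> S} w wt wx \<and> (\<forall>p. wt p + f' (w p) * wx p = g (w p)) \<and>
     (\<forall>t>-1. \<forall>\<xi>\<in>S. \<exists>z. \<bar>z - \<xi>\<bar> \<le> 1/2 \<and> \<bar>w (t, \<sigma> * t + \<xi>) - u\<bar> \<le> b t z \<and> \<bar>wx (t, \<sigma> * t + \<xi>)\<bar> \<le> b t z) \<and>
     (\<forall>\<xi>\<in>S. w (0, \<xi>) = e \<xi>)"

text \<open>The function \<open>m\<close> is the profile of the data. The second bound in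
  \<open>m\<close> is the decisive one: transported along the straight line with speed
  \<open>a\<close> and amplified by \<open>exp (l * t)\<close>, the profile must remain bounded, and
  then smallness of \<open>E\<close> is enough for all times.\<close>

lemma side_branch:
  fixes f' f'' g g' g'' :: "real \<Rightarrow> real" and m :: "real \<Rightarrow> real" and S S' :: "real set"
  assumes f': "\<And>x. (f' has_real_derivative f'' x) (at x)"
    and g: "\<And>x. (g has_real_derivative g' x) (at x)" "\<And>x. (g' has_real_derivative g'' x) (at x)"
    and u: "g u = 0" "g' u = l" "l \<noteq> 0" and a: "a = f' u - \<sigma>"
    and S: "open S" "convex S" and S': "open S'" "\<And>\<xi>. \<xi> \<in> S' \<Longrightarrow> \<xi> - 1/2 \<in> S \<and> \<xi> + 1/2 \<in> S"
    and m: "\<And>x. m x \<le> M" "\<And>t z. - 1 < t \<Longrightarrow> z \<in> S \<Longrightarrow> exp (l * t) * m (z - a * t) \<le> M"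
  obtains \<delta> where "0 < \<delta>" "\<And>E e e'. 0 \<le> E \<Longrightarrow> E \<le> \<delta> \<Longrightarrow> C1_near u (\<lambda>x. E * m x) e e' \<Longrightarrow>
     \<exists>w wt wx. solution_branch f' g \<sigma> S' u (\<lambda>t z. 8 * E * (exp (l * t) * m (z - a * t))) e w wt wx"
proof -
  obtain r \<eta> W W' A A' B h h' where r: "0 < r" "0 < \<eta>"
    and W: "\<And>y. \<bar>y\<bar> < r \<Longrightarrow> (W has_real_derivative W' y) (at y)" "continuous_on {-r<..<r} W'"
    and A: "\<And>y. \<bar>y\<bar> < r \<Longrightarrow> (A has_real_derivative A' y) (at y)" "continuous_on {-r<..<r} A'"
    and W'2: "\<And>y. \<bar>y\<bar> < r \<Longrightarrow> \<bar>W' y\<bar> \<le> 2" and A'B: "\<And>y. \<bar>y\<bar> < r \<Longrightarrow> \<bar>A' y\<bar> \<le> B"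
    and Wg: "\<And>y. \<bar>y\<bar> < r \<Longrightarrow> l * y * W' y = g (W y)" and Ac: "\<And>y. \<bar>y\<bar> < r \<Longrightarrow> l * y * A' y = f' (W y) - f' u"
    and W0: "W 0 = u"
    and h: "\<And>x. \<bar>x - u\<bar> < \<eta> \<Longrightarrow> (h has_real_derivative h' x) (at x)" "continuous_on {u-\<eta><..<u+\<eta>} h'"
    and hb: "\<And>x. \<bar>x - u\<bar> < \<eta> \<Longrightarrow> \<bar>h x\<bar> \<le> 2 * \<bar>x - u\<bar>" "\<And>x. \<bar>x - u\<bar> < \<eta> \<Longrightarrow> \<bar>h' x\<bar> \<le> 2"
    and hr: "\<And>x. \<bar>x - u\<bar> < \<eta> \<Longrightarrow> \<bar>h x\<bar> < r" and Wh: "\<And>x. \<bar>x - u\<bar> < \<eta> \<Longrightarrow> W (h x) = x"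
    by (rule linearization[OF g f' u]) (rule that)
  have B0: "0 \<le> B" using A'B[of 0] r by auto
  have cf': "continuous_on UNIV f'" and cg: "continuous_on UNIV g"
    using f' g(1) by (meson DERIV_isCont continuous_at_imp_continuous_on)+
  define M1 where "M1 = max M 1"
  \<comment> \<open>The three terms keep the data in the domain of \<open>h\<close>, the linear
    variable in the domain of \<open>W\<close> and \<open>A\<close>, and the displacement and
    compression of characteristics below 1/4.\<close>
  define \<delta> where "\<delta> = min (\<eta> / (2 * M1)) (min (r / (4 * M1)) (1 / (8 * (B + 1) * M1)))"
  have M1: "0 < M1" "M \<le> M1" by (auto simp: M1_def)
  have \<delta>0: "0 < \<delta>" using M1 r B0 by (simp add: \<delta>_def)
  have \<delta>: "E * M1 < \<eta>" "2 * (E * M1) < r" "B * (2 * (E * M1)) \<le> 1/4" if E: "0 \<le> E" "E \<le> \<delta>" for E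
  proof -
    have "E \<le> \<eta> / (2 * M1)" "E \<le> r / (4 * M1)" "E \<le> 1 / (8 * (B + 1) * M1)" using E by (auto simp: \<delta>_def)
    moreover have "0 < 8 * (B + 1) * M1" using M1 B0 by simp
    ultimately have "E * M1 \<le> \<eta> / 2" "E * M1 \<le> r / 4" "E * (8 * (B + 1) * M1) \<le> 1"
      using M1 by (simp_all add: pos_le_divide_eq mult_ac)
    then have *: "E * M1 \<le> \<eta> / 2" "E * M1 \<le> r / 4" "(B + 1) * (E * M1) \<le> 1 / 8"
      by (simp_all add: algebra_simps)
    then show "E * M1 < \<eta>" "2 * (E * M1) < r" using r by linarith+
    have "0 \<le> E * M1" using E M1 by simp
    then show "B * (2 * (E * M1)) \<le> 1/4" using *(3) by (simp add: algebra_simps)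
  qed
  show thesis
  proof (rule that[OF \<delta>0])
    fix E :: real and e e' :: "real \<Rightarrow> real"
    assume E: "0 \<le> E" "E \<le> \<delta>" and "C1_near u (\<lambda>x. E * m x) e e'"
    then have e: "\<And>x. (e has_real_derivative e' x) (at x)" "continuous_on UNIV e'"
      and eb: "\<And>x. \<bar>e x - u\<bar> \<le> E * m x" "\<And>x. \<bar>e' x\<bar> \<le> E * m x" by (simp_all add: C1_near_def)
    have EM: "E * x \<le> E * M1" if "x \<le> M" for x using E(1) M1 that by (intro mult_left_mono) auto
    have e\<eta>: "\<bar>e x - u\<bar> < \<eta>" for x using eb(1)[of x] EM[OF m(1)[of x]] \<delta>(1)[OF E] by linarith
    define y0 y0' where "y0 x = h (e x)" and "y0' x = h' (e x) * e' x" for x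
    have y0D: "(y0 has_real_derivative y0' x) (at x)" for x
      unfolding y0_def[abs_def] y0'_def by (rule DERIV_chain2[OF h(1)[OF e\<eta>] e(1)])
    have ce: "continuous_on UNIV e" using e(1) by (meson DERIV_isCont continuous_at_imp_continuous_on)
    have in\<eta>: "e x \<in> {u-\<eta><..<u+\<eta>}" for x using e\<eta>[of x] unfolding greaterThanLessThan_iff by linarith
    have y0'c: "continuous_on UNIV y0'"
      unfolding y0'_def[abs_def] by (intro continuous_intros e(2) continuous_on_compose2[OF h(2) ce]) (use in\<eta> in auto)
    have yb: "\<bar>y0 x\<bar> \<le> 2 * (E * m x)" "\<bar>y0' x\<bar> \<le> 2 * (E * m x)" for x
    proof -
      show "\<bar>y0 x\<bar> \<le> 2 * (E * m x)" using hb(1)[OF e\<eta>, of x] eb(1)[of x] by (simp add: y0_def)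
      show "\<bar>y0' x\<bar> \<le> 2 * (E * m x)" unfolding y0'_def abs_mult
        using hb(2)[OF e\<eta>, of x] eb(2)[of x] by (intro mult_mono) auto
    qed
    have yb': "\<bar>exp (l * t) * y0 x\<bar> \<le> 2 * (E * (exp (l * t) * m x))" "\<bar>exp (l * t) * y0' x\<bar> \<le> 2 * (E * (exp (l * t) * m x))" for t x
      using mult_left_mono[OF yb(1)[of x], of "exp (l * t)"] mult_left_mono[OF yb(2)[of x], of "exp (l * t)"] by (simp_all add: abs_mult mult_ac)
    have y1: "\<bar>exp (l * t) * y0 (z - a * t)\<bar> \<le> 2 * (E * M1)" "\<bar>exp (l * t) * y0' (z - a * t)\<bar> \<le> 2 * (E * M1)"
      if "- 1 < t" "z \<in> S" for t z
      using yb'[of t "z - a * t"] EM[OF m(2)[OF that]] by linarith+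
    have y2: "\<bar>y0 x\<bar> \<le> 2 * (E * M1)" "\<bar>y0' x\<bar> \<le> 2 * (E * M1)" for x
      using yb[of x] EM[OF m(1)[of x]] by linarith+
    have By: "B * y \<le> 1/4" if "y \<le> 2 * (E * M1)" for y
      using mult_left_mono[OF that B0] \<delta>(3)[OF E] by linarith
    obtain w wt wx where w: "C1_on {p. - 1 < fst p \<and> snd p - \<sigma> * fst p \<in> S'} w wt wx"
      "\<And>p. wt p + f' (w p) * wx p = g (w p)"
      "\<And>t \<xi>. - 1 < t \<Longrightarrow> \<xi> \<in> S' \<Longrightarrow> \<exists>z\<in>S. \<bar>z - \<xi>\<bar> \<le> 1/2 \<and> w (t, \<sigma> * t + \<xi>) = W (exp (l * t) * y0 (z - a * t))
        \<and> \<bar>wx (t, \<sigma> * t + \<xi>)\<bar> \<le> 4 * \<bar>exp (l * t) * y0' (z - a * t)\<bar>"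
      "\<And>\<xi>. \<xi> \<in> S' \<Longrightarrow> w (0, \<xi>) = W (y0 \<xi>)"
    proof (rule characteristics_solution[where a=a and \<sigma>=\<sigma>, OF W A W'2 A'B Wg _ cf' cg y0D y0'c S S'])
      show "l * y * A' y = f' (W y) - (a + \<sigma>)" if "\<bar>y\<bar> < r" for y using Ac[OF that] a by simp
      show "\<bar>exp (l * t) * y0 (z - a * t)\<bar> < r" if "- 1 < t" "z \<in> S" for t z
        using y1(1)[OF that] \<delta>(2)[OF E] by linarith
      show "\<bar>y0 (z - a * t)\<bar> < r" for t z using y2(1)[of "z - a * t"] \<delta>(2)[OF E] by linarith
      show "B * \<bar>exp (l * t) * y0 (z - a * t)\<bar> \<le> 1/4" "B * \<bar>exp (l * t) * y0' (z - a * t)\<bar> \<le> 1/4"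
        if "- 1 < t" "z \<in> S" for t z using By[OF y1(1)[OF that]] By[OF y1(2)[OF that]] by simp_all
      show "B * \<bar>y0 (z - a * t)\<bar> \<le> 1/4" "B * \<bar>y0' (z - a * t)\<bar> \<le> 1/4" for t z
        using By[OF y2(1)] By[OF y2(2)] by simp_all
    qed (assumption | rule that)+
    have "\<exists>z. \<bar>z - \<xi>\<bar> \<le> 1/2 \<and> \<bar>w (t, \<sigma> * t + \<xi>) - u\<bar> \<le> 8 * E * (exp (l * t) * m (z - a * t))
          \<and> \<bar>wx (t, \<sigma> * t + \<xi>)\<bar> \<le> 8 * E * (exp (l * t) * m (z - a * t))" if t: "- 1 < t" and \<xi>: "\<xi> \<in> S'" for t \<xi>
    proof -
      obtain z where z: "z \<in> S" "\<bar>z - \<xi>\<bar> \<le> 1/2" "w (t, \<sigma> * t + \<xi>) = W (exp (l * t) * y0 (z - a * t))"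
        "\<bar>wx (t, \<sigma> * t + \<xi>)\<bar> \<le> 4 * \<bar>exp (l * t) * y0' (z - a * t)\<bar>"
        using w(3)[OF t \<xi>] by blast
      define y where "y = exp (l * t) * y0 (z - a * t)"
      have yr: "\<bar>y\<bar> < r" using y1(1)[OF t z(1)] \<delta>(2)[OF E] by (simp add: y_def)
      have "norm (W y - W 0) \<le> 2 * norm (y - 0)"
      proof (rule field_differentiable_bound[of "{-\<bar>y\<bar>..\<bar>y\<bar>}"])
        fix x assume "x \<in> {-\<bar>y\<bar>..\<bar>y\<bar>}"
        then have "\<bar>x\<bar> < r" using yr by auto
        then show "(W has_real_derivative W' x) (at x within {-\<bar>y\<bar>..\<bar>y\<bar>})" "norm (W' x) \<le> 2"
          using W(1) W'2 by (auto intro: has_field_derivative_at_within)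
      qed auto
      then have "\<bar>w (t, \<sigma> * t + \<xi>) - u\<bar> \<le> 2 * \<bar>y\<bar>" by (simp add: z(3) W0 y_def)
      moreover have "0 \<le> E * (exp (l * t) * m (z - a * t))" using yb'(1)[of t "z - a * t"] by linarith
      \<comment> \<open>The constant 8 combines the factor 4 for \<open>wx\<close> with the factor 2
        lost by passing from the data to \<open>y0'\<close>; the bound for \<open>w\<close> itself
        needs only 4.\<close>
      ultimately show ?thesis
        using z yb'[of t "z - a * t"] by (intro exI[of _ z]) (auto simp: y_def)
    qed
    moreover have "w (0, \<xi>) = e \<xi>" if "\<xi> \<in> S'" for \<xi> using w(4)[OF that] Wh[OF e\<eta>] by (simp add: y0_def)
    ultimately show "\<exists>w wt wx. solution_branch f' g \<sigma> S' u (\<lambda>t z. 8 * E * (exp (l * t) * m (z - a * t))) e w wt wx"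
      using w(1,2) unfolding solution_branch_def by (intro exI[of _ w] exI[of _ wt] exI[of _ wx]) auto
  qed
qed

section \<open>Motion of the shock between two branches\<close>

lemma mean_slope_lipschitz:
  fixes c :: "real \<Rightarrow> real"
  assumes c: "continuous_on UNIV c" and L: "0 \<le> L" "\<And>a b. \<bar>a\<bar> \<le> M \<Longrightarrow> \<bar>b\<bar> \<le> M \<Longrightarrow> \<bar>c a - c b\<bar> \<le> L * \<bar>a - b\<bar>"
    and b: "\<bar>x\<bar> \<le> M" "\<bar>y\<bar> \<le> M" "\<bar>x'\<bar> \<le> M" "\<bar>y'\<bar> \<le> M"
  shows "\<bar>mean_slope c x y - mean_slope c x' y'\<bar> \<le> L * (\<bar>x - x'\<bar> + \<bar>y - y'\<bar>)"
proof -
  have i: "(\<lambda>\<theta>. c (x + \<theta> * (y - x))) integrable_on {0..1}" for x y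
    by (intro integrable_continuous_real continuous_on_compose2[OF c] continuous_intros) auto
  have seg: "\<bar>x + \<theta> * (y - x)\<bar> \<le> M" if "\<bar>x\<bar> \<le> M" "\<bar>y\<bar> \<le> M" "\<theta> \<in> {0..1}" for x y \<theta>
  proof -
    have "x + \<theta> * (y - x) = (1 - \<theta>) * x + \<theta> * y" by (simp add: algebra_simps)
    also have "\<bar>\<dots>\<bar> \<le> (1 - \<theta>) * \<bar>x\<bar> + \<theta> * \<bar>y\<bar>"
      using that(3) abs_triangle_ineq[of "(1 - \<theta>) * x" "\<theta> * y"] by (simp add: abs_mult)
    also have "\<dots> \<le> (1 - \<theta>) * M + \<theta> * M" using that by (intro add_mono mult_left_mono) auto
    finally show ?thesis by (simp add: algebra_simps)
  qed
  have "mean_slope c x y - mean_slope c x' y' = integral {0..1} (\<lambda>\<theta>. c (x + \<theta> * (y - x)) - c (x' + \<theta> * (y' - x')))"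
    unfolding mean_slope_def by (rule Henstock_Kurzweil_Integration.integral_diff[symmetric, OF i i])
  also have "norm \<dots> \<le> integral {0..1} (\<lambda>_::real. L * (\<bar>x - x'\<bar> + \<bar>y - y'\<bar>))"
  proof (rule integral_norm_bound_integral)
    fix \<theta> :: real assume \<theta>: "\<theta> \<in> {0..1}"
    have "(x + \<theta> * (y - x)) - (x' + \<theta> * (y' - x')) = (1 - \<theta>) * (x - x') + \<theta> * (y - y')" by (simp add: algebra_simps)
    also have "\<bar>\<dots>\<bar> \<le> (1 - \<theta>) * \<bar>x - x'\<bar> + \<theta> * \<bar>y - y'\<bar>"
      using \<theta> abs_triangle_ineq[of "(1 - \<theta>) * (x - x')" "\<theta> * (y - y')"] by (simp add: abs_mult)
    also have "\<dots> \<le> 1 * \<bar>x - x'\<bar> + 1 * \<bar>y - y'\<bar>" using \<theta> by (intro add_mono mult_right_mono) auto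
    finally have "\<bar>(x + \<theta> * (y - x)) - (x' + \<theta> * (y' - x'))\<bar> \<le> \<bar>x - x'\<bar> + \<bar>y - y'\<bar>" by simp
    from mult_left_mono[OF this L(1)] L(2)[OF seg[OF b(1,2) \<theta>] seg[OF b(3,4) \<theta>]]
    show "norm (c (x + \<theta> * (y - x)) - c (x' + \<theta> * (y' - x'))) \<le> L * (\<bar>x - x'\<bar> + \<bar>y - y'\<bar>)" by simp
  qed (auto intro!: Henstock_Kurzweil_Integration.integrable_diff i)
  finally show ?thesis by simp
qed

lemma mean_slope_bound:
  fixes c :: "real \<Rightarrow> real"
  assumes c: "continuous_on UNIV c" and F: "\<And>a. \<bar>a\<bar> \<le> M \<Longrightarrow> \<bar>c a\<bar> \<le> F" and b: "\<bar>x\<bar> \<le> M" "\<bar>y\<bar> \<le> M"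
  shows "\<bar>mean_slope c x y\<bar> \<le> F"
proof -
  have "norm (integral {0..1} (\<lambda>\<theta>. c (x + \<theta> * (y - x)))) \<le> integral {0..1} (\<lambda>_::real. F)"
  proof (rule integral_norm_bound_integral)
    show "(\<lambda>\<theta>. c (x + \<theta> * (y - x))) integrable_on {0..1}"
      by (intro integrable_continuous_real continuous_on_compose2[OF c] continuous_intros) auto
    fix \<theta> :: real assume \<theta>: "\<theta> \<in> {0..1}"
    have "x + \<theta> * (y - x) = (1 - \<theta>) * x + \<theta> * y" by (simp add: algebra_simps)
    also have "\<bar>\<dots>\<bar> \<le> (1 - \<theta>) * \<bar>x\<bar> + \<theta> * \<bar>y\<bar>"
      using \<theta> abs_triangle_ineq[of "(1 - \<theta>) * x" "\<theta> * y"] by (simp add: abs_mult)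
    also have "\<dots> \<le> (1 - \<theta>) * M + \<theta> * M" using b \<theta> by (intro add_mono mult_left_mono) auto
    finally have "\<bar>x + \<theta> * (y - x)\<bar> \<le> M" by (simp add: algebra_simps)
    then show "norm (c (x + \<theta> * (y - x))) \<le> F" using F by simp
  qed auto
  then show ?thesis by (simp add: mean_slope_def)
qed

lemma C1_on_section:
  assumes "C1_on S w wt wx" "(t, x) \<in> S"
  shows "((\<lambda>x. w (t, x)) has_real_derivative wx (t, x)) (at x)"
proof -
  have "((\<lambda>x. (t, x)) has_derivative (\<lambda>h. (0, h))) (at x)" by (auto intro!: derivative_eq_intros)
  from has_derivative_compose[OF this C1_on_D[OF assms]] show ?thesis
    by (simp add: has_field_derivative_def)
qed

lemma C1_on_along_curve:
  assumes w: "C1_on S w wt wx" and s: "(s has_real_derivative s') (at t within T)" and "(t, s t) \<in> S"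
  shows "((\<lambda>t. w (t, s t)) has_real_derivative wt (t, s t) + wx (t, s t) * s') (at t within T)"
proof -
  have "((\<lambda>t. (t, s t)) has_derivative (\<lambda>h. (h, s' * h))) (at t within T)"
    using s unfolding has_field_derivative_def by (intro has_derivative_Pair derivative_intros)
  from has_derivative_compose[OF this C1_on_D[OF w assms(3)]] show ?thesis
    unfolding has_field_derivative_def by (rule has_derivative_eq_rhs) (auto simp: algebra_simps)
qed

text \<open>Here \<open>q\<close> is a decay profile in time and \<open>c\<close> an amplitude. The
  bound of increments by the tail of \<open>q\<close> is what later provides the limit of
  \<open>\<psi>\<close>.\<close>

definition shock_path :: "real \<Rightarrow> (real \<Rightarrow> real) \<Rightarrow> (real \<Rightarrow> real) \<Rightarrow> (real \<Rightarrow> real) \<Rightarrow> (real \<Rightarrow> real) \<Rightarrow> bool" where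
  "shock_path c q \<psi> \<psi>1 \<psi>2 \<longleftrightarrow> \<psi> 0 = 0 \<and> (\<forall>t\<ge>0. (\<psi> has_real_derivative \<psi>1 t) (at t within {0..})) \<and>
     (\<forall>t\<ge>0. (\<psi>1 has_real_derivative \<psi>2 t) (at t within {0..})) \<and> continuous_on {0..} \<psi>2 \<and>
     (\<forall>t\<ge>0. \<bar>\<psi> t\<bar> \<le> 1/2 \<and> \<bar>\<psi>1 t\<bar> \<le> c * q t \<and> \<bar>\<psi>2 t\<bar> \<le> c * q t) \<and>
     (\<forall>a b. 0 \<le> a \<and> a \<le> b \<longrightarrow> \<bar>\<psi> b - \<psi> a\<bar> \<le> c * (LINT s:{a..}|lborel. q s))"

text \<open>The two branches are smooth across the shock, so its position solves an ordinary differential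
  equation given by the Rankine-Hugoniot condition. The position is clipped in the equation so that the
  vector field is globally defined; the bounds show afterwards that clipping is inactive.\<close>

lemma shock_front:
  fixes f f' f'' g g' q :: "real \<Rightarrow> real"
  assumes f: "\<And>x. (f has_real_derivative f' x) (at x)" "\<And>x. (f' has_real_derivative f'' x) (at x)" "continuous_on UNIV f''"
    and g: "\<And>x. (g has_real_derivative g' x) (at x)" "continuous_on UNIV g'"
    and g0: "g um = 0" "g up = 0"
    and ne: "um \<noteq> up" and rh: "f um - f up = \<sigma> * (um - up)" and lax: "\<sigma> < f' um" "f' up < \<sigma>"
    and ol: "\<And>v. min um up < v \<Longrightarrow> v < max um up \<Longrightarrow> (f v - f up) / (v - up) < (f v - f um) / (v - um)"
    and q: "\<And>t. 0 \<le> t \<Longrightarrow> 0 \<le> q t" "\<And>t. 0 \<le> t \<Longrightarrow> q t \<le> Q" "set_integrable lborel {0..} q"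
  obtains C e0 where "0 < C" "0 < e0"
    "\<And>e wl wlt wlx wr wrt wrx. 0 \<le> e \<Longrightarrow> e \<le> e0 \<Longrightarrow>
      C1_on {p. - 1 < fst p} wl wlt wlx \<Longrightarrow> C1_on {p. - 1 < fst p \<and> - 1 < snd p - \<sigma> * fst p} wr wrt wrx \<Longrightarrow>
      (\<forall>p. wlt p + f' (wl p) * wlx p = g (wl p)) \<Longrightarrow> (\<forall>p. wrt p + f' (wr p) * wrx p = g (wr p)) \<Longrightarrow>
      (\<forall>t\<ge>0. \<forall>x. \<bar>wl (t, x) - um\<bar> \<le> e * q t \<and> \<bar>wlx (t, x)\<bar> \<le> e * q t) \<Longrightarrow>
      (\<forall>t\<ge>0. \<forall>\<xi>\<ge>- (3/4). \<bar>wr (t, \<sigma> * t + \<xi>) - up\<bar> \<le> e * q t \<and> \<bar>wrx (t, \<sigma> * t + \<xi>)\<bar> \<le> e * q t) \<Longrightarrow>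
      \<exists>\<psi> \<psi>1 \<psi>2. shock_path (C * e) q \<psi> \<psi>1 \<psi>2 \<and>
        (\<forall>u0. (AE x in lborel. (if x < 0 then wl (0, x) else wr (0, x)) = u0 x) \<longrightarrow>
           the_entropy_solution f g u0 (\<lambda>t x. if x < \<sigma> * t + \<psi> t then wl (t, x) else wr (t, x)))"
proof -
  have cf': "continuous_on UNIV f'" and cf: "continuous_on UNIV f"
    using f by (meson DERIV_isCont continuous_at_imp_continuous_on)+
  obtain \<eta> where \<eta>: "0 < \<eta>" and \<eta>k: "\<And>l r k. \<bar>l - um\<bar> < \<eta> \<Longrightarrow> \<bar>r - up\<bar> < \<eta> \<Longrightarrow>
      sgn (k - r) * (f k - f r) - sgn (k - l) * (f k - f l) - (f l - f r) / (l - r) * (\<bar>k - r\<bar> - \<bar>k - l\<bar>) \<le> 0"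
    using oleinik_stable[OF f(1) cf' ne rh lax ol] by metis
  define d0 where "d0 = \<bar>um - up\<bar> / 2"
  have d0: "0 < d0" using ne by (simp add: d0_def)
  \<comment> \<open>The original jump is \<open>2 * d0\<close>. Moving each state by at most
    \<open>d0 / 2\<close> leaves a jump of at least \<open>d0\<close>, which bounds the denominators
    in the shock speed from below; the bound 1 keeps both states in \<open>{-M..M}\<close>.\<close>
  define \<eta>1 where "\<eta>1 = min \<eta> (min (d0 / 2) 1)"
  have \<eta>1: "0 < \<eta>1" "\<eta>1 \<le> \<eta>" "\<eta>1 \<le> d0 / 2" "\<eta>1 \<le> 1" using \<eta> d0 by (auto simp: \<eta>1_def)
  define M where "M = \<bar>um\<bar> + \<bar>up\<bar> + 1"
  have near: "\<bar>l\<bar> \<le> M \<and> \<bar>r\<bar> \<le> M \<and> d0 \<le> \<bar>l - r\<bar> \<and> l \<noteq> r" if "\<bar>l - um\<bar> < \<eta>1" "\<bar>r - up\<bar> < \<eta>1" for l r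
  proof -
    have "\<bar>l\<bar> \<le> M" "\<bar>r\<bar> \<le> M" using that \<eta>1(4) unfolding M_def by linarith+
    moreover have "\<bar>um - up\<bar> = 2 * d0" by (simp add: d0_def)
    then have "d0 \<le> \<bar>l - r\<bar>" using that \<eta>1(3) by linarith
    ultimately show ?thesis using d0 by auto
  qed
  obtain L where L: "0 \<le> L" "\<And>a b. \<bar>a\<bar> \<le> M \<Longrightarrow> \<bar>b\<bar> \<le> M \<Longrightarrow> \<bar>f' a - f' b\<bar> \<le> L * \<bar>a - b\<bar>"
    using C1_Lipschitz_on_interval[OF f(2,3)] by metis
  obtain N where N: "0 \<le> N" "\<And>a b. \<bar>a\<bar> \<le> M \<Longrightarrow> \<bar>b\<bar> \<le> M \<Longrightarrow> \<bar>g a - g b\<bar> \<le> N * \<bar>a - b\<bar>"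
    using C1_Lipschitz_on_interval[OF g] by metis
  obtain F where F0: "0 < F" and F: "\<And>a. \<bar>a\<bar> \<le> M \<Longrightarrow> \<bar>f' a\<bar> \<le> F"
  proof -
    have "bounded (f' ` {-M..M})"
      by (intro compact_imp_bounded compact_continuous_image continuous_on_subset[OF cf']) auto
    then obtain F where "0 < F" "\<And>a. a \<in> {-M..M} \<Longrightarrow> \<bar>f' a\<bar> \<le> F" unfolding bounded_pos by auto
    then show thesis using that[of F] by (auto simp: abs_le_iff)
  qed
  define Sl where "Sl l r = (f l - f r) / (l - r)" for l r
  have SlD: "Sl l r = mean_slope f' r l" if "l \<noteq> r" for l r
    using mean_slope_quotient[OF f(1), of r l] that by (simp add: Sl_def)
  have Sl_lip: "\<bar>Sl l r - Sl l' r'\<bar> \<le> L * (\<bar>l - l'\<bar> + \<bar>r - r'\<bar>)"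
    if "\<bar>l - um\<bar> < \<eta>1" "\<bar>r - up\<bar> < \<eta>1" "\<bar>l' - um\<bar> < \<eta>1" "\<bar>r' - up\<bar> < \<eta>1" for l r l' r'
    using mean_slope_lipschitz[OF cf' L, where x=r and y=l and x'=r' and y'=l'] near[OF that(1,2)] near[OF that(3,4)]
    by (simp add: SlD add.commute)
  have Sl_F: "\<bar>Sl l r\<bar> \<le> F" if "\<bar>l - um\<bar> < \<eta>1" "\<bar>r - up\<bar> < \<eta>1" for l r
    using mean_slope_bound[OF cf' F, where x=r and y=l] near[OF that] by (simp add: SlD)
  have Sl\<sigma>: "Sl um up = \<sigma>" using rh ne by (simp add: Sl_def)
  define Qi where "Qi = (LINT s:{0..}|lborel. q s)"
  have Qi: "0 \<le> Qi" unfolding Qi_def set_lebesgue_integral_def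
    by (intro integral_nonneg_AE AE_I2) (use q(1) in \<open>auto simp: indicator_def\<close>)
  have Q0: "0 \<le> Q" using q(1,2)[of 0] by simp
  \<comment> \<open>The first term keeps the branches within \<open>\<eta>1\<close> of the end
    states. The second makes the mass \<open>2 * L * e * Qi\<close> of the Lipschitz rate at most
    1/2, as \<open>integrable_lipschitz_ode\<close> demands.\<close>
  define e0 where "e0 = min (\<eta>1 / (2 * (Q + 1))) (1 / (4 * (L + 1) * (Qi + 1)))"
  have e0: "0 < e0" using \<eta>1 Q0 L(1) Qi by (simp add: e0_def)
  \<comment> \<open>\<open>2 * L\<close> serves for the velocity and the increments, the quotient by
    \<open>d0\<close> for the acceleration; adding 1 makes the constant positive.\<close>
  define C where "C = 2 * L + 4 * F * (N + 2 * F) / d0 + 1"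
  have Cpos: "0 < C" "2 * L \<le> C" "4 * F * (N + 2 * F) / d0 \<le> C"
    using L(1) F0 N(1) d0 by (auto simp: C_def add_nonneg_pos add_nonneg_nonneg)
  show thesis
  proof (rule that[OF Cpos(1) e0])
    fix e wl wlt wlx wr wrt wrx
    assume e: "0 \<le> e" "e \<le> e0"
      and wl: "C1_on {p. - 1 < fst p} wl wlt wlx" and wr: "C1_on {p. - 1 < fst p \<and> - 1 < snd p - \<sigma> * fst p} wr wrt wrx"
      and pde: "\<forall>p. wlt p + f' (wl p) * wlx p = g (wl p)" "\<forall>p. wrt p + f' (wr p) * wrx p = g (wr p)"
      and bl': "\<forall>t\<ge>0. \<forall>x. \<bar>wl (t, x) - um\<bar> \<le> e * q t \<and> \<bar>wlx (t, x)\<bar> \<le> e * q t"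
      and br': "\<forall>t\<ge>0. \<forall>\<xi>\<ge>- (3/4). \<bar>wr (t, \<sigma> * t + \<xi>) - up\<bar> \<le> e * q t \<and> \<bar>wrx (t, \<sigma> * t + \<xi>)\<bar> \<le> e * q t"
    note pde_l = pde(1)[rule_format] and pde_r = pde(2)[rule_format]
      and bl = bl'[rule_format] and br0 = br'[rule_format]
    define DL DR where "DL = {p :: real \<times> real. - 1 < fst p}" and "DR = {p :: real \<times> real. - 1 < fst p \<and> - 1 < snd p - \<sigma> * fst p}"
    have br: "\<bar>wr (t, x) - up\<bar> \<le> e * q t \<and> \<bar>wrx (t, x)\<bar> \<le> e * q t" if "0 \<le> t" "\<sigma> * t - 3/4 \<le> x" for t x
      using br0[OF that(1), of "x - \<sigma> * t"] that(2) by simp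
    have eq_small: "e * q t < \<eta>1" "e * q t \<le> e * Q" if "0 \<le> t" for t
    proof -
      show 1: "e * q t \<le> e * Q" using q(2)[OF that] e by (intro mult_left_mono) auto
      have "e \<le> \<eta>1 / (2 * (Q + 1))" using e by (simp add: e0_def)
      then have "e * (2 * (Q + 1)) \<le> \<eta>1" using Q0 by (simp add: pos_le_divide_eq)
      then have "2 * (e * Q) + 2 * e \<le> \<eta>1" by (simp add: algebra_simps)
      moreover have "0 \<le> e * Q" using e Q0 by simp
      ultimately have "e * Q < \<eta>1" using e(1) \<eta>1(1) by linarith
      then show "e * q t < \<eta>1" using 1 by linarith
    qed
    have nl: "\<bar>wl (t, x) - um\<bar> < \<eta>1" if "0 \<le> t" for t x using bl[OF that, of x] eq_small[OF that] by linarith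
    have nr: "\<bar>wr (t, x) - up\<bar> < \<eta>1" if "0 \<le> t" "\<sigma> * t - 3/4 \<le> x" for t x using br[OF that] eq_small[OF that(1)] by linarith
    define cl where "cl p = max (-1/2) (min (1/2) p)" for p :: real
    have clb: "- 1/2 \<le> cl p" "cl p \<le> 1/2" and cl_lip: "\<bar>cl p - cl p'\<bar> \<le> \<bar>p - p'\<bar>" for p p'
      by (auto simp: cl_def max_def min_def)
    have cl_id: "cl p = p" if "\<bar>p\<bar> \<le> 1/2" for p using that by (auto simp: cl_def max_def min_def abs_le_iff)
    \<comment> \<open>The clipped shock stays within 1/2 of \<open>\<sigma> * t\<close>. Together
      with a layer of width 1/4 this explains why the right branch is controlled for
      \<open>\<xi> \<ge> - (3/4)\<close>.\<close>
    define X where "X t p = \<sigma> * t + cl p" for t p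
    have Xr: "\<sigma> * t - 3/4 \<le> X t p" "\<sigma> * t - 1/2 \<le> X t p" "X t p \<le> \<sigma> * t + 1/2" for t p using clb[of p] by (auto simp: X_def)
    have XD: "(t, X t p) \<in> DL" "(t, X t p) \<in> DR" if "0 \<le> t" for t p
      using that Xr(2)[where t=t and p=p] by (auto simp: DL_def DR_def)
    define V where "V t p = Sl (wl (t, X t p)) (wr (t, X t p)) - \<sigma>" for t p
    define \<beta> where "\<beta> t = 2 * L * e * q t" for t
    note nlr = nl nr[OF _ Xr(1)]
    have lipl: "\<bar>wl (t, x) - wl (t, x')\<bar> \<le> e * q t * \<bar>x - x'\<bar>" if "0 \<le> t" for t x x'
    proof -
      have "norm (wl (t, x) - wl (t, x')) \<le> (e * q t) * norm (x - x')"
        by (rule field_differentiable_bound[of UNIV "\<lambda>x. wl (t, x)" "\<lambda>x. wlx (t, x)"])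
           (use that(1) bl[OF that(1)] C1_on_section[OF wl, of t] in simp_all)
      then show ?thesis by simp
    qed
    have lipr: "\<bar>wr (t, x) - wr (t, x')\<bar> \<le> e * q t * \<bar>x - x'\<bar>" if "0 \<le> t" "\<sigma> * t - 3/4 \<le> x" "\<sigma> * t - 3/4 \<le> x'" for t x x'
    proof -
      have "norm (wr (t, x) - wr (t, x')) \<le> (e * q t) * norm (x - x')"
      proof (rule field_differentiable_bound[of "{\<sigma> * t - 3/4..}" "\<lambda>x. wr (t, x)" "\<lambda>x. wrx (t, x)"])
        fix z assume z: "z \<in> {\<sigma> * t - 3/4..}"
        then have z': "\<sigma> * t - 3/4 \<le> z" by (simp only: atLeast_iff)
        have "- 1 < t" "- 1 < z - \<sigma> * t" using that(1) z' by linarith+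
        then have "(t, z) \<in> {p. - 1 < fst p \<and> - 1 < snd p - \<sigma> * fst p}" by (simp only: mem_Collect_eq fst_conv snd_conv)
        then show "((\<lambda>x. wr (t, x)) has_real_derivative wrx (t, z)) (at z within {\<sigma> * t - 3/4..})"
          by (rule has_field_derivative_at_within[OF C1_on_section[OF wr]])
        show "norm (wrx (t, z)) \<le> e * q t" using br[OF that(1) z'] by simp
      qed (use that in auto)
      then show ?thesis by simp
    qed
    have Vb: "\<bar>V t p\<bar> \<le> \<beta> t" if "0 \<le> t" for t p
    proof -
      have "\<bar>V t p\<bar> \<le> L * (\<bar>wl (t, X t p) - um\<bar> + \<bar>wr (t, X t p) - up\<bar>)"
        unfolding V_def Sl\<sigma>[symmetric] by (rule Sl_lip) (use nlr[OF that] \<eta>1 in auto)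
      also have "\<dots> \<le> L * (e * q t + e * q t)"
        using bl[OF that] br[OF that Xr(1)] L(1) by (intro mult_left_mono add_mono) auto
      finally show ?thesis by (simp add: \<beta>_def)
    qed
    have Vl: "\<bar>V t p - V t p'\<bar> \<le> \<beta> t * \<bar>p - p'\<bar>" if t: "0 \<le> t" for t p p'
    proof -
      have eqn: "0 \<le> e * q t" using e q(1)[OF t] by simp
      have Xl: "\<bar>X t p - X t p'\<bar> \<le> \<bar>p - p'\<bar>" using cl_lip[of p p'] by (simp add: X_def)
      have "\<bar>V t p - V t p'\<bar> \<le> L * (\<bar>wl (t, X t p) - wl (t, X t p')\<bar> + \<bar>wr (t, X t p) - wr (t, X t p')\<bar>)"
        using Sl_lip[OF nlr(1)[OF t] nlr(2)[OF t] nlr(1)[OF t] nlr(2)[OF t], of "X t p" p "X t p'" p'] by (simp add: V_def)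
      also have "\<dots> \<le> L * (e * q t * \<bar>p - p'\<bar> + e * q t * \<bar>p - p'\<bar>)"
        using lipl[OF t, of "X t p" "X t p'"] lipr[OF t Xr(1) Xr(1), of p p'] mult_left_mono[OF Xl eqn] L(1)
        by (intro mult_left_mono add_mono) linarith+
      finally show ?thesis by (simp add: \<beta>_def algebra_simps)
    qed
    have \<beta>i: "set_integrable lborel {a..} \<beta>" if "0 \<le> a" for a
      unfolding \<beta>_def by (intro set_integrable_mult_right set_integrable_subset[OF q(3)]) (use that in auto)
    have \<beta>L: "(LINT t:{a..}|lborel. \<beta> t) = 2 * L * e * (LINT s:{a..}|lborel. q s)" for a
      unfolding \<beta>_def by (rule set_integral_mult_right)
    have \<beta>half: "(LINT t:{0..}|lborel. \<beta> t) \<le> 1/2"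
    proof -
      have "e \<le> 1 / (4 * (L + 1) * (Qi + 1))" using e by (simp add: e0_def)
      then have "e * (4 * (L + 1) * (Qi + 1)) \<le> 1" using L(1) Qi by (simp add: pos_le_divide_eq)
      moreover have "e * (L * Qi) \<le> e * ((L + 1) * (Qi + 1))"
        using e(1) L(1) Qi by (intro mult_left_mono mult_mono) auto
      moreover have "e * (4 * (L + 1) * (Qi + 1)) = 4 * (e * ((L + 1) * (Qi + 1)))" by (simp only: mult_ac)
      ultimately have "4 * (e * (L * Qi)) \<le> 1" by linarith
      then show ?thesis unfolding \<beta>L Qi_def[symmetric] by (simp add: mult_ac)
    qed
    have comp_cont: "continuous_on T (\<lambda>p. h (fst p, X (fst p) (snd p)))"
      if "continuous_on D h" "T \<subseteq> {0..} \<times> UNIV" "D = DL \<or> D = DR" for h :: "real \<times> real \<Rightarrow> real" and D T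
    proof (rule continuous_on_compose2[OF that(1)])
      show "continuous_on T (\<lambda>p. (fst p, X (fst p) (snd p)))"
        unfolding X_def cl_def by (intro continuous_intros)
      show "(\<lambda>p. (fst p, X (fst p) (snd p))) ` T \<subseteq> D"
      proof (rule image_subsetI)
        fix p assume "p \<in> T"
        then have "0 \<le> fst p" using that(2) by auto
        then show "(fst p, X (fst p) (snd p)) \<in> D" using XD[of "fst p" "snd p"] that(3) by blast
      qed
    qed
    have Vcont: "continuous_on ({0..} \<times> UNIV) (\<lambda>p. V (fst p) (snd p))"
    proof -
      have "continuous_on ({0..} \<times> UNIV) (\<lambda>p. wl (fst p, X (fst p) (snd p)))"
        "continuous_on ({0..} \<times> UNIV) (\<lambda>p. wr (fst p, X (fst p) (snd p)))"
        using comp_cont[OF C1_on_continuous(1)[OF wl]] comp_cont[OF C1_on_continuous(1)[OF wr]] by (auto simp: DL_def DR_def)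
      moreover have "wl (t, X t p) - wr (t, X t p) \<noteq> 0" if "0 \<le> t" for t p
        using near[OF nlr(1)[OF that] nlr(2)[OF that], of "X t p" p] by simp
      ultimately show ?thesis
        unfolding V_def Sl_def
        by (intro continuous_intros continuous_on_compose2[OF cf]) auto
    qed
    obtain \<psi> where \<psi>c: "continuous_on UNIV \<psi>" and \<psi>0: "\<psi> 0 = 0"
      and \<psi>D: "\<And>t. 0 \<le> t \<Longrightarrow> (\<psi> has_real_derivative V t (\<psi> t)) (at t within {0..})"
      and \<psi>i: "\<And>a b. 0 \<le> a \<Longrightarrow> a \<le> b \<Longrightarrow> \<bar>\<psi> b - \<psi> a\<bar> \<le> (LINT t:{a..}|lborel. \<beta> t)"
      and \<psi>b: "\<And>t. 0 \<le> t \<Longrightarrow> \<bar>\<psi> t\<bar> \<le> 1/2"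
      by (rule integrable_lipschitz_ode[OF Vcont Vb Vl \<beta>i[OF order_refl] \<beta>half]) (assumption | rule that)+
    define s where "s t = \<sigma> * t + \<psi> t" for t
    have Xs: "X t (\<psi> t) = s t" if "0 \<le> t" for t using cl_id[OF \<psi>b[OF that]] by (simp add: X_def s_def)
    define s1 where "s1 t = \<sigma> + V t (\<psi> t)" for t
    have s1: "s1 t = Sl (wl (t, s t)) (wr (t, s t))" if "0 \<le> t" for t by (simp add: s1_def V_def Xs[OF that])
    have sD: "(s has_real_derivative s1 t) (at t within {0..})" if "0 \<le> t" for t
      unfolding s_def[abs_def] s1_def by (auto intro!: derivative_eq_intros \<psi>D that)
    have sDL: "(t, s t) \<in> {p. - 1 < fst p}" "(t, s t) \<in> {p. - 1 < fst p \<and> - 1 < snd p - \<sigma> * fst p}"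
      and sr: "\<sigma> * t - 1/2 \<le> s t" if "0 \<le> t" for t
      using XD[OF that, of "\<psi> t"] Xr(2)[of t "\<psi> t"] Xs[OF that] by (auto simp: DL_def DR_def)
    have sr': "\<sigma> * t - 3/4 \<le> s t" if "0 \<le> t" for t using sr[OF that] by linarith
    have sc: "continuous_on UNIV s" unfolding s_def[abs_def] by (intro continuous_intros \<psi>c)
    define l r where "l t = wl (t, s t)" and "r t = wr (t, s t)" for t
    define l1 r1 where "l1 t = wlt (t, s t) + wlx (t, s t) * s1 t" and "r1 t = wrt (t, s t) + wrx (t, s t) * s1 t" for t
    have lrD: "(l has_real_derivative l1 t) (at t within {0..})" "(r has_real_derivative r1 t) (at t within {0..})" if "0 \<le> t" for t
      unfolding l_def[abs_def] r_def[abs_def] l1_def r1_def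
      by (rule C1_on_along_curve[OF wl sD[OF that] sDL(1)[OF that]] C1_on_along_curve[OF wr sD[OF that] sDL(2)[OF that]])+
    have lr: "\<bar>l t - um\<bar> < \<eta>1" "\<bar>r t - up\<bar> < \<eta>1" if "0 \<le> t" for t
      using nl[OF that] nr[OF that sr'[OF that]] by (auto simp: l_def r_def)
    note lr_near = near[OF lr]
    define \<psi>1 where "\<psi>1 t = V t (\<psi> t)" for t
    \<comment> \<open>The quotient rule for the shock speed, simplified by the Rankine-Hugoniot
      relation. It involves first derivatives of the branches only, so \<open>C1\<close> branches
      give a \<open>C2\<close> shock curve.\<close>
    define \<psi>2 where "\<psi>2 t = ((f' (l t) - s1 t) * l1 t - (f' (r t) - s1 t) * r1 t) / (l t - r t)" for t
    have \<psi>1eq: "\<psi>1 t = (f (l t) - f (r t)) / (l t - r t) - \<sigma>" if "0 \<le> t" for t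
      using s1[OF that] by (simp add: \<psi>1_def s1_def l_def r_def Sl_def)
    have \<psi>1D: "(\<psi>1 has_real_derivative \<psi>2 t) (at t within {0..})" if t: "0 \<le> t" for t
    proof -
      have nz: "l t - r t \<noteq> 0" using lr_near[OF t t] by simp
      have fl: "((\<lambda>t. f (l t)) has_real_derivative f' (l t) * l1 t) (at t within {0..})"
        "((\<lambda>t. f (r t)) has_real_derivative f' (r t) * r1 t) (at t within {0..})"
        using DERIV_chain2[OF f(1) lrD(1)[OF t]] DERIV_chain2[OF f(1) lrD(2)[OF t]] by auto
      have s1t: "s1 t = (f (l t) - f (r t)) / (l t - r t)" using s1[OF t] by (simp add: l_def r_def Sl_def)
      have "((\<lambda>t. (f (l t) - f (r t)) / (l t - r t) - \<sigma>) has_real_derivative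
         ((f' (l t) * l1 t - f' (r t) * r1 t) * (l t - r t) - (f (l t) - f (r t)) * (l1 t - r1 t)) / ((l t - r t) * (l t - r t)) - 0) (at t within {0..})"
        by (intro DERIV_diff DERIV_divide fl lrD t nz DERIV_const)
      also have "((f' (l t) * l1 t - f' (r t) * r1 t) * (l t - r t) - (f (l t) - f (r t)) * (l1 t - r1 t)) / ((l t - r t) * (l t - r t)) - 0 = \<psi>2 t"
      proof -
        have s1lr: "f (l t) - f (r t) = s1 t * (l t - r t)" using s1t nz by simp
        have "((f' (l t) * l1 t - f' (r t) * r1 t) * (l t - r t) - (f (l t) - f (r t)) * (l1 t - r1 t))
            = (((f' (l t) - s1 t) * l1 t - (f' (r t) - s1 t) * r1 t)) * (l t - r t)"
          unfolding s1lr by (simp add: algebra_simps)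
        then show ?thesis using nz by (simp add: \<psi>2_def)
      qed
      finally show ?thesis
        by (rule has_field_derivative_transform_within[OF _ zero_less_one]) (use t \<psi>1eq in auto)
    qed
    have cs: "continuous_on {0..} (\<lambda>t. (t, s t))" by (intro continuous_intros continuous_on_subset[OF sc]) auto
    have cont_l: "continuous_on {0..} (\<lambda>t. h (t, s t))" if "continuous_on {p. - 1 < fst p} h" for h :: "real \<times> real \<Rightarrow> real"
      by (rule continuous_on_compose2[OF that cs]) (intro image_subsetI sDL(1), simp)
    have cont_r: "continuous_on {0..} (\<lambda>t. h (t, s t))" if "continuous_on {p. - 1 < fst p \<and> - 1 < snd p - \<sigma> * fst p} h" for h :: "real \<times> real \<Rightarrow> real"
      by (rule continuous_on_compose2[OF that cs]) (intro image_subsetI sDL(2), simp)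
    have clr: "continuous_on {0..} l" "continuous_on {0..} r"
      unfolding l_def[abs_def] r_def[abs_def] by (intro cont_l cont_r C1_on_continuous(1)[OF wl] C1_on_continuous(1)[OF wr])+
    have cs1: "continuous_on {0..} s1"
    proof -
      have "continuous_on {0..} (\<lambda>t. (f (l t) - f (r t)) / (l t - r t))"
        using lr_near by (intro continuous_intros clr continuous_on_compose2[OF cf]) auto
      then show ?thesis by (rule continuous_on_eq) (use s1 in \<open>simp add: l_def r_def Sl_def\<close>)
    qed
    have c\<psi>2: "continuous_on {0..} \<psi>2"
    proof -
      have "continuous_on {0..} l1" "continuous_on {0..} r1"
        unfolding l1_def[abs_def] r1_def[abs_def]
        by (intro continuous_intros cs1 cont_l cont_r C1_on_continuous[OF wl] C1_on_continuous[OF wr])+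
      then show ?thesis unfolding \<psi>2_def[abs_def]
        using lr_near by (intro continuous_intros clr cs1 continuous_on_compose2[OF cf']) auto
    qed
    \<comment> \<open>The equation trades the time derivative for the source and the flux. The
      source costs \<open>N\<close> because \<open>g\<close> vanishes at the end state, the flux
      costs \<open>F\<close>, and transport with the shock costs another \<open>F\<close>.\<close>
    have one: "\<bar>wt\<bar> \<le> (N + F) * (e * q t) \<and> \<bar>wt + wx * s1 t\<bar> \<le> (N + 2 * F) * (e * q t)"
      if t: "0 \<le> t" and pde: "wt + f' w * wx = g w" and w: "\<bar>w\<bar> \<le> M" "\<bar>w - z\<bar> \<le> e * q t" and z: "g z = 0" "\<bar>z\<bar> \<le> M"
        and wx: "\<bar>wx\<bar> \<le> e * q t" for t wt w wx z
    proof -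
      have eqn: "0 \<le> e * q t" using e q(1)[OF t] by simp
      have "\<bar>g w\<bar> \<le> N * (e * q t)" using N(2)[OF w(1) z(2)] mult_left_mono[OF w(2) N(1)] z(1) by simp
      moreover have "\<bar>f' w * wx\<bar> \<le> F * (e * q t)" unfolding abs_mult using F[OF w(1)] wx F0 by (intro mult_mono) auto
      moreover have "\<bar>wx * s1 t\<bar> \<le> (e * q t) * F" unfolding abs_mult
        using wx Sl_F[OF lr[OF t]] eqn s1[OF t] by (intro mult_mono) (auto simp: l_def r_def)
      moreover have "wt = g w - f' w * wx" using pde by simp
      ultimately show ?thesis by (auto simp: algebra_simps abs_le_iff)
    qed
    have zM: "\<bar>um\<bar> \<le> M" "\<bar>up\<bar> \<le> M" by (auto simp: M_def)
    have \<psi>2b: "\<bar>\<psi>2 t\<bar> \<le> C * e * q t" if t: "0 \<le> t" for t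
    proof -
      have eqn: "0 \<le> e * q t" using e q(1)[OF t] by simp
      have l1: "\<bar>l1 t\<bar> \<le> (N + 2 * F) * (e * q t)" unfolding l1_def
        using one[OF t pde_l, of "(t, s t)" um] lr_near[OF t t] bl[OF t] g0 zM by (simp add: l_def)
      have r1: "\<bar>r1 t\<bar> \<le> (N + 2 * F) * (e * q t)" unfolding r1_def
        using one[OF t pde_r, of "(t, s t)" up] lr_near[OF t t] br[OF t sr'[OF t]] g0 zM by (simp add: r_def)
      have S: "\<bar>s1 t\<bar> \<le> F" using Sl_F[OF lr[OF t]] s1[OF t] by (simp add: l_def r_def)
      have "\<bar>f' (l t) - s1 t\<bar> \<le> 2 * F" "\<bar>f' (r t) - s1 t\<bar> \<le> 2 * F"
        using F[of "l t"] F[of "r t"] lr_near[OF t t] S by linarith+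
      then have "\<bar>(f' (l t) - s1 t) * l1 t\<bar> \<le> 2 * F * ((N + 2 * F) * (e * q t))" "\<bar>(f' (r t) - s1 t) * r1 t\<bar> \<le> 2 * F * ((N + 2 * F) * (e * q t))"
        unfolding abs_mult using l1 r1 F0 by (intro mult_mono; simp)+
      then have "\<bar>(f' (l t) - s1 t) * l1 t - (f' (r t) - s1 t) * r1 t\<bar> \<le> 4 * F * (N + 2 * F) * (e * q t)" by linarith
      then have "\<bar>\<psi>2 t\<bar> \<le> (4 * F * (N + 2 * F) * (e * q t)) / d0"
        unfolding \<psi>2_def abs_divide using lr_near[OF t t] d0 F0 N(1) eqn by (intro frac_le) auto
      also have "\<dots> = (4 * F * (N + 2 * F) / d0) * (e * q t)" by simp
      also have "\<dots> \<le> C * (e * q t)" using Cpos(3) eqn by (rule mult_right_mono)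
      finally show ?thesis by (simp add: mult.assoc)
    qed
    have \<psi>1b: "\<bar>\<psi>1 t\<bar> \<le> C * e * q t" if t: "0 \<le> t" for t
    proof -
      have "0 \<le> e * q t" using e q(1)[OF t] by simp
      then have "2 * L * (e * q t) \<le> C * (e * q t)" using Cpos(2) by (intro mult_right_mono) auto
      then show ?thesis using Vb[OF t, of "\<psi> t"] by (simp add: \<psi>1_def \<beta>_def mult.assoc)
    qed
    have \<psi>ib: "\<bar>\<psi> b - \<psi> a\<bar> \<le> C * e * (LINT s:{a..}|lborel. q s)" if "0 \<le> a" "a \<le> b" for a b
    proof -
      have "0 \<le> (LINT s:{a..}|lborel. q s)" unfolding set_lebesgue_integral_def
        by (intro integral_nonneg_AE AE_I2) (use q(1) that in \<open>auto simp: indicator_def\<close>)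
      then have "2 * L * (e * (LINT s:{a..}|lborel. q s)) \<le> C * (e * (LINT s:{a..}|lborel. q s))"
        using Cpos(2) e(1) by (intro mult_right_mono) auto
      then show ?thesis using \<psi>i[OF that] unfolding \<beta>L by (simp add: mult.assoc)
    qed
    have sol: "the_entropy_solution f g u0 (\<lambda>t x. if x < \<sigma> * t + \<psi> t then wl (t, x) else wr (t, x))"
      if init: "AE x in lborel. (if x < 0 then wl (0, x) else wr (0, x)) = u0 x" for u0
    proof (rule shock_entropy_solution[OF f(1) cf' g wl _ wr _ _ sc, where s'=s1 and \<delta>="1/4" and C="2 * L * (e * Q) * (2 * M)" and M=M])
      show "open {p :: real \<times> real. - 1 < fst p}" "open {p :: real \<times> real. - 1 < fst p \<and> - 1 < snd p - \<sigma> * fst p}"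
        by (intro open_Collect_conj open_Collect_less continuous_intros)+
      show "(s has_real_derivative s1 t) (at t)" if "0 < t" for t
      proof -
        have "at t within {0..} = at t" by (rule at_within_interior) (use that in simp)
        then show ?thesis using sD[of t] that by simp
      qed
      show "continuous_on {0<..} s1" by (rule continuous_on_subset[OF cs1]) auto
      have eQ: "0 \<le> e * Q" using e Q0 by simp
      show "0 \<le> 2 * L * (e * Q) * (2 * M)" using L(1) eQ by (simp add: M_def)
      show "(t, x) \<in> {p. - 1 < fst p}" if "0 \<le> t" for t x :: real using that by simp
      show "(t, x) \<in> {p. - 1 < fst p \<and> - 1 < snd p - \<sigma> * fst p}" if "0 \<le> t" "s t - 1/4 \<le> x" for t x
        using that sr[of t] by simp
      show "\<bar>wl (t, x)\<bar> \<le> M" if "0 \<le> t" for t x using near[OF nl[OF that], of up x] \<eta>1 by simp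
      show "\<bar>wr (t, x)\<bar> \<le> M" if "0 \<le> t" "s t \<le> x" for t x
      proof -
        have "\<sigma> * t - 3/4 \<le> x" using sr'[OF that(1)] that(2) by linarith
        then show ?thesis using near[OF _ nr[OF that(1)], of um x] \<eta>1 by simp
      qed
      show "AE x in lborel. (if x < \<sigma> * 0 + \<psi> 0 then wl (0, x) else wr (0, x)) = u0 x"
        using init by (simp add: \<psi>0)
      show "(if x < \<sigma> * t + \<psi> t then wl (t, x) else wr (t, x)) = (if x < s t then wl (t, x) else wr (t, x))" for t x by (simp add: s_def)
      fix t x k :: real assume t: "0 < t" and x: "s t - 1/4 \<le> x" "x \<le> s t"
      have t0: "0 \<le> t" using t by simp
      have xr: "\<sigma> * t - 3/4 \<le> x" using x sr[OF t0] by linarith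
      define a b where "a = wl (t, x)" and "b = wr (t, x)"
      have ab: "\<bar>a - um\<bar> < \<eta>1" "\<bar>b - up\<bar> < \<eta>1" using nl[OF t0] nr[OF t0 xr] by (auto simp: a_def b_def)
      have "sgn (k - b) * (f k - f b) - sgn (k - a) * (f k - f a) - Sl a b * (\<bar>k - b\<bar> - \<bar>k - a\<bar>) \<le> 0"
        unfolding Sl_def by (rule \<eta>k) (use ab \<eta>1 in auto)
      \<comment> \<open>Oleinik's inequality is exact for the chord slope of the states at
        \<open>x\<close>, whereas the shock moves with the chord slope of the states at
        \<open>s t\<close>. The mismatch is linear in \<open>s t - x\<close> since the branches are
        Lipschitz in space, and the entropy jump is at most \<open>2 * M\<close>.\<close>
      moreover have "(Sl a b - s1 t) * (\<bar>k - b\<bar> - \<bar>k - a\<bar>) \<le> 2 * L * (e * Q) * (2 * M) * (s t - x)"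
      proof -
        have "(Sl a b - s1 t) * (\<bar>k - b\<bar> - \<bar>k - a\<bar>) \<le> \<bar>Sl a b - s1 t\<bar> * \<bar>\<bar>k - b\<bar> - \<bar>k - a\<bar>\<bar>"
          by (metis abs_ge_self abs_mult)
        also have "\<dots> \<le> (2 * L * (e * Q) * (s t - x)) * (2 * M)"
        proof (rule mult_mono)
          have "\<bar>Sl a b - s1 t\<bar> \<le> L * (\<bar>a - l t\<bar> + \<bar>b - r t\<bar>)"
            using Sl_lip[OF ab lr[OF t0]] s1[OF t0] by (simp add: l_def r_def)
          also have "\<dots> \<le> L * (e * q t * \<bar>x - s t\<bar> + e * q t * \<bar>x - s t\<bar>)"
            unfolding a_def b_def l_def r_def using lipl[OF t0] lipr[OF t0 xr sr'[OF t0]] L(1)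
            by (intro mult_left_mono add_mono) auto
          also have "\<dots> = 2 * L * (e * q t) * (s t - x)" using x by (simp add: algebra_simps)
          also have "\<dots> \<le> 2 * L * (e * Q) * (s t - x)"
            by (rule mult_right_mono[OF mult_left_mono[OF eq_small(2)[OF t0]]]) (use L(1) x in auto)
          finally show "\<bar>Sl a b - s1 t\<bar> \<le> 2 * L * (e * Q) * (s t - x)" .
          show "\<bar>\<bar>k - b\<bar> - \<bar>k - a\<bar>\<bar> \<le> 2 * M" using near[OF ab] by linarith
        qed (use L(1) eQ x in auto)
        finally show ?thesis by (simp add: mult_ac)
      qed
      ultimately show "sgn (k - wr (t, x)) * (f k - f (wr (t, x))) - sgn (k - wl (t, x)) * (f k - f (wl (t, x)))
        - s1 t * (\<bar>k - wr (t, x)\<bar> - \<bar>k - wl (t, x)\<bar>) \<le> 2 * L * (e * Q) * (2 * M) * (s t - x)"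
        unfolding a_def[symmetric] b_def[symmetric] by (simp add: left_diff_distrib)
    qed (use pde_l pde_r in auto)
    show "\<exists>\<psi> \<psi>1 \<psi>2. shock_path (C * e) q \<psi> \<psi>1 \<psi>2 \<and>
        (\<forall>u0. (AE x in lborel. (if x < 0 then wl (0, x) else wr (0, x)) = u0 x) \<longrightarrow>
           the_entropy_solution f g u0 (\<lambda>t x. if x < \<sigma> * t + \<psi> t then wl (t, x) else wr (t, x)))"
      unfolding shock_path_def
    proof (rule exI[of _ \<psi>], rule exI[of _ \<psi>1], rule exI[of _ \<psi>2], intro conjI allI impI)
      show "(\<psi> has_real_derivative \<psi>1 t) (at t within {0..})" if "0 \<le> t" for t using \<psi>D[OF that] by (simp add: \<psi>1_def)
    qed (use \<psi>0 \<psi>1D c\<psi>2 \<psi>b \<psi>1b \<psi>2b \<psi>ib sol in \<open>blast+\<close>)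
  qed
qed

section \<open>Decay rates and pointwise weighted stability\<close>

definition stable_shock ::
    "(real \<Rightarrow> real) \<Rightarrow> (real \<Rightarrow> real) \<Rightarrow> real \<Rightarrow> real \<Rightarrow> real \<Rightarrow> real \<Rightarrow> real \<Rightarrow> (real \<Rightarrow> real) \<Rightarrow> (real \<Rightarrow> real) \<Rightarrow> bool" where
  "stable_shock f g \<sigma> um up \<kappa> c q u0 \<longleftrightarrow> (\<exists>\<psi> \<psi>1 \<psi>2 u. shock_path c q \<psi> \<psi>1 \<psi>2 \<and> the_entropy_solution f g u0 u \<and>
     (\<forall>t\<ge>0. \<exists>v d. (\<forall>x. x \<noteq> 0 \<longrightarrow> v x = u t (x + \<sigma> * t + \<psi> t) - (if x < 0 then um else up) \<and>
          (v has_real_derivative d x) (at x) \<and> \<bar>v x\<bar> \<le> c * q t * exp_weight \<kappa> x \<and> \<bar>d x\<bar> \<le> c * q t * exp_weight \<kappa> x) \<and>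
        continuous_on (-{0}) d))"

text \<open>The two branches decay for different reasons, the left one exponentially in time and the
  right one because ever smaller data reach the shock. The lower exponential bound of a
  sub-exponential weight and the choice of \<open>\<theta>\<close> let the single profile
  \<open>\<rho> (\<theta> * t)\<close> dominate both.\<close>

lemma shock_stability:
  fixes f f' f'' g g' g'' \<rho> :: "real \<Rightarrow> real"
  assumes f: "\<And>x. (f has_real_derivative f' x) (at x)" "\<And>x. (f' has_real_derivative f'' x) (at x)" "continuous_on UNIV f''"
    and g: "\<And>x. (g has_real_derivative g' x) (at x)" "\<And>x. (g' has_real_derivative g'' x) (at x)"
    and g0: "g um = 0" "g up = 0" and gs: "g' um < 0" "0 < g' up"
    and rh: "f um - f up = \<sigma> * (um - up)" and lax: "\<sigma> < f' um" "f' up < \<sigma>"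
    and ol: "\<And>v. min um up < v \<Longrightarrow> v < max um up \<Longrightarrow> (f v - f up) / (v - up) < (f v - f um) / (v - um)"
    and \<kappa>: "\<kappa> = g' up / (\<sigma> - f' up)"
    and \<rho>: "subexp_weight \<rho>" "set_integrable lborel {0..} \<rho>"
  obtains C \<theta> \<delta> where "0 < C" "0 < \<theta>" "0 < \<delta>"
    "\<And>E u0 u0'. 0 \<le> E \<Longrightarrow> E \<le> \<delta> \<Longrightarrow> \<forall>x. x \<noteq> 0 \<longrightarrow> (u0 has_real_derivative u0' x) (at x) \<and>
        \<bar>u0 x - (if x < 0 then um else up)\<bar> \<le> E * exp_weight_rho \<rho> \<kappa> x \<and> \<bar>u0' x\<bar> \<le> E * exp_weight_rho \<rho> \<kappa> x \<Longrightarrow>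
      uniformly_continuous_on {..<0} u0' \<Longrightarrow> uniformly_continuous_on {0<..} u0' \<Longrightarrow>
      stable_shock f g \<sigma> um up \<kappa> (C * E) (\<lambda>t. \<rho> (\<theta> * t)) u0"
proof -
  have cg': "continuous_on UNIV g'" using g(2) by (meson DERIV_isCont continuous_at_imp_continuous_on)
  have ne: "um \<noteq> up" using lax by auto
  define c where "c = \<sigma> - f' up"
  define \<mu> where "\<mu> = - g' um"
  have c0: "0 < c" and \<mu>0: "0 < \<mu>" and \<kappa>0: "0 < \<kappa>" and \<kappa>c: "\<kappa> * c = g' up"
    using lax gs by (auto simp: c_def \<mu>_def \<kappa>)
  have \<rho>p: "\<And>t. 0 \<le> t \<Longrightarrow> 0 < \<rho> t" and \<rho>m: "\<And>s t. 0 \<le> s \<Longrightarrow> s \<le> t \<Longrightarrow> \<rho> t \<le> \<rho> s"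
    using \<rho>(1) by (auto simp: subexp_weight_def monotone_on_def)
  obtain \<omega> C0 where \<omega>: "0 < \<omega>" "0 < C0" "\<And>t. 0 \<le> t \<Longrightarrow> C0 * exp (- \<omega> * t) \<le> \<rho> t"
    using \<rho>(1) unfolding subexp_weight_def by blast
  \<comment> \<open>Data reaching the shock at time \<open>t\<close> start near the distance
    \<open>c * t\<close>; half of that speed absorbs the bounded displacement once \<open>t\<close>
    is large. The bound \<open>\<mu> / \<omega>\<close> makes \<open>exp (- \<mu> * t)\<close> at
    most \<open>exp (- \<omega> * (\<theta> * t))\<close>, which
    \<open>\<rho> (\<theta> * t)\<close> dominates up to \<open>C0\<close>.\<close>
  define \<theta> where "\<theta> = min (c / 2) (\<mu> / \<omega>)"
  have \<theta>: "0 < \<theta>" "\<theta> \<le> c / 2" "\<omega> * \<theta> \<le> \<mu>" using c0 \<mu>0 \<omega>(1) by (auto simp: \<theta>_def min_def field_simps)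
  define q where "q t = \<rho> (\<theta> * t)" for t
  have qp: "0 < q t" if "0 \<le> t" for t using \<rho>p[of "\<theta> * t"] \<theta>(1) that by (simp add: q_def)
  have q\<rho>: "q t \<le> \<rho> 0" if "0 \<le> t" for t using \<rho>m[of 0 "\<theta> * t"] \<theta>(1) that by (simp add: q_def)
  define \<rho>0 where "\<rho>0 = \<rho> 0"
  have \<rho>0: "0 < \<rho>0" using \<rho>p[of 0] by (simp add: \<rho>0_def)
  have qi: "set_integrable lborel {0..} q"
  proof -
    have "integrable lborel (\<lambda>t. indicator {0..} (0 + \<theta> * t) *\<^sub>R \<rho> (0 + \<theta> * t))"
      using lborel_integrable_real_affine[OF \<rho>(2)[unfolded set_integrable_def], of \<theta> 0] \<theta>(1) by simp
    moreover have "indicator {0..} (0 + \<theta> * t) = (indicator {0..} t :: real)" for t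
      using \<theta>(1) by (auto simp: indicator_def zero_le_mult_iff)
    ultimately show ?thesis by (simp add: set_integrable_def q_def)
  qed
  \<comment> \<open>\<open>1 / C0\<close> is for the left branch and the ratio of values of
    \<open>\<rho>\<close> for the early times \<open>c * t < 5/2\<close> of the right one. The
    number 5/4 is 3/4, the reach of the right branch beyond \<open>\<sigma> * t\<close>, plus the
    displacement 1/2.\<close>
  define K1 where "K1 = 1 / C0 + \<rho>0 / \<rho> (5/4) + 1"
  have K1a: "1 / C0 \<le> K1" "\<rho>0 / \<rho> (5/4) \<le> K1" "1 \<le> K1" "0 < K1"
    using \<omega>(2) \<rho>0 \<rho>p[of "5/4"] by (auto simp: K1_def add_pos_pos)
  have exp_q: "exp (- \<mu> * t) \<le> K1 * q t" if t: "0 \<le> t" for t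
  proof -
    have "C0 * exp (- \<mu> * t) \<le> C0 * exp (- \<omega> * (\<theta> * t))"
      using mult_right_mono[OF \<theta>(3) t] \<omega>(2) by (simp add: mult.assoc)
    also have "\<dots> \<le> q t" unfolding q_def by (rule \<omega>(3)) (use t \<theta>(1) in simp)
    finally have "exp (- \<mu> * t) \<le> 1 / C0 * q t" using \<omega>(2) by (simp add: field_simps)
    also have "\<dots> \<le> K1 * q t" using K1a(1) qp[OF t] by (intro mult_right_mono) auto
    finally show ?thesis .
  qed
  have \<rho>_q: "\<rho> (max (c * t - 5/4) 0) \<le> K1 * q t" if t: "0 \<le> t" for t
  proof (cases "5/2 \<le> c * t")
    case True
    have "\<theta> * t \<le> c / 2 * t" using \<theta>(2) t by (rule mult_right_mono)
    also have "\<dots> \<le> c * t - 5/4" using True by (simp add: field_simps)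
    finally have "\<rho> (max (c * t - 5/4) 0) \<le> q t"
      unfolding q_def using True \<theta>(1) t by (intro \<rho>m) auto
    also have "\<dots> \<le> K1 * q t" using K1a(3) qp[OF t] mult_right_mono[of 1 K1 "q t"] by simp
    finally show ?thesis .
  next
    case False
    have "\<theta> * t \<le> c / 2 * t" using \<theta>(2) t by (rule mult_right_mono)
    then have "\<theta> * t \<le> 5/4" using False by simp
    then have "\<rho> (5/4) \<le> q t" unfolding q_def using t \<theta>(1) by (intro \<rho>m) auto
    then have "\<rho>0 / \<rho> (5/4) * \<rho> (5/4) \<le> K1 * q t"
      using K1a(2,4) \<rho>p[of "5/4"] \<rho>0 by (intro mult_mono) auto
    then have "\<rho>0 \<le> K1 * q t" using \<rho>p[of "5/4"] by simp
    moreover have "\<rho> (max (c * t - 5/4) 0) \<le> \<rho>0" unfolding \<rho>0_def by (rule \<rho>m) auto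
    ultimately show ?thesis by simp
  qed
  have exp_w: "exp_weight \<kappa> x = (if x < 0 then 1 else exp (- \<kappa> * x))" for x by (auto simp: exp_weight_def max_def)
  text \<open>\<open>m\<close> bounds the data extended to the left of the shock.\<close>
  define m where "m x = 3 * (\<rho> (max x 0) * exp (- \<kappa> * max x 0))" for x
  have m_le: "m x \<le> 3 * \<rho>0" for x
  proof -
    have "\<rho> (max x 0) * exp (- \<kappa> * max x 0) \<le> \<rho>0 * 1"
      using \<rho>m[of 0 "max x 0"] \<rho>0 \<kappa>0 by (intro mult_mono) (auto simp: \<rho>0_def)
    then show ?thesis by (simp add: m_def)
  qed
  \<comment> \<open>Here \<open>\<kappa> * c = g' up\<close> is used: the growth cancels the weight
    gained over the distance \<open>c * t\<close>, and what is left is \<open>\<rho>\<close> at the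
    starting point and the weight at \<open>z\<close>.\<close>
  have m_grow: "exp (g' up * t) * m (z + c * t) \<le> 3 * \<rho> (max (z + c * t) 0) * exp (- \<kappa> * z)" for t z
  proof -
    have "g' up * t + - \<kappa> * max (z + c * t) 0 \<le> - \<kappa> * z"
    proof -
      have "\<kappa> * (z + c * t) \<le> \<kappa> * max (z + c * t) 0" using \<kappa>0 by (intro mult_left_mono) auto
      then show ?thesis using \<kappa>c[symmetric] by (simp add: algebra_simps)
    qed
    then have "exp (g' up * t) * exp (- \<kappa> * max (z + c * t) 0) \<le> exp (- \<kappa> * z)"
      by (simp add: exp_add[symmetric])
    then have "(3 * \<rho> (max (z + c * t) 0)) * (exp (g' up * t) * exp (- \<kappa> * max (z + c * t) 0)) \<le> (3 * \<rho> (max (z + c * t) 0)) * exp (- \<kappa> * z)"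
      using \<rho>p[of "max (z + c * t) 0"] by (intro mult_left_mono) auto
    then show ?thesis by (simp add: m_def mult_ac)
  qed
  \<comment> \<open>On the left the weight of the data is constant, so a constant profile on the
    whole line will do. The factor \<open>exp \<mu>\<close> covers the times between -1 and 0, where
    the decaying exponential exceeds 1.\<close>
  obtain \<delta>l where \<delta>l: "0 < \<delta>l" and left: "\<And>E e e'. 0 \<le> E \<Longrightarrow> E \<le> \<delta>l \<Longrightarrow> C1_near um (\<lambda>x. E * (3 * \<rho>0)) e e' \<Longrightarrow>
     \<exists>w wt wx. solution_branch f' g \<sigma> UNIV um (\<lambda>t z. 8 * E * (exp (g' um * t) * (3 * \<rho>0))) e w wt wx"
  proof (rule side_branch[OF f(2) g g0(1) refl _ refl, where S=UNIV and S'=UNIV and m="\<lambda>_. 3 * \<rho>0" and M="exp \<mu> * (3 * \<rho>0)" and \<sigma>=\<sigma>])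
    show "3 * \<rho>0 \<le> exp \<mu> * (3 * \<rho>0)" using \<mu>0 \<rho>0 by simp
    show "exp (g' um * t) * (3 * \<rho>0) \<le> exp \<mu> * (3 * \<rho>0)" if "- 1 < t" for t
    proof -
      have "\<mu> * (- t) \<le> \<mu> * 1" using that \<mu>0 by (intro mult_left_mono) auto
      then have "g' um * t \<le> \<mu>" by (simp add: \<mu>_def)
      then show ?thesis using \<rho>0 by simp
    qed
  qed (rule that | (use gs in \<open>simp; fail\<close>))+
  \<comment> \<open>To the left \<open>exp (- \<kappa> * z)\<close> is unbounded, so labels are
    restricted to \<open>z > -2\<close>, whence \<open>exp (2 * \<kappa>)\<close>. This leaves more
    than the displacement 1/2 below the target set \<open>\<xi> > -1\<close>.\<close>
  obtain \<delta>r where \<delta>r: "0 < \<delta>r" and right: "\<And>E e e'. 0 \<le> E \<Longrightarrow> E \<le> \<delta>r \<Longrightarrow> C1_near up (\<lambda>x. E * m x) e e' \<Longrightarrow>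
     \<exists>w wt wx. solution_branch f' g \<sigma> {- 1<..} up (\<lambda>t z. 8 * E * (exp (g' up * t) * m (z - (f' up - \<sigma>) * t))) e w wt wx"
  proof (rule side_branch[OF f(2) g g0(2) refl _ refl, where S="{- 2<..}" and S'="{- 1<..}" and m=m and M="3 * \<rho>0 * exp (2 * \<kappa>)" and \<sigma>=\<sigma>])
    have "1 \<le> exp (2 * \<kappa>)" using \<kappa>0 by simp
    then have "3 * \<rho>0 * 1 \<le> 3 * \<rho>0 * exp (2 * \<kappa>)" using \<rho>0 by (intro mult_left_mono) auto
    then show "m x \<le> 3 * \<rho>0 * exp (2 * \<kappa>)" for x using m_le[of x] by simp
    show "exp (g' up * t) * m (z - (f' up - \<sigma>) * t) \<le> 3 * \<rho>0 * exp (2 * \<kappa>)" if "z \<in> {- 2<..}" for t z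
    proof -
      have "exp (g' up * t) * m (z + c * t) \<le> 3 * \<rho> (max (z + c * t) 0) * exp (- \<kappa> * z)" by (rule m_grow)
      also have "\<dots> \<le> 3 * \<rho>0 * exp (2 * \<kappa>)"
      proof (rule mult_mono)
        show "3 * \<rho> (max (z + c * t) 0) \<le> 3 * \<rho>0" using \<rho>m[of 0 "max (z + c * t) 0"] by (simp add: \<rho>0_def)
        have "\<kappa> * (- z) \<le> \<kappa> * 2" using that \<kappa>0 by (intro mult_left_mono) auto
        then show "exp (- \<kappa> * z) \<le> exp (2 * \<kappa>)" by simp
      qed (use \<rho>0 in auto)
      also have "z + c * t = z - (f' up - \<sigma>) * t" by (simp add: c_def algebra_simps)
      finally show ?thesis .
    qed
  qed (rule that | (use gs in \<open>simp; fail\<close>))+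
  obtain C e0 where C: "0 < C" and e0: "0 < e0" and front: "\<And>e wl wlt wlx wr wrt wrx. 0 \<le> e \<Longrightarrow> e \<le> e0 \<Longrightarrow>
      C1_on {p. - 1 < fst p} wl wlt wlx \<Longrightarrow> C1_on {p. - 1 < fst p \<and> - 1 < snd p - \<sigma> * fst p} wr wrt wrx \<Longrightarrow>
      (\<forall>p. wlt p + f' (wl p) * wlx p = g (wl p)) \<Longrightarrow> (\<forall>p. wrt p + f' (wr p) * wrx p = g (wr p)) \<Longrightarrow>
      (\<forall>t\<ge>0. \<forall>x. \<bar>wl (t, x) - um\<bar> \<le> e * q t \<and> \<bar>wlx (t, x)\<bar> \<le> e * q t) \<Longrightarrow>
      (\<forall>t\<ge>0. \<forall>\<xi>\<ge>- (3/4). \<bar>wr (t, \<sigma> * t + \<xi>) - up\<bar> \<le> e * q t \<and> \<bar>wrx (t, \<sigma> * t + \<xi>)\<bar> \<le> e * q t) \<Longrightarrow>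
      \<exists>\<psi> \<psi>1 \<psi>2. shock_path (C * e) q \<psi> \<psi>1 \<psi>2 \<and>
        (\<forall>u0. (AE x in lborel. (if x < 0 then wl (0, x) else wr (0, x)) = u0 x) \<longrightarrow>
           the_entropy_solution f g u0 (\<lambda>t x. if x < \<sigma> * t + \<psi> t then wl (t, x) else wr (t, x)))"
    by (rule shock_front[OF f g(1) cg' g0 ne rh lax ol less_imp_le[OF qp] q\<rho> qi]) (assumption+, rule that)
  \<comment> \<open>24 is the constant 8 of \<open>side_branch\<close> times the 3 of the
    reflection. The other factors dominate both the left bound, with \<open>\<rho>0\<close>, and the
    right bound near the shock, where the exponent is at most \<open>2 * \<kappa>\<close>.\<close>
  define c2 where "c2 = 24 * K1 * (\<rho>0 + 1) * exp (2 * \<kappa>)"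
  have c2: "0 < c2" "24 * K1 * \<rho>0 \<le> c2" "24 * K1 * exp (2 * \<kappa>) \<le> c2"
  proof -
    show "0 < c2" using K1a \<rho>0 by (simp add: c2_def)
    have "1 \<le> exp (2 * \<kappa>)" using \<kappa>0 by simp
    then have "24 * K1 * \<rho>0 * 1 \<le> 24 * K1 * (\<rho>0 + 1) * exp (2 * \<kappa>)" using K1a \<rho>0 by (intro mult_mono) auto
    then show "24 * K1 * \<rho>0 \<le> c2" by (simp add: c2_def)
    have "24 * K1 * 1 * exp (2 * \<kappa>) \<le> 24 * K1 * (\<rho>0 + 1) * exp (2 * \<kappa>)" using K1a \<rho>0 by (intro mult_mono) auto
    then show "24 * K1 * exp (2 * \<kappa>) \<le> c2" by (simp add: c2_def)
  qed
  define C' where "C' = C * c2 + c2"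
  define \<delta> where "\<delta> = min (min \<delta>l \<delta>r) (e0 / c2)"
  have \<delta>0: "0 < \<delta>" using \<delta>l \<delta>r e0 c2 by (simp add: \<delta>_def)
  have C': "0 < C'" "C * c2 \<le> C'" "c2 \<le> C'" using C c2(1) by (auto simp: C'_def add_pos_pos)
  show thesis
  proof (rule that[OF C'(1) \<theta>(1) \<delta>0])
    fix E u0 u0'
    assume E: "0 \<le> E" "E \<le> \<delta>"
      and H: "\<forall>x. x \<noteq> 0 \<longrightarrow> (u0 has_real_derivative u0' x) (at x) \<and>
        \<bar>u0 x - (if x < 0 then um else up)\<bar> \<le> E * exp_weight_rho \<rho> \<kappa> x \<and> \<bar>u0' x\<bar> \<le> E * exp_weight_rho \<rho> \<kappa> x"
      and uc: "uniformly_continuous_on {..<0} u0'" "uniformly_continuous_on {0<..} u0'"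
    have u0: "(u0 has_real_derivative u0' x) (at x)"
      and ub: "\<bar>u0 x - (if x < 0 then um else up)\<bar> \<le> E * exp_weight_rho \<rho> \<kappa> x"
      and ub': "\<bar>u0' x\<bar> \<le> E * exp_weight_rho \<rho> \<kappa> x" if "x \<noteq> 0" for x
      using H that by blast+
    have wm: "exp_weight_rho \<rho> \<kappa> x = m x / 3" for x by (simp add: exp_weight_rho_def m_def)
    have w\<rho>0: "exp_weight_rho \<rho> \<kappa> x \<le> \<rho>0" for x using m_le[of x] by (simp add: wm)
    have Eub: "E * exp_weight_rho \<rho> \<kappa> x \<le> E * \<rho>0" for x using w\<rho>0 E(1) by (rule mult_left_mono)
    \<comment> \<open>The extension lemma is written for the right half line; here it is applied to
      the mirror image and the result mirrored back.\<close>
    obtain el el' where el: "C1_near um (\<lambda>x. E * (3 * \<rho>0)) el el'" "\<And>x. x < 0 \<Longrightarrow> el x = u0 x"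
    proof -
      have 1: "((\<lambda>x. u0 (- x)) has_real_derivative - u0' (- x)) (at x)" if "0 < x" for x
        using DERIV_chain2[OF u0[of "- x"] DERIV_minus[OF DERIV_ident]] that by simp
      have 2: "uniformly_continuous_on {0<..} (\<lambda>x. - u0' (- x))"
      proof -
        have "uniformly_continuous_on {0<..} (\<lambda>x. u0' (- x))"
          by (rule uniformly_continuous_on_compose[of "{0<..}" uminus u0', unfolded o_def])
             (use uc(1) in \<open>auto intro!: uniformly_continuous_on_minus uniformly_continuous_on_id simp: image_uminus_greaterThan\<close>)
        then show ?thesis by (rule uniformly_continuous_on_minus)
      qed
      have 3: "\<bar>u0 (- x) - um\<bar> \<le> E * \<rho>0" "\<bar>- u0' (- x)\<bar> \<le> E * \<rho>0" if "0 < x" for x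
        using ub[of "- x"] ub'[of "- x"] Eub[of "- x"] that by auto
      obtain e e' where e: "\<And>x. (e has_real_derivative e' x) (at x)" "continuous_on UNIV e'"
        "\<And>x. 0 < x \<Longrightarrow> e x = u0 (- x)" "\<And>x. 0 < x \<Longrightarrow> e' x = - u0' (- x)"
        "\<And>x. \<bar>e x - um\<bar> \<le> 3 * (E * \<rho>0)" "\<And>x. \<bar>e' x\<bar> \<le> E * \<rho>0"
        by (rule odd_reflection_extension[OF 1 2 3]) (assumption | rule that)+
      have E\<rho>: "0 \<le> E * \<rho>0" using E \<rho>0 by simp
      have "((\<lambda>x. e (- x)) has_real_derivative - e' (- x)) (at x)" for x
        using DERIV_chain2[OF e(1)[of "- x"] DERIV_minus[OF DERIV_ident]] by simp
      moreover have "continuous_on UNIV (\<lambda>x. - e' (- x))"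
        by (intro continuous_intros continuous_on_compose2[OF e(2)]) auto
      moreover have "\<bar>e (- x) - um\<bar> \<le> E * (3 * \<rho>0)" "\<bar>- e' (- x)\<bar> \<le> E * (3 * \<rho>0)" for x
        using e(5,6)[of "- x"] E\<rho> by (simp_all add: mult_ac)
      ultimately have "C1_near um (\<lambda>x. E * (3 * \<rho>0)) (\<lambda>x. e (- x)) (\<lambda>x. - e' (- x))"
        unfolding C1_near_def by blast
      moreover have "e (- x) = u0 x" if "x < 0" for x using e(3)[of "- x"] that by simp
      ultimately show thesis by (rule that)
    qed
    obtain er er' where er: "C1_near up (\<lambda>x. E * m x) er er'" "\<And>x. 0 < x \<Longrightarrow> er x = u0 x"
    proof -
      have 3: "\<bar>u0 x - up\<bar> \<le> E * \<rho>0" "\<bar>u0' x\<bar> \<le> E * \<rho>0" if "0 < x" for x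
        using ub[of x] ub'[of x] Eub[of x] that by auto
      have 1: "(u0 has_real_derivative u0' x) (at x)" if "0 < x" for x using u0 that by simp
      obtain e e' where e: "\<And>x. (e has_real_derivative e' x) (at x)" "continuous_on UNIV e'"
        "\<And>x. 0 < x \<Longrightarrow> e x = u0 x" "\<And>x. 0 < x \<Longrightarrow> e' x = u0' x"
        "\<And>x. \<bar>e x - up\<bar> \<le> 3 * (E * \<rho>0)" "\<And>x. \<bar>e' x\<bar> \<le> E * \<rho>0"
        by (rule odd_reflection_extension[OF 1 uc(2) 3]) (assumption | rule that)+
      have E\<rho>: "0 \<le> E * \<rho>0" using E \<rho>0 by simp
      have "\<bar>e x - up\<bar> \<le> E * m x \<and> \<bar>e' x\<bar> \<le> E * m x" for x
      proof (cases "0 < x")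
        case True
        have "0 \<le> m x" using \<rho>p[of x] True by (simp add: m_def max_def)
        then have "E * (m x / 3) \<le> E * m x" using E(1) by (intro mult_left_mono) auto
        then show ?thesis using ub[of x] ub'[of x] True e(3,4)[OF True] unfolding wm by auto
      next
        case False
        then have "m x = 3 * \<rho>0" by (simp add: m_def max_def \<rho>0_def)
        then show ?thesis using e(5,6)[of x] E\<rho> by (simp add: mult_ac)
      qed
      then have "C1_near up (\<lambda>x. E * m x) e e'" using e(1,2) unfolding C1_near_def by blast
      then show thesis using e(3) by (rule that)
    qed
    have E\<delta>: "E \<le> \<delta>l" "E \<le> \<delta>r" "c2 * E \<le> e0" "0 \<le> c2 * E"
    proof -
      show "E \<le> \<delta>l" "E \<le> \<delta>r" using E by (auto simp: \<delta>_def)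
      have "E \<le> e0 / c2" using E by (simp add: \<delta>_def)
      then show "c2 * E \<le> e0" using c2(1) by (simp add: pos_le_divide_eq mult.commute)
      show "0 \<le> c2 * E" using c2(1) E(1) by simp
    qed
    obtain wl wlt wlx where WL: "solution_branch f' g \<sigma> UNIV um (\<lambda>t z. 8 * E * (exp (g' um * t) * (3 * \<rho>0))) el wl wlt wlx"
      using left[OF E(1) E\<delta>(1) el(1)] by blast
    obtain wr wrt wrx where WR: "solution_branch f' g \<sigma> {- 1<..} up (\<lambda>t z. 8 * E * (exp (g' up * t) * m (z - (f' up - \<sigma>) * t))) er wr wrt wrx"
      using right[OF E(1) E\<delta>(2) er(1)] by blast
    note WL = WL[unfolded solution_branch_def] and WR = WR[unfolded solution_branch_def]
    have wl: "C1_on {p. - 1 < fst p} wl wlt wlx" and wr: "C1_on {p. - 1 < fst p \<and> - 1 < snd p - \<sigma> * fst p} wr wrt wrx"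
      using WL[THEN conjunct1] WR[THEN conjunct1] by simp_all
    have wl0: "wl (0, \<xi>) = el \<xi>" for \<xi> using WL by simp
    have wr0: "wr (0, \<xi>) = er \<xi>" if "- 1 < \<xi>" for \<xi> using WR that by simp
    have wlb: "\<bar>wl (t, \<sigma> * t + \<xi>) - um\<bar> \<le> 8 * E * (exp (g' um * t) * (3 * \<rho>0)) \<and> \<bar>wlx (t, \<sigma> * t + \<xi>)\<bar> \<le> 8 * E * (exp (g' um * t) * (3 * \<rho>0))"
      if "- 1 < t" for t \<xi>
      using WL[THEN conjunct2, THEN conjunct2, THEN conjunct1, rule_format, OF that, of \<xi>] by blast
    note wrb = WR[THEN conjunct2, THEN conjunct2, THEN conjunct1, rule_format, unfolded greaterThan_iff]
    have bl: "\<bar>wl (t, x) - um\<bar> \<le> c2 * E * q t \<and> \<bar>wlx (t, x)\<bar> \<le> c2 * E * q t" if t: "0 \<le> t" for t x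
    proof -
      have "8 * E * (exp (g' um * t) * (3 * \<rho>0)) = (24 * \<rho>0 * E) * exp (- \<mu> * t)" by (simp add: \<mu>_def mult_ac)
      also have "\<dots> \<le> (24 * \<rho>0 * E) * (K1 * q t)" using exp_q[OF t] \<rho>0 E(1) by (intro mult_left_mono) auto
      also have "\<dots> = (24 * K1 * \<rho>0) * (E * q t)" by (simp add: mult_ac)
      also have "\<dots> \<le> c2 * (E * q t)" using c2(2) E(1) qp[OF t] by (intro mult_right_mono) auto
      finally show ?thesis using wlb[of t "x - \<sigma> * t"] t by (simp add: mult.assoc)
    qed
    \<comment> \<open>The label is within 1/2 of \<open>\<xi>\<close>, which costs the factor
      \<open>exp (\<kappa> / 2)\<close>. The dependence on \<open>\<xi>\<close> is kept: it is the
      weight \<open>\<Omega>\<close> of the conclusion.\<close>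
    have br: "\<bar>wr (t, \<sigma> * t + \<xi>) - up\<bar> \<le> 24 * K1 * E * q t * exp (\<kappa> / 2 - \<kappa> * \<xi>) \<and> \<bar>wrx (t, \<sigma> * t + \<xi>)\<bar> \<le> 24 * K1 * E * q t * exp (\<kappa> / 2 - \<kappa> * \<xi>)"
      if t: "0 \<le> t" and \<xi>: "- (3/4) \<le> \<xi>" for t \<xi>
    proof -
      obtain z where z: "\<bar>z - \<xi>\<bar> \<le> 1/2" and zb: "\<bar>wr (t, \<sigma> * t + \<xi>) - up\<bar> \<le> 8 * E * (exp (g' up * t) * m (z - (f' up - \<sigma>) * t))"
        "\<bar>wrx (t, \<sigma> * t + \<xi>)\<bar> \<le> 8 * E * (exp (g' up * t) * m (z - (f' up - \<sigma>) * t))"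
        using wrb[of t \<xi>] t \<xi> by auto
      have z1: "\<xi> - 1/2 \<le> z" using z by linarith
      have "exp (g' up * t) * m (z + c * t) \<le> 3 * \<rho> (max (z + c * t) 0) * exp (- \<kappa> * z)" by (rule m_grow)
      also have "\<dots> \<le> 3 * (K1 * q t) * exp (\<kappa> / 2 - \<kappa> * \<xi>)"
      proof (rule mult_mono)
        have "\<rho> (max (z + c * t) 0) \<le> \<rho> (max (c * t - 5/4) 0)" by (rule \<rho>m) (use z1 \<xi> in auto)
        also have "\<dots> \<le> K1 * q t" by (rule \<rho>_q[OF t])
        finally show "3 * \<rho> (max (z + c * t) 0) \<le> 3 * (K1 * q t)" by simp
        have "\<kappa> * (\<xi> - 1/2) \<le> \<kappa> * z" using z1 \<kappa>0 by (intro mult_left_mono) auto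
        then show "exp (- \<kappa> * z) \<le> exp (\<kappa> / 2 - \<kappa> * \<xi>)" by (simp add: algebra_simps)
      qed (use K1a qp[OF t] in auto)
      also have "z + c * t = z - (f' up - \<sigma>) * t" by (simp add: c_def algebra_simps)
      finally have "8 * E * (exp (g' up * t) * m (z - (f' up - \<sigma>) * t)) \<le> 8 * E * (3 * (K1 * q t) * exp (\<kappa> / 2 - \<kappa> * \<xi>))"
        using E(1) by (intro mult_left_mono) auto
      also have "\<dots> = 24 * K1 * E * q t * exp (\<kappa> / 2 - \<kappa> * \<xi>)" by (simp add: mult_ac)
      finally show ?thesis using zb by linarith
    qed
    have exp_c2: "24 * K1 * E * q t * exp y \<le> c2 * E * q t" if "0 \<le> t" "y \<le> 2 * \<kappa>" for t y
    proof -
      have "24 * K1 * E * q t * exp y = (24 * K1 * exp y) * (E * q t)" by (simp add: mult_ac)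
      also have "\<dots> \<le> (24 * K1 * exp (2 * \<kappa>)) * (E * q t)"
        using that K1a E(1) qp[of t] by (intro mult_right_mono mult_left_mono) auto
      also have "\<dots> \<le> c2 * (E * q t)" using c2(3) E(1) qp[of t] that by (intro mult_right_mono) auto
      finally show ?thesis by (simp add: mult.assoc)
    qed
    have br2: "\<bar>wr (t, \<sigma> * t + \<xi>) - up\<bar> \<le> c2 * E * q t \<and> \<bar>wrx (t, \<sigma> * t + \<xi>)\<bar> \<le> c2 * E * q t"
      if "0 \<le> t" "- (3/4) \<le> \<xi>" for t \<xi>
    proof -
      have "\<kappa> * (- \<xi>) \<le> \<kappa> * (3/4)" using that(2) \<kappa>0 by (intro mult_left_mono) auto
      then have "\<kappa> / 2 - \<kappa> * \<xi> \<le> 2 * \<kappa>" using \<kappa>0 by simp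
      from exp_c2[OF that(1) this] show ?thesis using br[OF that] by linarith
    qed
    have "\<exists>\<psi> \<psi>1 \<psi>2. shock_path (C * (c2 * E)) q \<psi> \<psi>1 \<psi>2 \<and>
        (\<forall>u0. (AE x in lborel. (if x < 0 then wl (0, x) else wr (0, x)) = u0 x) \<longrightarrow>
           the_entropy_solution f g u0 (\<lambda>t x. if x < \<sigma> * t + \<psi> t then wl (t, x) else wr (t, x)))"
      by (rule front[OF E\<delta>(4,3) wl wr WL[THEN conjunct2, THEN conjunct1] WR[THEN conjunct2, THEN conjunct1]])
         (use bl br2 in blast)+
    then obtain \<psi> \<psi>1 \<psi>2 where \<psi>: "shock_path (C * (c2 * E)) q \<psi> \<psi>1 \<psi>2"
      and sol: "\<forall>u0. (AE x in lborel. (if x < 0 then wl (0, x) else wr (0, x)) = u0 x) \<longrightarrow>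
           the_entropy_solution f g u0 (\<lambda>t x. if x < \<sigma> * t + \<psi> t then wl (t, x) else wr (t, x))"
      by blast
    note \<psi>b = \<psi>[unfolded shock_path_def, THEN conjunct2, THEN conjunct2, THEN conjunct2, THEN conjunct2, THEN conjunct1, rule_format]
      and \<psi>i = \<psi>[unfolded shock_path_def, THEN conjunct2, THEN conjunct2, THEN conjunct2, THEN conjunct2, THEN conjunct2, rule_format]
    define u where "u t x = (if x < \<sigma> * t + \<psi> t then wl (t, x) else wr (t, x))" for t x
    have CE: "C * (c2 * E) * y \<le> C' * E * y" "c2 * E * y \<le> C' * E * y" if "0 \<le> y" for y
      using mult_right_mono[OF C'(2), of "E * y"] mult_right_mono[OF C'(3), of "E * y"] E(1) that by (simp_all add: mult.assoc)
    have "AE x in lborel. (if x < 0 then wl (0, x) else wr (0, x)) = u0 x"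
    proof -
      have "AE x in lborel. x \<noteq> (0::real)" by (rule AE_lborel_singleton)
      then show ?thesis by eventually_elim (use wl0 wr0 el(2) er(2) in auto)
    qed
    then have usol: "the_entropy_solution f g u0 u" using sol unfolding u_def[abs_def] by blast
    have reg: "\<exists>v d. (\<forall>x. x \<noteq> 0 \<longrightarrow> v x = u t (x + \<sigma> * t + \<psi> t) - (if x < 0 then um else up) \<and>
          (v has_real_derivative d x) (at x) \<and> \<bar>v x\<bar> \<le> C' * E * \<rho> (\<theta> * t) * exp_weight \<kappa> x \<and> \<bar>d x\<bar> \<le> C' * E * \<rho> (\<theta> * t) * exp_weight \<kappa> x) \<and>
        continuous_on (-{0}) d" if t: "0 \<le> t" for t
    proof -
      define X where "X x = x + \<sigma> * t + \<psi> t" for x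
      define v where "v x = u t (x + \<sigma> * t + \<psi> t) - (if x < 0 then um else up)" for x
      define d where "d x = (if x < 0 then wlx (t, X x) else wrx (t, X x))" for x
      have \<psi>t: "- 1/2 \<le> \<psi> t" "\<psi> t \<le> 1/2" using \<psi>b[OF t] by (auto simp: abs_le_iff)
      have vl: "v x = wl (t, X x) - um" if "x < 0" for x using that by (simp add: v_def u_def X_def)
      have vr: "v x = wr (t, X x) - up" if "0 < x" for x using that by (simp add: v_def u_def X_def)
      have inl: "(t, X x) \<in> {p. - 1 < fst p}" for x using t by simp
      have inr: "(t, X x) \<in> {p. - 1 < fst p \<and> - 1 < snd p - \<sigma> * fst p}" if "0 < x" for x using t that \<psi>t by (simp add: X_def)
      have XD: "(X has_real_derivative 1) (at x)" for x unfolding X_def[abs_def] by (auto intro!: derivative_eq_intros)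
      have vD: "(v has_real_derivative d x) (at x)" if "x \<noteq> 0" for x
      proof (cases "x < 0")
        case True
        have "((\<lambda>x. wl (t, X x) - um) has_real_derivative wlx (t, X x) * 1 - 0) (at x)"
          by (intro DERIV_diff DERIV_const DERIV_chain2[OF C1_on_section[OF wl inl] XD])
        then have "(v has_real_derivative wlx (t, X x) * 1 - 0) (at x)"
          by (rule has_field_derivative_transform_within_open[where S="{..<0}"]) (use True vl in auto)
        then show ?thesis using True by (simp add: d_def)
      next
        case False
        then have x: "0 < x" using that by simp
        have "((\<lambda>x. wr (t, X x) - up) has_real_derivative wrx (t, X x) * 1 - 0) (at x)"
          by (intro DERIV_diff DERIV_const DERIV_chain2[OF C1_on_section[OF wr inr[OF x]] XD])
        then have "(v has_real_derivative wrx (t, X x) * 1 - 0) (at x)"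
          by (rule has_field_derivative_transform_within_open[where S="{0<..}"]) (use x vr in auto)
        then show ?thesis using x by (simp add: d_def)
      qed
      have dc: "continuous_on (-{0}) d"
      proof -
        have cX: "continuous_on T (\<lambda>x. (t, X x))" for T unfolding X_def by (intro continuous_intros)
        have "continuous_on {..<0} (\<lambda>x. wlx (t, X x))"
          by (rule continuous_on_compose2[OF C1_on_continuous(3)[OF wl] cX]) (intro image_subsetI inl)
        then have "continuous_on {..<0} d" by (rule continuous_on_eq) (simp add: d_def)
        moreover have "continuous_on {0<..} (\<lambda>x. wrx (t, X x))"
          by (rule continuous_on_compose2[OF C1_on_continuous(3)[OF wr] cX]) (intro image_subsetI inr, simp)
        then have "continuous_on {0<..} d" by (rule continuous_on_eq) (simp add: d_def)
        ultimately have "continuous_on ({..<0} \<union> {0<..}) d" by (intro continuous_on_open_Un) auto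
        moreover have "{..<0} \<union> {0<..} = -{0::real}" by auto
        ultimately show ?thesis by simp
      qed
      have bound: "\<bar>v x\<bar> \<le> C' * E * \<rho> (\<theta> * t) * exp_weight \<kappa> x \<and> \<bar>d x\<bar> \<le> C' * E * \<rho> (\<theta> * t) * exp_weight \<kappa> x" if "x \<noteq> 0" for x
      proof (cases "x < 0")
        case True
        then show ?thesis using bl[OF t, of "X x"] CE(2)[of "q t"] qp[OF t]
          by (auto simp: vl d_def exp_w q_def)
      next
        case False
        then have x: "0 < x" using that by simp
        have X: "X x = \<sigma> * t + (x + \<psi> t)" by (simp add: X_def)
        have "\<kappa> * (- \<psi> t) \<le> \<kappa> * (1/2)" using \<psi>t \<kappa>0 by (intro mult_left_mono) auto
        then have y: "\<kappa> / 2 - \<kappa> * \<psi> t \<le> 2 * \<kappa>" using \<kappa>0 by simp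
        have "24 * K1 * E * q t * exp (\<kappa> / 2 - \<kappa> * (x + \<psi> t)) = (24 * K1 * E * q t * exp (\<kappa> / 2 - \<kappa> * \<psi> t)) * exp (- \<kappa> * x)"
          by (simp add: mult.assoc exp_add[symmetric] algebra_simps)
        also have "\<dots> \<le> (C' * E * q t) * exp (- \<kappa> * x)"
          using exp_c2[OF t y] CE(2)[of "q t"] qp[OF t] by (intro mult_right_mono) auto
        finally have "24 * K1 * E * q t * exp (\<kappa> / 2 - \<kappa> * (x + \<psi> t)) \<le> C' * E * \<rho> (\<theta> * t) * exp_weight \<kappa> x"
          using x by (simp add: exp_w q_def)
        moreover have "- (3/4) \<le> x + \<psi> t" using x \<psi>t by simp
        ultimately show ?thesis using br[OF t, of "x + \<psi> t"] x by (auto simp: vr d_def X)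
      qed
      show ?thesis
        by (rule exI[of _ v], rule exI[of _ d]) (use vD dc bound in \<open>auto simp: v_def\<close>)
    qed
    have "shock_path (C' * E) q \<psi> \<psi>1 \<psi>2"
      unfolding shock_path_def
    proof (intro conjI)
      show "\<forall>t\<ge>0. \<bar>\<psi> t\<bar> \<le> 1/2 \<and> \<bar>\<psi>1 t\<bar> \<le> C' * E * q t \<and> \<bar>\<psi>2 t\<bar> \<le> C' * E * q t"
      proof (intro allI impI)
        fix t :: real assume t: "0 \<le> t"
        show "\<bar>\<psi> t\<bar> \<le> 1/2 \<and> \<bar>\<psi>1 t\<bar> \<le> C' * E * q t \<and> \<bar>\<psi>2 t\<bar> \<le> C' * E * q t"
          using \<psi>b[OF t] CE(1)[of "q t"] qp[OF t] by linarith
      qed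
      show "\<forall>a b. 0 \<le> a \<and> a \<le> b \<longrightarrow> \<bar>\<psi> b - \<psi> a\<bar> \<le> C' * E * (LINT s:{a..}|lborel. q s)"
      proof (intro allI impI)
        fix a b :: real assume ab: "0 \<le> a \<and> a \<le> b"
        have "0 \<le> (LINT s:{a..}|lborel. q s)" unfolding set_lebesgue_integral_def
        proof (rule Bochner_Integration.integral_nonneg)
          fix s :: real
          show "0 \<le> indicator {a..} s *\<^sub>R q s" using less_imp_le[OF qp[of s]] ab by (simp add: indicator_def)
        qed
        from CE(1)[OF this] \<psi>i[OF ab]
        show "\<bar>\<psi> b - \<psi> a\<bar> \<le> C' * E * (LINT s:{a..}|lborel. q s)" by linarith
      qed
    qed (use \<psi> in \<open>simp_all add: shock_path_def\<close>)
    then show "stable_shock f g \<sigma> um up \<kappa> (C' * E) (\<lambda>t. \<rho> (\<theta> * t)) u0"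
      unfolding stable_shock_def q_def[abs_def] using usol reg by blast
  qed
qed

section \<open>From pointwise estimates to the norms of the theorem\<close>

lemma smooth_derivatives:
  assumes "smooth f"
  shows "(f has_real_derivative deriv f x) (at x)"
    "(deriv f has_real_derivative deriv (deriv f) x) (at x)" "continuous_on UNIV (deriv (deriv f))"
proof -
  have d: "((deriv ^^ n) f) differentiable (at x)" for n x
    using assms by (simp add: smooth_def)
  show "(f has_real_derivative deriv f x) (at x)" using d[of 0 x] by (simp add: DERIV_deriv_iff_real_differentiable)
  show "(deriv f has_real_derivative deriv (deriv f) x) (at x)"
    using d[of 1 x] by (simp add: DERIV_deriv_iff_real_differentiable)
  have "(deriv (deriv f)) differentiable (at x)" for x using d[of 2 x] by (simp add: numeral_2_eq_2)
  then show "continuous_on UNIV (deriv (deriv f))"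
    by (auto intro!: continuous_at_imp_continuous_on differentiable_imp_continuous_within)
qed

lemma BUC_on_1_open:
  assumes "BUC_on 1 S v" "open S"
  shows "x \<in> S \<Longrightarrow> (v has_real_derivative D_on S v x) (at x)" "uniformly_continuous_on S (D_on S v)"
proof -
  show "uniformly_continuous_on S (D_on S v)"
    using assms(1)[unfolded BUC_on_def, THEN conjunct2, rule_format, of 1] by simp
  assume x: "x \<in> S"
  have "v differentiable (at x within S)"
    using assms(1)[unfolded BUC_on_def, THEN conjunct1, rule_format, of 0 x] x by simp
  then have "(v has_vector_derivative D_on S v x) (at x within S)"
    unfolding D_on_def by (simp add: vector_derivative_works)
  then show "(v has_real_derivative D_on S v x) (at x)"
    using at_within_open[OF x assms(2)] by (simp add: has_real_derivative_iff_has_vector_derivative)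
qed

lemma D_on_eq:
  assumes "\<And>x. x \<in> S \<Longrightarrow> (v has_real_derivative v' x) (at x within S)" "x \<in> S" "at x within S \<noteq> bot"
  shows "D_on S v x = v' x"
  using assms unfolding D_on_def has_real_derivative_iff_has_vector_derivative
  by (intro vector_derivative_within) auto

text \<open>Compactness handles bounded times and smallness the rest. This serves for the second
  derivative of the shift, which is only known to be continuous and dominated by a decaying profile;
  lower derivatives are Lipschitz.\<close>

lemma uniformly_continuous_on_vanishing:
  fixes h :: "real \<Rightarrow> real"
  assumes h: "continuous_on {0..} h" and lim: "(h \<longlongrightarrow> 0) at_top"
  shows "uniformly_continuous_on {0..} h"
  unfolding uniformly_continuous_on_def
proof (intro allI impI)
  fix e :: real assume e: "0 < e"
  then have "\<forall>\<^sub>F t in at_top. dist (h t) 0 < e / 2" by (intro tendstoD[OF lim]) simp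
  then obtain T where T: "\<And>t. T \<le> t \<Longrightarrow> \<bar>h t\<bar> < e / 2" by (auto simp: eventually_at_top_linorder)
  have "uniformly_continuous_on {0..T + 1} h"
    by (intro compact_uniformly_continuous continuous_on_subset[OF h]) auto
  from uniformly_continuous_onE[OF this e]
  obtain d where d: "0 < d" "\<And>x y. x \<in> {0..T + 1} \<Longrightarrow> y \<in> {0..T + 1} \<Longrightarrow> dist y x < d \<Longrightarrow> dist (h y) (h x) < e"
    by metis
  \<comment> \<open>Two points closer than 1 lie both in \<open>{0..T + 1}\<close> or both beyond
    \<open>T\<close>, hence the overlap of length 1.\<close>
  show "\<exists>d>0. \<forall>x\<in>{0..}. \<forall>y\<in>{0..}. dist y x < d \<longrightarrow> dist (h y) (h x) < e"
  proof (intro exI[of _ "min d 1"] conjI ballI impI)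
    fix x y :: real assume xy: "x \<in> {0..}" "y \<in> {0..}" "dist y x < min d 1"
    show "dist (h y) (h x) < e"
    proof (cases "x \<le> T + 1 \<and> y \<le> T + 1")
      case True
      then show ?thesis using d(2)[of x y] xy by simp
    next
      case False
      then have "T \<le> x" "T \<le> y" using xy(3) by (auto simp: dist_real_def)
      then show ?thesis using T[of x] T[of y] by (simp add: dist_real_def)
    qed
  qed (use d in simp)
qed

lemma BUC_Rplus_2I:
  fixes \<psi> \<psi>1 \<psi>2 r :: "real \<Rightarrow> real"
  assumes \<psi>1: "\<And>t. 0 \<le> t \<Longrightarrow> (\<psi> has_real_derivative \<psi>1 t) (at t within {0..})"
    and \<psi>2: "\<And>t. 0 \<le> t \<Longrightarrow> (\<psi>1 has_real_derivative \<psi>2 t) (at t within {0..})" "continuous_on {0..} \<psi>2"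
    and b: "\<And>t. 0 \<le> t \<Longrightarrow> \<bar>\<psi> t\<bar> \<le> B" "\<And>t. 0 \<le> t \<Longrightarrow> \<bar>\<psi>1 t\<bar> \<le> r t" "\<And>t. 0 \<le> t \<Longrightarrow> \<bar>\<psi>2 t\<bar> \<le> r t"
    and r: "\<And>t. 0 \<le> t \<Longrightarrow> r t \<le> R" "(r \<longlongrightarrow> 0) at_top"
  shows "BUC_Rplus 2 \<psi>" "0 \<le> t \<Longrightarrow> D_on {0..} \<psi> t = \<psi>1 t" "0 \<le> t \<Longrightarrow> (D_on {0..} ^^ 2) \<psi> t = \<psi>2 t"
proof -
  have nb: "at t within {0..} \<noteq> bot" if "0 \<le> t" for t :: real
  proof -
    have "at_right t \<le> at t within {0..}" using that by (intro at_le) auto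
    then show ?thesis using trivial_limit_at_right_real[of t] by (metis bot.extremum_uniqueI)
  qed
  have D1: "D_on {0..} \<psi> t = \<psi>1 t" if "0 \<le> t" for t
    by (rule D_on_eq[OF _ _ nb]) (use that \<psi>1 in auto)
  have D1': "(D_on {0..} \<psi> has_real_derivative \<psi>2 t) (at t within {0..})" if "0 \<le> t" for t
    by (rule has_field_derivative_transform_within[OF \<psi>2(1)[OF that], of 1]) (use that D1 in auto)
  have D2: "D_on {0..} (D_on {0..} \<psi>) t = \<psi>2 t" if "0 \<le> t" for t
    by (rule D_on_eq[OF _ _ nb]) (use that D1' in auto)
  have lip: "uniformly_continuous_on {0..} h"
    if h: "\<And>t. 0 \<le> t \<Longrightarrow> (h has_real_derivative h' t) (at t within {0..})" "\<And>t. 0 \<le> t \<Longrightarrow> \<bar>h' t\<bar> \<le> R" for h h' :: "real \<Rightarrow> real"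
  proof (rule lipschitz_on_uniformly_continuous[of "\<bar>R\<bar>"])
    show "\<bar>R\<bar>-lipschitz_on {0..} h"
    proof (rule lipschitz_onI)
      fix x y :: real assume "x \<in> {0..}" "y \<in> {0..}"
      then have "norm (h x - h y) \<le> \<bar>R\<bar> * norm (x - y)"
        by (intro field_differentiable_bound[of "{0..}" h h']) (use h in \<open>auto intro: order_trans[OF h(2)]\<close>)
      then show "dist (h x) (h y) \<le> \<bar>R\<bar> * dist x y" by (simp add: dist_norm)
    qed simp
  qed
  have bR: "\<bar>\<psi>1 t\<bar> \<le> R" "\<bar>\<psi>2 t\<bar> \<le> R" if "0 \<le> t" for t using b(2,3)[OF that] r(1)[OF that] by simp_all
  have u0: "uniformly_continuous_on {0..} \<psi>" by (rule lip[OF \<psi>1 bR(1)])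
  have u1: "uniformly_continuous_on {0..} (D_on {0..} \<psi>)" by (rule lip[OF D1' bR(2)])
  have "uniformly_continuous_on {0..} \<psi>2"
  proof (rule uniformly_continuous_on_vanishing[OF \<psi>2(2)])
    show "(\<psi>2 \<longlongrightarrow> 0) at_top"
    proof (rule Lim_null_comparison[OF _ r(2)])
      show "\<forall>\<^sub>F t in at_top. norm (\<psi>2 t) \<le> r t"
        using eventually_ge_at_top[of 0] by eventually_elim (use b(3) in simp)
    qed
  qed
  then have u2: "uniformly_continuous_on {0..} (D_on {0..} (D_on {0..} \<psi>))"
    unfolding uniformly_continuous_on_def using D2 by auto
  have bd: "bounded (\<psi> ` {0..})" "bounded (D_on {0..} \<psi> ` {0..})" "bounded (D_on {0..} (D_on {0..} \<psi>) ` {0..})"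
    unfolding bounded_iff using b(1) bR D1 D2 by auto
  show "BUC_Rplus 2 \<psi>" unfolding BUC_Rplus_def BUC_on_def
  proof (intro conjI allI impI ballI)
    fix j :: nat and x :: real assume "j < 2" "x \<in> {0..}"
    then consider "j = 0" | "j = 1" by linarith
    then show "(D_on {0..} ^^ j) \<psi> differentiable at x within {0..}"
      by cases (use \<psi>1[of x] D1'[of x] \<open>x \<in> {0..}\<close> in \<open>auto simp: real_differentiable_def\<close>)
  next
    fix j :: nat assume "j \<le> 2"
    then consider "j = 0" | "j = 1" | "j = 2" by linarith
    then show "bounded ((D_on {0..} ^^ j) \<psi> ` {0..})" "uniformly_continuous_on {0..} ((D_on {0..} ^^ j) \<psi>)"
      by (cases; use bd u0 u1 u2 in \<open>simp add: numeral_2_eq_2\<close>)+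
  qed
  show "D_on {0..} \<psi> t = \<psi>1 t" "(D_on {0..} ^^ 2) \<psi> t = \<psi>2 t" if "0 \<le> t" for t
    using D1[OF that] D2[OF that] by (simp_all add: numeral_2_eq_2)
qed

text \<open>Boundedness gives a limit along a subsequence of the integers. For fixed
  \<open>t\<close> its indices eventually exceed \<open>t\<close>, so the bound \<open>R t\<close>
  passes to the limit, the same for all \<open>t\<close>.\<close>

lemma limit_with_tail_bound:
  fixes \<psi> R :: "real \<Rightarrow> real"
  assumes b: "\<And>t. 0 \<le> t \<Longrightarrow> \<bar>\<psi> t\<bar> \<le> B" and R: "\<And>a b. 0 \<le> a \<Longrightarrow> a \<le> b \<Longrightarrow> \<bar>\<psi> b - \<psi> a\<bar> \<le> R a"
  obtains l where "\<And>t. 0 \<le> t \<Longrightarrow> \<bar>\<psi> t - l\<bar> \<le> R t"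
proof -
  have "bounded (range (\<lambda>n. \<psi> (real n)))" unfolding bounded_iff using b by (intro exI[of _ B]) auto
  from bounded_imp_convergent_subsequence[OF this]
  obtain l s where s: "strict_mono s" and l: "((\<lambda>n. \<psi> (real n)) \<circ> s) \<longlonglongrightarrow> l" by blast
  have "\<bar>\<psi> t - l\<bar> \<le> R t" if t: "0 \<le> t" for t
  proof (rule tendsto_upperbound)
    show "(\<lambda>n. \<bar>\<psi> t - \<psi> (real (s n))\<bar>) \<longlonglongrightarrow> \<bar>\<psi> t - l\<bar>"
      using l by (intro tendsto_intros) (simp add: o_def)
    show "\<forall>\<^sub>F n in sequentially. \<bar>\<psi> t - \<psi> (real (s n))\<bar> \<le> R t"
      using eventually_ge_at_top[of "nat \<lceil>t\<rceil>"]
    proof eventually_elim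
      case (elim n)
      then have "t \<le> real (s n)" using seq_suble[OF s, of n] by linarith
      from R[OF t this] show ?case by (simp add: abs_minus_commute)
    qed
  qed simp
  then show thesis by (rule that)
qed

lemma set_integral_rescale:
  fixes h :: "real \<Rightarrow> real"
  assumes "0 < c"
  shows "(LINT s:{a..}|lborel. h (c * s)) = (LINT s:{c * a..}|lborel. h s) / c"
proof -
  have "(LINT s:{c * a..}|lborel. h s) = \<bar>c\<bar> *\<^sub>R (LINT s|lborel. indicator {c * a..} (0 + c * s) *\<^sub>R h (0 + c * s))"
    unfolding set_lebesgue_integral_def by (rule lborel_integral_real_affine) (use assms in simp)
  also have "(\<lambda>s. indicator {c * a..} (0 + c * s) *\<^sub>R h (0 + c * s)) = (\<lambda>s. indicator {a..} s *\<^sub>R h (c * s))"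
    using assms by (auto simp: fun_eq_iff indicator_def)
  finally show ?thesis using assms by (simp add: set_lebesgue_integral_def)
qed

text \<open>The weight \<open>\<rho>\<close> may have jumps; measurability and the upper bound come
  from monotonicity.\<close>

lemma exp_weight_rho_basic:
  assumes \<rho>: "subexp_weight \<rho>" and \<kappa>: "0 \<le> \<kappa>"
  shows "0 < exp_weight_rho \<rho> \<kappa> x" "exp_weight_rho \<rho> \<kappa> \<in> borel_measurable borel" "exp_weight_rho \<rho> \<kappa> x \<le> \<rho> 0"
proof -
  have \<rho>p: "\<And>t. 0 \<le> t \<Longrightarrow> 0 < \<rho> t" and \<rho>m: "\<And>s t. 0 \<le> s \<Longrightarrow> s \<le> t \<Longrightarrow> \<rho> t \<le> \<rho> s"
    using \<rho> by (auto simp: subexp_weight_def monotone_on_def)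
  show pos: "0 < exp_weight_rho \<rho> \<kappa> x" for x using \<rho>p[of "max x 0"] by (simp add: exp_weight_rho_def)
  have anti: "exp_weight_rho \<rho> \<kappa> y \<le> exp_weight_rho \<rho> \<kappa> x" if "x \<le> y" for x y
  proof -
    have "\<kappa> * max x 0 \<le> \<kappa> * max y 0" using that \<kappa> by (intro mult_left_mono) auto
    then show ?thesis unfolding exp_weight_rho_def
      using that \<rho>p[of "max x 0"] by (intro mult_mono \<rho>m) auto
  qed
  have "(\<lambda>x. - exp_weight_rho \<rho> \<kappa> x) \<in> borel_measurable borel"
    by (rule borel_measurable_mono) (use anti in \<open>auto simp: mono_def\<close>)
  then show "exp_weight_rho \<rho> \<kappa> \<in> borel_measurable borel" by (subst (asm) borel_measurable_uminus_eq) simp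
  show "exp_weight_rho \<rho> \<kappa> x \<le> \<rho> 0"
  proof (cases "x \<le> 0")
    case True
    then show ?thesis by (simp add: exp_weight_rho_def)
  next
    case False
    then show ?thesis using anti[of 0 x] by (simp add: exp_weight_rho_def)
  qed
qed

theorem theorem4:
  fixes f g U \<rho> :: "real \<Rightarrow> real" and \<sigma> um up \<kappa> :: real and \<Omega> \<Omega>\<rho> :: "real \<Rightarrow> real"
  assumes "smooth f" and "smooth g"
    and "nondegenerate_wave f g U \<sigma>"
    and "0 \<in> discontinuities U"
    and "\<forall>x<0. U x = um" and "\<forall>x>0. U x = up"
    and "deriv g um < 0" and "0 < deriv g up"
    and "subexp_weight \<rho>" and "set_integrable lborel {0..} \<rho>"
  defines "\<kappa> \<equiv> deriv g up / \<bar>deriv f up - \<sigma>\<bar>"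
  defines "\<Omega> \<equiv> exp_weight \<kappa>"
  defines "\<Omega>\<rho> \<equiv> exp_weight_rho \<rho> \<kappa>"
  shows "\<exists>C>0. \<exists>\<theta>>0. \<exists>\<delta>\<^sub>0>0. \<forall>u0 :: real \<Rightarrow> real.
    BUC_Rstar 1 u0 \<and>
    BUC_Rstar 0 (\<lambda>x. (u0 x - U x) / \<Omega>\<rho> x) \<and>
    BUC_Rstar 0 (\<lambda>x. deriv (\<lambda>y. u0 y - U y) x / \<Omega>\<rho> x) \<and>
    W1inf_norm \<Omega>\<rho> (\<lambda>x. u0 x - U x) \<le> ereal \<delta>\<^sub>0 \<longrightarrow>
    (\<exists>\<psi> u. BUC_Rplus 2 \<psi> \<and> the_entropy_solution f g u0 u \<and>
      (\<forall>t\<ge>0.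
        W1inf_norm \<Omega> (\<lambda>x. u t (x + \<sigma> * t + \<psi> t) - U x)
          + ereal (norm (D_on {0..} \<psi> t, (D_on {0..} ^^ 2) \<psi> t))
        \<le> ereal C * W1inf_norm \<Omega>\<rho> (\<lambda>x. u0 x - U x) * ereal (\<rho> (\<theta> * t))) \<and>
      (\<exists>\<psi>inf. \<forall>t\<ge>0.
        ereal \<bar>\<psi>inf\<bar> \<le> ereal C * W1inf_norm \<Omega>\<rho> (\<lambda>x. u0 x - U x) \<and>
        ereal \<bar>\<psi> t - \<psi>inf\<bar> \<le> ereal C * W1inf_norm \<Omega>\<rho> (\<lambda>x. u0 x - U x)
          * ereal (LINT s:{\<theta> * t..}|lborel. \<rho> s)))"
proof -
  define f' f'' g' where "f' = deriv f" and "f'' = deriv f'" and "g' = deriv g"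
  have f: "\<And>x. (f has_real_derivative f' x) (at x)" "\<And>x. (f' has_real_derivative f'' x) (at x)" "continuous_on UNIV f''"
    using smooth_derivatives[OF assms(1)] by (simp_all add: f'_def f''_def)
  have g: "\<And>x. (g has_real_derivative g' x) (at x)" "\<And>x. (g' has_real_derivative deriv g' x) (at x)"
    using smooth_derivatives[OF assms(2)] by (simp_all add: g'_def)
  have cf: "continuous_on UNIV f" and cg: "continuous_on UNIV g"
    using f(1) g(1) by (meson DERIV_isCont continuous_at_imp_continuous_on)+
  note nd = assms(3)[unfolded nondegenerate_wave_def]
  have wr: "g um = 0" "g up = 0" "f um - f up = \<sigma> * (um - up)"
    by (rule wave_relations[OF nd[THEN conjunct1] cf cg]; use assms(5,6) in simp)+
  have "(U \<longlongrightarrow> um) (at_left 0)" "(U \<longlongrightarrow> up) (at_right 0)"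
    by (rule tendsto_eventually; use assms(5,6) in \<open>simp add: eventually_at_filter\<close>)+
  then have shock: "f' um > \<sigma> \<and> \<sigma> > f' up \<and>
      (\<forall>v. min um up < v \<and> v < max um up \<longrightarrow> (f v - f um) / (v - um) > (f v - f up) / (v - up))"
    using nd assms(4) unfolding f'_def by blast
  have \<kappa>: "\<kappa> = g' up / (\<sigma> - f' up)" using shock by (simp add: \<kappa>_def f'_def g'_def)
  have gs: "g' um < 0" "0 < g' up" using assms(7,8) by (simp_all add: g'_def)
  have \<kappa>0: "0 < \<kappa>" using \<kappa> gs shock by simp
  obtain C \<theta> \<delta> where C: "0 < C" "0 < \<theta>" "0 < \<delta>"
    and stab: "\<And>E u0 u0'. 0 \<le> E \<Longrightarrow> E \<le> \<delta> \<Longrightarrow> \<forall>x. x \<noteq> 0 \<longrightarrow> (u0 has_real_derivative u0' x) (at x) \<and>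
        \<bar>u0 x - (if x < 0 then um else up)\<bar> \<le> E * exp_weight_rho \<rho> \<kappa> x \<and> \<bar>u0' x\<bar> \<le> E * exp_weight_rho \<rho> \<kappa> x \<Longrightarrow>
      uniformly_continuous_on {..<0} u0' \<Longrightarrow> uniformly_continuous_on {0<..} u0' \<Longrightarrow>
      stable_shock f g \<sigma> um up \<kappa> (C * E) (\<lambda>t. \<rho> (\<theta> * t)) u0"
  proof (rule shock_stability[OF f g wr(1,2) gs wr(3) _ _ _ \<kappa> assms(9,10)])
    show "(f v - f up) / (v - up) < (f v - f um) / (v - um)" if "min um up < v" "v < max um up" for v
      using shock that by blast
    show "\<sigma> < f' um" "f' up < \<sigma>" using shock by simp_all
  qed (rule that)
  have \<rho>p: "\<And>t. 0 \<le> t \<Longrightarrow> 0 < \<rho> t" and \<rho>m: "\<And>s t. 0 \<le> s \<Longrightarrow> s \<le> t \<Longrightarrow> \<rho> t \<le> \<rho> s" and \<rho>l: "(\<rho> \<longlongrightarrow> 0) at_top"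
    using assms(9) by (auto simp: subexp_weight_def monotone_on_def)
  note \<Omega>\<rho> = exp_weight_rho_basic[OF assms(9) less_imp_le[OF \<kappa>0], folded \<Omega>\<rho>_def]
  have U: "U x = (if x < 0 then um else up)" if "x \<noteq> 0" for x using that assms(5,6) by auto
  define I0 where "I0 = (LINT s:{0..}|lborel. \<rho> s)"
  have tail: "0 \<le> (LINT s:{a..}|lborel. \<rho> s)" if "0 \<le> a" for a
    unfolding set_lebesgue_integral_def
  proof (rule Bochner_Integration.integral_nonneg)
    fix s :: real
    show "0 \<le> indicator {a..} s *\<^sub>R \<rho> s" using less_imp_le[OF \<rho>p[of s]] that by (simp add: indicator_def)
  qed
  \<comment> \<open>\<open>4 * C\<close> is twice the factor 2 lost in passing to norms of pairs,
    once for the solution and once for the derivatives of the shift. \<open>1 / \<theta>\<close>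
    comes from rescaling the tail integral, and \<open>I0\<close> from the tail at time 0, which
    bounds the limit of the shift.\<close>
  define K where "K = 4 * C + C / \<theta> + C / \<theta> * I0"
  have K: "0 < K" "4 * C \<le> K" "C / \<theta> \<le> K" "C / \<theta> * I0 \<le> K"
    using C tail[of 0] by (simp_all add: K_def I0_def add_pos_nonneg)
  show ?thesis
  proof (rule exI[of _ K], rule conjI[OF K(1)], rule exI[of _ \<theta>], rule conjI[OF C(2)], rule exI[of _ \<delta>], rule conjI[OF C(3)], intro allI impI)
    fix u0 :: "real \<Rightarrow> real"
    define N where "N = W1inf_norm \<Omega>\<rho> (\<lambda>x. u0 x - U x)"
    assume H: "BUC_Rstar 1 u0 \<and> BUC_Rstar 0 (\<lambda>x. (u0 x - U x) / \<Omega>\<rho> x) \<and>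
      BUC_Rstar 0 (\<lambda>x. deriv (\<lambda>y. u0 y - U y) x / \<Omega>\<rho> x) \<and> W1inf_norm \<Omega>\<rho> (\<lambda>x. u0 x - U x) \<le> ereal \<delta>"
    define u0' where "u0' x = (if x < 0 then D_on {..<0} u0 x else D_on {0<..} u0 x)" for x
    have B: "BUC_on 1 {..<0} u0" "BUC_on 1 {0<..} u0" using H by (simp_all add: BUC_Rstar_def)
    have u0: "(u0 has_real_derivative u0' x) (at x)" if "x \<noteq> 0" for x
      using BUC_on_1_open(1)[OF B(1), of x] BUC_on_1_open(1)[OF B(2), of x] that by (auto simp: u0'_def)
    have uc: "uniformly_continuous_on {..<0} u0'" "uniformly_continuous_on {0<..} u0'"
      using BUC_on_1_open(2)[OF B(1)] BUC_on_1_open(2)[OF B(2)]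
      by (simp_all add: u0'_def uniformly_continuous_on_def)
    have both: "continuous_on (-{0}) h" if "continuous_on {..<0} h" "continuous_on {0<..} h" for h :: "real \<Rightarrow> real"
    proof -
      have "continuous_on ({..<0} \<union> {0<..}) h" using that by (intro continuous_on_open_Un) auto
      moreover have "{..<0} \<union> {0<..} = -{0::real}" by auto
      ultimately show ?thesis by simp
    qed
    have BUC0: "continuous_on (-{0}) h" if "BUC_Rstar 0 h" for h
      using that unfolding BUC_Rstar_def BUC_on_def by (intro both) (auto intro: uniformly_continuous_imp_continuous)
    have v: "((\<lambda>y. u0 y - U y) has_real_derivative u0' x) (at x)" if "x \<noteq> 0" for x
    proof (cases "x < 0")
      case True
      have "((\<lambda>y. u0 y - um) has_real_derivative u0' x - 0) (at x)" by (intro DERIV_diff u0 DERIV_const that)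
      then show ?thesis unfolding diff_0_right
        by (rule has_field_derivative_transform_within_open[where S="{..<0}"]) (use True U in auto)
    next
      case False
      have "((\<lambda>y. u0 y - up) has_real_derivative u0' x - 0) (at x)" by (intro DERIV_diff u0 DERIV_const that)
      then show ?thesis unfolding diff_0_right
        by (rule has_field_derivative_transform_within_open[where S="{0<..}"]) (use False that U in auto)
    qed
    have cu0': "continuous_on (-{0}) u0'" by (rule both[OF uc[THEN uniformly_continuous_imp_continuous]])
    have cv: "continuous_on (-{0}) (\<lambda>x. (u0 x - U x) / \<Omega>\<rho> x)" using H by (intro BUC0) blast
    have cv': "continuous_on (-{0}) (\<lambda>x. u0' x / \<Omega>\<rho> x)"
    proof -
      have "continuous_on (-{0}) (\<lambda>x. deriv (\<lambda>y. u0 y - U y) x / \<Omega>\<rho> x)" using H by (intro BUC0) blast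
      then show ?thesis by (rule continuous_on_eq) (use DERIV_imp_deriv[OF v] in simp)
    qed
    \<comment> \<open>The hypothesis bounds an essential supremum, whereas the characteristics carry
      individual values. Continuity of the weighted quotients makes the bound hold at every point
      off 0.\<close>
    have pw: "ereal (\<bar>u0 x - U x\<bar> / \<Omega>\<rho> x) \<le> N" "ereal (\<bar>u0' x\<bar> / \<Omega>\<rho> x) \<le> N" if "x \<noteq> 0" for x
      unfolding N_def by (rule W1inf_norm_pointwise[OF v cu0' \<Omega>\<rho> cv cv' that], assumption)+
    have "0 \<le> N" using \<Omega>\<rho>(1)[of 1] by (intro order_trans[OF _ pw(1)[of 1]]) simp_all
    moreover have "N \<le> ereal \<delta>" using H by (simp add: N_def)
    \<comment> \<open>Nonnegativity, read off at the point 1, and the bound by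
      \<open>\<delta>\<close> turn the extended real \<open>N\<close> into a real number, the
      amplitude for the construction.\<close>
    ultimately obtain E where E: "N = ereal E" "0 \<le> E" "E \<le> \<delta>" by (cases N) auto
    have pb: "\<bar>u0 x - (if x < 0 then um else up)\<bar> \<le> E * exp_weight_rho \<rho> \<kappa> x" "\<bar>u0' x\<bar> \<le> E * exp_weight_rho \<rho> \<kappa> x" if "x \<noteq> 0" for x
      using pw[OF that] \<Omega>\<rho>(1)[of x] U[OF that] by (simp_all add: E(1) pos_divide_le_eq \<Omega>\<rho>_def)
    have "stable_shock f g \<sigma> um up \<kappa> (C * E) (\<lambda>t. \<rho> (\<theta> * t)) u0"
      by (rule stab[OF E(2,3) _ uc]) (use u0 pb in blast)
    then obtain \<psi> \<psi>1 \<psi>2 u where path: "shock_path (C * E) (\<lambda>t. \<rho> (\<theta> * t)) \<psi> \<psi>1 \<psi>2"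
      and u: "the_entropy_solution f g u0 u"
      and vd: "\<forall>t\<ge>0. \<exists>v d. (\<forall>x. x \<noteq> 0 \<longrightarrow> v x = u t (x + \<sigma> * t + \<psi> t) - (if x < 0 then um else up) \<and>
          (v has_real_derivative d x) (at x) \<and> \<bar>v x\<bar> \<le> C * E * \<rho> (\<theta> * t) * exp_weight \<kappa> x \<and> \<bar>d x\<bar> \<le> C * E * \<rho> (\<theta> * t) * exp_weight \<kappa> x) \<and>
        continuous_on (-{0}) d"
      unfolding stable_shock_def by (elim exE conjE) (rule that)
    note \<psi> = path[unfolded shock_path_def, THEN conjunct1] path[unfolded shock_path_def, THEN conjunct2, THEN conjunct1]
        path[unfolded shock_path_def, THEN conjunct2, THEN conjunct2, THEN conjunct1]
        path[unfolded shock_path_def, THEN conjunct2, THEN conjunct2, THEN conjunct2, THEN conjunct1]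
      and \<psi>b = path[unfolded shock_path_def, THEN conjunct2, THEN conjunct2, THEN conjunct2, THEN conjunct2, THEN conjunct1]
      and \<psi>i = path[unfolded shock_path_def, THEN conjunct2, THEN conjunct2, THEN conjunct2, THEN conjunct2, THEN conjunct2]
    have CE: "0 \<le> C * E" using C E by simp
    have BUC: "BUC_Rplus 2 \<psi>" and D: "0 \<le> t \<Longrightarrow> D_on {0..} \<psi> t = \<psi>1 t" "0 \<le> t \<Longrightarrow> (D_on {0..} ^^ 2) \<psi> t = \<psi>2 t" for t
    proof -
      have r: "C * E * \<rho> (\<theta> * t) \<le> C * E * \<rho> 0" if "0 \<le> t" for t
        using \<rho>m[of 0 "\<theta> * t"] C(2) that by (intro mult_left_mono[OF _ CE]) auto
      have "LIM t at_top. \<theta> * t :> at_top"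
        by (rule filterlim_tendsto_pos_mult_at_top[OF tendsto_const C(2) filterlim_ident])
      then have rl: "((\<lambda>t. C * E * \<rho> (\<theta> * t)) \<longlongrightarrow> 0) at_top"
        by (intro tendsto_mult_right_zero filterlim_compose[OF \<rho>l])
      note bp = BUC_Rplus_2I[of \<psi> \<psi>1 \<psi>2 "1/2" "\<lambda>t. C * E * \<rho> (\<theta> * t)" "C * E * \<rho> 0", OF _ _ \<psi>(4) _ _ _ _ rl]
      show "BUC_Rplus 2 \<psi>" by (rule bp(1)) (use \<psi> \<psi>b r in auto)
      show "D_on {0..} \<psi> t = \<psi>1 t" if "0 \<le> t" by (rule bp(2)[OF _ _ _ _ _ _ that]) (use \<psi> \<psi>b r in auto)
      show "(D_on {0..} ^^ 2) \<psi> t = \<psi>2 t" if "0 \<le> t" by (rule bp(3)[OF _ _ _ _ _ _ that]) (use \<psi> \<psi>b r in auto)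
    qed
    have norm: "W1inf_norm \<Omega> (\<lambda>x. u t (x + \<sigma> * t + \<psi> t) - U x) + ereal (norm (D_on {0..} \<psi> t, (D_on {0..} ^^ 2) \<psi> t))
        \<le> ereal K * N * ereal (\<rho> (\<theta> * t))" if t: "0 \<le> t" for t
    proof -
      define r where "r = C * E * \<rho> (\<theta> * t)"
      obtain v d where v: "\<forall>x. x \<noteq> 0 \<longrightarrow> v x = u t (x + \<sigma> * t + \<psi> t) - (if x < 0 then um else up) \<and>
          (v has_real_derivative d x) (at x) \<and> \<bar>v x\<bar> \<le> r * exp_weight \<kappa> x \<and> \<bar>d x\<bar> \<le> r * exp_weight \<kappa> x"
        and d: "continuous_on (-{0}) d"
        using vd[rule_format, OF t, folded r_def] by (elim exE conjE) (rule that)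
      have vU: "v x = u t (x + \<sigma> * t + \<psi> t) - U x" if "x \<noteq> 0" for x using v U[OF that] that by simp
      have "W1inf_norm \<Omega> (\<lambda>x. u t (x + \<sigma> * t + \<psi> t) - U x) \<le> ereal (2 * r)"
      proof (rule W1inf_norm_le[OF _ d])
        show "((\<lambda>x. u t (x + \<sigma> * t + \<psi> t) - U x) has_real_derivative d x) (at x)" if "x \<noteq> 0" for x
          by (rule has_field_derivative_transform_within_open[where f=v and S="-{0}"]) (use that v vU in auto)
        show "0 < \<Omega> x" for x by (simp add: \<Omega>_def exp_weight_def)
        show "\<Omega> \<in> borel_measurable borel" unfolding \<Omega>_def exp_weight_def[abs_def] by measurable
        show "\<bar>u t (x + \<sigma> * t + \<psi> t) - U x\<bar> \<le> r * \<Omega> x" "\<bar>d x\<bar> \<le> r * \<Omega> x" if "x \<noteq> 0" for x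
          using v that vU[OF that] by (auto simp: \<Omega>_def)
      qed
      moreover have "norm (D_on {0..} \<psi> t, (D_on {0..} ^^ 2) \<psi> t) \<le> 2 * r"
        using norm_Pair_le[of "\<psi>1 t" "\<psi>2 t"] \<psi>b t D[OF t] by (force simp: r_def)
      ultimately have "W1inf_norm \<Omega> (\<lambda>x. u t (x + \<sigma> * t + \<psi> t) - U x) + ereal (norm (D_on {0..} \<psi> t, (D_on {0..} ^^ 2) \<psi> t))
          \<le> ereal (2 * r) + ereal (2 * r)" by (intro add_mono) simp_all
      also have "\<dots> = ereal (4 * C * (E * \<rho> (\<theta> * t)))" by (simp add: r_def)
      also have "\<dots> \<le> ereal (K * (E * \<rho> (\<theta> * t)))"
        unfolding ereal_less_eq using K(2) E(2) \<rho>p[of "\<theta> * t"] C(2) t by (intro mult_right_mono) auto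
      also have "\<dots> = ereal K * N * ereal (\<rho> (\<theta> * t))" by (simp add: E(1) mult.assoc)
      finally show ?thesis .
    qed
    have resc: "C * E * (LINT s:{a..}|lborel. \<rho> (\<theta> * s)) = C / \<theta> * (E * (LINT s:{\<theta> * a..}|lborel. \<rho> s))" for a
      by (simp add: set_integral_rescale[OF C(2)])
    obtain l where l: "\<And>t. 0 \<le> t \<Longrightarrow> \<bar>\<psi> t - l\<bar> \<le> C * E * (LINT s:{t..}|lborel. \<rho> (\<theta> * s))"
      by (rule limit_with_tail_bound[of \<psi> "1/2" "\<lambda>a. C * E * (LINT s:{a..}|lborel. \<rho> (\<theta> * s))"]) (use \<psi>b \<psi>i in \<open>blast intro: that\<close>)+
    have lim: "ereal \<bar>l\<bar> \<le> ereal K * N \<and> ereal \<bar>\<psi> t - l\<bar> \<le> ereal K * N * ereal (LINT s:{\<theta> * t..}|lborel. \<rho> s)" if t: "0 \<le> t" for t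
    proof
      \<comment> \<open>Since \<open>\<psi> 0 = 0\<close>, the tail estimate at time 0 bounds the
        limit itself.\<close>
      have "\<bar>l\<bar> \<le> C / \<theta> * (E * I0)" using l[of 0] \<psi>(1) resc[of 0] by (simp add: I0_def)
      also have "\<dots> = (C / \<theta> * I0) * E" by simp
      also have "\<dots> \<le> K * E" using K(4) E(2) by (rule mult_right_mono)
      finally show "ereal \<bar>l\<bar> \<le> ereal K * N" by (simp add: E(1))
      have "\<bar>\<psi> t - l\<bar> \<le> C / \<theta> * (E * (LINT s:{\<theta> * t..}|lborel. \<rho> s))" using l[OF t] resc[of t] by simp
      also have "\<dots> \<le> K * (E * (LINT s:{\<theta> * t..}|lborel. \<rho> s))"
        using K(3) E(2) tail[of "\<theta> * t"] C(2) t by (intro mult_right_mono) auto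
      finally show "ereal \<bar>\<psi> t - l\<bar> \<le> ereal K * N * ereal (LINT s:{\<theta> * t..}|lborel. \<rho> s)" by (simp add: E(1) mult.assoc)
    qed
    show "\<exists>\<psi> u. BUC_Rplus 2 \<psi> \<and> the_entropy_solution f g u0 u \<and>
      (\<forall>t\<ge>0. W1inf_norm \<Omega> (\<lambda>x. u t (x + \<sigma> * t + \<psi> t) - U x)
          + ereal (norm (D_on {0..} \<psi> t, (D_on {0..} ^^ 2) \<psi> t))
        \<le> ereal K * W1inf_norm \<Omega>\<rho> (\<lambda>x. u0 x - U x) * ereal (\<rho> (\<theta> * t))) \<and>
      (\<exists>\<psi>inf. \<forall>t\<ge>0.
        ereal \<bar>\<psi>inf\<bar> \<le> ereal K * W1inf_norm \<Omega>\<rho> (\<lambda>x. u0 x - U x) \<and>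
        ereal \<bar>\<psi> t - \<psi>inf\<bar> \<le> ereal K * W1inf_norm \<Omega>\<rho> (\<lambda>x. u0 x - U x)
          * ereal (LINT s:{\<theta> * t..}|lborel. \<rho> s))"
      unfolding N_def[symmetric]
    proof (rule exI[of _ \<psi>], rule exI[of _ u], intro conjI BUC u)
      show "\<forall>t\<ge>0. W1inf_norm \<Omega> (\<lambda>x. u t (x + \<sigma> * t + \<psi> t) - U x) + ereal (norm (D_on {0..} \<psi> t, (D_on {0..} ^^ 2) \<psi> t))
        \<le> ereal K * N * ereal (\<rho> (\<theta> * t))" using norm by blast
      show "\<exists>\<psi>inf. \<forall>t\<ge>0. ereal \<bar>\<psi>inf\<bar> \<le> ereal K * N \<and>
        ereal \<bar>\<psi> t - \<psi>inf\<bar> \<le> ereal K * N * ereal (LINT s:{\<theta> * t..}|lborel. \<rho> s)" using lim by blast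
    qed
  qed
qed

end
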